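(* Suppose that assumptions (H1)-(H6) of the context hold and $\xi_0\in\mathcal{L}^2_{\mathscr{F}_0}$. There exists $\delta>0$ depending only on $(L,T)$ such that, when $L_mC_f^{-1}\le\delta$, the FBSDE $$\left\{\begin{aligned} dX_t&=b(t,X_t,\hat u_t,\mathcal{L}(X_t|\tilde{\mathscr F}_t))\,dt+\sigma(t,X_t,\hat u_t,\mathcal{L}(X_t|\tilde{\mathscr F}_t))\,dW_t+\tilde\sigma(t,X_t,\hat u_t,\mathcal{L}(X_t|\tilde{\mathscr F}_t))\,d\tilde W_t,\quad t\in(0,T];\\ dp_t&=-\partial_xH(t,X_t,p_t,q_t,\tilde q_t,\hat u_t,\mathcal{L}(X_t|\tilde{\mathscr F}_t))\,dt+q_t\,dW_t+\tilde q_t\,d\tilde W_t,\quad t\in[0,T);\\ X_0&=\xi_0,\quad p_T=g_x(X_T,\mathcal{L}(X_T|\tilde{\mathscr F}_T)), \end{aligned}\right.$$ with $\hat u_t:=\hat u(t,X_t,p_t,q_t,\tilde q_t)$, has at most one adapted solution $\{(X_t,p_t,q_t,\tilde q_t),0\le t\le T\}$ satisfying $$\mathbb{E}\Big[\sup_{0\le t\le T}|(X_t,p_t)|^2+\int_0^T|(q_t,\tilde q_t)|^2dt\Big]<\infty.$$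
   Context: Setting. $T>0$ is fixed; $W$ and $\tilde W$ are independent one-dimensional Brownian motions on a complete probability space $(\Omega,\mathbb{P})$; $\xi_0$ is a square-integrable random variable independent of $(W,\tilde W)$. $\mathscr F=\{\mathscr F_t\}_{0\le t\le T}$ is the natural filtration of $(\xi_0,W,\tilde W)$ and $\tilde{\mathscr F}=\{\tilde{\mathscr F}_t\}_{0\le t\le T}$ the natural filtration of $\tilde W$ (the common noise), both augmented by all $\mathbb{P}$-null sets. Adapted means $\mathscr F$-adapted. $\mathcal{L}(\cdot|\tilde{\mathscr F}_t)$ is the conditional law given $\tilde{\mathscr F}_t$. $\mathcal{L}^2_{\mathscr F_t}$ is the set of $\mathscr F_t$-measurable square-integrable real random variables. $\mathcal{P}_2(\mathbb{R})$ is the set of Borel probability measures on $\mathbb{R}$ with finite second moment, with the 2-Wasserstein distance $W_2$. Data: measurable functions $b,\sigma,\tilde\sigma,f:[0,T]\times\mathbb{R}\times\mathbb{R}\times\mathcal{P}_2(\mathbb{R})\to\mathbb{R}$ (arguments $(t,x,u,m)$) and $g:\mathbb{R}\times\mathcal{P}_2(\mathbb{R})\to\mathbb{R}$ (arguments $(x,m)$). Subscripts $x,u$ on $f,g$ and on $f_0,f_1$ below denote partial derivatives. $L>0$ is a constant. A constant "depends only on $(L,T)$" if it can be chosen the same for all data satisfying the assumptions with these $L$ and $T$. (H1) For $\phi=b,\sigma,\tilde\sigma$: $\phi(t,x,u,m)=\phi_0(t,m)+\phi_1(t)x+\phi_2(t)u$ with measurable deterministic $\phi_0,\phi_1,\phi_2$,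 $|\phi_0(t,m)|\le L(1+(\int|x|^2dm(x))^{1/2})$, and $\phi_1,\phi_2$ bounded by $L$. Further, $(\sigma_2,\tilde\sigma_2)$ is bounded by a positive constant $B_u\le L$. (H2) $f(t,\cdot,\cdot,m)$ and $g(\cdot,m)$ are differentiable, and $\max\{|f(t,0,0,m)|,|g(0,m)|\}\le L(1+\int|x|^2dm(x))$, $\max\{|f_x(t,x,u,m)|,|f_u(t,x,u,m)|,|g_x(x,m)|\}\le L(1+|x|+|u|+(\int|y|^2dm(y))^{1/2})$ for all $(t,x,u,m)$. (H3) $f(t,x,u,m)=f_0(t,x,u)+f_1(t,x,m)$, with $f_0$ differentiable in $(x,u)$ and $f_1$ differentiable in $x$; $(f_{0x},f_{0u})(t,\cdot,\cdot)$ is $L$-Lipschitz uniformly in $t$; $f_{1x}(t,\cdot,m)$ is $L$-Lipschitz uniformly in $(t,m)$; $g_x(\cdot,m)$ is $L$-Lipschitz uniformly in $m$. (H4) $(f_{1x}(t,x',m)-f_{1x}(t,x,m))(x'-x)\ge0$ and $(g_x(x',m)-g_x(x,m))(x'-x)\ge0$ for all $t,x,x',m$; and for some $C_f>0$, $f_0(t,x',u')-f_0(t,x,u)-(f_{0x},f_{0u})(t,x,u)\cdot(x'-x,u'-u)\ge C_f|u'-u|^2$ for all $t,x,x',u,u'$. (H5) For a constant $L_m\le L$ and all $t,x,m,m'$: $|b_0(t,m')-b_0(t,m)|+|\sigma_0(t,m')-\sigma_0(t,m)|+|\tilde\sigma_0(t,m')-\tilde\sigma_0(t,m)|\le L_mW_2(m,m')$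 and $|f_{1x}(t,x,m')-f_{1x}(t,x,m)|+|g_x(x,m')-g_x(x,m)|\le LW_2(m,m')$. (H6) (Weak monotonicity) For any square-integrable random variables $\xi,\xi'$ on the same probability space, with (unconditional) laws $\mathcal{L}(\xi),\mathcal{L}(\xi')$: $\mathbb{E}[(f_{1x}(t,\xi',\mathcal{L}(\xi'))-f_{1x}(t,\xi,\mathcal{L}(\xi)))(\xi'-\xi)]\ge0$ for $t\in[0,T]$, and $\mathbb{E}[(g_x(\xi',\mathcal{L}(\xi'))-g_x(\xi,\mathcal{L}(\xi)))(\xi'-\xi)]\ge0$. Hamiltonian: $H(t,x,p,q,\tilde q,u,m):=b(t,x,u,m)p+\sigma(t,x,u,m)q+\tilde\sigma(t,x,u,m)\tilde q+f(t,x,u,m)$. Under (H1)-(H4), $\hat u(t,x,p,q,\tilde q)$ denotes its unique minimizer in $u$, which does not depend on $m$; it is characterized by $b_2(t)p+\sigma_2(t)q+\tilde\sigma_2(t)\tilde q+f_{0u}(t,x,\hat u(t,x,p,q,\tilde q))=0$. *)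

theory Defs
  imports "HOL-Probability.Probability"
begin

definition P2 :: "real measure set" where
  "P2 = {m \<in> space (prob_algebra borel). integrable m (\<lambda>x. x\<^sup>2)}"

definition second_moment :: "real measure \<Rightarrow> real" where
  "second_moment m = (\<integral>x. x\<^sup>2 \<partial>m)"

definition couplings :: "real measure \<Rightarrow> real measure \<Rightarrow> (real \<times> real) measure set" where
  "couplings m m' = {\<pi> \<in> space (prob_algebra borel). distr \<pi> borel fst = m \<and> distr \<pi> borel snd = m'}"

definition W2 :: "real measure \<Rightarrow> real measure \<Rightarrow> real" where
  "W2 m m' = sqrt (INF \<pi>\<in>couplings m m'. \<integral>z. (fst z - snd z)\<^sup>2 \<partial>\<pi>)"

text \<open>Generated by the \<open>W2\<close>-open sets, not by the evaluations as in \<open>prob_algebra\<close>.\<close>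

definition borel_P2 :: "real measure measure" where
  "borel_P2 = sigma P2 {U. Metric_space.mopen P2 W2 U}"

abbreviation borel_time :: "real \<Rightarrow> real measure" where
  "borel_time T \<equiv> restrict_space borel {0..T}"

definition generators :: "'a measure \<Rightarrow> ('a \<Rightarrow> real) set \<Rightarrow> 'a set set" where
  "generators M Xs = {X -` A \<inter> space M | X A. X \<in> Xs \<and> A \<in> sets borel}"

definition generated_events :: "'a measure \<Rightarrow> ('a \<Rightarrow> real) set \<Rightarrow> 'a set set" where
  "generated_events M Xs = sigma_sets (space M) (generators M Xs)"

definition augmented_sigma :: "'a measure \<Rightarrow> ('a \<Rightarrow> real) set \<Rightarrow> 'a measure" where
  "augmented_sigma M Xs = sigma (space M) (generators M Xs \<union> null_sets M)"

definition brownian_motion :: "'a measure \<Rightarrow> real \<Rightarrow> (real \<Rightarrow> 'a \<Rightarrow> real) \<Rightarrow> bool" where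
  "brownian_motion M T W \<longleftrightarrow>
     (\<forall>t\<in>{0..T}. W t \<in> borel_measurable M) \<and>
     (AE \<omega> in M. W 0 \<omega> = 0) \<and>
     (AE \<omega> in M. continuous_on {0..T} (\<lambda>t. W t \<omega>)) \<and>
     (\<forall>s t. 0 \<le> s \<and> s < t \<and> t \<le> T \<longrightarrow>
        distributed M lborel (\<lambda>\<omega>. W t \<omega> - W s \<omega>) (normal_density 0 (sqrt (t - s)))) \<and>
     (\<forall>n (\<tau> :: nat \<Rightarrow> real). 0 \<le> \<tau> 0 \<and> (\<forall>i<n. \<tau> i < \<tau> (Suc i)) \<and> \<tau> n \<le> T \<longrightarrow>
        prob_space.indep_vars M (\<lambda>_. borel) (\<lambda>i \<omega>. W (\<tau> (Suc i)) \<omega> - W (\<tau> i) \<omega>) {..<n})"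

text \<open>\<open>W\<close> is the idiosyncratic and \<open>W\<^sub>c\<close> the common noise; below, the subscript \<open>c\<close> always
  marks an object attached to the common noise (a tilde in the usual notation).\<close>

definition noise_setting ::
  "'a measure \<Rightarrow> real \<Rightarrow> (real \<Rightarrow> 'a \<Rightarrow> real) \<Rightarrow> (real \<Rightarrow> 'a \<Rightarrow> real) \<Rightarrow> ('a \<Rightarrow> real) \<Rightarrow> bool" where
  "noise_setting M T W W\<^sub>c \<xi>0 \<longleftrightarrow>
     prob_space M \<and> complete_measure M \<and>
     brownian_motion M T W \<and> brownian_motion M T W\<^sub>c \<and>
     \<xi>0 \<in> borel_measurable M \<and> integrable M (\<lambda>\<omega>. (\<xi>0 \<omega>)\<^sup>2) \<and>
     prob_space.indep_set M (generated_events M (W ` {0..T})) (generated_events M (W\<^sub>c ` {0..T})) \<and>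
     prob_space.indep_set M (generated_events M {\<xi>0})
       (generated_events M (W ` {0..T} \<union> W\<^sub>c ` {0..T}))"

definition full_filtration ::
  "'a measure \<Rightarrow> (real \<Rightarrow> 'a \<Rightarrow> real) \<Rightarrow> (real \<Rightarrow> 'a \<Rightarrow> real) \<Rightarrow> ('a \<Rightarrow> real) \<Rightarrow> real \<Rightarrow> 'a measure" where
  "full_filtration M W W\<^sub>c \<xi>0 t = augmented_sigma M ({\<xi>0} \<union> W ` {0..t} \<union> W\<^sub>c ` {0..t})"

definition common_filtration :: "'a measure \<Rightarrow> (real \<Rightarrow> 'a \<Rightarrow> real) \<Rightarrow> real \<Rightarrow> 'a measure" where
  "common_filtration M W\<^sub>c t = augmented_sigma M (W\<^sub>c ` {0..t})"

definition L2_vars :: "'a measure \<Rightarrow> 'a measure \<Rightarrow> ('a \<Rightarrow> real) set" where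
  "L2_vars M G = {\<xi> \<in> borel_measurable G. integrable M (\<lambda>\<omega>. (\<xi> \<omega>)\<^sup>2)}"

definition measurable_process :: "'a measure \<Rightarrow> real \<Rightarrow> (real \<Rightarrow> 'a \<Rightarrow> real) \<Rightarrow> bool" where
  "measurable_process M T Y \<longleftrightarrow> (\<lambda>(t, \<omega>). Y t \<omega>) \<in> borel_measurable (borel_time T \<Otimes>\<^sub>M M)"

definition adapted_process ::
  "'a measure \<Rightarrow> (real \<Rightarrow> 'a measure) \<Rightarrow> real \<Rightarrow> (real \<Rightarrow> 'a \<Rightarrow> real) \<Rightarrow> bool" where
  "adapted_process M F T Y \<longleftrightarrow>
     measurable_process M T Y \<and> (\<forall>t\<in>{0..T}. Y t \<in> borel_measurable (F t))"

definition simple_integrand ::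
  "(real \<Rightarrow> 'a measure) \<Rightarrow> real \<Rightarrow> nat \<Rightarrow> (nat \<Rightarrow> real) \<Rightarrow> (nat \<Rightarrow> 'a \<Rightarrow> real) \<Rightarrow> bool" where
  "simple_integrand F t n \<tau> \<eta> \<longleftrightarrow> 0 \<le> \<tau> 0 \<and> \<tau> n \<le> t \<and>
     (\<forall>i<n. \<tau> i \<le> \<tau> (Suc i) \<and> \<eta> i \<in> borel_measurable (F (\<tau> i)) \<and>
        (\<exists>C. \<forall>\<omega>\<in>space (F (\<tau> i)). \<bar>\<eta> i \<omega>\<bar> \<le> C))"

definition simple_process :: "nat \<Rightarrow> (nat \<Rightarrow> real) \<Rightarrow> (nat \<Rightarrow> 'a \<Rightarrow> real) \<Rightarrow> real \<Rightarrow> 'a \<Rightarrow> real" where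
  "simple_process n \<tau> \<eta> s \<omega> = (\<Sum>i<n. \<eta> i \<omega> * indicator {\<tau> i<..\<tau> (Suc i)} s)"

definition simple_integral ::
  "(real \<Rightarrow> 'a \<Rightarrow> real) \<Rightarrow> nat \<Rightarrow> (nat \<Rightarrow> real) \<Rightarrow> (nat \<Rightarrow> 'a \<Rightarrow> real) \<Rightarrow> 'a \<Rightarrow> real" where
  "simple_integral W n \<tau> \<eta> \<omega> = (\<Sum>i<n. \<eta> i \<omega> * (W (\<tau> (Suc i)) \<omega> - W (\<tau> i) \<omega>))"

text \<open>\<open>I\<close> is a version of \<open>\<integral>\<^sub>0\<^sup>t H\<^sub>s dW\<^sub>s\<close>: the \<open>L\<^sup>2\<close> limit of the elementary integrals of simple
  adapted processes that approximate \<open>H\<close> in \<open>L\<^sup>2([0,t] \<times> \<Omega>)\<close>.  All integrands of interest here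
  are square integrable, so no localisation is needed.\<close>

definition has_ito_integral ::
  "'a measure \<Rightarrow> (real \<Rightarrow> 'a measure) \<Rightarrow> (real \<Rightarrow> 'a \<Rightarrow> real) \<Rightarrow> real \<Rightarrow>
     (real \<Rightarrow> 'a \<Rightarrow> real) \<Rightarrow> ('a \<Rightarrow> real) \<Rightarrow> bool" where
  "has_ito_integral M F W t H I \<longleftrightarrow>
     measurable_process M t H \<and> I \<in> borel_measurable M \<and>
     (\<exists>n \<tau> \<eta>. (\<forall>k. simple_integrand F t (n k) (\<tau> k) (\<eta> k)) \<and>
        (\<lambda>k. \<integral>\<^sup>+\<omega>. (\<integral>\<^sup>+s\<in>{0..t}.
            ennreal ((H s \<omega> - simple_process (n k) (\<tau> k) (\<eta> k) s \<omega>)\<^sup>2) \<partial>lborel) \<partial>M)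
          \<longlonglongrightarrow> 0 \<and>
        (\<lambda>k. \<integral>\<^sup>+\<omega>. ennreal ((I \<omega> - simple_integral W (n k) (\<tau> k) (\<eta> k) \<omega>)\<^sup>2) \<partial>M) \<longlonglongrightarrow> 0)"

text \<open>The relation \<open>dY = \<alpha> dt + \<beta> dW + \<gamma> dW\<^sub>c\<close> on \<open>[0,T]\<close>.  A backward equation is this relation
  together with a terminal condition on \<open>Y\<close>.  As \<open>Y\<close> is continuous, quantifying over \<open>t\<close> outside
  the almost-sure statement gives nothing weaker.\<close>

definition has_stoch_differential ::
  "'a measure \<Rightarrow> (real \<Rightarrow> 'a measure) \<Rightarrow> real \<Rightarrow> (real \<Rightarrow> 'a \<Rightarrow> real) \<Rightarrow> (real \<Rightarrow> 'a \<Rightarrow> real) \<Rightarrow>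
     (real \<Rightarrow> 'a \<Rightarrow> real) \<Rightarrow> (real \<Rightarrow> 'a \<Rightarrow> real) \<Rightarrow> (real \<Rightarrow> 'a \<Rightarrow> real) \<Rightarrow> (real \<Rightarrow> 'a \<Rightarrow> real) \<Rightarrow> bool" where
  "has_stoch_differential M F T W W\<^sub>c Y \<alpha> \<beta> \<gamma> \<longleftrightarrow>
     (AE \<omega> in M. continuous_on {0..T} (\<lambda>t. Y t \<omega>)) \<and>
     (AE \<omega> in M. set_integrable lborel {0..T} (\<lambda>s. \<alpha> s \<omega>)) \<and>
     (\<forall>t\<in>{0..T}. \<exists>I J. has_ito_integral M F W t \<beta> I \<and> has_ito_integral M F W\<^sub>c t \<gamma> J \<and>
        (AE \<omega> in M. Y t \<omega> = Y 0 \<omega> + (LINT s:{0..t}|lborel. \<alpha> s \<omega>) + I \<omega> + J \<omega>))"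

definition is_cond_law ::
  "'a measure \<Rightarrow> 'a measure \<Rightarrow> ('a \<Rightarrow> real) \<Rightarrow> ('a \<Rightarrow> real measure) \<Rightarrow> bool" where
  "is_cond_law M G X \<kappa> \<longleftrightarrow> \<kappa> \<in> G \<rightarrow>\<^sub>M prob_algebra borel \<and>
     (\<forall>A\<in>sets borel. AE \<omega> in M.
        measure (\<kappa> \<omega>) A = real_cond_exp M G (\<lambda>\<omega>. indicator A (X \<omega>)) \<omega>)"

text \<open>For each \<open>t\<close> the conditional law is determined only up to a null set; for it to appear in
  coefficients integrated over time, the versions are chosen so that they form a \<open>P2\<close>-valued
  measurable process.\<close>

definition cond_law_process ::
  "'a measure \<Rightarrow> (real \<Rightarrow> 'a measure) \<Rightarrow> real \<Rightarrow> (real \<Rightarrow> 'a \<Rightarrow> real) \<Rightarrow> (real \<Rightarrow> 'a \<Rightarrow> real measure) \<Rightarrow> bool"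
where
  "cond_law_process M G T X \<mu> \<longleftrightarrow>
     (\<lambda>(t, \<omega>). \<mu> t \<omega>) \<in> borel_time T \<Otimes>\<^sub>M M \<rightarrow>\<^sub>M borel_P2 \<and>
     (\<forall>t\<in>{0..T}. is_cond_law M (G t) (X t) (\<mu> t))"

type_synonym coeff = "real \<Rightarrow> real \<Rightarrow> real \<Rightarrow> real measure \<Rightarrow> real"

definition measurable_coeff :: "real \<Rightarrow> coeff \<Rightarrow> bool" where
  "measurable_coeff T \<phi> \<longleftrightarrow> (\<lambda>(t, x, u, m). \<phi> t x u m)
     \<in> borel_measurable (borel_time T \<Otimes>\<^sub>M borel \<Otimes>\<^sub>M borel \<Otimes>\<^sub>M borel_P2)"

definition measurable_data ::
  "real \<Rightarrow> coeff \<Rightarrow> coeff \<Rightarrow> coeff \<Rightarrow> coeff \<Rightarrow> (real \<Rightarrow> real measure \<Rightarrow> real) \<Rightarrow> bool" where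
  "measurable_data T b \<sigma> \<sigma>\<^sub>c f g \<longleftrightarrow>
     measurable_coeff T b \<and> measurable_coeff T \<sigma> \<and> measurable_coeff T \<sigma>\<^sub>c \<and> measurable_coeff T f \<and>
     (\<lambda>(x, m). g x m) \<in> borel_measurable (borel \<Otimes>\<^sub>M borel_P2)"

definition affine_coeff ::
  "real \<Rightarrow> real \<Rightarrow> coeff \<Rightarrow> (real \<Rightarrow> real measure \<Rightarrow> real) \<Rightarrow> (real \<Rightarrow> real) \<Rightarrow> (real \<Rightarrow> real) \<Rightarrow> bool" where
  "affine_coeff T L \<phi> \<phi>0 \<phi>1 \<phi>2 \<longleftrightarrow>
     (\<lambda>(t, m). \<phi>0 t m) \<in> borel_measurable (borel_time T \<Otimes>\<^sub>M borel_P2) \<and>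
     \<phi>1 \<in> borel_measurable (borel_time T) \<and> \<phi>2 \<in> borel_measurable (borel_time T) \<and>
     (\<forall>t\<in>{0..T}. \<forall>m\<in>P2. \<forall>x u. \<phi> t x u m = \<phi>0 t m + \<phi>1 t * x + \<phi>2 t * u) \<and>
     (\<forall>t\<in>{0..T}. \<forall>m\<in>P2. \<bar>\<phi>0 t m\<bar> \<le> L * (1 + sqrt (second_moment m))) \<and>
     (\<forall>t\<in>{0..T}. \<bar>\<phi>1 t\<bar> \<le> L \<and> \<bar>\<phi>2 t\<bar> \<le> L)"

definition H1 ::
  "real \<Rightarrow> real
    \<Rightarrow> coeff \<Rightarrow> (real \<Rightarrow> real measure \<Rightarrow> real) \<Rightarrow> (real \<Rightarrow> real) \<Rightarrow> (real \<Rightarrow> real)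
    \<Rightarrow> coeff \<Rightarrow> (real \<Rightarrow> real measure \<Rightarrow> real) \<Rightarrow> (real \<Rightarrow> real) \<Rightarrow> (real \<Rightarrow> real)
    \<Rightarrow> coeff \<Rightarrow> (real \<Rightarrow> real measure \<Rightarrow> real) \<Rightarrow> (real \<Rightarrow> real) \<Rightarrow> (real \<Rightarrow> real) \<Rightarrow> bool" where
  "H1 T L b b0 b1 b2 \<sigma> \<sigma>0 \<sigma>1 \<sigma>2 \<sigma>\<^sub>c \<sigma>\<^sub>c0 \<sigma>\<^sub>c1 \<sigma>\<^sub>c2 \<longleftrightarrow>
     affine_coeff T L b b0 b1 b2 \<and> affine_coeff T L \<sigma> \<sigma>0 \<sigma>1 \<sigma>2 \<and>
     affine_coeff T L \<sigma>\<^sub>c \<sigma>\<^sub>c0 \<sigma>\<^sub>c1 \<sigma>\<^sub>c2 \<and>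
     (\<exists>B\<^sub>u. 0 < B\<^sub>u \<and> B\<^sub>u \<le> L \<and> (\<forall>t\<in>{0..T}. \<bar>\<sigma>2 t\<bar> \<le> B\<^sub>u \<and> \<bar>\<sigma>\<^sub>c2 t\<bar> \<le> B\<^sub>u))"

definition H2 :: "real \<Rightarrow> real \<Rightarrow> coeff \<Rightarrow> (real \<Rightarrow> real measure \<Rightarrow> real) \<Rightarrow> bool" where
  "H2 T L f g \<longleftrightarrow>
     (\<forall>t\<in>{0..T}. \<forall>m\<in>P2. (\<lambda>(x, u). f t x u m) differentiable_on UNIV) \<and>
     (\<forall>m\<in>P2. (\<lambda>x. g x m) differentiable_on UNIV) \<and>
     (\<forall>t\<in>{0..T}. \<forall>m\<in>P2. max \<bar>f t 0 0 m\<bar> \<bar>g 0 m\<bar> \<le> L * (1 + second_moment m)) \<and>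
     (\<forall>t\<in>{0..T}. \<forall>m\<in>P2. \<forall>x u.
        Max {\<bar>deriv (\<lambda>y. f t y u m) x\<bar>, \<bar>deriv (\<lambda>v. f t x v m) u\<bar>, \<bar>deriv (\<lambda>y. g y m) x\<bar>}
          \<le> L * (1 + \<bar>x\<bar> + \<bar>u\<bar> + sqrt (second_moment m)))"

definition H3 ::
  "real \<Rightarrow> real \<Rightarrow> coeff \<Rightarrow> (real \<Rightarrow> real \<Rightarrow> real \<Rightarrow> real) \<Rightarrow> (real \<Rightarrow> real \<Rightarrow> real measure \<Rightarrow> real)
     \<Rightarrow> (real \<Rightarrow> real measure \<Rightarrow> real) \<Rightarrow> bool" where
  "H3 T L f f0 f1 g \<longleftrightarrow>
     (\<forall>t\<in>{0..T}. \<forall>m\<in>P2. \<forall>x u. f t x u m = f0 t x u + f1 t x m) \<and>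
     (\<forall>t\<in>{0..T}. (\<lambda>(x, u). f0 t x u) differentiable_on UNIV) \<and>
     (\<forall>t\<in>{0..T}. \<forall>m\<in>P2. (\<lambda>x. f1 t x m) differentiable_on UNIV) \<and>
     (\<forall>t\<in>{0..T}. L-lipschitz_on UNIV
        (\<lambda>(x, u). (deriv (\<lambda>y. f0 t y u) x, deriv (\<lambda>v. f0 t x v) u))) \<and>
     (\<forall>t\<in>{0..T}. \<forall>m\<in>P2. L-lipschitz_on UNIV (\<lambda>x. deriv (\<lambda>y. f1 t y m) x)) \<and>
     (\<forall>m\<in>P2. L-lipschitz_on UNIV (\<lambda>x. deriv (\<lambda>y. g y m) x))"

definition H4 ::
  "real \<Rightarrow> real \<Rightarrow> (real \<Rightarrow> real \<Rightarrow> real \<Rightarrow> real) \<Rightarrow> (real \<Rightarrow> real \<Rightarrow> real measure \<Rightarrow> real)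
     \<Rightarrow> (real \<Rightarrow> real measure \<Rightarrow> real) \<Rightarrow> bool" where
  "H4 T C\<^sub>f f0 f1 g \<longleftrightarrow>
     (\<forall>t\<in>{0..T}. \<forall>m\<in>P2. \<forall>x x'.
        (deriv (\<lambda>y. f1 t y m) x' - deriv (\<lambda>y. f1 t y m) x) * (x' - x) \<ge> 0) \<and>
     (\<forall>m\<in>P2. \<forall>x x'. (deriv (\<lambda>y. g y m) x' - deriv (\<lambda>y. g y m) x) * (x' - x) \<ge> 0) \<and>
     C\<^sub>f > 0 \<and>
     (\<forall>t\<in>{0..T}. \<forall>x x' u u'.
        f0 t x' u' - f0 t x u
          - (deriv (\<lambda>y. f0 t y u) x * (x' - x) + deriv (\<lambda>v. f0 t x v) u * (u' - u))
        \<ge> C\<^sub>f * \<bar>u' - u\<bar>\<^sup>2)"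

definition H5 ::
  "real \<Rightarrow> real \<Rightarrow> real \<Rightarrow> (real \<Rightarrow> real measure \<Rightarrow> real) \<Rightarrow> (real \<Rightarrow> real measure \<Rightarrow> real)
     \<Rightarrow> (real \<Rightarrow> real measure \<Rightarrow> real) \<Rightarrow> (real \<Rightarrow> real \<Rightarrow> real measure \<Rightarrow> real)
     \<Rightarrow> (real \<Rightarrow> real measure \<Rightarrow> real) \<Rightarrow> bool" where
  "H5 T L L\<^sub>m b0 \<sigma>0 \<sigma>\<^sub>c0 f1 g \<longleftrightarrow> L\<^sub>m \<le> L \<and>
     (\<forall>t\<in>{0..T}. \<forall>m\<in>P2. \<forall>m'\<in>P2.
        \<bar>b0 t m' - b0 t m\<bar> + \<bar>\<sigma>0 t m' - \<sigma>0 t m\<bar> + \<bar>\<sigma>\<^sub>c0 t m' - \<sigma>\<^sub>c0 t m\<bar> \<le> L\<^sub>m * W2 m m') \<and>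
     (\<forall>t\<in>{0..T}. \<forall>x. \<forall>m\<in>P2. \<forall>m'\<in>P2.
        \<bar>deriv (\<lambda>y. f1 t y m') x - deriv (\<lambda>y. f1 t y m) x\<bar>
          + \<bar>deriv (\<lambda>y. g y m') x - deriv (\<lambda>y. g y m) x\<bar> \<le> L * W2 m m')"

text \<open>The condition depends on \<open>(\<xi>, \<xi>')\<close> only through their joint law, so probability measures on
  the type \<open>real \<times> real\<close> carry all pairs of random variables that matter.\<close>

definition weakly_monotone :: "(real \<Rightarrow> real measure \<Rightarrow> real) \<Rightarrow> bool" where
  "weakly_monotone h \<longleftrightarrow>
     (\<forall>(N :: (real \<times> real) measure) \<xi> \<xi>'. prob_space N \<and> \<xi> \<in> L2_vars N N \<and> \<xi>' \<in> L2_vars N N \<longrightarrow>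
        (\<integral>\<omega>. (h (\<xi>' \<omega>) (distr N borel \<xi>') - h (\<xi> \<omega>) (distr N borel \<xi>)) * (\<xi>' \<omega> - \<xi> \<omega>) \<partial>N) \<ge> 0)"

definition H6 ::
  "real \<Rightarrow> (real \<Rightarrow> real \<Rightarrow> real measure \<Rightarrow> real) \<Rightarrow> (real \<Rightarrow> real measure \<Rightarrow> real) \<Rightarrow> bool" where
  "H6 T f1 g \<longleftrightarrow>
     (\<forall>t\<in>{0..T}. weakly_monotone (\<lambda>x m. deriv (\<lambda>y. f1 t y m) x)) \<and>
     weakly_monotone (\<lambda>x m. deriv (\<lambda>y. g y m) x)"

definition hamiltonian ::
  "coeff \<Rightarrow> coeff \<Rightarrow> coeff \<Rightarrow> coeff \<Rightarrow> real \<Rightarrow> real \<Rightarrow> real \<Rightarrow> real \<Rightarrow> real \<Rightarrow> real \<Rightarrow> real measure \<Rightarrow> real" where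
  "hamiltonian b \<sigma> \<sigma>\<^sub>c f t x p q q\<^sub>c u m =
     b t x u m * p + \<sigma> t x u m * q + \<sigma>\<^sub>c t x u m * q\<^sub>c + f t x u m"

text \<open>Under the assumptions above the minimiser is the same for all \<open>m\<close>, and unique.\<close>

definition u_hat ::
  "coeff \<Rightarrow> coeff \<Rightarrow> coeff \<Rightarrow> coeff \<Rightarrow> real \<Rightarrow> real \<Rightarrow> real \<Rightarrow> real \<Rightarrow> real \<Rightarrow> real" where
  "u_hat b \<sigma> \<sigma>\<^sub>c f t x p q q\<^sub>c =
     (THE u. \<forall>m\<in>P2. \<forall>v. hamiltonian b \<sigma> \<sigma>\<^sub>c f t x p q q\<^sub>c u m \<le> hamiltonian b \<sigma> \<sigma>\<^sub>c f t x p q q\<^sub>c v m)"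

definition fbsde_solution ::
  "'a measure \<Rightarrow> real \<Rightarrow> (real \<Rightarrow> 'a \<Rightarrow> real) \<Rightarrow> (real \<Rightarrow> 'a \<Rightarrow> real) \<Rightarrow> ('a \<Rightarrow> real)
     \<Rightarrow> coeff \<Rightarrow> coeff \<Rightarrow> coeff \<Rightarrow> coeff \<Rightarrow> (real \<Rightarrow> real measure \<Rightarrow> real)
     \<Rightarrow> (real \<Rightarrow> 'a \<Rightarrow> real) \<Rightarrow> (real \<Rightarrow> 'a \<Rightarrow> real) \<Rightarrow> (real \<Rightarrow> 'a \<Rightarrow> real) \<Rightarrow> (real \<Rightarrow> 'a \<Rightarrow> real) \<Rightarrow> bool" where
  "fbsde_solution M T W W\<^sub>c \<xi>0 b \<sigma> \<sigma>\<^sub>c f g X p q q\<^sub>c \<longleftrightarrow>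
     (let F = full_filtration M W W\<^sub>c \<xi>0;
          u = (\<lambda>t \<omega>. u_hat b \<sigma> \<sigma>\<^sub>c f t (X t \<omega>) (p t \<omega>) (q t \<omega>) (q\<^sub>c t \<omega>))
      in adapted_process M F T X \<and> adapted_process M F T p \<and>
         adapted_process M F T q \<and> adapted_process M F T q\<^sub>c \<and>
         (\<exists>\<mu>. cond_law_process M (common_filtration M W\<^sub>c) T X \<mu> \<and>
            has_stoch_differential M F T W W\<^sub>c X
              (\<lambda>t \<omega>. b t (X t \<omega>) (u t \<omega>) (\<mu> t \<omega>))
              (\<lambda>t \<omega>. \<sigma> t (X t \<omega>) (u t \<omega>) (\<mu> t \<omega>))
              (\<lambda>t \<omega>. \<sigma>\<^sub>c t (X t \<omega>) (u t \<omega>) (\<mu> t \<omega>)) \<and>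
            has_stoch_differential M F T W W\<^sub>c p
              (\<lambda>t \<omega>. - deriv (\<lambda>x. hamiltonian b \<sigma> \<sigma>\<^sub>c f t x (p t \<omega>) (q t \<omega>) (q\<^sub>c t \<omega>) (u t \<omega>) (\<mu> t \<omega>)) (X t \<omega>))
              q q\<^sub>c \<and>
            (AE \<omega> in M. X 0 \<omega> = \<xi>0 \<omega>) \<and>
            (AE \<omega> in M. p T \<omega> = deriv (\<lambda>x. g x (\<mu> T \<omega>)) (X T \<omega>))))"

definition square_integrable_quadruple ::
  "'a measure \<Rightarrow> real \<Rightarrow> (real \<Rightarrow> 'a \<Rightarrow> real) \<Rightarrow> (real \<Rightarrow> 'a \<Rightarrow> real) \<Rightarrow> (real \<Rightarrow> 'a \<Rightarrow> real)
     \<Rightarrow> (real \<Rightarrow> 'a \<Rightarrow> real) \<Rightarrow> bool" where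
  "square_integrable_quadruple M T X p q q\<^sub>c \<longleftrightarrow>
     (\<integral>\<^sup>+\<omega>. (SUP t\<in>{0..T}. ennreal ((norm (X t \<omega>, p t \<omega>))\<^sup>2))
         + (\<integral>\<^sup>+t\<in>{0..T}. ennreal ((norm (q t \<omega>, q\<^sub>c t \<omega>))\<^sup>2) \<partial>lborel) \<partial>M) < \<infinity>"

text \<open>Solutions are identified as usual: \<open>X\<close> and \<open>p\<close> up to indistinguishability, the martingale
  integrands \<open>dt \<otimes> dP\<close>-almost everywhere.\<close>

definition same_solution ::
  "'a measure \<Rightarrow> real
     \<Rightarrow> (real \<Rightarrow> 'a \<Rightarrow> real) \<Rightarrow> (real \<Rightarrow> 'a \<Rightarrow> real) \<Rightarrow> (real \<Rightarrow> 'a \<Rightarrow> real) \<Rightarrow> (real \<Rightarrow> 'a \<Rightarrow> real)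
     \<Rightarrow> (real \<Rightarrow> 'a \<Rightarrow> real) \<Rightarrow> (real \<Rightarrow> 'a \<Rightarrow> real) \<Rightarrow> (real \<Rightarrow> 'a \<Rightarrow> real) \<Rightarrow> (real \<Rightarrow> 'a \<Rightarrow> real) \<Rightarrow> bool" where
  "same_solution M T X p q q\<^sub>c X' p' q' q\<^sub>c' \<longleftrightarrow>
     (AE \<omega> in M. \<forall>t\<in>{0..T}. X t \<omega> = X' t \<omega> \<and> p t \<omega> = p' t \<omega>) \<and>
     (AE z in restrict_space lborel {0..T} \<Otimes>\<^sub>M M.
        q (fst z) (snd z) = q' (fst z) (snd z) \<and> q\<^sub>c (fst z) (snd z) = q\<^sub>c' (fst z) (snd z))"

end

theory Submission
  imports Defs
begin

text \<open>
  Uniqueness is an energy argument for the difference of two solutions. All quantities are compared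
  with the energy \<open>V\<close> of the difference of the controls, that is, the integral of
  \<open>E |u' - u|\<^sup>2\<close> over \<open>[0,T]\<close>.

  The squares of \<open>X' - X\<close> and of \<open>p' - p\<close> satisfy linear energy identities, and Gronwall's inequality
  bounds \<open>E |X' - X|\<^sup>2\<close>, \<open>E |p' - p|\<^sup>2\<close> and the energy of the differences of \<open>q\<close> and \<open>q\<^sub>c\<close> by
  multiples of \<open>V\<close> that depend only on \<open>L\<close> and \<open>T\<close> (\<open>forward_estimate\<close>, \<open>backward_estimate\<close>,
  \<open>integrand_energy\<close>). The product of \<open>X' - X\<close> and \<open>p' - p\<close> yields the reverse information. Its
  expectation vanishes at time \<open>0\<close> and is nonnegative at time \<open>T\<close> by weak monotonicity of \<open>g\<^sub>x\<close>. In its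
  drift the control terms combine, by the first-order condition for the minimiser, with the
  derivatives of \<open>f0\<close> to a term that strong convexity bounds by \<open>- 2 C\<^sub>f |u' - u|\<^sup>2\<close>; the derivative
  of \<open>f1\<close> has a sign by weak monotonicity; and what is left is the dependence of the
  coefficients on the conditional law, with the factor \<open>L\<^sub>m\<close> (\<open>duality_rate\<close>). Hence
  \<open>0 \<le> (L\<^sub>m K / 2 - 2 C\<^sub>f) V\<close> with \<open>K\<close> depending on \<open>L\<close> and \<open>T\<close>, and \<open>V = 0\<close> once
  \<open>L\<^sub>m / C\<^sub>f \<le> 2 / K\<close> (\<open>control_energy_zero\<close>). Then the other energies vanish too.

  Three points need more than this computation.

  \<^item> The monotonicity hypotheses speak of laws, whereas the equation contains conditional laws
    given the common noise. The joint conditional law of the two states is therefore disintegrated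
    (\<open>joint_cond_law\<close>): for almost every \<open>\<omega>\<close> it couples the two conditional laws. Weak monotonicity
    holds for each of these couplings and then on average
    (\<open>weakly_monotone_cond_laws\<close>), and the squared Wasserstein distance of the conditional laws
    averages to at most \<open>E |X' - X|\<^sup>2\<close> (\<open>W2_cond_laws\<close>).

  \<^item> Functionals of the conditional law that are Lipschitz for the Wasserstein distance have to be
    measurable with respect to the common noise. This follows by approximating quantile functions
    by step functions with rounded jumps (\<open>W2_lipschitz_measurable\<close>).

  \<^item> The energy identities are instances of Ito's product rule in expectation (\<open>product_rule\<close>). For
    integrands that are limits of simple ones it follows from the isometry, the martingale property
    and Fubini's theorem: in an expectation, a martingale that is multiplied by a quantity known at
    time \<open>s\<close> may be replaced by its value at time \<open>s\<close>.
\<close>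

section \<open>Square-integrable functions\<close>

lemma L2_varsD:
  assumes "f \<in> L2_vars M G"
  shows "f \<in> borel_measurable G" "integrable M (\<lambda>x. (f x)\<^sup>2)"
  using assms by (auto simp: L2_vars_def)

lemma L2_vars_subalgebra:
  assumes "subalgebra M G" "f \<in> L2_vars M G" shows "f \<in> L2_vars M M"
  using assms measurable_from_subalg by (auto simp: L2_vars_def)

lemma L2_vars_mult_integrable:
  fixes f g :: "'a \<Rightarrow> real"
  assumes f: "f \<in> L2_vars M M" and g: "g \<in> L2_vars M M"
  shows "integrable M (\<lambda>x. f x * g x)"
proof (rule Bochner_Integration.integrable_bound)
  show "integrable M (\<lambda>x. (f x)\<^sup>2 + (g x)\<^sup>2)"
    using L2_varsD(2)[OF f] L2_varsD(2)[OF g] by simp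
  show "(\<lambda>x. f x * g x) \<in> borel_measurable M"
    using L2_varsD(1)[OF f] L2_varsD(1)[OF g] by simp
  have "\<bar>a * b\<bar> \<le> \<bar>a\<^sup>2 + b\<^sup>2\<bar>" for a b :: real
  proof -
    have "2 * (\<bar>a\<bar> * \<bar>b\<bar>) \<le> a\<^sup>2 + b\<^sup>2"
      using sum_squares_bound[of "\<bar>a\<bar>" "\<bar>b\<bar>"] by simp
    moreover have "0 \<le> \<bar>a\<bar> * \<bar>b\<bar>" by simp
    ultimately show ?thesis unfolding abs_mult by linarith
  qed
  then show "AE x in M. norm (f x * g x) \<le> norm ((f x)\<^sup>2 + (g x)\<^sup>2)" by simp
qed

lemma L2_vars_integrable:
  assumes "finite_measure M" "f \<in> L2_vars M M" shows "integrable M f"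
proof -
  interpret finite_measure M by fact
  have "(\<lambda>_. 1::real) \<in> L2_vars M M" by (auto simp: L2_vars_def)
  from L2_vars_mult_integrable[OF assms(2) this] show ?thesis by simp
qed

lemma L2_vars_add:
  assumes G: "subalgebra M G" and f: "f \<in> L2_vars M G" and g: "g \<in> L2_vars M G"
  shows "(\<lambda>x. f x + g x) \<in> L2_vars M G"
proof -
  have "integrable M (\<lambda>x. (f x)\<^sup>2 + 2 * (f x * g x) + (g x)\<^sup>2)"
    using L2_vars_mult_integrable[OF L2_vars_subalgebra[OF G f] L2_vars_subalgebra[OF G g]]
      L2_varsD(2)[OF f] L2_varsD(2)[OF g] by simp
  then show ?thesis using L2_varsD(1)[OF f] L2_varsD(1)[OF g]
    by (auto simp: L2_vars_def power2_sum algebra_simps)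
qed

lemma L2_vars_cmult:
  assumes "f \<in> L2_vars M G" shows "(\<lambda>x. c * f x) \<in> L2_vars M G"
  using assms by (auto simp: L2_vars_def power_mult_distrib)

lemma L2_vars_diff:
  assumes G: "subalgebra M G" and f: "f \<in> L2_vars M G" and g: "g \<in> L2_vars M G"
  shows "(\<lambda>x. f x - g x) \<in> L2_vars M G"
  using L2_vars_add[OF G f L2_vars_cmult[OF g, of "-1"]] by simp

lemma subalgebra_refl: "subalgebra M M" by (simp add: subalgebra_def)

lemmas L2_add = L2_vars_add[OF subalgebra_refl]
lemmas L2_diff = L2_vars_diff[OF subalgebra_refl]

lemma L2_vars_bound:
  assumes "f \<in> borel_measurable G" "subalgebra M G" "g \<in> L2_vars M M"
    "AE x in M. \<bar>f x\<bar> \<le> \<bar>g x\<bar>"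
  shows "f \<in> L2_vars M G"
proof -
  have m: "f \<in> borel_measurable M" using measurable_from_subalg assms by blast
  have "integrable M (\<lambda>x. (f x)\<^sup>2)"
  proof (rule Bochner_Integration.integrable_bound[OF L2_varsD(2)[OF assms(3)]])
    show "(\<lambda>x. (f x)\<^sup>2) \<in> borel_measurable M" using m by simp
    show "AE x in M. norm ((f x)\<^sup>2) \<le> norm ((g x)\<^sup>2)"
      using assms(4) by eventually_elim (simp add: abs_le_square_iff)
  qed
  then show ?thesis using assms by (simp add: L2_vars_def)
qed

lemma L2_vars_bounded:
  assumes "finite_measure M" "subalgebra M G" "f \<in> borel_measurable G" "\<And>x. x \<in> space M \<Longrightarrow> \<bar>f x\<bar> \<le> C"
  shows "f \<in> L2_vars M G"
proof (rule L2_vars_bound[OF assms(3,2), where g="\<lambda>_. C"])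
  interpret finite_measure M by fact
  show "(\<lambda>_. C) \<in> L2_vars M M" by (auto simp: L2_vars_def)
  show "AE x in M. \<bar>f x\<bar> \<le> \<bar>C\<bar>" using assms(4) by (auto intro!: AE_I2 order_trans[OF _ abs_ge_self])
qed

lemma L2_vars_sum:
  assumes "finite_measure M" "finite I" "\<And>i. i \<in> I \<Longrightarrow> f i \<in> L2_vars M M"
  shows "(\<lambda>x. \<Sum>i\<in>I. f i x) \<in> L2_vars M M"
  using assms(2,3)
proof (induction I rule: finite_induct)
  case empty
  then show ?case using assms(1) by (auto simp: L2_vars_def)
next
  case (insert i I)
  then show ?case using L2_add[of "f i" M "\<lambda>x. \<Sum>i\<in>I. f i x"] by simp
qed

text \<open>Optimising the weight in \<open>2 a b \<le> s a\<^sup>2 + b\<^sup>2 / s\<close> gives the inequality; the degenerate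
  case \<open>\<integral> f\<^sup>2 = 0\<close> is covered by letting the weight go to infinity.\<close>

lemma L2_Cauchy_Schwarz:
  fixes f g :: "'a \<Rightarrow> real"
  assumes f: "f \<in> L2_vars M M" and g: "g \<in> L2_vars M M"
  shows "(\<integral>x. f x * g x \<partial>M)\<^sup>2 \<le> (\<integral>x. (f x)\<^sup>2 \<partial>M) * (\<integral>x. (g x)\<^sup>2 \<partial>M)"
proof -
  let ?A = "\<integral>x. (f x)\<^sup>2 \<partial>M" and ?B = "\<integral>x. (g x)\<^sup>2 \<partial>M" and ?C = "\<integral>x. f x * g x \<partial>M"
  note i = L2_vars_mult_integrable[OF f g] L2_varsD(2)[OF f] L2_varsD(2)[OF g]
  have q: "0 \<le> s\<^sup>2 * ?A + 2 * s * ?C + ?B" for s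
  proof -
    have "0 \<le> (\<integral>x. (s * f x + g x)\<^sup>2 \<partial>M)" by simp
    also have "\<dots> = (\<integral>x. s\<^sup>2 * (f x)\<^sup>2 + 2 * s * (f x * g x) + (g x)\<^sup>2 \<partial>M)"
      by (simp add: power2_sum power_mult_distrib algebra_simps)
    also have "\<dots> = s\<^sup>2 * ?A + 2 * s * ?C + ?B" using i by simp
    finally show ?thesis .
  qed
  show ?thesis
  proof (cases "?A = 0")
    case True
    have "?C = 0"
    proof (rule ccontr)
      assume "?C \<noteq> 0"
      then show False using q[of "- (?B + 1) / (2 * ?C)"] True by (simp add: field_simps)
    qed
    then show ?thesis using True by simp
  next
    case False
    then have "?A > 0" by (simp add: less_le)
    then show ?thesis using q[of "- ?C / ?A"]
      by (simp add: field_simps power2_eq_square)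
  qed
qed

lemma L2_limit:
  fixes f :: "'a \<Rightarrow> real"
  assumes f: "f \<in> borel_measurable M" and fk: "\<And>k. F k \<in> L2_vars M M"
    and lim: "(\<lambda>k. \<integral>\<^sup>+x. ennreal ((f x - F k x)\<^sup>2) \<partial>M) \<longlonglongrightarrow> 0"
  shows "f \<in> L2_vars M M" "(\<lambda>k. \<integral>x. (f x - F k x)\<^sup>2 \<partial>M) \<longlonglongrightarrow> 0"
proof -
  note [measurable] = f L2_varsD(1)[OF fk]
  have "eventually (\<lambda>k. (\<integral>\<^sup>+x. ennreal ((f x - F k x)\<^sup>2) \<partial>M) < 1) sequentially"
    by (rule order_tendstoD(2)[OF lim]) simp
  then obtain k where "(\<integral>\<^sup>+x. ennreal ((f x - F k x)\<^sup>2) \<partial>M) < 1"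
    by (auto simp: eventually_sequentially)
  then have "(\<integral>\<^sup>+x. ennreal ((f x - F k x)\<^sup>2) \<partial>M) < \<infinity>"
    using less_trans by fastforce
  then have "(\<lambda>x. f x - F k x) \<in> L2_vars M M"
    by (auto simp: L2_vars_def intro!: integrableI_nonneg)
  from L2_add[OF this fk[of k]] show fL: "f \<in> L2_vars M M" by simp
  have "integrable M (\<lambda>x. (f x - F k x)\<^sup>2)" for k
    using L2_diff[OF fL fk[of k]] by (simp add: L2_vars_def)
  then have "(\<integral>\<^sup>+x. ennreal ((f x - F k x)\<^sup>2) \<partial>M) = ennreal (\<integral>x. (f x - F k x)\<^sup>2 \<partial>M)" for k
    by (intro nn_integral_eq_integral) auto
  with lim show "(\<lambda>k. \<integral>x. (f x - F k x)\<^sup>2 \<partial>M) \<longlonglongrightarrow> 0"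
    using tendsto_ennrealD[of "\<lambda>k. \<integral>x. (f x - F k x)\<^sup>2 \<partial>M" 0 sequentially] by simp
qed

text \<open>The error is a sum of three inner products, each with a factor that tends to zero; the
  Cauchy-Schwarz inequality bounds them.\<close>

lemma L2_inner_tendsto:
  fixes f g :: "'a \<Rightarrow> real"
  assumes f: "f \<in> L2_vars M M" and fk: "\<And>k. F k \<in> L2_vars M M"
    and limf: "(\<lambda>k. \<integral>x. (f x - F k x)\<^sup>2 \<partial>M) \<longlonglongrightarrow> 0"
    and g: "g \<in> L2_vars M M" and gk: "\<And>k. G k \<in> L2_vars M M"
    and limg: "(\<lambda>k. \<integral>x. (g x - G k x)\<^sup>2 \<partial>M) \<longlonglongrightarrow> 0"
  shows "(\<lambda>k. \<integral>x. F k x * G k x \<partial>M) \<longlonglongrightarrow> (\<integral>x. f x * g x \<partial>M)"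
proof -
  note int = L2_vars_mult_integrable
  note df = L2_diff[OF f fk] and dg = L2_diff[OF g gk]
  have prod0: "(\<lambda>k. \<integral>x. U k x * V k x \<partial>M) \<longlonglongrightarrow> 0"
    if U: "\<And>k. U k \<in> L2_vars M M" and V: "\<And>k. V k \<in> L2_vars M M"
      and l: "(\<lambda>k. (\<integral>x. (U k x)\<^sup>2 \<partial>M) * (\<integral>x. (V k x)\<^sup>2 \<partial>M)) \<longlonglongrightarrow> 0" for U V :: "nat \<Rightarrow> 'a \<Rightarrow> real"
  proof -
    have "(\<lambda>k. (\<integral>x. U k x * V k x \<partial>M)\<^sup>2) \<longlonglongrightarrow> 0"
      by (rule real_tendsto_sandwich[OF _ _ tendsto_const l]) (auto intro!: always_eventually L2_Cauchy_Schwarz U V)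
    then have "(\<lambda>k. sqrt ((\<integral>x. U k x * V k x \<partial>M)\<^sup>2)) \<longlonglongrightarrow> sqrt 0" by (rule tendsto_real_sqrt)
    then show ?thesis by (simp add: tendsto_rabs_zero_iff)
  qed
  have e: "(\<integral>x. F k x * G k x \<partial>M) = (\<integral>x. f x * g x \<partial>M) - (\<integral>x. f x * (g x - G k x) \<partial>M)
      - (\<integral>x. g x * (f x - F k x) \<partial>M) + (\<integral>x. (f x - F k x) * (g x - G k x) \<partial>M)" for k
  proof -
    have "(\<integral>x. F k x * G k x \<partial>M) = (\<integral>x. f x * g x - f x * (g x - G k x) - g x * (f x - F k x)
       + (f x - F k x) * (g x - G k x) \<partial>M)" by (simp add: algebra_simps)
    also have "\<dots> = (\<integral>x. f x * g x \<partial>M) - (\<integral>x. f x * (g x - G k x) \<partial>M)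
      - (\<integral>x. g x * (f x - F k x) \<partial>M) + (\<integral>x. (f x - F k x) * (g x - G k x) \<partial>M)"
      using int[OF f g] int[OF f dg] int[OF g df] int[OF df dg] by simp
    finally show ?thesis .
  qed
  have "(\<lambda>k. \<integral>x. f x * (g x - G k x) \<partial>M) \<longlonglongrightarrow> 0"
    using tendsto_mult[OF tendsto_const limg] by (intro prod0 f dg) auto
  moreover have "(\<lambda>k. \<integral>x. g x * (f x - F k x) \<partial>M) \<longlonglongrightarrow> 0"
    using tendsto_mult[OF tendsto_const limf] by (intro prod0 g df) auto
  moreover have "(\<lambda>k. \<integral>x. (f x - F k x) * (g x - G k x) \<partial>M) \<longlonglongrightarrow> 0"
    using tendsto_mult[OF limf limg] by (intro prod0 dg df) auto
  ultimately have "(\<lambda>k. \<integral>x. F k x * G k x \<partial>M) \<longlonglongrightarrow> (\<integral>x. f x * g x \<partial>M) - 0 - 0 + 0"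
    unfolding e by (intro tendsto_intros)
  then show ?thesis by simp
qed

lemma L2_sq_tendsto:
  assumes "f \<in> L2_vars M M" "\<And>k. F k \<in> L2_vars M M" "(\<lambda>k. \<integral>x. (f x - F k x)\<^sup>2 \<partial>M) \<longlonglongrightarrow> 0"
    "g \<in> L2_vars M M"
  shows "(\<lambda>k. \<integral>x. F k x * g x \<partial>M) \<longlonglongrightarrow> (\<integral>x. f x * g x \<partial>M)"
  by (rule L2_inner_tendsto[where G="\<lambda>_. g"]) (use assms in auto)

section \<open>Filtrations and independence of Brownian increments\<close>

lemma generators_mono: "Xs \<subseteq> Ys \<Longrightarrow> generators M Xs \<subseteq> generators M Ys"
  by (auto simp: generators_def)

lemma generators_subset:
  assumes "Xs \<subseteq> borel_measurable M" shows "generators M Xs \<subseteq> sets M"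
  using assms by (auto simp: generators_def intro: measurable_sets)

lemma space_augmented_sigma [simp]: "space (augmented_sigma M Xs) = space M"
  by (simp add: augmented_sigma_def space_measure_of_conv)

lemma sets_augmented_sigma:
  assumes "Xs \<subseteq> borel_measurable M"
  shows "sets (augmented_sigma M Xs) = sigma_sets (space M) (generators M Xs \<union> null_sets M)"
  unfolding augmented_sigma_def using generators_subset[OF assms]
  by (intro sets_measure_of) (auto dest: sets.sets_into_space null_setsD2)

lemma subalgebra_augmented_sigma:
  assumes "Xs \<subseteq> borel_measurable M" shows "subalgebra M (augmented_sigma M Xs)"
  unfolding subalgebra_def sets_augmented_sigma[OF assms]
  using generators_subset[OF assms] by (auto intro!: sets.sigma_sets_subset dest: null_setsD2)

lemma augmented_sigma_mono:
  assumes "Ys \<subseteq> borel_measurable M" "Xs \<subseteq> Ys"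
  shows "subalgebra (augmented_sigma M Ys) (augmented_sigma M Xs)"
proof -
  have "Xs \<subseteq> borel_measurable M" using assms by auto
  from sets_augmented_sigma[OF this] sets_augmented_sigma[OF assms(1)] show ?thesis
    unfolding subalgebra_def using generators_mono[OF assms(2), of M]
    by (metis Un_mono order_refl sigma_sets_mono' space_augmented_sigma)
qed

lemma measurable_augmented_sigma:
  assumes "Xs \<subseteq> borel_measurable M" "X \<in> Xs" shows "X \<in> borel_measurable (augmented_sigma M Xs)"
proof (rule measurableI)
  fix A :: "real set" assume "A \<in> sets borel"
  then have "X -` A \<inter> space M \<in> generators M Xs" using assms(2) by (auto simp: generators_def)
  then show "X -` A \<inter> space (augmented_sigma M Xs) \<in> sets (augmented_sigma M Xs)"
    by (simp add: sets_augmented_sigma[OF assms(1)])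
qed simp

text \<open>Up to null sets the augmentation adds nothing; moreover each generator may first be replaced
  by an almost surely equal one, such as \<open>W\<^sub>r\<close> by \<open>W\<^sub>r - W\<^sub>0\<close>.\<close>

lemma augmented_sigma_AE_eq:
  assumes Xs: "Xs \<subseteq> borel_measurable M"
    and A: "A \<subseteq> Pow (space M)"
    and gen: "\<And>X B. X \<in> Xs \<Longrightarrow> B \<in> sets borel \<Longrightarrow>
      \<exists>S'\<in>sigma_sets (space M) A. AE x in M. (x \<in> X -` B \<inter> space M) \<longleftrightarrow> x \<in> S'"
    and S: "S \<in> sets (augmented_sigma M Xs)"
  shows "\<exists>S'\<in>sigma_sets (space M) A. AE x in M. x \<in> S \<longleftrightarrow> x \<in> S'"
  using S[unfolded sets_augmented_sigma[OF Xs]]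
proof (induction rule: sigma_sets.induct)
  case (Basic a)
  then show ?case
  proof
    assume "a \<in> generators M Xs"
    then obtain X B where "X \<in> Xs" "B \<in> sets borel" "a = X -` B \<inter> space M"
      by (auto simp: generators_def)
    with gen[of X B] show ?thesis by simp
  next
    assume "a \<in> null_sets M"
    then have "AE x in M. x \<in> a \<longleftrightarrow> x \<in> {}" by (auto dest: AE_not_in)
    then show ?thesis using sigma_sets.Empty by blast
  qed
next
  case Empty
  then show ?case using sigma_sets.Empty by (auto intro!: bexI[of _ "{}"])
next
  case (Compl a)
  then obtain S' where S': "S' \<in> sigma_sets (space M) A" "AE x in M. x \<in> a \<longleftrightarrow> x \<in> S'" by auto
  from S'(2) have "AE x in M. x \<in> space M - a \<longleftrightarrow> x \<in> space M - S'" by eventually_elim auto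
  then show ?case using sigma_sets.Compl[OF S'(1)] by blast
next
  case (Union a)
  then obtain S' where S': "\<And>i. S' i \<in> sigma_sets (space M) A" "\<And>i. AE x in M. x \<in> a i \<longleftrightarrow> x \<in> S' i"
    by metis
  have "AE x in M. \<forall>i. x \<in> a i \<longleftrightarrow> x \<in> S' i" using S'(2) by (simp add: AE_all_countable)
  then have "AE x in M. x \<in> (\<Union>i. a i) \<longleftrightarrow> x \<in> (\<Union>i. S' i)" by eventually_elim auto
  moreover have "(\<Union>i. S' i) \<in> sigma_sets (space M) A" using S'(1) by (rule sigma_sets.Union)
  ultimately show ?case by blast
qed

lemma (in prob_space) indep_set_mono:
  assumes "indep_set A B" "A' \<subseteq> A" "B' \<subseteq> B" shows "indep_set A' B'"
  using assms unfolding indep_sets2_eq by (meson subset_iff)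

lemma generated_events_subset_vimage:
  assumes U: "U \<in> M \<rightarrow>\<^sub>M N"
    and Xs: "\<And>X. X \<in> Xs \<Longrightarrow> \<exists>h\<in>borel_measurable N. \<forall>\<omega>\<in>space M. X \<omega> = h (U \<omega>)"
  shows "generated_events M Xs \<subseteq> sigma_sets (space M) { U -` A \<inter> space M | A. A \<in> sets N}"
  unfolding generated_events_def
proof (rule sigma_sets_mono, rule)
  fix S assume "S \<in> generators M Xs"
  then obtain X A where X: "X \<in> Xs" "A \<in> sets borel" "S = X -` A \<inter> space M" by (auto simp: generators_def)
  from Xs[OF X(1)] obtain h where h: "h \<in> borel_measurable N" "\<forall>\<omega>\<in>space M. X \<omega> = h (U \<omega>)" by auto
  have "S = U -` (h -` A \<inter> space N) \<inter> space M"
    using h(2) measurable_space[OF U] X(3) by auto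
  moreover have "h -` A \<inter> space N \<in> sets N" using h(1) X(2) by (rule measurable_sets)
  ultimately show "S \<in> sigma_sets (space M) { U -` A \<inter> space M | A. A \<in> sets N}" by blast
qed

lemma (in prob_space) indep_var_generated_events:
  assumes "indep_var N U N' U'"
    and "\<And>X. X \<in> Xs \<Longrightarrow> \<exists>h\<in>borel_measurable N. \<forall>\<omega>\<in>space M. X \<omega> = h (U \<omega>)"
    and "\<And>Y. Y \<in> Ys \<Longrightarrow> \<exists>h\<in>borel_measurable N'. \<forall>\<omega>\<in>space M. Y \<omega> = h (U' \<omega>)"
  shows "indep_set (generated_events M Xs) (generated_events M Ys)"
proof -
  from assms(1) have U: "U \<in> M \<rightarrow>\<^sub>M N" "U' \<in> M \<rightarrow>\<^sub>M N'" and ind: "indep_set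
      (sigma_sets (space M) { U -` A \<inter> space M | A. A \<in> sets N})
      (sigma_sets (space M) { U' -` A \<inter> space M | A. A \<in> sets N'})"
    unfolding indep_var_eq by blast+
  show ?thesis
    by (rule indep_set_mono[OF ind generated_events_subset_vimage[OF U(1) assms(2)]
          generated_events_subset_vimage[OF U(2) assms(3)]])
qed

lemma generated_events_directed_union:
  assumes "\<And>J. J \<in> \<J> \<Longrightarrow> Xs J \<subseteq> borel_measurable M" "\<And>J K. J \<in> \<J> \<Longrightarrow> K \<in> \<J> \<Longrightarrow> \<exists>L\<in>\<J>. Xs J \<union> Xs K \<subseteq> Xs L"
  shows "Int_stable (\<Union>J\<in>\<J>. generated_events M (Xs J))"
proof (rule Int_stableI)
  fix a b assume "a \<in> (\<Union>J\<in>\<J>. generated_events M (Xs J))" "b \<in> (\<Union>J\<in>\<J>. generated_events M (Xs J))"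
  then obtain J K where JK: "J \<in> \<J>" "K \<in> \<J>" "a \<in> generated_events M (Xs J)" "b \<in> generated_events M (Xs K)"
    by auto
  from assms(2)[OF JK(1,2)] obtain L where L: "L \<in> \<J>" "Xs J \<subseteq> Xs L" "Xs K \<subseteq> Xs L" by auto
  have m: "generated_events M (Xs J) \<subseteq> generated_events M (Xs L)" if "Xs J \<subseteq> Xs L" for J
    unfolding generated_events_def by (intro sigma_sets_mono' generators_mono that)
  interpret sigma_algebra "space M" "generated_events M (Xs L)"
    unfolding generated_events_def
    by (rule sigma_algebra_sigma_sets) (auto simp: generators_def)
  have "a \<inter> b \<in> generated_events M (Xs L)" using JK m L by (intro Int) auto
  then show "a \<inter> b \<in> (\<Union>J\<in>\<J>. generated_events M (Xs J))" using L by auto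
qed

text \<open>The increments over a finite grid are independent, and any finite set of times is contained
  in a grid; finite sets of times generate the whole past.\<close>

lemma (in prob_space) brownian_past_indep_increment:
  assumes V: "brownian_motion M T V" and st: "0 \<le> s" "s < t" "t \<le> T"
  shows "indep_set (generated_events M ((\<lambda>r \<omega>. V r \<omega> - V 0 \<omega>) ` {0..s}))
    (generated_events M {\<lambda>\<omega>. V t \<omega> - V s \<omega>})"
proof -
  let ?X = "\<lambda>r \<omega>. V r \<omega> - V 0 \<omega>" and ?Y = "\<lambda>\<omega>. V t \<omega> - V s \<omega>"
  have meas: "V r \<in> borel_measurable M" if "0 \<le> r" "r \<le> T" for r
    using V that by (auto simp: brownian_motion_def)
  let ?\<J> = "{J. finite J \<and> J \<subseteq> {0..s}}"
  let ?P = "\<Union>J\<in>?\<J>. generated_events M (?X ` J)"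
  have grid: "indep_set (generated_events M (?X ` J)) (generated_events M {?Y})" if J: "J \<in> ?\<J>" for J
  proof -
    define K where "K = insert 0 (insert s J)"
    have K: "finite K" "K \<subseteq> {0..s}" "0 \<in> K" "s \<in> K" "J \<subseteq> K" using J st by (auto simp: K_def)
    define l where "l = sorted_list_of_set K"
    have l: "sorted l" "distinct l" "set l = K" using K(1) by (auto simp: l_def)
    have ln: "l \<noteq> []" using l K by auto
    define n where "n = length l - 1"
    have len: "length l = Suc n" using ln by (cases l) (auto simp: n_def)
    define \<tau> where "\<tau> i = (if i \<le> n then l ! i else t)" for i
    have nth_less: "l ! i < l ! j" if "i < j" "j < length l" for i j
      using sorted_wrt_nth_less[of "(<)" l i j] l(1,2) that by (simp add: strict_sorted_iff)
    have l0: "l ! 0 = 0"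
    proof -
      obtain i where "i < length l" "l ! i = 0" using K(3) l(3) by (metis in_set_conv_nth)
      moreover have "l ! 0 \<ge> 0" using K(2) l(3) ln by (metis atLeastAtMost_iff length_greater_0_conv nth_mem subsetD)
      ultimately show ?thesis using nth_less[of 0 i] by (cases i) auto
    qed
    have lns: "l ! n = s"
    proof -
      obtain i where i: "i < length l" "l ! i = s" using K(4) l(3) by (metis in_set_conv_nth)
      moreover have "l ! n \<le> s" using K(2) l(3) len by (metis atLeastAtMost_iff lessI nth_mem subsetD)
      ultimately show ?thesis using nth_less[of i n] len by (cases "i = n") auto
    qed
    have \<tau>: "\<forall>i<Suc n. \<tau> i < \<tau> (Suc i)" "\<tau> 0 = 0" "\<tau> n = s" "\<tau> (Suc n) = t"
    proof -
      show "\<forall>i<Suc n. \<tau> i < \<tau> (Suc i)"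
      proof (intro allI impI)
        fix i assume "i < Suc n"
        then show "\<tau> i < \<tau> (Suc i)"
          using nth_less[of i "Suc i"] len lns st by (cases "i = n") (auto simp: \<tau>_def)
      qed
    qed (use l0 lns in \<open>auto simp: \<tau>_def\<close>)
    define D where "D i \<omega> = V (\<tau> (Suc i)) \<omega> - V (\<tau> i) \<omega>" for i \<omega>
    have "indep_vars (\<lambda>_. borel) D {..<Suc n}"
      using V \<tau> st unfolding brownian_motion_def D_def by auto
    from indep_var_restrict[OF this, of "{..<n}" "{n}"]
    have iv: "indep_var (PiM {..<n} (\<lambda>_. borel)) (\<lambda>\<omega>. restrict (\<lambda>i. D i \<omega>) {..<n})
       (PiM {n} (\<lambda>_. borel)) (\<lambda>\<omega>. restrict (\<lambda>i. D i \<omega>) {n})" by auto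
    have Dn: "D n = ?Y" using \<tau> by (auto simp: D_def)
    show ?thesis unfolding Dn[symmetric]
    proof (rule indep_var_generated_events[OF iv])
      fix X assume "X \<in> ?X ` J"
      then obtain r where r: "r \<in> J" "X = ?X r" by auto
      then obtain j where j: "j < length l" "l ! j = r" using K(5) l(3) by (metis in_set_conv_nth subsetD)
      then have jn: "j \<le> n" using len by simp
      let ?h = "\<lambda>v :: nat \<Rightarrow> real. \<Sum>i<j. v i"
      have "?h \<in> borel_measurable (PiM {..<n} (\<lambda>_. borel))" 
      proof (rule borel_measurable_sum)
        fix i assume "i \<in> {..<j}"
        then have "i \<in> {..<n}" using jn by auto
        then show "(\<lambda>v. v i) \<in> borel_measurable (PiM {..<n} (\<lambda>_. borel :: real measure))"
          by (rule measurable_component_singleton)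
      qed
      moreover have "X \<omega> = ?h (restrict (\<lambda>i. D i \<omega>) {..<n})" for \<omega>
      proof -
        have "?h (restrict (\<lambda>i. D i \<omega>) {..<n}) = (\<Sum>i<j. V (\<tau> (Suc i)) \<omega> - V (\<tau> i) \<omega>)"
          using jn by (intro sum.cong) (auto simp: D_def)
        also have "\<dots> = V (\<tau> j) \<omega> - V (\<tau> 0) \<omega>" by (rule sum_lessThan_telescope)
        finally show ?thesis using r j jn \<tau> by (simp add: \<tau>_def[of j])
      qed
      ultimately show "\<exists>h\<in>borel_measurable (PiM {..<n} (\<lambda>_. borel)). \<forall>\<omega>\<in>space M. X \<omega> = h (\<lambda>i\<in>{..<n}. D i \<omega>)"
        by (intro bexI[of _ ?h]) auto
    next
      fix Y assume "Y \<in> {D n}"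
      moreover have "(\<lambda>v. v n) \<in> borel_measurable (PiM {n} (\<lambda>_. borel :: real measure))"
        by (rule measurable_component_singleton) auto
      ultimately show "\<exists>h\<in>borel_measurable (PiM {n} (\<lambda>_. borel)). \<forall>\<omega>\<in>space M. Y \<omega> = h (\<lambda>i\<in>{n}. D i \<omega>)"
        by (intro bexI[of _ "\<lambda>v. v n"]) auto
    qed
  qed
  have sub: "?X ` J \<subseteq> borel_measurable M" if "J \<in> ?\<J>" for J using that st meas by (auto intro!: borel_measurable_diff)
  have "indep_set ?P (generated_events M {?Y})"
    using grid unfolding indep_sets2_eq by blast
  moreover have "Int_stable ?P"
  proof (rule generated_events_directed_union[OF sub])
    fix J K assume "J \<in> ?\<J>" "K \<in> ?\<J>"
    then show "\<exists>L\<in>?\<J>. ?X ` J \<union> ?X ` K \<subseteq> ?X ` L" by (intro bexI[of _ "J \<union> K"]) auto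
  qed
  moreover have "Int_stable (generated_events M {?Y})"
  proof -
    interpret sigma_algebra "space M" "generated_events M {?Y}"
      unfolding generated_events_def by (rule sigma_algebra_sigma_sets) (auto simp: generators_def)
    show ?thesis by (rule Int_stableI) auto
  qed
  ultimately have "indep_set (sigma_sets (space M) ?P) (sigma_sets (space M) (generated_events M {?Y}))"
    by (rule indep_set_sigma_sets)
  moreover have "generated_events M (?X ` {0..s}) \<subseteq> sigma_sets (space M) ?P"
    unfolding generated_events_def[of M "?X ` {0..s}"]
  proof (rule sigma_sets_mono, rule)
    fix S assume "S \<in> generators M (?X ` {0..s})"
    then obtain r A where r: "r \<in> {0..s}" "A \<in> sets borel" "S = ?X r -` A \<inter> space M"
      by (auto simp: generators_def)
    then have "S \<in> generated_events M (?X ` {r})"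
      unfolding generated_events_def generators_def by auto
    then have "S \<in> ?P" using r by (auto intro!: exI[of _ "{r}"])
    then show "S \<in> sigma_sets (space M) ?P" by blast
  qed
  moreover have "generated_events M {?Y} \<subseteq> sigma_sets (space M) (generated_events M {?Y})" by auto
  ultimately show ?thesis by (rule indep_set_mono)
qed

lemma sigma_algebra_generated_events: "sigma_algebra (space M) (generated_events M Xs)"
  unfolding generated_events_def by (rule sigma_algebra_sigma_sets) (auto simp: generators_def)

lemma generated_events_Int:
  "a \<in> generated_events M Xs \<Longrightarrow> b \<in> generated_events M Xs \<Longrightarrow> a \<inter> b \<in> generated_events M Xs"
proof -
  interpret sigma_algebra "space M" "generated_events M Xs" by (rule sigma_algebra_generated_events)
  show "a \<in> generated_events M Xs \<Longrightarrow> b \<in> generated_events M Xs \<Longrightarrow> a \<inter> b \<in> generated_events M Xs" by auto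
qed

lemma generated_events_top: "space M \<in> generated_events M Xs"
  unfolding generated_events_def by (rule sigma_sets_top)

lemma generated_events_vimage:
  "X \<in> Xs \<Longrightarrow> A \<in> sets borel \<Longrightarrow> X -` A \<inter> space M \<in> generated_events M Xs"
  unfolding generated_events_def generators_def by blast

lemma generated_events_mono:
  assumes "\<And>X. X \<in> Xs \<Longrightarrow> X \<in> borel_measurable (sigma (space M) (generated_events M Ys))"
  shows "generated_events M Xs \<subseteq> generated_events M Ys"
proof -
  interpret sigma_algebra "space M" "generated_events M Ys" by (rule sigma_algebra_generated_events)
  have s: "sets (sigma (space M) (generated_events M Ys)) = generated_events M Ys"
    by (metis sets_measure_of_eq)
  have sp: "space (sigma (space M) (generated_events M Ys)) = space M"
    by (metis space_measure_of_eq)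
  have "generators M Xs \<subseteq> generated_events M Ys"
    using measurable_sets[OF assms] unfolding s sp by (auto simp: generators_def)
  then show ?thesis unfolding generated_events_def[of M Xs] by (rule sigma_sets_subset)
qed

lemma generated_events_increments_subset:
  assumes "\<And>X. X \<in> Xs \<Longrightarrow> \<exists>Y\<in>Ys. \<exists>Z\<in>Ys. X = (\<lambda>\<omega>. Y \<omega> - Z \<omega>)"
  shows "generated_events M Xs \<subseteq> generated_events M Ys"
proof (rule generated_events_mono)
  fix X assume "X \<in> Xs"
  then obtain Y Z where YZ: "Y \<in> Ys" "Z \<in> Ys" "X = (\<lambda>\<omega>. Y \<omega> - Z \<omega>)" using assms by blast
  interpret sigma_algebra "space M" "generated_events M Ys" by (rule sigma_algebra_generated_events)
  have m: "U \<in> borel_measurable (sigma (space M) (generated_events M Ys))" if "U \<in> Ys" for U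
    by (rule measurableI) (use generated_events_vimage[OF that] in auto)
  show "X \<in> borel_measurable (sigma (space M) (generated_events M Ys))"
    unfolding YZ(3) using m YZ by (intro borel_measurable_diff)
qed

locale common_noise = prob_space M for M :: "'a measure" +
  fixes T :: real and W W\<^sub>c :: "real \<Rightarrow> 'a \<Rightarrow> real" and \<xi>0 :: "'a \<Rightarrow> real"
  assumes noise: "noise_setting M T W W\<^sub>c \<xi>0" and T_pos: "0 < T"
begin

abbreviation F :: "real \<Rightarrow> 'a measure" where "F \<equiv> full_filtration M W W\<^sub>c \<xi>0"
abbreviation G :: "real \<Rightarrow> 'a measure" where "G \<equiv> common_filtration M W\<^sub>c"

lemma noiseD:
  shows "brownian_motion M T W" "brownian_motion M T W\<^sub>c" "\<xi>0 \<in> borel_measurable M"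
    "indep_set (generated_events M (W ` {0..T})) (generated_events M (W\<^sub>c ` {0..T}))"
    "indep_set (generated_events M {\<xi>0}) (generated_events M (W ` {0..T} \<union> W\<^sub>c ` {0..T}))"
  using noise by (auto simp: noise_setting_def)

lemma W_measurable: "0 \<le> t \<Longrightarrow> t \<le> T \<Longrightarrow> W t \<in> borel_measurable M" "0 \<le> t \<Longrightarrow> t \<le> T \<Longrightarrow> W\<^sub>c t \<in> borel_measurable M"
  using noiseD(1,2) by (auto simp: brownian_motion_def)

lemma noises_measurable: "t \<le> T \<Longrightarrow> {\<xi>0} \<union> W ` {0..t} \<union> W\<^sub>c ` {0..t} \<subseteq> borel_measurable M"
  using W_measurable noiseD(3) by auto

lemma subalgebra_F: "t \<le> T \<Longrightarrow> subalgebra M (F t)"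
  unfolding full_filtration_def by (rule subalgebra_augmented_sigma[OF noises_measurable])

lemma subalgebra_F_F: "s \<le> t \<Longrightarrow> t \<le> T \<Longrightarrow> subalgebra (F t) (F s)"
  unfolding full_filtration_def by (rule augmented_sigma_mono[OF noises_measurable]) auto

lemma subalgebra_G: "t \<le> T \<Longrightarrow> subalgebra M (G t)"
  unfolding common_filtration_def using W_measurable by (intro subalgebra_augmented_sigma) auto

lemma subalgebra_F_G: "t \<le> T \<Longrightarrow> subalgebra (F t) (G t)"
  unfolding full_filtration_def common_filtration_def by (rule augmented_sigma_mono[OF noises_measurable]) auto

lemma space_F [simp]: "space (F t) = space M" by (simp add: full_filtration_def)

lemma W_adapted:
  assumes "0 \<le> s" "s \<le> t" "t \<le> T"
  shows "W s \<in> borel_measurable (F t)" "W\<^sub>c s \<in> borel_measurable (F t)"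
  unfolding full_filtration_def using assms
  by (auto intro!: measurable_augmented_sigma[OF noises_measurable, unfolded Un_insert_left Un_empty_left])

text \<open>The past of the two noises, up to null sets, is generated by the intersections of an event of
  \<open>\<xi>0\<close> with one event of each noise.  For such intersections the three independence assumptions
  factorise the probability.\<close>

lemma past_indep_increments:
  assumes st: "0 \<le> s" "s < t" "t \<le> T"
  shows "indep_set (sets (F s)) (generated_events M {\<lambda>\<omega>. W t \<omega> - W s \<omega>, \<lambda>\<omega>. W\<^sub>c t \<omega> - W\<^sub>c s \<omega>})"
proof -
  let ?inc = "\<lambda>V. (\<lambda>r \<omega>. V r \<omega> - V 0 \<omega>) ` {0..s} :: ('a \<Rightarrow> real) set"
  let ?D = "\<lambda>V \<omega>. V t \<omega> - V s \<omega> :: real"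
  let ?A = "generated_events M {\<xi>0}"
  let ?B = "generated_events M (?inc W)" and ?C = "generated_events M (?inc W\<^sub>c)"
  let ?D1 = "generated_events M {?D W}" and ?D2 = "generated_events M {?D W\<^sub>c}"
  let ?P = "{a \<inter> b \<inter> c | a b c. a \<in> ?A \<and> b \<in> ?B \<and> c \<in> ?C}"
  let ?Q = "{a \<inter> b | a b. a \<in> ?D1 \<and> b \<in> ?D2}"
  let ?W = "generated_events M (W ` {0..T})" and ?Wc = "generated_events M (W\<^sub>c ` {0..T})"
  let ?WW = "generated_events M (W ` {0..T} \<union> W\<^sub>c ` {0..T})"
  have inc_sub: "generated_events M (?inc V) \<subseteq> generated_events M (V ` {0..T})" for V
    using st by (intro generated_events_increments_subset) fastforce
  have D_sub: "generated_events M {?D V} \<subseteq> generated_events M (V ` {0..T})" for V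
    using st by (intro generated_events_increments_subset) fastforce
  have W_sub: "?W \<subseteq> ?WW" "?Wc \<subseteq> ?WW"
    unfolding generated_events_def by (auto intro!: sigma_sets_mono' generators_mono)
  have ev: "?A \<subseteq> events" "?WW \<subseteq> events"
    using indep_setD_ev1[OF noiseD(5)] indep_setD_ev2[OF noiseD(5)] by auto
  have ev2: "?B \<subseteq> events" "?C \<subseteq> events" "?D1 \<subseteq> events" "?D2 \<subseteq> events"
    using inc_sub[of W] inc_sub[of W\<^sub>c] D_sub[of W] D_sub[of W\<^sub>c] W_sub ev(2) by blast+
  note indB = brownian_past_indep_increment[OF noiseD(1) st]
  note indC = brownian_past_indep_increment[OF noiseD(2) st]
  have prod_W: "prob (b \<inter> c) = prob b * prob c" if "b \<in> ?W" "c \<in> ?Wc" for b c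
    using indep_setD[OF noiseD(4) that] .
  have prod_xi: "prob (a \<inter> w) = prob a * prob w" if "a \<in> ?A" "w \<in> ?WW" for a w
    using indep_setD[OF noiseD(5) that] .
  have ind0: "indep_set ?P ?Q"
  proof (rule indep_setI)
    show "?P \<subseteq> events" using ev ev2 by (blast intro: sets.Int)
    show "?Q \<subseteq> events" using ev2 by (blast intro: sets.Int)
    fix p q assume "p \<in> ?P" "q \<in> ?Q"
    then obtain a b c d e where *: "a \<in> ?A" "b \<in> ?B" "c \<in> ?C" "d \<in> ?D1" "e \<in> ?D2"
      "p = a \<inter> b \<inter> c" "q = d \<inter> e" by auto
    have W: "b \<in> ?W" "d \<in> ?W" "c \<in> ?Wc" "e \<in> ?Wc"
      using * inc_sub[of W] inc_sub[of W\<^sub>c] D_sub[of W] D_sub[of W\<^sub>c] by auto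
    have bd: "b \<inter> d \<in> ?W" "c \<inter> e \<in> ?Wc" using W by (auto intro: generated_events_Int)
    have bc: "b \<inter> c \<in> ?WW" "(b \<inter> d) \<inter> (c \<inter> e) \<in> ?WW"
      using W bd W_sub by (auto intro!: generated_events_Int[of _ M "W ` {0..T} \<union> W\<^sub>c ` {0..T}"])
    have "prob (p \<inter> q) = prob (a \<inter> ((b \<inter> d) \<inter> (c \<inter> e)))"
      unfolding * by (rule arg_cong[where f=prob]) auto
    also have "\<dots> = prob a * (prob (b \<inter> d) * prob (c \<inter> e))"
      using prod_xi[OF *(1) bc(2)] prod_W[OF bd] by simp
    also have "\<dots> = prob a * ((prob b * prob d) * (prob c * prob e))"
      using indep_setD[OF indB *(2,4)] indep_setD[OF indC *(3,5)] by simp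
    also have "\<dots> = (prob a * (prob b * prob c)) * (prob d * prob e)" by simp
    also have "prob a * (prob b * prob c) = prob p"
      using prod_xi[OF *(1) bc(1)] prod_W[OF W(1,3)] by (simp add: *(6) Int_assoc)
    also have "prob d * prob e = prob q" using prod_W[OF W(2,4)] by (simp add: *(7))
    finally show "prob (p \<inter> q) = prob p * prob q" .
  qed
  have "Int_stable ?P"
  proof (rule Int_stableI)
    fix x y assume "x \<in> ?P" "y \<in> ?P"
    then obtain a b c a' b' c' where *: "a \<in> ?A" "b \<in> ?B" "c \<in> ?C" "a' \<in> ?A" "b' \<in> ?B" "c' \<in> ?C"
      "x = a \<inter> b \<inter> c" "y = a' \<inter> b' \<inter> c'" by auto
    have "x \<inter> y = (a \<inter> a') \<inter> (b \<inter> b') \<inter> (c \<inter> c')" using * by auto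
    with * show "x \<inter> y \<in> ?P" by (blast intro: generated_events_Int)
  qed
  moreover have "Int_stable ?Q"
  proof (rule Int_stableI)
    fix x y assume "x \<in> ?Q" "y \<in> ?Q"
    then obtain a b a' b' where *: "a \<in> ?D1" "b \<in> ?D2" "a' \<in> ?D1" "b' \<in> ?D2"
      "x = a \<inter> b" "y = a' \<inter> b'" by auto
    have "x \<inter> y = (a \<inter> a') \<inter> (b \<inter> b')" using * by auto
    with * show "x \<inter> y \<in> ?Q" by (blast intro: generated_events_Int)
  qed
  ultimately have ind: "indep_set (sigma_sets (space M) ?P) (sigma_sets (space M) ?Q)"
    by (intro indep_set_sigma_sets[OF ind0])
  have Qsub: "generated_events M {?D W, ?D W\<^sub>c} \<subseteq> sigma_sets (space M) ?Q"
    unfolding generated_events_def[of M "{?D W, ?D W\<^sub>c}"]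
  proof (rule sigma_sets_mono, rule)
    fix S assume "S \<in> generators M {?D W, ?D W\<^sub>c}"
    then obtain B where B: "B \<in> sets borel" "S = ?D W -` B \<inter> space M \<or> S = ?D W\<^sub>c -` B \<inter> space M"
      by (auto simp: generators_def)
    have "?D W -` B \<inter> space M \<in> ?D1" "?D W\<^sub>c -` B \<inter> space M \<in> ?D2"
      using B(1) by (auto intro: generated_events_vimage)
    moreover note generated_events_top[of M "{?D W}"] generated_events_top[of M "{?D W\<^sub>c}"]
    moreover have "S = S \<inter> space M" "S = space M \<inter> S" using B(2) by auto
    ultimately have "S \<in> ?Q" using B(2) by blast
    then show "S \<in> sigma_sets (space M) ?Q" by blast
  qed
  have Wpre: "\<exists>S'\<in>sigma_sets (space M) ?P. AE x in M. (x \<in> X -` B \<inter> space M) \<longleftrightarrow> x \<in> S'"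
    if X: "X \<in> {\<xi>0} \<union> W ` {0..s} \<union> W\<^sub>c ` {0..s}" and B: "B \<in> sets borel" for X B
  proof -
    have tops: "space M \<in> ?A" "space M \<in> ?B" "space M \<in> ?C" by (auto intro: generated_events_top)
    from X consider "X = \<xi>0" | r where "r \<in> {0..s}" "X = W r" | r where "r \<in> {0..s}" "X = W\<^sub>c r" by auto
    then show ?thesis
    proof cases
      case 1
      have "X -` B \<inter> space M \<in> ?A" using 1 B by (auto intro: generated_events_vimage)
      then have "X -` B \<inter> space M \<inter> space M \<inter> space M \<in> ?P" using tops by blast
      then show ?thesis by (intro bexI[of _ "X -` B \<inter> space M \<inter> space M \<inter> space M"] sigma_sets.Basic) auto
    next
      case 2
      let ?S = "(\<lambda>\<omega>. W r \<omega> - W 0 \<omega>) -` B \<inter> space M"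
      have "?S \<in> ?B" using 2 B by (auto intro!: generated_events_vimage)
      then have "space M \<inter> ?S \<inter> space M \<in> ?P" using tops by blast
      moreover have "AE \<omega> in M. W 0 \<omega> = 0" using noiseD(1) by (auto simp: brownian_motion_def)
      then have "AE x in M. x \<in> X -` B \<inter> space M \<longleftrightarrow> x \<in> space M \<inter> ?S \<inter> space M"
        by eventually_elim (auto simp: 2)
      ultimately show ?thesis by blast
    next
      case 3
      let ?S = "(\<lambda>\<omega>. W\<^sub>c r \<omega> - W\<^sub>c 0 \<omega>) -` B \<inter> space M"
      have "?S \<in> ?C" using 3 B by (auto intro!: generated_events_vimage)
      then have "space M \<inter> space M \<inter> ?S \<in> ?P" using tops by blast
      moreover have "AE \<omega> in M. W\<^sub>c 0 \<omega> = 0" using noiseD(2) by (auto simp: brownian_motion_def)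
      then have "AE x in M. x \<in> X -` B \<inter> space M \<longleftrightarrow> x \<in> space M \<inter> space M \<inter> ?S"
        by eventually_elim (auto simp: 3)
      ultimately show ?thesis by blast
    qed
  qed
  show ?thesis
  proof (rule indep_setI)
    show "sets (F s) \<subseteq> events" using subalgebra_F[of s] st by (auto simp: subalgebra_def)
    show "generated_events M {?D W, ?D W\<^sub>c} \<subseteq> events"
      using Qsub indep_setD_ev2[OF ind] by blast
    fix a b assume a: "a \<in> sets (F s)" and b: "b \<in> generated_events M {?D W, ?D W\<^sub>c}"
    have "\<exists>a'\<in>sigma_sets (space M) ?P. AE x in M. x \<in> a \<longleftrightarrow> x \<in> a'"
    proof (rule augmented_sigma_AE_eq)
      show "{\<xi>0} \<union> W ` {0..s} \<union> W\<^sub>c ` {0..s} \<subseteq> borel_measurable M" using st by (intro noises_measurable) auto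
      show "?P \<subseteq> Pow (space M)" using ev(1) sets.sets_into_space by auto
      show "a \<in> sets (augmented_sigma M ({\<xi>0} \<union> W ` {0..s} \<union> W\<^sub>c ` {0..s}))"
        using a by (simp add: full_filtration_def)
    qed (rule Wpre)
    then obtain a' where a': "a' \<in> sigma_sets (space M) ?P" "AE x in M. x \<in> a \<longleftrightarrow> x \<in> a'" by auto
    have bQ: "b \<in> sigma_sets (space M) ?Q" using b Qsub by auto
    have evs: "a \<in> events" "a' \<in> events" "b \<in> events"
      using a a' bQ indep_setD_ev1[OF ind] indep_setD_ev2[OF ind] subalgebra_F[of s] st
      by (auto simp: subalgebra_def)
    have "prob (a \<inter> b) = prob (a' \<inter> b)"
      using a'(2) evs by (intro measure_eq_AE) auto
    also have "\<dots> = prob a' * prob b" by (rule indep_setD[OF ind a'(1) bQ])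
    also have "prob a' = prob a" using a'(2) evs by (intro measure_eq_AE) auto
    finally show "prob (a \<inter> b) = prob a * prob b" .
  qed
qed

end

lemma (in prob_space) normal_moments:
  assumes X: "distributed M lborel X (normal_density 0 \<sigma>)" and \<sigma>: "0 < \<sigma>"
  shows "integrable M X" "integrable M (\<lambda>x. (X x)\<^sup>2)" "expectation X = 0" "(\<integral>x. (X x)\<^sup>2 \<partial>M) = \<sigma>\<^sup>2"
proof -
  have 1: "integrable lborel (\<lambda>x. normal_density 0 \<sigma> x * x)" using integrable_normal_moment[OF \<sigma>, of 0 1] by simp
  have 2: "integrable lborel (\<lambda>x. normal_density 0 \<sigma> x * x\<^sup>2)" using integrable_normal_moment[OF \<sigma>, of 0 2] by simp
  show "integrable M X" using distributed_integrable[OF X, of "\<lambda>x. x"] 1 by simp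
  show "integrable M (\<lambda>x. (X x)\<^sup>2)" using distributed_integrable[OF X, of "\<lambda>x. x\<^sup>2"] 2 by simp
  show "expectation X = 0"
    using distributed_integral[OF X, of "\<lambda>x. x"] integral_normal_moment_odd[OF \<sigma>, of 0 0] by simp
  show "(\<integral>x. (X x)\<^sup>2 \<partial>M) = \<sigma>\<^sup>2"
    using distributed_integral[OF X, of "\<lambda>x. x\<^sup>2"] integral_normal_moment_even[OF \<sigma>, of 0 1]
    by (simp add: fact_numeral power2_eq_square)
qed

lemma measurable_sigma_generated:
  assumes "X \<in> Xs"
  shows "X \<in> borel_measurable (sigma (space M) (generated_events M Xs))"
proof -
  interpret sigma_algebra "space M" "generated_events M Xs" by (rule sigma_algebra_generated_events)
  show ?thesis by (rule measurableI) (use generated_events_vimage[OF assms] in auto)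
qed

lemma (in prob_space) indep_var_of_indep_set:
  assumes ind: "indep_set (sets G) (generated_events M Ys)" and G: "subalgebra M G"
    and Ys: "Ys \<subseteq> borel_measurable M"
    and \<zeta>: "\<zeta> \<in> borel_measurable G" and Y: "Y \<in> borel_measurable (sigma (space M) (generated_events M Ys))"
  shows "indep_var borel \<zeta> borel (Y :: 'a \<Rightarrow> real)"
proof -
  interpret sa: sigma_algebra "space M" "generated_events M Ys" by (rule sigma_algebra_generated_events)
  have spG: "space G = space M" using G by (simp add: subalgebra_def)
  have sub: "subalgebra M (sigma (space M) (generated_events M Ys))"
    using indep_setD_ev2[OF ind] by (auto simp: subalgebra_def)
  have 1: "{\<zeta> -` A \<inter> space M |A. A \<in> sets borel} \<subseteq> sets G"
    using measurable_sets[OF \<zeta>] by (auto simp: spG)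
  have 2: "{Y -` A \<inter> space M |A. A \<in> sets borel} \<subseteq> generated_events M Ys"
    using measurable_sets[OF Y] by auto
  show ?thesis
    unfolding indep_var_eq
  proof (intro conjI indep_set_mono[OF ind])
    show "random_variable borel \<zeta>" using measurable_from_subalg[OF G \<zeta>] .
    show "random_variable borel Y" using measurable_from_subalg[OF sub Y] .
    show "sigma_sets (space M) {\<zeta> -` A \<inter> space M |A. A \<in> sets borel} \<subseteq> sets G"
      using sets.sigma_sets_subset[OF 1] by (simp add: spG)
    show "sigma_sets (space M) {Y -` A \<inter> space M |A. A \<in> sets borel} \<subseteq> generated_events M Ys"
      using sa.sigma_sets_subset[OF 2] .
  qed
qed

context common_noise
begin

text \<open>The only properties of the noises used from here on: adaptedness, centred increments
  given the past, and the bracket \<open>\<rho> dt\<close> of a pair of noises.\<close>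

definition noise_bracket :: "(real \<Rightarrow> 'a \<Rightarrow> real) \<Rightarrow> (real \<Rightarrow> 'a \<Rightarrow> real) \<Rightarrow> real \<Rightarrow> bool" where
  "noise_bracket V V' \<rho> \<longleftrightarrow>
    (\<forall>t\<in>{0..T}. V t \<in> borel_measurable (F t) \<and> V' t \<in> borel_measurable (F t)) \<and>
    (\<forall>s t \<zeta>. 0 \<le> s \<and> s \<le> t \<and> t \<le> T \<and> \<zeta> \<in> borel_measurable (F s) \<and> integrable M \<zeta> \<longrightarrow>
       (\<integral>\<omega>. \<zeta> \<omega> * (V t \<omega> - V s \<omega>) \<partial>M) = 0 \<and> (\<integral>\<omega>. \<zeta> \<omega> * (V' t \<omega> - V' s \<omega>) \<partial>M) = 0 \<and>
       integrable M (\<lambda>\<omega>. \<zeta> \<omega> * ((V t \<omega> - V s \<omega>) * (V' t \<omega> - V' s \<omega>))) \<and>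
       (\<integral>\<omega>. \<zeta> \<omega> * ((V t \<omega> - V s \<omega>) * (V' t \<omega> - V' s \<omega>)) \<partial>M) = \<rho> * (t - s) * (\<integral>\<omega>. \<zeta> \<omega> \<partial>M))"

lemma noise_bracket_sym: "noise_bracket V V' \<rho> \<Longrightarrow> noise_bracket V' V \<rho>"
  unfolding noise_bracket_def by (simp add: mult.commute)

lemma noise_bracket_adapted:
  assumes "noise_bracket V V' \<rho>" "0 \<le> s" "s \<le> t" "t \<le> T"
  shows "V s \<in> borel_measurable (F t)"
proof -
  have "V s \<in> borel_measurable (F s)" using assms unfolding noise_bracket_def by simp
  then show ?thesis using measurable_from_subalg[OF subalgebra_F_F[OF assms(3,4)]] by blast
qed

lemma noise_bracketD:
  assumes "noise_bracket V V' \<rho>" "0 \<le> s" "s \<le> t" "t \<le> T" "\<zeta> \<in> borel_measurable (F s)" "integrable M \<zeta>"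
  shows "(\<integral>\<omega>. \<zeta> \<omega> * (V t \<omega> - V s \<omega>) \<partial>M) = 0"
    "integrable M (\<lambda>\<omega>. \<zeta> \<omega> * ((V t \<omega> - V s \<omega>) * (V' t \<omega> - V' s \<omega>)))"
    "(\<integral>\<omega>. \<zeta> \<omega> * ((V t \<omega> - V s \<omega>) * (V' t \<omega> - V' s \<omega>)) \<partial>M) = \<rho> * (t - s) * (\<integral>\<omega>. \<zeta> \<omega> \<partial>M)"
  using assms unfolding noise_bracket_def by blast+

text \<open>Increments are independent of the past, so expectations of products with a past factor
  factorise; what remains are the first two moments of normal variables, and the product of
  increments of two independent noises.\<close>

lemma noise_brackets:
  shows "noise_bracket W W 1" "noise_bracket W\<^sub>c W\<^sub>c 1" "noise_bracket W W\<^sub>c 0"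
proof -
  note bm = noiseD(1,2)[unfolded brownian_motion_def]
  have key: "integrable M (\<lambda>\<omega>. \<zeta> \<omega> * Y \<omega>) \<and> (\<integral>\<omega>. \<zeta> \<omega> * Y \<omega> \<partial>M) = expectation \<zeta> * expectation Y"
    if "0 \<le> s" "s < t" "t \<le> T" "\<zeta> \<in> borel_measurable (F s)" "integrable M \<zeta>" "integrable M Y"
      "Y \<in> borel_measurable (sigma (space M) (generated_events M {\<lambda>\<omega>. W t \<omega> - W s \<omega>, \<lambda>\<omega>. W\<^sub>c t \<omega> - W\<^sub>c s \<omega>}))"
    for s t and \<zeta> Y :: "'a \<Rightarrow> real"
  proof -
    have "indep_var borel \<zeta> borel Y"
      using that W_measurable
      by (intro indep_var_of_indep_set[OF past_indep_increments subalgebra_F]) auto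
    from indep_var_lebesgue_integral[OF this that(5,6)] indep_var_integrable[OF this that(5,6)] show ?thesis by simp
  qed
  have mom: "integrable M (\<lambda>\<omega>. V t \<omega> - V s \<omega>)" "integrable M (\<lambda>\<omega>. (V t \<omega> - V s \<omega>)\<^sup>2)"
     "(\<integral>\<omega>. V t \<omega> - V s \<omega> \<partial>M) = 0" "(\<integral>\<omega>. (V t \<omega> - V s \<omega>)\<^sup>2 \<partial>M) = t - s"
    if "V = W \<or> V = W\<^sub>c" "0 \<le> s" "s < t" "t \<le> T" for V s t
  proof -
    have "distributed M lborel (\<lambda>\<omega>. V t \<omega> - V s \<omega>) (normal_density 0 (sqrt (t - s)))"
      using that bm by blast
    from normal_moments[OF this] that show "integrable M (\<lambda>\<omega>. V t \<omega> - V s \<omega>)" "integrable M (\<lambda>\<omega>. (V t \<omega> - V s \<omega>)\<^sup>2)"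
     "(\<integral>\<omega>. V t \<omega> - V s \<omega> \<partial>M) = 0" "(\<integral>\<omega>. (V t \<omega> - V s \<omega>)\<^sup>2 \<partial>M) = t - s" by auto
  qed
  have cross: "integrable M (\<lambda>\<omega>. (W t \<omega> - W s \<omega>) * (W\<^sub>c t \<omega> - W\<^sub>c s \<omega>))"
     "(\<integral>\<omega>. (W t \<omega> - W s \<omega>) * (W\<^sub>c t \<omega> - W\<^sub>c s \<omega>) \<partial>M) = 0" if st: "0 \<le> s" "s < t" "t \<le> T" for s t
  proof -
    have i: "indep_var borel (\<lambda>\<omega>. W t \<omega> - W s \<omega>) borel (\<lambda>\<omega>. W\<^sub>c t \<omega> - W\<^sub>c s \<omega>)"
    proof (rule indep_var_of_indep_set[where G="sigma (space M) (generated_events M (W ` {0..T}))"])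
      interpret sa: sigma_algebra "space M" "generated_events M (W ` {0..T})" by (rule sigma_algebra_generated_events)
      show "indep_set (sets (sigma (space M) (generated_events M (W ` {0..T})))) (generated_events M (W\<^sub>c ` {0..T}))"
        using noiseD(4) by simp
      show "subalgebra M (sigma (space M) (generated_events M (W ` {0..T})))"
        using indep_setD_ev1[OF noiseD(4)] by (simp add: subalgebra_def)
      show "W\<^sub>c ` {0..T} \<subseteq> borel_measurable M" using W_measurable by auto
      show "(\<lambda>\<omega>. W t \<omega> - W s \<omega>) \<in> borel_measurable (sigma (space M) (generated_events M (W ` {0..T})))"
        using st by (intro borel_measurable_diff measurable_sigma_generated imageI) auto
      show "(\<lambda>\<omega>. W\<^sub>c t \<omega> - W\<^sub>c s \<omega>) \<in> borel_measurable (sigma (space M) (generated_events M (W\<^sub>c ` {0..T})))"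
        using st by (intro borel_measurable_diff measurable_sigma_generated imageI) auto
    qed
    show "integrable M (\<lambda>\<omega>. (W t \<omega> - W s \<omega>) * (W\<^sub>c t \<omega> - W\<^sub>c s \<omega>))"
      using indep_var_integrable[OF i] mom(1)[OF _ st] by auto
    show "(\<integral>\<omega>. (W t \<omega> - W s \<omega>) * (W\<^sub>c t \<omega> - W\<^sub>c s \<omega>) \<partial>M) = 0"
      using indep_var_lebesgue_integral[OF i] mom(1,3)[OF _ st] by auto
  qed
  have gen: "noise_bracket V V' \<rho>"
    if VV: "V = W \<or> V = W\<^sub>c" "V' = W \<or> V' = W\<^sub>c"
      and ii: "\<And>s t. 0 \<le> s \<Longrightarrow> s < t \<Longrightarrow> t \<le> T \<Longrightarrow> integrable M (\<lambda>\<omega>. (V t \<omega> - V s \<omega>) * (V' t \<omega> - V' s \<omega>))"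
      and cc: "\<And>s t. 0 \<le> s \<Longrightarrow> s < t \<Longrightarrow> t \<le> T \<Longrightarrow> (\<integral>\<omega>. (V t \<omega> - V s \<omega>) * (V' t \<omega> - V' s \<omega>) \<partial>M) = \<rho> * (t - s)"
    for V V' \<rho>
    unfolding noise_bracket_def
  proof (intro conjI ballI allI impI)
    fix t assume "t \<in> {0..T}"
    then show "V t \<in> borel_measurable (F t)" "V' t \<in> borel_measurable (F t)"
      using VV W_adapted[of t t] by auto
  next
    fix s t :: real and \<zeta> :: "'a \<Rightarrow> real" assume *: "0 \<le> s \<and> s \<le> t \<and> t \<le> T \<and> \<zeta> \<in> borel_measurable (F s) \<and> integrable M \<zeta>"
    have "(\<integral>\<omega>. \<zeta> \<omega> * (V t \<omega> - V s \<omega>) \<partial>M) = 0 \<and> (\<integral>\<omega>. \<zeta> \<omega> * (V' t \<omega> - V' s \<omega>) \<partial>M) = 0 \<and>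
        integrable M (\<lambda>\<omega>. \<zeta> \<omega> * ((V t \<omega> - V s \<omega>) * (V' t \<omega> - V' s \<omega>))) \<and>
        (\<integral>\<omega>. \<zeta> \<omega> * ((V t \<omega> - V s \<omega>) * (V' t \<omega> - V' s \<omega>)) \<partial>M) = \<rho> * (t - s) * (\<integral>\<omega>. \<zeta> \<omega> \<partial>M)"
    proof (cases "s = t")
      case True
      then show ?thesis
        by simp
    next
      case False
      then have st: "0 \<le> s" "s < t" "t \<le> T" using * by auto
      let ?Y = "{\<lambda>\<omega>. W t \<omega> - W s \<omega>, \<lambda>\<omega>. W\<^sub>c t \<omega> - W\<^sub>c s \<omega>}"
      have mV: "(\<lambda>\<omega>. V t \<omega> - V s \<omega>) \<in> borel_measurable (sigma (space M) (generated_events M ?Y))"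
        using VV by (intro measurable_sigma_generated) auto
      have mV': "(\<lambda>\<omega>. V' t \<omega> - V' s \<omega>) \<in> borel_measurable (sigma (space M) (generated_events M ?Y))"
        using VV by (intro measurable_sigma_generated) auto
      from key[OF st _ _ mom(1)[OF VV(1) st] mV, of \<zeta>] mom(3)[OF VV(1) st]
        key[OF st _ _ mom(1)[OF VV(2) st] mV', of \<zeta>] mom(3)[OF VV(2) st]
        key[OF st _ _ ii[OF st] borel_measurable_times[OF mV mV'], of \<zeta>] cc[OF st] *
      show ?thesis
        by simp
    qed
    then
    show "(\<integral>\<omega>. \<zeta> \<omega> * (V t \<omega> - V s \<omega>) \<partial>M) = 0" "(\<integral>\<omega>. \<zeta> \<omega> * (V' t \<omega> - V' s \<omega>) \<partial>M) = 0"
      "integrable M (\<lambda>\<omega>. \<zeta> \<omega> * ((V t \<omega> - V s \<omega>) * (V' t \<omega> - V' s \<omega>)))"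
      "(\<integral>\<omega>. \<zeta> \<omega> * ((V t \<omega> - V s \<omega>) * (V' t \<omega> - V' s \<omega>)) \<partial>M) = \<rho> * (t - s) * (\<integral>\<omega>. \<zeta> \<omega> \<partial>M)" by blast+
  qed
  show "noise_bracket W W 1" by (rule gen) (use mom in \<open>auto simp: power2_eq_square[symmetric]\<close>)
  show "noise_bracket W\<^sub>c W\<^sub>c 1" by (rule gen) (use mom in \<open>auto simp: power2_eq_square[symmetric]\<close>)
  show "noise_bracket W W\<^sub>c 0" by (rule gen) (use cross in auto)
qed

definition bounded_past :: "real \<Rightarrow> ('a \<Rightarrow> real) set" where
  "bounded_past s = {\<eta> \<in> borel_measurable (F s). \<exists>C. \<forall>\<omega>\<in>space M. \<bar>\<eta> \<omega>\<bar> \<le> C}"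

lemma bounded_past_mono: "s \<le> t \<Longrightarrow> t \<le> T \<Longrightarrow> \<eta> \<in> bounded_past s \<Longrightarrow> \<eta> \<in> bounded_past t"
  using measurable_from_subalg[OF subalgebra_F_F] by (auto simp: bounded_past_def)

lemma L2_past_mono: "s \<le> t \<Longrightarrow> t \<le> T \<Longrightarrow> \<eta> \<in> L2_vars M (F s) \<Longrightarrow> \<eta> \<in> L2_vars M (F t)"
  using measurable_from_subalg[OF subalgebra_F_F] by (auto simp: L2_vars_def)

lemma L2_vars_bounded_mult:
  assumes "\<eta> \<in> bounded_past s" "\<zeta> \<in> L2_vars M (F s)" "s \<le> T"
  shows "(\<lambda>\<omega>. \<eta> \<omega> * \<zeta> \<omega>) \<in> L2_vars M (F s)"
proof -
  obtain C where C: "\<And>\<omega>. \<omega> \<in> space M \<Longrightarrow> \<bar>\<eta> \<omega>\<bar> \<le> C" using assms by (auto simp: bounded_past_def)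
  show ?thesis
  proof (rule L2_vars_bound[where g="\<lambda>\<omega>. C * \<zeta> \<omega>"])
    show "(\<lambda>\<omega>. \<eta> \<omega> * \<zeta> \<omega>) \<in> borel_measurable (F s)"
      using assms by (auto simp: bounded_past_def L2_vars_def)
    show "subalgebra M (F s)" by (rule subalgebra_F) fact
    show "(\<lambda>\<omega>. C * \<zeta> \<omega>) \<in> L2_vars M M"
      by (intro L2_vars_cmult L2_vars_subalgebra[OF subalgebra_F[OF assms(3)] assms(2)])
    show "AE \<omega> in M. \<bar>\<eta> \<omega> * \<zeta> \<omega>\<bar> \<le> \<bar>C * \<zeta> \<omega>\<bar>"
      using order_trans[OF C abs_ge_self] by (auto simp: abs_mult intro!: AE_I2 mult_right_mono)
  qed
qed

lemma L2_bounded_past: "\<eta> \<in> bounded_past s \<Longrightarrow> s \<le> T \<Longrightarrow> \<eta> \<in> L2_vars M (F s)"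
  using L2_vars_bounded[OF finite_measure_axioms subalgebra_F] by (auto simp: bounded_past_def)

lemma increment_L2:
  assumes V: "noise_bracket V V 1" and st: "0 \<le> s" "s \<le> t" "t \<le> T"
  shows "(\<lambda>\<omega>. V t \<omega> - V s \<omega>) \<in> L2_vars M (F t)"
proof -
  have "integrable M (\<lambda>\<omega>. 1 * ((V t \<omega> - V s \<omega>) * (V t \<omega> - V s \<omega>)))"
    by (rule noise_bracketD(2)[OF V st]) auto
  moreover have "(\<lambda>\<omega>. V t \<omega> - V s \<omega>) \<in> borel_measurable (F t)"
    using st by (intro borel_measurable_diff noise_bracket_adapted[OF V]) auto
  ultimately show ?thesis by (simp add: L2_vars_def power2_eq_square)
qed

lemma increment_orthogonal:
  assumes V: "noise_bracket V V 1" and st: "0 \<le> s" "s \<le> t" "t \<le> T"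
    and \<zeta>: "\<zeta> \<in> L2_vars M (F s)" and \<eta>: "\<eta> \<in> bounded_past s"
  shows "(\<integral>\<omega>. \<zeta> \<omega> * (\<eta> \<omega> * (V t \<omega> - V s \<omega>)) \<partial>M) = 0"
proof -
  have z: "(\<lambda>\<omega>. \<eta> \<omega> * \<zeta> \<omega>) \<in> L2_vars M (F s)" using st by (intro L2_vars_bounded_mult \<zeta> \<eta>) auto
  have "integrable M (\<lambda>\<omega>. \<eta> \<omega> * \<zeta> \<omega>)"
    using st by (intro L2_vars_integrable finite_measure_axioms L2_vars_subalgebra[OF subalgebra_F z]) auto
  from noise_bracketD(1)[OF V st L2_varsD(1)[OF z] this]
  have "(\<integral>\<omega>. (\<eta> \<omega> * \<zeta> \<omega>) * (V t \<omega> - V s \<omega>) \<partial>M) = 0" .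
  then show ?thesis by (simp add: mult_ac)
qed

lemma L2_increment_term:
  assumes V: "noise_bracket V V 1" and st: "0 \<le> s" "s \<le> t" "t \<le> T" and \<eta>: "\<eta> \<in> bounded_past s"
  shows "(\<lambda>\<omega>. \<eta> \<omega> * (V t \<omega> - V s \<omega>)) \<in> L2_vars M (F t)"
  using st by (intro L2_vars_bounded_mult bounded_past_mono[OF _ _ \<eta>] increment_L2[OF V]) auto

text \<open>Cut both intervals at each other's end points: only the common part contributes, every other
  piece pairs a future increment with a past factor.\<close>

lemma increments_covariance_ordered:
  assumes V: "noise_bracket V V 1" and V': "noise_bracket V' V' 1" and VV': "noise_bracket V V' \<rho>"
    and ab: "0 \<le> a" "a \<le> b" "b \<le> T" and cd: "a \<le> c" "c \<le> d" "d \<le> T"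
    and \<eta>: "\<eta> \<in> bounded_past a" and \<eta>': "\<eta>' \<in> bounded_past c"
  shows "(\<integral>\<omega>. (\<eta> \<omega> * (V b \<omega> - V a \<omega>)) * (\<eta>' \<omega> * (V' d \<omega> - V' c \<omega>)) \<partial>M)
    = \<rho> * (\<integral>\<omega>. \<eta> \<omega> * \<eta>' \<omega> \<partial>M) * measure lborel ({a<..b} \<inter> {c<..d})"
proof (cases "b \<le> c")
  case True
  then have "{a<..b} \<inter> {c<..d} = {}" by auto
  moreover have "(\<integral>\<omega>. (\<eta> \<omega> * (V b \<omega> - V a \<omega>)) * (\<eta>' \<omega> * (V' d \<omega> - V' c \<omega>)) \<partial>M) = 0"
    using ab cd True
    by (intro increment_orthogonal[OF V'] \<eta>' L2_past_mono[OF _ _ L2_increment_term[OF V]] \<eta>) auto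
  ultimately show ?thesis by (simp only: measure_empty mult_zero_right)
next
  case False
  have \<eta>c: "\<eta> \<in> bounded_past c" using bounded_past_mono[OF _ _ \<eta>] cd by auto
  note sub = L2_vars_subalgebra[OF subalgebra_F]
  note L2t = sub[OF _ L2_increment_term[OF V]] and L2t' = sub[OF _ L2_increment_term[OF V']]
  have i1: "integrable M (\<lambda>\<omega>. (\<eta> \<omega> * (V c \<omega> - V a \<omega>)) * (\<eta>' \<omega> * (V' d \<omega> - V' c \<omega>)))"
    using ab cd \<eta> \<eta>' by (intro L2_vars_mult_integrable L2t L2t') auto
  have i2: "integrable M (\<lambda>\<omega>. (\<eta> \<omega> * (V b \<omega> - V c \<omega>)) * (\<eta>' \<omega> * (V' d \<omega> - V' c \<omega>)))"
    using ab cd \<eta>c \<eta>' False by (intro L2_vars_mult_integrable L2t L2t') auto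
  have "(\<integral>\<omega>. (\<eta> \<omega> * (V b \<omega> - V a \<omega>)) * (\<eta>' \<omega> * (V' d \<omega> - V' c \<omega>)) \<partial>M) =
     (\<integral>\<omega>. (\<eta> \<omega> * (V c \<omega> - V a \<omega>)) * (\<eta>' \<omega> * (V' d \<omega> - V' c \<omega>)) +
       (\<eta> \<omega> * (V b \<omega> - V c \<omega>)) * (\<eta>' \<omega> * (V' d \<omega> - V' c \<omega>)) \<partial>M)"
    by (intro Bochner_Integration.integral_cong) (auto simp: algebra_simps)
  also have "\<dots> = (\<integral>\<omega>. (\<eta> \<omega> * (V c \<omega> - V a \<omega>)) * (\<eta>' \<omega> * (V' d \<omega> - V' c \<omega>)) \<partial>M) +
       (\<integral>\<omega>. (\<eta> \<omega> * (V b \<omega> - V c \<omega>)) * (\<eta>' \<omega> * (V' d \<omega> - V' c \<omega>)) \<partial>M)"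
    using i1 i2 by simp
  also have "(\<integral>\<omega>. (\<eta> \<omega> * (V c \<omega> - V a \<omega>)) * (\<eta>' \<omega> * (V' d \<omega> - V' c \<omega>)) \<partial>M) = 0"
    using ab cd by (intro increment_orthogonal[OF V'] \<eta>' L2_increment_term[OF V] \<eta>) auto
  finally have red: "(\<integral>\<omega>. (\<eta> \<omega> * (V b \<omega> - V a \<omega>)) * (\<eta>' \<omega> * (V' d \<omega> - V' c \<omega>)) \<partial>M) =
     (\<integral>\<omega>. (\<eta> \<omega> * (V b \<omega> - V c \<omega>)) * (\<eta>' \<omega> * (V' d \<omega> - V' c \<omega>)) \<partial>M)" by simp
  define e where "e = min b d"
  have e: "c \<le> e" "e \<le> b" "e \<le> d" "e \<le> T" "0 \<le> c" using ab cd False by (auto simp: e_def)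
  have meas: "measure lborel ({a<..b} \<inter> {c<..d}) = e - c"
  proof -
    have "{a<..b} \<inter> {c<..d} = {c<..e}" using cd False by (auto simp: e_def)
    then show ?thesis using e by simp
  qed
  have prodL2: "(\<lambda>\<omega>. \<eta> \<omega> * \<eta>' \<omega>) \<in> L2_vars M (F c)"
    using cd by (intro L2_vars_bounded_mult \<eta>c L2_bounded_past \<eta>') auto
  have core: "(\<integral>\<omega>. (\<eta> \<omega> * \<eta>' \<omega>) * ((V e \<omega> - V c \<omega>) * (V' e \<omega> - V' c \<omega>)) \<partial>M) = \<rho> * (e - c) * (\<integral>\<omega>. \<eta> \<omega> * \<eta>' \<omega> \<partial>M)"
    "integrable M (\<lambda>\<omega>. (\<eta> \<omega> * \<eta>' \<omega>) * ((V e \<omega> - V c \<omega>) * (V' e \<omega> - V' c \<omega>)))"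
  proof -
    have "integrable M (\<lambda>\<omega>. \<eta> \<omega> * \<eta>' \<omega>)"
      using e by (intro L2_vars_integrable finite_measure_axioms sub[OF _ prodL2]) auto
    from noise_bracketD(3,2)[OF VV' e(5,1,4) L2_varsD(1)[OF prodL2] this]
    show "(\<integral>\<omega>. (\<eta> \<omega> * \<eta>' \<omega>) * ((V e \<omega> - V c \<omega>) * (V' e \<omega> - V' c \<omega>)) \<partial>M) = \<rho> * (e - c) * (\<integral>\<omega>. \<eta> \<omega> * \<eta>' \<omega> \<partial>M)"
      "integrable M (\<lambda>\<omega>. (\<eta> \<omega> * \<eta>' \<omega>) * ((V e \<omega> - V c \<omega>) * (V' e \<omega> - V' c \<omega>)))"
      by blast+
  qed
  have "(\<integral>\<omega>. (\<eta> \<omega> * (V b \<omega> - V c \<omega>)) * (\<eta>' \<omega> * (V' d \<omega> - V' c \<omega>)) \<partial>M) = \<rho> * (e - c) * (\<integral>\<omega>. \<eta> \<omega> * \<eta>' \<omega> \<partial>M)"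
  proof (cases "b \<le> d")
    case True
    then have eb: "e = b" by (simp add: e_def)
    have i3: "integrable M (\<lambda>\<omega>. (\<eta> \<omega> * (V b \<omega> - V c \<omega>)) * (\<eta>' \<omega> * (V' d \<omega> - V' b \<omega>)))"
      using ab cd \<eta>c \<eta>' False True bounded_past_mono[OF _ _ \<eta>', of b] by (intro L2_vars_mult_integrable L2t L2t') auto
    have o: "(\<integral>\<omega>. (\<eta> \<omega> * (V b \<omega> - V c \<omega>)) * (\<eta>' \<omega> * (V' d \<omega> - V' b \<omega>)) \<partial>M) = 0"
      using ab cd False True by (intro increment_orthogonal[OF V'] bounded_past_mono[OF _ _ \<eta>'] L2_increment_term[OF V] \<eta>c) auto
    have "(\<integral>\<omega>. (\<eta> \<omega> * (V b \<omega> - V c \<omega>)) * (\<eta>' \<omega> * (V' d \<omega> - V' c \<omega>)) \<partial>M) =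
      (\<integral>\<omega>. (\<eta> \<omega> * \<eta>' \<omega>) * ((V e \<omega> - V c \<omega>) * (V' e \<omega> - V' c \<omega>)) + (\<eta> \<omega> * (V b \<omega> - V c \<omega>)) * (\<eta>' \<omega> * (V' d \<omega> - V' b \<omega>)) \<partial>M)"
      by (intro Bochner_Integration.integral_cong) (auto simp: algebra_simps eb)
    also have "\<dots> = \<rho> * (e - c) * (\<integral>\<omega>. \<eta> \<omega> * \<eta>' \<omega> \<partial>M)" using core i3 o by simp
    finally show ?thesis .
  next
    case F: False
    then have eb: "e = d" by (simp add: e_def)
    have i3: "integrable M (\<lambda>\<omega>. (\<eta>' \<omega> * (V' d \<omega> - V' c \<omega>)) * (\<eta> \<omega> * (V b \<omega> - V d \<omega>)))"
      using ab cd \<eta>c \<eta>' F bounded_past_mono[OF _ _ \<eta>, of d] by (intro L2_vars_mult_integrable L2t L2t') auto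
    have o: "(\<integral>\<omega>. (\<eta>' \<omega> * (V' d \<omega> - V' c \<omega>)) * (\<eta> \<omega> * (V b \<omega> - V d \<omega>)) \<partial>M) = 0"
      using ab cd F by (intro increment_orthogonal[OF V] bounded_past_mono[OF _ _ \<eta>] L2_increment_term[OF V'] \<eta>') auto
    have "(\<integral>\<omega>. (\<eta> \<omega> * (V b \<omega> - V c \<omega>)) * (\<eta>' \<omega> * (V' d \<omega> - V' c \<omega>)) \<partial>M) =
      (\<integral>\<omega>. (\<eta> \<omega> * \<eta>' \<omega>) * ((V e \<omega> - V c \<omega>) * (V' e \<omega> - V' c \<omega>)) + (\<eta>' \<omega> * (V' d \<omega> - V' c \<omega>)) * (\<eta> \<omega> * (V b \<omega> - V d \<omega>)) \<partial>M)"
      by (intro Bochner_Integration.integral_cong) (auto simp: algebra_simps eb)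
    also have "\<dots> = \<rho> * (e - c) * (\<integral>\<omega>. \<eta> \<omega> * \<eta>' \<omega> \<partial>M)" using core i3 o by simp
    finally show ?thesis .
  qed
  then show ?thesis unfolding red meas by simp
qed

lemma increments_covariance:
  assumes V: "noise_bracket V V 1" and V': "noise_bracket V' V' 1" and VV': "noise_bracket V V' \<rho>"
    and ab: "0 \<le> a" "a \<le> b" "b \<le> T" and cd: "0 \<le> c" "c \<le> d" "d \<le> T"
    and \<eta>: "\<eta> \<in> bounded_past a" and \<eta>': "\<eta>' \<in> bounded_past c"
  shows "(\<integral>\<omega>. (\<eta> \<omega> * (V b \<omega> - V a \<omega>)) * (\<eta>' \<omega> * (V' d \<omega> - V' c \<omega>)) \<partial>M)
    = \<rho> * (\<integral>\<omega>. \<eta> \<omega> * \<eta>' \<omega> \<partial>M) * measure lborel ({a<..b} \<inter> {c<..d})"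
proof (cases "a \<le> c")
  case True
  then show ?thesis using increments_covariance_ordered[OF V V' VV'] assms by auto
next
  case False
  then show ?thesis
    using increments_covariance_ordered[OF V' V noise_bracket_sym[OF VV'], of c d a b \<eta>' \<eta>] assms
    by (simp add: mult_ac Int_commute)
qed

end

section \<open>Ito isometry and the martingale property\<close>

lemma sets_restrict_lborel: "sets (restrict_space lborel A) = sets (restrict_space borel A)"
  by (intro sets_restrict_space_cong) simp

lemma finite_measure_time: "finite_measure (restrict_space lborel {0..t::real})"
  by (intro finite_measureI) (simp add: emeasure_restrict_space space_restrict_space emeasure_lborel_Icc_eq)

lemma integral_double_sum:
  fixes f :: "nat \<Rightarrow> nat \<Rightarrow> 'a \<Rightarrow> real"
  assumes "\<And>i j. i < n \<Longrightarrow> j < m \<Longrightarrow> integrable N (f i j)"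
  shows "(\<integral>x. (\<Sum>i<n. \<Sum>j<m. f i j x) \<partial>N) = (\<Sum>i<n. \<Sum>j<m. \<integral>x. f i j x \<partial>N)"
  using assms by (subst Bochner_Integration.integral_sum) (auto intro!: sum.cong Bochner_Integration.integral_sum)

context common_noise
begin

abbreviation Q :: "real \<Rightarrow> (real \<times> 'a) measure" where "Q t \<equiv> restrict_space lborel {0..t} \<Otimes>\<^sub>M M"

lemma pair_Q: "pair_sigma_finite (restrict_space lborel {0..t::real}) M"
proof -
  interpret R: finite_measure "restrict_space lborel {0..t}" by (rule finite_measure_time)
  show ?thesis by unfold_locales
qed

lemma finite_measure_Q: "finite_measure (Q t)"
  by (intro finite_measure_pair_measure finite_measure_time finite_measure_axioms)

lemma sets_Q: "sets (Q t) = sets (borel_time t \<Otimes>\<^sub>M M)"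
  by (intro sets_pair_measure_cong sets_restrict_lborel) simp

lemma space_Q: "space (Q t) = {0..t} \<times> space M"
  by (simp add: space_pair_measure space_restrict_space)

lemma measurable_process_Q: "measurable_process M t Y \<longleftrightarrow> case_prod Y \<in> borel_measurable (Q t)"
  unfolding measurable_process_def by (intro arg_cong2[where f="(\<in>)"] measurable_cong_sets) (simp_all add: sets_Q)

lemma L2_Q_fixed_time:
  assumes "measurable_process M T Y" "0 \<le> t" "t \<le> T"
  shows "Y t \<in> borel_measurable M"
proof -
  have "(\<lambda>\<omega>. case_prod Y (t, \<omega>)) \<in> borel_measurable M"
    using assms by (intro measurable_compose[OF measurable_Pair1'[of t "borel_time T" M]])
      (auto simp: measurable_process_def space_restrict_space)
  then show ?thesis by simp
qed

lemma Q_integral_rectangle: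
  assumes g: "integrable M g" and A: "A \<in> sets borel" "A \<subseteq> {0..t}"
  shows "integrable (Q t) (\<lambda>(s, \<omega>). g \<omega> * indicator A s :: real)"
    "(\<integral>(s, \<omega>). g \<omega> * indicator A s \<partial>Q t) = (\<integral>\<omega>. g \<omega> \<partial>M) * measure lborel A"
proof -
  interpret R: finite_measure "restrict_space lborel {0..t}" by (rule finite_measure_time)
  interpret P: pair_sigma_finite "restrict_space lborel {0..t}" M by (rule pair_Q)
  have AR: "A \<in> sets (restrict_space lborel {0..t})" using A by (auto simp: sets_restrict_space image_iff)
  have [measurable]: "g \<in> borel_measurable M" using g by simp
  note [measurable] = AR
  have m: "(\<lambda>(s, \<omega>). g \<omega> * indicator A s :: real) \<in> borel_measurable (Q t)" by measurable
  have ig: "integrable M (\<lambda>\<omega>. \<bar>g \<omega>\<bar> * indicator A s :: real)" "integrable M (\<lambda>\<omega>. g \<omega> * indicator A s :: real)" for s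
    using g by (auto split: split_indicator)
  show 1: "integrable (Q t) (\<lambda>(s, \<omega>). g \<omega> * indicator A s :: real)"
  proof (rule P.Fubini_integrable[OF m])
    have "integrable (restrict_space lborel {0..t}) (\<lambda>s. (\<integral>\<omega>. \<bar>g \<omega>\<bar> \<partial>M) * indicator A s)"
      using AR by (intro integrable_mult_right integrable_real_indicator) (auto simp: less_top[symmetric])
    then show "integrable (restrict_space lborel {0..t}) (\<lambda>s. \<integral>\<omega>. norm (case (s, \<omega>) of (s, \<omega>) \<Rightarrow> g \<omega> * indicator A s) \<partial>M)"
      by (simp add: abs_mult)
  qed (use ig in auto)
  have "(\<integral>(s, \<omega>). g \<omega> * indicator A s \<partial>Q t) = (\<integral>s. (\<integral>\<omega>. g \<omega> * indicator A s \<partial>M) \<partial>restrict_space lborel {0..t})"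
    using P.integral_fst'[OF 1] by simp
  also have "\<dots> = (\<integral>s. (\<integral>\<omega>. g \<omega> \<partial>M) * indicator A s \<partial>restrict_space lborel {0..t})" by simp
  also have "\<dots> = (\<integral>\<omega>. g \<omega> \<partial>M) * measure (restrict_space lborel {0..t}) A"
    using A(2) by (simp add: space_restrict_space Int_absorb2)
  also have "measure (restrict_space lborel {0..t}) A = measure lborel A"
    using A by (intro measure_restrict_space) auto
  finally show "(\<integral>(s, \<omega>). g \<omega> * indicator A s \<partial>Q t) = (\<integral>\<omega>. g \<omega> \<partial>M) * measure lborel A" .
qed

lemma simple_integrandD:
  assumes S: "simple_integrand F t n \<tau> \<eta>" and i: "i < n"
  shows "0 \<le> \<tau> i" "\<tau> i \<le> \<tau> (Suc i)" "\<tau> (Suc i) \<le> t" "\<eta> i \<in> bounded_past (\<tau> i)"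
proof -
  have mono: "\<tau> j \<le> \<tau> k" if "j \<le> k" "k \<le> n" for j k
    using that
  proof (induction k)
    case (Suc k)
    then show ?case using S unfolding simple_integrand_def
      by (cases "j = Suc k") (auto dest!: spec[of _ k])
  qed simp
  show "0 \<le> \<tau> i" using mono[of 0 i] i S by (auto simp: simple_integrand_def)
  show "\<tau> i \<le> \<tau> (Suc i)" using mono[of i "Suc i"] i by auto
  show "\<tau> (Suc i) \<le> t" using mono[of "Suc i" n] i S by (auto simp: simple_integrand_def)
  show "\<eta> i \<in> bounded_past (\<tau> i)" using S i by (auto simp: simple_integrand_def bounded_past_def)
qed

lemma simple_integral_L2:
  assumes V: "noise_bracket V V 1" and t: "t \<le> T" and S: "simple_integrand F t n \<tau> \<eta>"
  shows "simple_integral V n \<tau> \<eta> \<in> L2_vars M M"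
  unfolding simple_integral_def
proof (rule L2_vars_sum[OF finite_measure_axioms])
  fix i assume "i \<in> {..<n}"
  then have i: "i < n" by simp
  note D = simple_integrandD[OF S i]
  show "(\<lambda>\<omega>. \<eta> i \<omega> * (V (\<tau> (Suc i)) \<omega> - V (\<tau> i) \<omega>)) \<in> L2_vars M M"
    using D t by (intro L2_vars_subalgebra[OF subalgebra_F L2_increment_term[OF V]]) auto
qed simp

lemma simple_process_L2:
  assumes t: "t \<le> T" and S: "simple_integrand F t n \<tau> \<eta>"
  shows "case_prod (simple_process n \<tau> \<eta>) \<in> L2_vars (Q t) (Q t)"
proof -
  have "(\<lambda>z. \<Sum>i<n. (\<lambda>(s, \<omega>). \<eta> i \<omega> * indicator {\<tau> i<..\<tau> (Suc i)} s) z) \<in> L2_vars (Q t) (Q t)"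
  proof (rule L2_vars_sum[OF finite_measure_Q])
    fix i assume "i \<in> {..<n}"
    then have i: "i < n" by simp
    note D = simple_integrandD[OF S i]
    obtain C where C: "\<And>\<omega>. \<omega> \<in> space M \<Longrightarrow> \<bar>\<eta> i \<omega>\<bar> \<le> C" using D by (auto simp: bounded_past_def)
    have [measurable]: "\<eta> i \<in> borel_measurable M"
      using measurable_from_subalg[OF subalgebra_F[of "\<tau> i"]] D t by (auto simp: bounded_past_def)
    have A [measurable]: "{\<tau> i<..\<tau> (Suc i)} \<in> sets (restrict_space lborel {0..t})"
      using D by (auto simp: sets_restrict_space image_iff intro!: bexI[of _ "{\<tau> i<..\<tau> (Suc i)}"])
    show "(\<lambda>(s, \<omega>). \<eta> i \<omega> * indicator {\<tau> i<..\<tau> (Suc i)} s :: real) \<in> L2_vars (Q t) (Q t)"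
    proof (rule L2_vars_bounded[OF finite_measure_Q subalgebra_refl])
      show "(\<lambda>(s, \<omega>). \<eta> i \<omega> * indicator {\<tau> i<..\<tau> (Suc i)} s :: real) \<in> borel_measurable (Q t)" by measurable
      show "\<bar>case z of (s, \<omega>) \<Rightarrow> \<eta> i \<omega> * indicator {\<tau> i<..\<tau> (Suc i)} s\<bar> \<le> C" if "z \<in> space (Q t)" for z
        using that C[of "snd z"] order_trans[OF abs_ge_zero C[of "snd z"]]
        by (auto simp: space_Q split: prod.split split_indicator)
    qed
  qed simp
  moreover have "(\<lambda>z. \<Sum>i<n. (\<lambda>(s, \<omega>). \<eta> i \<omega> * indicator {\<tau> i<..\<tau> (Suc i)} s) z) = case_prod (simple_process n \<tau> \<eta>)"
    by (auto simp: simple_process_def fun_eq_iff)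
  ultimately show ?thesis by simp
qed

text \<open>Both sides are double sums over the steps of the two integrands. The product of two indicator
  functions integrates to the length of the common part of the intervals, which is also the
  covariance of the increments.\<close>

lemma simple_isometry:
  assumes V: "noise_bracket V V 1" and V': "noise_bracket V' V' 1" and VV': "noise_bracket V V' \<rho>"
    and t: "t \<le> T" and S: "simple_integrand F t n \<tau> \<eta>" and S': "simple_integrand F t n' \<tau>' \<eta>'"
  shows "(\<integral>\<omega>. simple_integral V n \<tau> \<eta> \<omega> * simple_integral V' n' \<tau>' \<eta>' \<omega> \<partial>M)
    = \<rho> * (\<integral>z. case_prod (simple_process n \<tau> \<eta>) z * case_prod (simple_process n' \<tau>' \<eta>') z \<partial>Q t)"
proof -
  note D = simple_integrandD[OF S] and D' = simple_integrandD[OF S']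
  let ?A = "\<lambda>i j. {\<tau> i<..\<tau> (Suc i)} \<inter> {\<tau>' j<..\<tau>' (Suc j)}"
  have ee: "integrable M (\<lambda>\<omega>. \<eta> i \<omega> * \<eta>' j \<omega>)" if ij: "i < n" "j < n'" for i j
    using D[OF ij(1)] D'[OF ij(2)] t
    by (intro L2_vars_mult_integrable L2_vars_subalgebra[OF subalgebra_F L2_bounded_past[OF D(4)[OF ij(1)]]]
       L2_vars_subalgebra[OF subalgebra_F L2_bounded_past[OF D'(4)[OF ij(2)]]]) auto
  have A: "?A i j \<in> sets borel" "?A i j \<subseteq> {0..t}" if ij: "i < n" "j < n'" for i j
    using D[OF ij(1)] D'[OF ij(2)] by auto
  have il: "integrable M (\<lambda>\<omega>. (\<eta> i \<omega> * (V (\<tau> (Suc i)) \<omega> - V (\<tau> i) \<omega>)) * (\<eta>' j \<omega> * (V' (\<tau>' (Suc j)) \<omega> - V' (\<tau>' j) \<omega>)))"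
    if ij: "i < n" "j < n'" for i j
    using D[OF ij(1)] D'[OF ij(2)] t
    by (intro L2_vars_mult_integrable L2_vars_subalgebra[OF subalgebra_F L2_increment_term[OF V]]
       L2_vars_subalgebra[OF subalgebra_F L2_increment_term[OF V']]) auto
  have "(\<integral>\<omega>. simple_integral V n \<tau> \<eta> \<omega> * simple_integral V' n' \<tau>' \<eta>' \<omega> \<partial>M) =
    (\<integral>\<omega>. (\<Sum>i<n. \<Sum>j<n'. (\<eta> i \<omega> * (V (\<tau> (Suc i)) \<omega> - V (\<tau> i) \<omega>)) * (\<eta>' j \<omega> * (V' (\<tau>' (Suc j)) \<omega> - V' (\<tau>' j) \<omega>))) \<partial>M)"
    by (simp add: simple_integral_def sum_product)
  also have "\<dots> = (\<Sum>i<n. \<Sum>j<n'. \<integral>\<omega>. (\<eta> i \<omega> * (V (\<tau> (Suc i)) \<omega> - V (\<tau> i) \<omega>)) * (\<eta>' j \<omega> * (V' (\<tau>' (Suc j)) \<omega> - V' (\<tau>' j) \<omega>)) \<partial>M)"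
    by (rule integral_double_sum[OF il])
  also have "\<dots> = (\<Sum>i<n. \<Sum>j<n'. \<rho> * (\<integral>\<omega>. \<eta> i \<omega> * \<eta>' j \<omega> \<partial>M) * measure lborel (?A i j))"
  proof (intro sum.cong refl)
    fix i j assume "i \<in> {..<n}" "j \<in> {..<n'}"
    then have ij: "i < n" "j < n'" by auto
    show "(\<integral>\<omega>. (\<eta> i \<omega> * (V (\<tau> (Suc i)) \<omega> - V (\<tau> i) \<omega>)) * (\<eta>' j \<omega> * (V' (\<tau>' (Suc j)) \<omega> - V' (\<tau>' j) \<omega>)) \<partial>M)
      = \<rho> * (\<integral>\<omega>. \<eta> i \<omega> * \<eta>' j \<omega> \<partial>M) * measure lborel (?A i j)"
      using D[OF ij(1)] D'[OF ij(2)] t by (intro increments_covariance[OF V V' VV']) auto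
  qed
  also have "\<dots> = \<rho> * (\<Sum>i<n. \<Sum>j<n'. (\<integral>\<omega>. \<eta> i \<omega> * \<eta>' j \<omega> \<partial>M) * measure lborel (?A i j))"
    by (simp add: sum_distrib_left mult.assoc)
  also have "(\<Sum>i<n. \<Sum>j<n'. (\<integral>\<omega>. \<eta> i \<omega> * \<eta>' j \<omega> \<partial>M) * measure lborel (?A i j))
    = (\<Sum>i<n. \<Sum>j<n'. \<integral>(s, \<omega>). (\<eta> i \<omega> * \<eta>' j \<omega>) * indicator (?A i j) s \<partial>Q t)"
    using Q_integral_rectangle(2)[OF ee A] by (intro sum.cong refl) auto
  also have "\<dots> = (\<integral>z. (\<Sum>i<n. \<Sum>j<n'. (\<lambda>(s, \<omega>). (\<eta> i \<omega> * \<eta>' j \<omega>) * indicator (?A i j) s) z) \<partial>Q t)"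
    by (rule integral_double_sum[symmetric], rule Q_integral_rectangle(1)[OF ee A])
  also have "\<dots> = (\<integral>z. case_prod (simple_process n \<tau> \<eta>) z * case_prod (simple_process n' \<tau>' \<eta>') z \<partial>Q t)"
  proof -
    have "(x * y) * indicator (A \<inter> B) s = (x * indicator A s) * (y * indicator B s)" for x y s :: real and A B
      by (simp add: indicator_inter_arith)
    then show ?thesis by (simp only: simple_process_def sum_product case_prod_beta)
  qed
  finally show ?thesis .
qed

lemma nn_integral_Q_iterated:
  assumes H: "measurable_process M t H" and t: "t \<le> T" and S: "simple_integrand F t n \<tau> \<eta>"
  shows "(\<integral>\<^sup>+\<omega>. (\<integral>\<^sup>+s\<in>{0..t}. ennreal ((H s \<omega> - simple_process n \<tau> \<eta> s \<omega>)\<^sup>2) \<partial>lborel) \<partial>M)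
    = (\<integral>\<^sup>+z. ennreal ((case_prod H z - case_prod (simple_process n \<tau> \<eta>) z)\<^sup>2) \<partial>Q t)"
proof -
  interpret P: pair_sigma_finite "restrict_space lborel {0..t}" M by (rule pair_Q)
  have m: "case_prod H \<in> borel_measurable (Q t)" "case_prod (simple_process n \<tau> \<eta>) \<in> borel_measurable (Q t)"
    using H L2_varsD(1)[OF simple_process_L2[OF t S]] by (auto simp: measurable_process_Q)
  have "(\<integral>\<^sup>+\<omega>. (\<integral>\<^sup>+s. ennreal ((H s \<omega> - simple_process n \<tau> \<eta> s \<omega>)\<^sup>2) \<partial>restrict_space lborel {0..t}) \<partial>M)
    = (\<integral>\<^sup>+z. ennreal ((case_prod H z - case_prod (simple_process n \<tau> \<eta>) z)\<^sup>2) \<partial>Q t)"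
    using P.nn_integral_snd[of "\<lambda>z. ennreal ((case_prod H z - case_prod (simple_process n \<tau> \<eta>) z)\<^sup>2)"] m by simp
  then show ?thesis by (simp add: nn_integral_restrict_space)
qed

lemma has_ito_integralE:
  assumes I: "has_ito_integral M F V t H I" and V: "noise_bracket V V 1" and t: "t \<le> T"
  obtains n \<tau> \<eta> where "\<And>k. simple_integrand F t (n k) (\<tau> k) (\<eta> k)"
    "(\<lambda>k. \<integral>z. (case_prod H z - case_prod (simple_process (n k) (\<tau> k) (\<eta> k)) z)\<^sup>2 \<partial>Q t) \<longlonglongrightarrow> 0"
    "(\<lambda>k. \<integral>\<omega>. (I \<omega> - simple_integral V (n k) (\<tau> k) (\<eta> k) \<omega>)\<^sup>2 \<partial>M) \<longlonglongrightarrow> 0"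
    "case_prod H \<in> L2_vars (Q t) (Q t)" "I \<in> L2_vars M M"
    "(\<lambda>k. \<integral>\<^sup>+\<omega>. (\<integral>\<^sup>+s\<in>{0..t}. ennreal ((H s \<omega> - simple_process (n k) (\<tau> k) (\<eta> k) s \<omega>)\<^sup>2) \<partial>lborel) \<partial>M) \<longlonglongrightarrow> 0"
proof -
  from I obtain n \<tau> \<eta> where H: "measurable_process M t H" and Im: "I \<in> borel_measurable M"
    and S: "\<And>k. simple_integrand F t (n k) (\<tau> k) (\<eta> k)"
    and l1: "(\<lambda>k. \<integral>\<^sup>+\<omega>. (\<integral>\<^sup>+s\<in>{0..t}. ennreal ((H s \<omega> - simple_process (n k) (\<tau> k) (\<eta> k) s \<omega>)\<^sup>2) \<partial>lborel) \<partial>M) \<longlonglongrightarrow> 0"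
    and l2: "(\<lambda>k. \<integral>\<^sup>+\<omega>. ennreal ((I \<omega> - simple_integral V (n k) (\<tau> k) (\<eta> k) \<omega>)\<^sup>2) \<partial>M) \<longlonglongrightarrow> 0"
    unfolding has_ito_integral_def by blast
  have H': "case_prod H \<in> borel_measurable (Q t)" using H by (simp add: measurable_process_Q)
  show ?thesis
    by (rule that[OF S _ _ _ _ l1])
      (use L2_limit[OF H' simple_process_L2[OF t S] l1[unfolded nn_integral_Q_iterated[OF H t S]]]
         L2_limit[OF Im simple_integral_L2[OF V t S] l2] in auto)
qed

lemma ito_L2:
  assumes I: "has_ito_integral M F V t H I" and V: "noise_bracket V V 1" and t: "t \<le> T"
  shows "case_prod H \<in> L2_vars (Q t) (Q t)" "I \<in> L2_vars M M"
  using has_ito_integralE[OF I V t] by blast+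

text \<open>Both sides are continuous in \<open>L\<^sup>2\<close>, so the identity passes from simple integrands to limits.\<close>

theorem ito_isometry:
  assumes V: "noise_bracket V V 1" and V': "noise_bracket V' V' 1" and VV': "noise_bracket V V' \<rho>"
    and t: "t \<le> T" and I: "has_ito_integral M F V t H I" and I': "has_ito_integral M F V' t H' I'"
  shows "(\<integral>\<omega>. I \<omega> * I' \<omega> \<partial>M) = \<rho> * (\<integral>z. case_prod H z * case_prod H' z \<partial>Q t)"
proof -
  obtain n \<tau> \<eta> where S: "\<And>k. simple_integrand F t (n k) (\<tau> k) (\<eta> k)"
    and l: "(\<lambda>k. \<integral>z. (case_prod H z - case_prod (simple_process (n k) (\<tau> k) (\<eta> k)) z)\<^sup>2 \<partial>Q t) \<longlonglongrightarrow> 0"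
    "(\<lambda>k. \<integral>\<omega>. (I \<omega> - simple_integral V (n k) (\<tau> k) (\<eta> k) \<omega>)\<^sup>2 \<partial>M) \<longlonglongrightarrow> 0"
    "case_prod H \<in> L2_vars (Q t) (Q t)" "I \<in> L2_vars M M"
    by (rule has_ito_integralE[OF I V t]) blast
  obtain n' \<tau>' \<eta>' where S': "\<And>k. simple_integrand F t (n' k) (\<tau>' k) (\<eta>' k)"
    and l': "(\<lambda>k. \<integral>z. (case_prod H' z - case_prod (simple_process (n' k) (\<tau>' k) (\<eta>' k)) z)\<^sup>2 \<partial>Q t) \<longlonglongrightarrow> 0"
    "(\<lambda>k. \<integral>\<omega>. (I' \<omega> - simple_integral V' (n' k) (\<tau>' k) (\<eta>' k) \<omega>)\<^sup>2 \<partial>M) \<longlonglongrightarrow> 0"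
    "case_prod H' \<in> L2_vars (Q t) (Q t)" "I' \<in> L2_vars M M"
    by (rule has_ito_integralE[OF I' V' t]) blast
  note L2S = simple_integral_L2[OF V t S] simple_integral_L2[OF V' t S']
  note L2P = simple_process_L2[OF t S] simple_process_L2[OF t S']
  have "(\<lambda>k. \<integral>\<omega>. simple_integral V (n k) (\<tau> k) (\<eta> k) \<omega> * simple_integral V' (n' k) (\<tau>' k) (\<eta>' k) \<omega> \<partial>M)
    \<longlonglongrightarrow> (\<integral>\<omega>. I \<omega> * I' \<omega> \<partial>M)"
    by (rule L2_inner_tendsto[OF l(4) L2S(1) l(2) l'(4) L2S(2) l'(2)])
  moreover have "(\<lambda>k. \<rho> * (\<integral>z. case_prod (simple_process (n k) (\<tau> k) (\<eta> k)) z * case_prod (simple_process (n' k) (\<tau>' k) (\<eta>' k)) z \<partial>Q t))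
    \<longlonglongrightarrow> \<rho> * (\<integral>z. case_prod H z * case_prod H' z \<partial>Q t)"
    by (intro tendsto_mult_left L2_inner_tendsto[OF l(3) L2P(1) l(1) l'(3) L2P(2) l'(1)])
  ultimately show ?thesis
    unfolding simple_isometry[OF V V' VV' t S S'] by (rule LIMSEQ_unique)
qed

lemma simple_has_ito_integral:
  assumes V: "noise_bracket V V 1" and t: "t \<le> T" and S: "simple_integrand F t n \<tau> \<eta>"
  shows "has_ito_integral M F V t (simple_process n \<tau> \<eta>) (simple_integral V n \<tau> \<eta>)"
  unfolding has_ito_integral_def
  using S L2_varsD(1)[OF simple_integral_L2[OF V t S]] L2_varsD(1)[OF simple_process_L2[OF t S]]
  by (auto simp: measurable_process_Q intro!: exI[of _ "\<lambda>_. n"] exI[of _ "\<lambda>_. \<tau>"] exI[of _ "\<lambda>_. \<eta>"])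

lemma ito_distance:
  assumes V: "noise_bracket V V 1" and t: "t \<le> T"
    and I: "has_ito_integral M F V t H I" and I': "has_ito_integral M F V t H' I'"
  shows "(\<integral>\<omega>. (I \<omega> - I' \<omega>)\<^sup>2 \<partial>M) = (\<integral>z. (case_prod H z - case_prod H' z)\<^sup>2 \<partial>Q t)"
proof -
  note i = ito_L2[OF I V t] and i' = ito_L2[OF I' V t]
  have expand: "(\<integral>x. (f x - g x)\<^sup>2 \<partial>N) = (\<integral>x. f x * f x \<partial>N) - 2 * (\<integral>x. f x * g x \<partial>N) + (\<integral>x. g x * g x \<partial>N)"
    if "f \<in> L2_vars N N" "g \<in> L2_vars N N" for f g :: "'b \<Rightarrow> real" and N
  proof -
    have "(\<integral>x. (f x - g x)\<^sup>2 \<partial>N) = (\<integral>x. f x * f x - 2 * (f x * g x) + g x * g x \<partial>N)"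
      by (simp add: power2_eq_square algebra_simps)
    also have "\<dots> = (\<integral>x. f x * f x \<partial>N) - 2 * (\<integral>x. f x * g x \<partial>N) + (\<integral>x. g x * g x \<partial>N)"
      using that by (simp add: L2_vars_mult_integrable)
    finally show ?thesis .
  qed
  show ?thesis
    unfolding expand[OF i(2) i'(2)] expand[OF i(1) i'(1)]
    using ito_isometry[OF V V V t I I] ito_isometry[OF V V V t I I'] ito_isometry[OF V V V t I' I'] by simp
qed

text \<open>Stopping a simple integrand at time \<open>r\<close> does not change it on \<open>[0,r]\<close>, and the part of the
  simple integral that is cut off is orthogonal to the past of \<open>r\<close>.\<close>

lemma simple_integrand_stopped:
  assumes S: "simple_integrand F t n \<tau> \<eta>" and r: "0 \<le> r" "r \<le> t" and t: "t \<le> T"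
  defines "\<tau>' \<equiv> \<lambda>i. min (\<tau> i) r" and "\<eta>' \<equiv> \<lambda>i. if \<tau> i \<le> r then \<eta> i else (\<lambda>_. 0)"
  shows "simple_integrand F r n \<tau>' \<eta>'"
    "s \<le> r \<Longrightarrow> simple_process n \<tau>' \<eta>' s \<omega> = simple_process n \<tau> \<eta> s \<omega>"
    "noise_bracket V V 1 \<Longrightarrow> \<zeta> \<in> L2_vars M (F r) \<Longrightarrow>
      (\<integral>\<omega>. simple_integral V n \<tau> \<eta> \<omega> * \<zeta> \<omega> \<partial>M) = (\<integral>\<omega>. simple_integral V n \<tau>' \<eta>' \<omega> * \<zeta> \<omega> \<partial>M)"
proof -
  note D = simple_integrandD[OF S]
  show S': "simple_integrand F r n \<tau>' \<eta>'"
    unfolding simple_integrand_def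
  proof (intro conjI allI impI)
    show "0 \<le> \<tau>' 0" using S r by (auto simp: simple_integrand_def \<tau>'_def)
    show "\<tau>' n \<le> r" by (simp add: \<tau>'_def)
    fix i assume i: "i < n"
    show "\<tau>' i \<le> \<tau>' (Suc i)" using D[OF i] by (auto simp: \<tau>'_def)
    show "\<eta>' i \<in> borel_measurable (F (\<tau>' i))" "\<exists>C. \<forall>\<omega>\<in>space (F (\<tau>' i)). \<bar>\<eta>' i \<omega>\<bar> \<le> C"
      using D(4)[OF i] by (auto simp: \<tau>'_def \<eta>'_def bounded_past_def)
  qed
  show "simple_process n \<tau>' \<eta>' s \<omega> = simple_process n \<tau> \<eta> s \<omega>" if "s \<le> r"
    unfolding simple_process_def using that
    by (intro sum.cong refl) (auto simp: \<tau>'_def \<eta>'_def indicator_def)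
  assume V: "noise_bracket V V 1" and \<zeta>: "\<zeta> \<in> L2_vars M (F r)"
  have \<zeta>M: "\<zeta> \<in> L2_vars M M" using L2_vars_subalgebra[OF subalgebra_F \<zeta>] r t by simp
  let ?I = "\<lambda>\<tau> \<eta> i \<omega>. \<eta> i \<omega> * (V (\<tau> (Suc i)) \<omega> - V (\<tau> i) \<omega>)"
  have L2: "?I \<tau> \<eta> i \<in> L2_vars M M" "?I \<tau>' \<eta>' i \<in> L2_vars M M" if i: "i < n" for i
    using D[OF i] simple_integrandD[OF S' i] r t
    by (auto intro!: L2_vars_subalgebra[OF subalgebra_F L2_increment_term[OF V]])
  have eq: "(\<integral>\<omega>. ?I \<tau> \<eta> i \<omega> * \<zeta> \<omega> \<partial>M) = (\<integral>\<omega>. ?I \<tau>' \<eta>' i \<omega> * \<zeta> \<omega> \<partial>M)" if i: "i < n" for i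
  proof -
    consider "\<tau> (Suc i) \<le> r" | "r < \<tau> i" | "\<tau> i \<le> r" "r < \<tau> (Suc i)" by linarith
    then show ?thesis
    proof cases
      case 1
      then show ?thesis using D(2)[OF i] by (simp add: \<tau>'_def \<eta>'_def)
    next
      case 2
      have "(\<integral>\<omega>. \<zeta> \<omega> * ?I \<tau> \<eta> i \<omega> \<partial>M) = 0"
        using D[OF i] 2 t r by (intro increment_orthogonal[OF V] L2_past_mono[OF _ _ \<zeta>]) auto
      then show ?thesis using 2 by (simp add: \<eta>'_def mult_ac)
    next
      case 3
      have o: "(\<integral>\<omega>. \<zeta> \<omega> * (\<eta> i \<omega> * (V (\<tau> (Suc i)) \<omega> - V r \<omega>)) \<partial>M) = 0"
        using D[OF i] 3 t r by (intro increment_orthogonal[OF V _ _ _ \<zeta>] bounded_past_mono[OF _ _ D(4)[OF i]]) auto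
      have L: "(\<lambda>\<omega>. \<eta> i \<omega> * (V (\<tau> (Suc i)) \<omega> - V r \<omega>)) \<in> L2_vars M M"
        using D[OF i] 3 t r
        by (intro L2_vars_subalgebra[OF subalgebra_F L2_increment_term[OF V]] bounded_past_mono[OF _ _ D(4)[OF i]]) auto
      have "(\<integral>\<omega>. ?I \<tau> \<eta> i \<omega> * \<zeta> \<omega> \<partial>M) = (\<integral>\<omega>. ?I \<tau>' \<eta>' i \<omega> * \<zeta> \<omega> + \<zeta> \<omega> * (\<eta> i \<omega> * (V (\<tau> (Suc i)) \<omega> - V r \<omega>)) \<partial>M)"
        using 3 by (intro Bochner_Integration.integral_cong) (auto simp: \<tau>'_def \<eta>'_def algebra_simps)
      also have "\<dots> = (\<integral>\<omega>. ?I \<tau>' \<eta>' i \<omega> * \<zeta> \<omega> \<partial>M)"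
        using L2_vars_mult_integrable[OF L2(2)[OF i] \<zeta>M] L2_vars_mult_integrable[OF \<zeta>M L] o by simp
      finally show ?thesis .
    qed
  qed
  show "(\<integral>\<omega>. simple_integral V n \<tau> \<eta> \<omega> * \<zeta> \<omega> \<partial>M) = (\<integral>\<omega>. simple_integral V n \<tau>' \<eta>' \<omega> * \<zeta> \<omega> \<partial>M)"
  proof -
    have "(\<integral>\<omega>. (\<Sum>i<n. f i \<omega>) * \<zeta> \<omega> \<partial>M) = (\<Sum>i<n. \<integral>\<omega>. f i \<omega> * \<zeta> \<omega> \<partial>M)"
      if "\<And>i. i < n \<Longrightarrow> f i \<in> L2_vars M M" for f
      unfolding sum_distrib_right
      by (intro Bochner_Integration.integral_sum L2_vars_mult_integrable that \<zeta>M) auto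
    from this[OF L2(1)] this[OF L2(2)] show ?thesis
      unfolding simple_integral_def by (simp add: eq)
  qed
qed

text \<open>The stopped approximations of \<open>H\<close> converge on \<open>[0,r]\<close>, and by the isometry their integrals
  converge to \<open>J\<close>, whichever sequence defined \<open>J\<close>.\<close>

theorem ito_martingale:
  assumes V: "noise_bracket V V 1" and r: "0 \<le> r" "r \<le> t" and t: "t \<le> T"
    and I: "has_ito_integral M F V t H I" and J: "has_ito_integral M F V r H J"
    and \<zeta>: "\<zeta> \<in> L2_vars M (F r)"
  shows "(\<integral>\<omega>. I \<omega> * \<zeta> \<omega> \<partial>M) = (\<integral>\<omega>. J \<omega> * \<zeta> \<omega> \<partial>M)"
proof -
  have rT: "r \<le> T" using r t by simp
  obtain n \<tau> \<eta> where S: "\<And>k. simple_integrand F t (n k) (\<tau> k) (\<eta> k)"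
    and l: "(\<lambda>k. \<integral>\<omega>. (I \<omega> - simple_integral V (n k) (\<tau> k) (\<eta> k) \<omega>)\<^sup>2 \<partial>M) \<longlonglongrightarrow> 0" "I \<in> L2_vars M M"
    "(\<lambda>k. \<integral>\<^sup>+\<omega>. (\<integral>\<^sup>+s\<in>{0..t}. ennreal ((H s \<omega> - simple_process (n k) (\<tau> k) (\<eta> k) s \<omega>)\<^sup>2) \<partial>lborel) \<partial>M) \<longlonglongrightarrow> 0"
    by (rule has_ito_integralE[OF I V t]) blast
  define \<tau>' where "\<tau>' k i = min (\<tau> k i) r" for k i
  define \<eta>' where "\<eta>' k i = (if \<tau> k i \<le> r then \<eta> k i else (\<lambda>_. 0))" for k i
  note st = simple_integrand_stopped[OF S r t, folded \<tau>'_def \<eta>'_def]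
  have Hm: "measurable_process M r H" using J by (simp add: has_ito_integral_def)
  have "(\<lambda>k. \<integral>\<^sup>+\<omega>. (\<integral>\<^sup>+s\<in>{0..r}. ennreal ((H s \<omega> - simple_process (n k) (\<tau>' k) (\<eta>' k) s \<omega>)\<^sup>2) \<partial>lborel) \<partial>M) \<longlonglongrightarrow> 0"
  proof (rule tendsto_sandwich[OF _ _ tendsto_const l(3)])
    show "\<forall>\<^sub>F k in sequentially. (\<integral>\<^sup>+\<omega>. (\<integral>\<^sup>+s\<in>{0..r}. ennreal ((H s \<omega> - simple_process (n k) (\<tau>' k) (\<eta>' k) s \<omega>)\<^sup>2) \<partial>lborel) \<partial>M)
      \<le> (\<integral>\<^sup>+\<omega>. (\<integral>\<^sup>+s\<in>{0..t}. ennreal ((H s \<omega> - simple_process (n k) (\<tau> k) (\<eta> k) s \<omega>)\<^sup>2) \<partial>lborel) \<partial>M)"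
      using r by (intro always_eventually allI nn_integral_mono) (auto simp: st(2) indicator_def)
  qed simp
  then have "(\<lambda>k. \<integral>z. (case_prod H z - case_prod (simple_process (n k) (\<tau>' k) (\<eta>' k)) z)\<^sup>2 \<partial>Q r) \<longlonglongrightarrow> 0"
    unfolding nn_integral_Q_iterated[OF Hm rT st(1)]
    by (rule L2_limit(2)[OF Hm[unfolded measurable_process_Q],
      of "\<lambda>k. case_prod (simple_process (n k) (\<tau>' k) (\<eta>' k))", OF simple_process_L2[OF rT st(1)]])
  then have lJ: "(\<lambda>k. \<integral>\<omega>. (J \<omega> - simple_integral V (n k) (\<tau>' k) (\<eta>' k) \<omega>)\<^sup>2 \<partial>M) \<longlonglongrightarrow> 0"
    unfolding ito_distance[OF V rT J simple_has_ito_integral[OF V rT st(1)]] .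
  have \<zeta>M: "\<zeta> \<in> L2_vars M M" using L2_vars_subalgebra[OF subalgebra_F \<zeta>] rT by simp
  have "(\<lambda>k. \<integral>\<omega>. simple_integral V (n k) (\<tau> k) (\<eta> k) \<omega> * \<zeta> \<omega> \<partial>M) \<longlonglongrightarrow> (\<integral>\<omega>. I \<omega> * \<zeta> \<omega> \<partial>M)"
    by (rule L2_sq_tendsto[OF l(2) simple_integral_L2[OF V t S] l(1) \<zeta>M])
  moreover have "(\<lambda>k. \<integral>\<omega>. simple_integral V (n k) (\<tau>' k) (\<eta>' k) \<omega> * \<zeta> \<omega> \<partial>M) \<longlonglongrightarrow> (\<integral>\<omega>. J \<omega> * \<zeta> \<omega> \<partial>M)"
    by (rule L2_sq_tendsto[OF ito_L2(2)[OF J V rT] simple_integral_L2[OF V rT st(1)] lJ \<zeta>M])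
  ultimately show ?thesis unfolding st(3)[OF V \<zeta>] by (rule LIMSEQ_unique)
qed

end

section \<open>Ito's product rule in expectation\<close>

lemma L2_const: "finite_measure N \<Longrightarrow> (\<lambda>_. c::real) \<in> L2_vars N N"
  using finite_measure.integrable_const by (auto simp: L2_vars_def)

lemma set_integral_time:
  fixes a :: "real \<Rightarrow> real"
  assumes "s \<le> t"
  shows "(LINT r:{0..s}|lborel. a r) = (\<integral>r. indicator {0..s} r * a r \<partial>restrict_space lborel {0..t})"
proof -
  have "(\<integral>r. indicator {0..s} r * a r \<partial>restrict_space lborel {0..t}) = (\<integral>r. indicator {0..t} r *\<^sub>R (indicator {0..s} r * a r) \<partial>lborel)"
    by (intro integral_restrict_space) simp
  also have "\<dots> = (LINT r:{0..s}|lborel. a r)"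
    unfolding set_lebesgue_integral_def using assms
    by (intro Bochner_Integration.integral_cong) (auto split: split_indicator)
  finally show ?thesis by simp
qed

lemma set_integral_time_full:
  fixes a :: "real \<Rightarrow> real"
  shows "(LINT r:{0..t}|lborel. a r) = (\<integral>r. a r \<partial>restrict_space lborel {0..t})"
  unfolding set_lebesgue_integral_def by (subst integral_restrict_space) auto

text \<open>Split the square \<open>[0,t] \<times> [0,t]\<close> along its diagonal, which is a null set.\<close>

lemma product_of_primitives:
  fixes a b :: "real \<Rightarrow> real" and t :: real
  defines "R \<equiv> restrict_space lborel {0..t}"
  assumes a: "integrable R a" and b: "integrable R b"
  shows "(\<integral>s. a s \<partial>R) * (\<integral>s. b s \<partial>R) =
     (\<integral>s. a s * (LINT r:{0..s}|lborel. b r) + b s * (LINT r:{0..s}|lborel. a r) \<partial>R)"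
proof -
  interpret R: finite_measure R unfolding R_def by (rule finite_measure_time)
  interpret P: pair_sigma_finite R R by unfold_locales
  have spR: "space R = {0..t}" by (simp add: R_def space_restrict_space)
  have idR [measurable]: "(\<lambda>x. x) \<in> borel_measurable R" unfolding R_def by (intro measurable_restrict_space1) simp
  have [measurable]: "a \<in> borel_measurable R" "b \<in> borel_measurable R" using a b by auto
  have int: "integrable (R \<Otimes>\<^sub>M R) (\<lambda>(s, r). a s * b r)" if "integrable R a" "integrable R b" for a b :: "real \<Rightarrow> real"
  proof (rule P.Fubini_integrable)
    note [measurable] = borel_measurable_integrable[OF that(1)] borel_measurable_integrable[OF that(2)]
    show "(\<lambda>(s, r). a s * b r) \<in> borel_measurable (R \<Otimes>\<^sub>M R)" by measurable
    show "integrable R (\<lambda>x. \<integral>y. norm (case (x, y) of (s, r) \<Rightarrow> a s * b r) \<partial>R)"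
      using that by (simp add: abs_mult)
    show "AE x in R. integrable R (\<lambda>y. case (x, y) of (s, r) \<Rightarrow> a s * b r)" using that by simp
  qed
  have prim: "(\<integral>r. indicator {r. r \<le> s} r * a r \<partial>R) = (LINT r:{0..s}|lborel. a r)"
    "(\<integral>r. indicator {r. r < s} r * a r \<partial>R) = (LINT r:{0..s}|lborel. a r)"
    if s: "s \<in> {0..t}" and [measurable]: "a \<in> borel_measurable R" for s and a :: "real \<Rightarrow> real"
  proof -
    have "(\<integral>r. indicator {0..s} r * a r \<partial>R) = (LINT r:{0..s}|lborel. a r)"
      using s unfolding R_def by (intro set_integral_time[symmetric]) auto
    moreover have "(\<integral>r. indicator {r. r \<le> s} r * a r \<partial>R) = (\<integral>r. indicator {0..s} r * a r \<partial>R)"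
      by (intro Bochner_Integration.integral_cong) (auto simp: spR split: split_indicator)
    moreover have "(\<integral>r. indicator {r. r < s} r * a r \<partial>R) = (\<integral>r. indicator {r. r \<le> s} r * a r \<partial>R)"
    proof (intro integral_cong_AE)
      have "AE r in R. r \<noteq> s" unfolding R_def 
        using AE_lborel_singleton[of s] by (subst AE_restrict_space_iff) (auto elim: eventually_mono)
      then show "AE r in R. indicator {r. r < s} r * a r = indicator {r. r \<le> s} r * a r"
        by eventually_elim (auto split: split_indicator)
    qed measurable
    ultimately show "(\<integral>r. indicator {r. r \<le> s} r * a r \<partial>R) = (LINT r:{0..s}|lborel. a r)"
      "(\<integral>r. indicator {r. r < s} r * a r \<partial>R) = (LINT r:{0..s}|lborel. a r)" by auto
  qed
  have i1: "integrable (R \<Otimes>\<^sub>M R) (\<lambda>(s, r). a s * b r * indicator {r. r \<le> s} r)"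
    by (rule Bochner_Integration.integrable_bound[OF int[OF a b]]) (auto split: split_indicator)
  have i2: "integrable (R \<Otimes>\<^sub>M R) (\<lambda>(s, r). a s * b r * indicator {s. s < r} s)"
    by (rule Bochner_Integration.integrable_bound[OF int[OF a b]]) (auto split: split_indicator)
  have f1: "(\<integral>r. a s * b r * indicator {r. r \<le> s} r \<partial>R) = a s * (LINT r:{0..s}|lborel. b r)" if "s \<in> {0..t}" for s
  proof -
    have "(\<integral>r. a s * b r * indicator {r. r \<le> s} r \<partial>R) = (\<integral>r. a s * (indicator {r. r \<le> s} r * b r) \<partial>R)"
      by (simp only: mult_ac)
    then show ?thesis using prim(1)[OF that, of b] by simp
  qed
  have f2: "(\<integral>s. a s * b r * indicator {s. s < r} s \<partial>R) = b r * (LINT s:{0..r}|lborel. a s)" if "r \<in> {0..t}" for r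
  proof -
    have "(\<integral>s. a s * b r * indicator {s. s < r} s \<partial>R) = (\<integral>s. b r * (indicator {s. s < r} s * a s) \<partial>R)"
      by (simp only: mult_ac)
    then show ?thesis using prim(2)[OF that, of a] by simp
  qed
  have I1: "integrable R (\<lambda>s. a s * (LINT r:{0..s}|lborel. b r))"
    using P.integrable_fst'[OF i1] by (rule Bochner_Integration.integrable_cong[THEN iffD1, rotated -1]) (auto simp: f1 spR)
  have I2: "integrable R (\<lambda>r. b r * (LINT s:{0..r}|lborel. a s))"
    using P.integrable_snd[OF i2] by (rule Bochner_Integration.integrable_cong[THEN iffD1, rotated -1]) (auto simp: f2 spR)
  have "(\<integral>s. a s \<partial>R) * (\<integral>s. b s \<partial>R) = (\<integral>z. (\<lambda>(s, r). a s * b r) z \<partial>(R \<Otimes>\<^sub>M R))"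
    using P.integral_fst'[OF int[OF a b]] by simp
  also have "\<dots> = (\<integral>z. (\<lambda>(s, r). a s * b r * indicator {r. r \<le> s} r) z + (\<lambda>(s, r). a s * b r * indicator {s. s < r} s) z \<partial>(R \<Otimes>\<^sub>M R))"
    by (intro Bochner_Integration.integral_cong) (auto split: split_indicator)
  also have "\<dots> = (\<integral>z. (\<lambda>(s, r). a s * b r * indicator {r. r \<le> s} r) z \<partial>(R \<Otimes>\<^sub>M R)) + (\<integral>z. (\<lambda>(s, r). a s * b r * indicator {s. s < r} s) z \<partial>(R \<Otimes>\<^sub>M R))"
    using i1 i2 by simp
  also have "(\<integral>z. (\<lambda>(s, r). a s * b r * indicator {r. r \<le> s} r) z \<partial>(R \<Otimes>\<^sub>M R)) = (\<integral>s. a s * (LINT r:{0..s}|lborel. b r) \<partial>R)"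
    unfolding P.integral_fst'[OF i1, symmetric]
    by (intro Bochner_Integration.integral_cong) (auto simp: f1 spR)
  also have "(\<integral>z. (\<lambda>(s, r). a s * b r * indicator {s. s < r} s) z \<partial>(R \<Otimes>\<^sub>M R)) = (\<integral>r. b r * (LINT s:{0..r}|lborel. a s) \<partial>R)"
    unfolding P.integral_snd[OF i2, symmetric]
    by (intro Bochner_Integration.integral_cong) (auto simp: f2 spR)
  finally show "(\<integral>s. a s \<partial>R) * (\<integral>s. b s \<partial>R) =
     (\<integral>s. a s * (LINT r:{0..s}|lborel. b r) + b s * (LINT r:{0..s}|lborel. a r) \<partial>R)"
    using I1 I2 by simp
qed

context common_noise
begin

abbreviation R :: "real \<Rightarrow> real measure" where "R t \<equiv> restrict_space lborel {0..t}"

lemma measurable_Q_restrict: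
  assumes "f \<in> borel_measurable (Q T)" "t \<le> T" shows "f \<in> borel_measurable (Q t)"
proof (rule measurable_compose[OF _ assms(1), of "\<lambda>z. z", simplified])
  have "(\<lambda>s. s) \<in> R t \<rightarrow>\<^sub>M R T"
    using assms(2) by (intro measurable_restrict_space2 measurable_restrict_space1) (auto simp: space_restrict_space)
  then have "(\<lambda>z. (fst z, snd z)) \<in> Q t \<rightarrow>\<^sub>M Q T"
    by (intro measurable_Pair measurable_compose[OF measurable_fst] measurable_snd)
  then show "(\<lambda>z. z) \<in> Q t \<rightarrow>\<^sub>M Q T" by simp
qed

lemma nn_integral_Q_mono:
  assumes "f \<in> borel_measurable (Q T)" "t \<le> T"
  shows "(\<integral>\<^sup>+z. f z \<partial>Q t) \<le> (\<integral>\<^sup>+z. f z \<partial>Q T)"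
proof -
  have e: "(\<integral>\<^sup>+z. f z \<partial>Q t) = (\<integral>\<^sup>+\<omega>. \<integral>\<^sup>+s. f (s, \<omega>) * indicator {0..t} s \<partial>lborel \<partial>M)" if "t \<le> T" for t
  proof -
    interpret P: pair_sigma_finite "R t" M by (rule pair_Q)
    have "(\<integral>\<^sup>+z. f z \<partial>Q t) = (\<integral>\<^sup>+\<omega>. \<integral>\<^sup>+s. f (s, \<omega>) \<partial>R t \<partial>M)"
      using P.nn_integral_snd[OF measurable_Q_restrict[OF assms(1) that]] by simp
    then show ?thesis by (simp add: nn_integral_restrict_space)
  qed
  show ?thesis unfolding e[OF assms(2)] e[OF order_refl] using assms(2)
    by (intro nn_integral_mono) (auto split: split_indicator)
qed

lemma integrable_Q_restrict:
  fixes f :: "real \<times> 'a \<Rightarrow> real"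
  assumes "integrable (Q T) f" "t \<le> T" shows "integrable (Q t) f"
proof -
  have "(\<integral>\<^sup>+z. ennreal (norm (f z)) \<partial>Q t) \<le> (\<integral>\<^sup>+z. ennreal (norm (f z)) \<partial>Q T)"
    using assms by (intro nn_integral_Q_mono) auto
  then show ?thesis using assms measurable_Q_restrict[of f t] unfolding integrable_iff_bounded
    by (meson le_less_trans)
qed

lemma L2_Q_restrict:
  "f \<in> L2_vars (Q T) (Q T) \<Longrightarrow> t \<le> T \<Longrightarrow> f \<in> L2_vars (Q t) (Q t)"
  using measurable_Q_restrict integrable_Q_restrict[of "\<lambda>z. (f z)\<^sup>2"] by (auto simp: L2_vars_def)

lemma L2_Q_constant_in_time:
  assumes "\<xi> \<in> L2_vars M M" shows "(\<lambda>z. \<xi> (snd z)) \<in> L2_vars (Q t) (Q t)"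
proof -
  have [measurable]: "\<xi> \<in> borel_measurable M" using assms by (simp add: L2_vars_def)
  have "integrable (Q t) (\<lambda>(s, \<omega>). (\<xi> \<omega>)\<^sup>2 * indicator {0..t} s :: real)"
    using assms by (intro Q_integral_rectangle) (auto simp: L2_vars_def)
  then have "integrable (Q t) (\<lambda>z. (\<xi> (snd z))\<^sup>2)"
    by (rule Bochner_Integration.integrable_cong[THEN iffD1, rotated -1]) (auto simp: space_Q)
  then show ?thesis by (simp add: L2_vars_def)
qed

lemma L2_Q_sections:
  assumes "f \<in> L2_vars (Q t) (Q t)"
  shows "AE \<omega> in M. (\<lambda>s. f (s, \<omega>)) \<in> L2_vars (R t) (R t)" "AE s in R t. (\<lambda>\<omega>. f (s, \<omega>)) \<in> L2_vars M M"
    "integrable M (\<lambda>\<omega>. \<integral>s. (f (s, \<omega>))\<^sup>2 \<partial>R t)"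
proof -
  interpret P: pair_sigma_finite "R t" M by (rule pair_Q)
  have i: "integrable (Q t) (\<lambda>(s, \<omega>). (f (s, \<omega>))\<^sup>2)" using assms by (simp add: L2_vars_def split_beta')
  have [measurable]: "f \<in> borel_measurable (Q t)" using assms by (simp add: L2_vars_def)
  have "AE \<omega> in M. (\<lambda>s. f (s, \<omega>)) \<in> borel_measurable (R t)"
    by (intro AE_I2) measurable
  with P.AE_integrable_snd[OF i] show "AE \<omega> in M. (\<lambda>s. f (s, \<omega>)) \<in> L2_vars (R t) (R t)"
    by eventually_elim (simp add: L2_vars_def)
  have "AE s in R t. (\<lambda>\<omega>. f (s, \<omega>)) \<in> borel_measurable M"
    by (intro AE_I2) measurable
  with P.AE_integrable_fst[OF i] show "AE s in R t. (\<lambda>\<omega>. f (s, \<omega>)) \<in> L2_vars M M"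
    by eventually_elim (simp add: L2_vars_def)
  show "integrable M (\<lambda>\<omega>. \<integral>s. (f (s, \<omega>))\<^sup>2 \<partial>R t)" using P.integrable_snd[OF i] .
qed

definition primitive :: "(real \<Rightarrow> 'a \<Rightarrow> real) \<Rightarrow> real \<Rightarrow> 'a \<Rightarrow> real" where
  "primitive \<alpha> s \<omega> = (LINT r:{0..s}|lborel. \<alpha> r \<omega>)"

lemma primitive_measurable:
  assumes "case_prod \<alpha> \<in> borel_measurable (Q T)"
  shows "case_prod (primitive \<alpha>) \<in> borel_measurable (Q T)"
proof -
  interpret R: finite_measure "R T" by (rule finite_measure_time)
  have [measurable]: "(\<lambda>x. x) \<in> borel_measurable (R T)" by (intro measurable_restrict_space1) simp
  note [measurable] = assms
  have "(\<lambda>(z, r). (if r \<le> fst z then case_prod \<alpha> (r, snd z) else 0)) \<in> borel_measurable (Q T \<Otimes>\<^sub>M R T)"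
    by measurable
  then have "(\<lambda>z. \<integral>r. (if r \<le> fst z then case_prod \<alpha> (r, snd z) else 0) \<partial>R T) \<in> borel_measurable (Q T)"
    by (rule R.borel_measurable_lebesgue_integral)
  moreover have "case_prod (primitive \<alpha>) z = (\<integral>r. (if r \<le> fst z then case_prod \<alpha> (r, snd z) else 0) \<partial>R T)"
    if "z \<in> space (Q T)" for z
    using that unfolding primitive_def
    by (auto simp: space_Q set_integral_time[of _ T] space_restrict_space intro!: Bochner_Integration.integral_cong split: split_indicator)
  ultimately show ?thesis by (subst measurable_cong) auto
qed

text \<open>Cauchy-Schwarz in time, with a bound that is uniform in \<open>s\<close>.\<close>

lemma primitive_square_bound:
  assumes \<alpha>: "case_prod \<alpha> \<in> L2_vars (Q T) (Q T)"
  shows "AE \<omega> in M. \<forall>s\<in>{0..T}. (primitive \<alpha> s \<omega>)\<^sup>2 \<le> T * (\<integral>r. (\<alpha> r \<omega>)\<^sup>2 \<partial>R T)"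
  using L2_Q_sections(1)[OF \<alpha>]
proof eventually_elim
  case (elim \<omega>)
  then have a: "(\<lambda>r. \<alpha> r \<omega>) \<in> L2_vars (R T) (R T)" by simp
  show ?case
  proof
    fix s assume s: "s \<in> {0..T}"
    have sets: "{0..s} \<in> sets (R T)" using s by (auto simp: sets_restrict_space image_iff intro!: bexI[of _ "{0..s}"])
    have ind: "(\<lambda>r. indicator {0..s} r :: real) \<in> L2_vars (R T) (R T)"
      using sets by (intro L2_vars_bounded[OF finite_measure_time subalgebra_refl, of _ _ 1]) (auto split: split_indicator)
    have "(primitive \<alpha> s \<omega>)\<^sup>2 \<le> (\<integral>r. (indicator {0..s} r)\<^sup>2 \<partial>R T) * (\<integral>r. (\<alpha> r \<omega>)\<^sup>2 \<partial>R T)"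
      unfolding primitive_def using s L2_Cauchy_Schwarz[OF ind a] by (simp add: set_integral_time[of s T])
    also have "(\<integral>r. (indicator {0..s} r :: real)\<^sup>2 \<partial>R T) = s"
    proof -
      have "(\<integral>r. (indicator {0..s} r :: real)\<^sup>2 \<partial>R T) = (\<integral>r. indicator {0..s} r * 1 \<partial>R T)"
        by (intro Bochner_Integration.integral_cong) (auto split: split_indicator)
      also have "\<dots> = (LINT r:{0..s}|lborel. 1)" using s by (subst set_integral_time[of s T]) auto
      finally show ?thesis using s by (simp add: set_lebesgue_integral_def)
    qed
    also have "s * (\<integral>r. (\<alpha> r \<omega>)\<^sup>2 \<partial>R T) \<le> T * (\<integral>r. (\<alpha> r \<omega>)\<^sup>2 \<partial>R T)"
      using s by (intro mult_right_mono) auto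
    finally show "(primitive \<alpha> s \<omega>)\<^sup>2 \<le> T * (\<integral>r. (\<alpha> r \<omega>)\<^sup>2 \<partial>R T)" .
  qed
qed

lemma primitive_L2:
  assumes \<alpha>: "case_prod \<alpha> \<in> L2_vars (Q T) (Q T)"
  shows "case_prod (primitive \<alpha>) \<in> L2_vars (Q T) (Q T)" "t \<in> {0..T} \<Longrightarrow> primitive \<alpha> t \<in> L2_vars M M"
proof -
  interpret P: pair_sigma_finite "R T" M by (rule pair_Q)
  have m [measurable]: "case_prod (primitive \<alpha>) \<in> borel_measurable (Q T)"
    using primitive_measurable \<alpha> by (simp add: L2_vars_def)
  let ?K = "\<lambda>\<omega>. T * (\<integral>r. (\<alpha> r \<omega>)\<^sup>2 \<partial>R T)"
  have K: "integrable M ?K" using L2_Q_sections(3)[OF \<alpha>] by simp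
  have K0: "0 \<le> ?K \<omega>" for \<omega> using T_pos by simp
  note bd = primitive_square_bound[OF \<alpha>]
  have fin: "(\<integral>\<^sup>+\<omega>. ennreal (?K \<omega>) \<partial>M) < \<infinity>"
    using K K0 by (subst nn_integral_eq_integral) auto
  have "(\<integral>\<^sup>+z. ennreal ((case_prod (primitive \<alpha>) z)\<^sup>2) \<partial>Q T) = (\<integral>\<^sup>+\<omega>. \<integral>\<^sup>+s. ennreal ((primitive \<alpha> s \<omega>)\<^sup>2) \<partial>R T \<partial>M)"
    using P.nn_integral_snd[of "\<lambda>z. ennreal ((case_prod (primitive \<alpha>) z)\<^sup>2)"] by simp
  also have "\<dots> \<le> (\<integral>\<^sup>+\<omega>. ennreal T * ennreal (?K \<omega>) \<partial>M)"
  proof (rule nn_integral_mono_AE)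
    show "AE \<omega> in M. (\<integral>\<^sup>+s. ennreal ((primitive \<alpha> s \<omega>)\<^sup>2) \<partial>R T) \<le> ennreal T * ennreal (?K \<omega>)"
      using bd
    proof eventually_elim
      case (elim \<omega>)
      have "(\<integral>\<^sup>+s. ennreal ((primitive \<alpha> s \<omega>)\<^sup>2) \<partial>R T) \<le> (\<integral>\<^sup>+s. ennreal (?K \<omega>) \<partial>R T)"
        using elim by (intro nn_integral_mono) (auto simp: space_restrict_space intro!: ennreal_leI)
      also have "\<dots> = ennreal T * ennreal (?K \<omega>)"
        using T_pos by (simp add: emeasure_restrict_space space_restrict_space mult.commute)
      finally show ?case .
    qed
  qed
  also have "\<dots> = ennreal T * (\<integral>\<^sup>+\<omega>. ennreal (?K \<omega>) \<partial>M)" 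
    by (intro nn_integral_cmult measurable_compose[OF borel_measurable_integrable[OF K] measurable_ennreal])
  also have "\<dots> < \<infinity>" using fin by (simp add: ennreal_mult_less_top)
  finally show "case_prod (primitive \<alpha>) \<in> L2_vars (Q T) (Q T)"
    by (auto simp: L2_vars_def intro!: integrableI_nonneg)
  assume t: "t \<in> {0..T}"
  have mt [measurable]: "primitive \<alpha> t \<in> borel_measurable M"
    using L2_Q_fixed_time[of "primitive \<alpha>" t] m t by (simp add: measurable_process_Q)
  have "integrable M (\<lambda>\<omega>. (primitive \<alpha> t \<omega>)\<^sup>2)"
    by (rule Bochner_Integration.integrable_bound[OF K]) (use bd t in \<open>auto elim!: eventually_mono\<close>)
  then show "primitive \<alpha> t \<in> L2_vars M M" by (simp add: L2_vars_def)
qed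

lemma expectation_primitive:
  assumes \<alpha>: "case_prod \<alpha> \<in> L2_vars (Q T) (Q T)" and t: "0 \<le> t" "t \<le> T" and \<xi>: "\<xi> \<in> L2_vars M M"
  shows "(\<integral>\<omega>. primitive \<alpha> t \<omega> * \<xi> \<omega> \<partial>M) = (\<integral>z. case_prod \<alpha> z * \<xi> (snd z) \<partial>Q t)"
proof -
  interpret P: pair_sigma_finite "R t" M by (rule pair_Q)
  have i: "integrable (Q t) (\<lambda>(s, \<omega>). \<alpha> s \<omega> * \<xi> \<omega>)"
    using L2_vars_mult_integrable[OF L2_Q_restrict[OF \<alpha> t(2)] L2_Q_constant_in_time[OF \<xi>]] by (simp add: split_beta')
  show ?thesis
    using P.integral_snd[OF i] by (simp add: primitive_def set_integral_time_full split_beta')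
qed

lemma expectation_primitives:
  assumes \<alpha>: "case_prod \<alpha> \<in> L2_vars (Q T) (Q T)" and \<alpha>': "case_prod \<alpha>' \<in> L2_vars (Q T) (Q T)"
    and t: "0 \<le> t" "t \<le> T"
  shows "(\<integral>\<omega>. primitive \<alpha> t \<omega> * primitive \<alpha>' t \<omega> \<partial>M) =
    (\<integral>z. case_prod \<alpha> z * case_prod (primitive \<alpha>') z + case_prod \<alpha>' z * case_prod (primitive \<alpha>) z \<partial>Q t)"
proof -
  interpret P: pair_sigma_finite "R t" M by (rule pair_Q)
  interpret R: finite_measure "R t" by (rule finite_measure_time)
  have i: "integrable (Q t) (\<lambda>(s, \<omega>). \<alpha> s \<omega> * primitive \<alpha>' s \<omega> + \<alpha>' s \<omega> * primitive \<alpha> s \<omega>)"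
    using L2_vars_mult_integrable[OF L2_Q_restrict[OF \<alpha> t(2)] L2_Q_restrict[OF primitive_L2(1)[OF \<alpha>'] t(2)]]
      L2_vars_mult_integrable[OF L2_Q_restrict[OF \<alpha>' t(2)] L2_Q_restrict[OF primitive_L2(1)[OF \<alpha>] t(2)]]
    by (simp add: split_beta')
  have "(\<integral>z. case_prod \<alpha> z * case_prod (primitive \<alpha>') z + case_prod \<alpha>' z * case_prod (primitive \<alpha>) z \<partial>Q t)
    = (\<integral>\<omega>. \<integral>s. \<alpha> s \<omega> * primitive \<alpha>' s \<omega> + \<alpha>' s \<omega> * primitive \<alpha> s \<omega> \<partial>R t \<partial>M)"
    using P.integral_snd[OF i] by (simp add: split_beta')
  also have "\<dots> = (\<integral>\<omega>. primitive \<alpha> t \<omega> * primitive \<alpha>' t \<omega> \<partial>M)"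
  proof (rule integral_cong_AE)
    show "(\<lambda>\<omega>. \<integral>s. \<alpha> s \<omega> * primitive \<alpha>' s \<omega> + \<alpha>' s \<omega> * primitive \<alpha> s \<omega> \<partial>R t) \<in> borel_measurable M"
      using P.integrable_snd[OF i] by simp
    show "(\<lambda>\<omega>. primitive \<alpha> t \<omega> * primitive \<alpha>' t \<omega>) \<in> borel_measurable M"
      using primitive_L2(2)[OF \<alpha>, of t] primitive_L2(2)[OF \<alpha>', of t] t by (auto simp: L2_vars_def)
    show "AE \<omega> in M. (\<integral>s. \<alpha> s \<omega> * primitive \<alpha>' s \<omega> + \<alpha>' s \<omega> * primitive \<alpha> s \<omega> \<partial>R t) = primitive \<alpha> t \<omega> * primitive \<alpha>' t \<omega>"
      using L2_Q_sections(1)[OF L2_Q_restrict[OF \<alpha> t(2)]] L2_Q_sections(1)[OF L2_Q_restrict[OF \<alpha>' t(2)]]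
    proof eventually_elim
      case (elim \<omega>)
      then have "integrable (R t) (\<lambda>s. \<alpha> s \<omega>)" "integrable (R t) (\<lambda>s. \<alpha>' s \<omega>)"
        using L2_vars_integrable[OF R.finite_measure_axioms] by auto
      from product_of_primitives(1)[OF this] show ?case
        by (simp add: primitive_def set_integral_time_full)
    qed
  qed
  finally show ?thesis by simp
qed

text \<open>Adaptedness of the drift is part of the notion: it is what makes the drift at time \<open>s\<close>
  orthogonal to the increments of a martingale after \<open>s\<close>.\<close>

definition ito_process ::
  "(real \<Rightarrow> 'a \<Rightarrow> real) \<Rightarrow> (real \<Rightarrow> 'a \<Rightarrow> real) \<Rightarrow> (real \<Rightarrow> 'a \<Rightarrow> real) \<Rightarrow> (real \<Rightarrow> 'a \<Rightarrow> real) \<Rightarrow> bool" where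
  "ito_process Y \<alpha> \<beta> \<gamma> \<longleftrightarrow> has_stoch_differential M F T W W\<^sub>c Y \<alpha> \<beta> \<gamma> \<and>
     case_prod Y \<in> L2_vars (Q T) (Q T) \<and> (\<forall>t\<in>{0..T}. Y t \<in> L2_vars M (F t)) \<and>
     case_prod \<alpha> \<in> L2_vars (Q T) (Q T) \<and> (\<forall>t\<in>{0..T}. \<alpha> t \<in> borel_measurable (F t))"

text \<open>The martingale part is written as a difference so that it is jointly measurable.\<close>

definition mart_part where
  "mart_part Y \<alpha> s \<omega> = (Y s \<omega> - Y 0 \<omega> - primitive \<alpha> s \<omega> :: real)"

lemma ito_processD:
  assumes "ito_process Y \<alpha> \<beta> \<gamma>"
  shows "case_prod Y \<in> L2_vars (Q T) (Q T)" "t \<in> {0..T} \<Longrightarrow> Y t \<in> L2_vars M (F t)"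
    "t \<in> {0..T} \<Longrightarrow> Y t \<in> L2_vars M M"
    "case_prod \<alpha> \<in> L2_vars (Q T) (Q T)" "t \<in> {0..T} \<Longrightarrow> \<alpha> t \<in> borel_measurable (F t)"
    "case_prod (mart_part Y \<alpha>) \<in> L2_vars (Q T) (Q T)" "t \<in> {0..T} \<Longrightarrow> mart_part Y \<alpha> t \<in> L2_vars M M"
proof -
  show 1: "case_prod Y \<in> L2_vars (Q T) (Q T)" and "t \<in> {0..T} \<Longrightarrow> Y t \<in> L2_vars M (F t)"
    and 2: "case_prod \<alpha> \<in> L2_vars (Q T) (Q T)" and "t \<in> {0..T} \<Longrightarrow> \<alpha> t \<in> borel_measurable (F t)"
    using assms by (auto simp: ito_process_def)
  show 3: "Y t \<in> L2_vars M M" if "t \<in> {0..T}" for t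
    using that assms L2_vars_subalgebra[OF subalgebra_F[of t]] by (auto simp: ito_process_def)
  have "(\<lambda>z. case_prod Y z - Y 0 (snd z) - case_prod (primitive \<alpha>) z) \<in> L2_vars (Q T) (Q T)"
    using T_pos by (intro L2_diff 1 L2_Q_constant_in_time primitive_L2 2 3) auto
  moreover have "(\<lambda>z. case_prod Y z - Y 0 (snd z) - case_prod (primitive \<alpha>) z) = case_prod (mart_part Y \<alpha>)"
    by (auto simp: mart_part_def fun_eq_iff)
  ultimately show "case_prod (mart_part Y \<alpha>) \<in> L2_vars (Q T) (Q T)" by simp
  show "mart_part Y \<alpha> t \<in> L2_vars M M" if "t \<in> {0..T}"
    unfolding mart_part_def[abs_def] using T_pos that by (intro L2_diff 3 primitive_L2 2) auto
qed

lemma mart_part_ito: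
  assumes "ito_process Y \<alpha> \<beta> \<gamma>" "t \<in> {0..T}"
  obtains I J where "has_ito_integral M F W t \<beta> I" "has_ito_integral M F W\<^sub>c t \<gamma> J"
    "AE \<omega> in M. mart_part Y \<alpha> t \<omega> = I \<omega> + J \<omega>"
proof -
  from assms obtain I J where I: "has_ito_integral M F W t \<beta> I" "has_ito_integral M F W\<^sub>c t \<gamma> J"
    and "AE \<omega> in M. Y t \<omega> = Y 0 \<omega> + (LINT s:{0..t}|lborel. \<alpha> s \<omega>) + I \<omega> + J \<omega>"
    unfolding ito_process_def has_stoch_differential_def by blast
  then have "AE \<omega> in M. mart_part Y \<alpha> t \<omega> = I \<omega> + J \<omega>"
    by (auto simp: mart_part_def primitive_def elim!: eventually_mono)
  with I that show ?thesis by blast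
qed

lemma integral_AE_sum_mult:
  assumes "AE \<omega> in M. N \<omega> = I \<omega> + J \<omega>" "I \<in> L2_vars M M" "J \<in> L2_vars M M" "\<zeta> \<in> L2_vars M M" "N \<in> L2_vars M M"
  shows "(\<integral>\<omega>. N \<omega> * \<zeta> \<omega> \<partial>M) = (\<integral>\<omega>. I \<omega> * \<zeta> \<omega> \<partial>M) + (\<integral>\<omega>. J \<omega> * \<zeta> \<omega> \<partial>M)"
proof -
  have "(\<integral>\<omega>. N \<omega> * \<zeta> \<omega> \<partial>M) = (\<integral>\<omega>. I \<omega> * \<zeta> \<omega> + J \<omega> * \<zeta> \<omega> \<partial>M)"
    using assms by (intro integral_cong_AE) (auto simp: L2_vars_def algebra_simps elim!: eventually_mono)
  then show ?thesis using assms by (simp add: L2_vars_mult_integrable)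
qed

lemma mart_part_martingale:
  assumes Y: "ito_process Y \<alpha> \<beta> \<gamma>" and st: "0 \<le> s" "s \<le> t" "t \<le> T" and \<zeta>: "\<zeta> \<in> L2_vars M (F s)"
  shows "(\<integral>\<omega>. mart_part Y \<alpha> t \<omega> * \<zeta> \<omega> \<partial>M) = (\<integral>\<omega>. mart_part Y \<alpha> s \<omega> * \<zeta> \<omega> \<partial>M)"
proof -
  have T: "s \<in> {0..T}" "t \<in> {0..T}" "s \<le> T" using st by auto
  obtain I J where t: "has_ito_integral M F W t \<beta> I" "has_ito_integral M F W\<^sub>c t \<gamma> J"
    "AE \<omega> in M. mart_part Y \<alpha> t \<omega> = I \<omega> + J \<omega>" by (rule mart_part_ito[OF Y T(2)])
  obtain I' J' where s: "has_ito_integral M F W s \<beta> I'" "has_ito_integral M F W\<^sub>c s \<gamma> J'"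
    "AE \<omega> in M. mart_part Y \<alpha> s \<omega> = I' \<omega> + J' \<omega>" by (rule mart_part_ito[OF Y T(1)])
  note b = noise_brackets
  have \<zeta>M: "\<zeta> \<in> L2_vars M M" using L2_vars_subalgebra[OF subalgebra_F[OF T(3)] \<zeta>] .
  show ?thesis
    using integral_AE_sum_mult[OF t(3) ito_L2(2)[OF t(1) b(1) st(3)] ito_L2(2)[OF t(2) b(2) st(3)] \<zeta>M ito_processD(7)[OF Y T(2)]]
      integral_AE_sum_mult[OF s(3) ito_L2(2)[OF s(1) b(1) T(3)] ito_L2(2)[OF s(2) b(2) T(3)] \<zeta>M ito_processD(7)[OF Y T(1)]]
      ito_martingale[OF b(1) st t(1) s(1) \<zeta>] ito_martingale[OF b(2) st t(2) s(2) \<zeta>] by simp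
qed

lemma mart_part_initial:
  assumes Y: "ito_process Y \<alpha> \<beta> \<gamma>" and t: "0 \<le> t" "t \<le> T" and \<zeta>: "\<zeta> \<in> L2_vars M (F 0)"
  shows "(\<integral>\<omega>. mart_part Y \<alpha> t \<omega> * \<zeta> \<omega> \<partial>M) = 0"
proof -
  have "mart_part Y \<alpha> 0 \<omega> = 0" for \<omega>
  proof -
    have "AE s in lborel. indicator {0..0} s *\<^sub>R \<alpha> s \<omega> = (0::real)"
      using AE_lborel_singleton[of 0] by eventually_elim auto
    then have "(LINT s:{0..0}|lborel. \<alpha> s \<omega>) = 0"
      unfolding set_lebesgue_integral_def by (rule integral_eq_zero_AE)
    then show ?thesis by (simp add: mart_part_def primitive_def)
  qed
  then show ?thesis using mart_part_martingale[OF Y order_refl t \<zeta>] by simp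
qed

lemma mart_part_isometry:
  assumes Y: "ito_process Y \<alpha> \<beta> \<gamma>" and Z: "ito_process Z \<alpha>' \<beta>' \<gamma>'" and t: "t \<in> {0..T}"
  shows "(\<integral>\<omega>. mart_part Y \<alpha> t \<omega> * mart_part Z \<alpha>' t \<omega> \<partial>M) = (\<integral>z. case_prod \<beta> z * case_prod \<beta>' z + case_prod \<gamma> z * case_prod \<gamma>' z \<partial>Q t)"
    "case_prod \<beta> \<in> L2_vars (Q t) (Q t)" "case_prod \<gamma> \<in> L2_vars (Q t) (Q t)"
proof -
  have tT: "t \<le> T" using t by simp
  obtain I J where I: "has_ito_integral M F W t \<beta> I" "has_ito_integral M F W\<^sub>c t \<gamma> J"
    "AE \<omega> in M. mart_part Y \<alpha> t \<omega> = I \<omega> + J \<omega>" by (rule mart_part_ito[OF Y t])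
  obtain I' J' where I': "has_ito_integral M F W t \<beta>' I'" "has_ito_integral M F W\<^sub>c t \<gamma>' J'"
    "AE \<omega> in M. mart_part Z \<alpha>' t \<omega> = I' \<omega> + J' \<omega>" by (rule mart_part_ito[OF Z t])
  note b = noise_brackets noise_bracket_sym[OF noise_brackets(3)]
  note L = ito_L2[OF I(1) b(1) tT] ito_L2[OF I(2) b(2) tT] and L' = ito_L2[OF I'(1) b(1) tT] ito_L2[OF I'(2) b(2) tT]
  note N = ito_processD(7)[OF Y t] and N' = ito_processD(7)[OF Z t]
  show "case_prod \<beta> \<in> L2_vars (Q t) (Q t)" "case_prod \<gamma> \<in> L2_vars (Q t) (Q t)" using L by auto
  have "(\<integral>\<omega>. mart_part Y \<alpha> t \<omega> * mart_part Z \<alpha>' t \<omega> \<partial>M) = (\<integral>\<omega>. I \<omega> * I' \<omega> \<partial>M) + (\<integral>\<omega>. J \<omega> * I' \<omega> \<partial>M) + ((\<integral>\<omega>. I \<omega> * J' \<omega> \<partial>M) + (\<integral>\<omega>. J \<omega> * J' \<omega> \<partial>M))"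
    using integral_AE_sum_mult[OF I(3) L(2,4) N' N]
      integral_AE_sum_mult[OF I'(3) L'(2,4) L(2) N'] integral_AE_sum_mult[OF I'(3) L'(2,4) L(4) N']
    by (simp add: mult.commute)
  also have "\<dots> = (\<integral>z. case_prod \<beta> z * case_prod \<beta>' z \<partial>Q t) + (\<integral>z. case_prod \<gamma> z * case_prod \<gamma>' z \<partial>Q t)"
    using ito_isometry[OF b(1) b(1) b(1) tT I(1) I'(1)] ito_isometry[OF b(2) b(2) b(2) tT I(2) I'(2)]
      ito_isometry[OF b(1) b(2) b(3) tT I(1) I'(2)] ito_isometry[OF b(2) b(1) b(4) tT I(2) I'(1)] by simp
  finally show "(\<integral>\<omega>. mart_part Y \<alpha> t \<omega> * mart_part Z \<alpha>' t \<omega> \<partial>M) = (\<integral>z. case_prod \<beta> z * case_prod \<beta>' z + case_prod \<gamma> z * case_prod \<gamma>' z \<partial>Q t)"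
    using L L' by (simp add: L2_vars_mult_integrable)
qed

text \<open>By Fubini's theorem the drift is paired with the martingale at the final time \<open>t\<close>; since it is
  known at time \<open>s\<close>, the martingale may be taken at time \<open>s\<close> instead.\<close>

lemma drift_martingale:
  assumes Y: "ito_process Y \<alpha> \<beta> \<gamma>" and Z: "ito_process Z \<alpha>' \<beta>' \<gamma>'" and t: "0 \<le> t" "t \<le> T"
  shows "(\<integral>\<omega>. primitive \<alpha> t \<omega> * mart_part Z \<alpha>' t \<omega> \<partial>M) = (\<integral>z. case_prod \<alpha> z * case_prod (mart_part Z \<alpha>') z \<partial>Q t)"
proof -
  interpret P: pair_sigma_finite "R t" M by (rule pair_Q)
  note a = ito_processD(4)[OF Y]
  have N: "mart_part Z \<alpha>' t \<in> L2_vars M M" using ito_processD(7)[OF Z] t by simp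
  have i1: "integrable (Q t) (\<lambda>(s, \<omega>). \<alpha> s \<omega> * mart_part Z \<alpha>' t \<omega>)"
    using L2_vars_mult_integrable[OF L2_Q_restrict[OF a t(2)] L2_Q_constant_in_time[OF N]] by (simp add: split_beta')
  have i2: "integrable (Q t) (\<lambda>(s, \<omega>). \<alpha> s \<omega> * mart_part Z \<alpha>' s \<omega>)"
    using L2_vars_mult_integrable[OF L2_Q_restrict[OF a t(2)] L2_Q_restrict[OF ito_processD(6)[OF Z] t(2)]] by (simp add: split_beta')
  have "(\<integral>\<omega>. primitive \<alpha> t \<omega> * mart_part Z \<alpha>' t \<omega> \<partial>M) = (\<integral>s. \<integral>\<omega>. \<alpha> s \<omega> * mart_part Z \<alpha>' t \<omega> \<partial>M \<partial>R t)"
    using expectation_primitive[OF a t N] P.integral_fst'[OF i1] by (simp add: split_beta')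
  also have "\<dots> = (\<integral>s. \<integral>\<omega>. \<alpha> s \<omega> * mart_part Z \<alpha>' s \<omega> \<partial>M \<partial>R t)"
  proof (rule integral_cong_AE)
    show "(\<lambda>s. \<integral>\<omega>. \<alpha> s \<omega> * mart_part Z \<alpha>' t \<omega> \<partial>M) \<in> borel_measurable (R t)"
      "(\<lambda>s. \<integral>\<omega>. \<alpha> s \<omega> * mart_part Z \<alpha>' s \<omega> \<partial>M) \<in> borel_measurable (R t)"
      using P.integrable_fst'[OF i1] P.integrable_fst'[OF i2] by auto
    show "AE s in R t. (\<integral>\<omega>. \<alpha> s \<omega> * mart_part Z \<alpha>' t \<omega> \<partial>M) = (\<integral>\<omega>. \<alpha> s \<omega> * mart_part Z \<alpha>' s \<omega> \<partial>M)"
      using L2_Q_sections(2)[OF L2_Q_restrict[OF a t(2)]] AE_space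
    proof eventually_elim
      case (elim s)
      then have s: "0 \<le> s" "s \<le> t" by (auto simp: space_restrict_space)
      have "\<alpha> s \<in> L2_vars M (F s)" using elim ito_processD(5)[OF Y, of s] s t by (auto simp: L2_vars_def)
      from mart_part_martingale[OF Z s t(2) this] show ?case by (simp add: mult.commute)
    qed
  qed
  also have "\<dots> = (\<integral>z. case_prod \<alpha> z * case_prod (mart_part Z \<alpha>') z \<partial>Q t)"
    using P.integral_fst'[OF i2] by (simp add: split_beta')
  finally show ?thesis .
qed

text \<open>Expand the product of \<open>Y\<^sub>t = Y\<^sub>0 + A\<^sub>t + N\<^sub>t\<close> and \<open>Z\<^sub>t = Z\<^sub>0 + B\<^sub>t + N'\<^sub>t\<close>.  Fubini and the
  martingale property turn every product with a drift into a time integral, where the pieces of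
  \<open>Y\<close> and \<open>Z\<close> are put together again.\<close>

theorem product_rule:
  assumes Y: "ito_process Y \<alpha> \<beta> \<gamma>" and Z: "ito_process Z \<alpha>' \<beta>' \<gamma>'" and t: "0 \<le> t" "t \<le> T"
  shows "(\<integral>\<omega>. Y t \<omega> * Z t \<omega> \<partial>M) = (\<integral>\<omega>. Y 0 \<omega> * Z 0 \<omega> \<partial>M) +
    (\<integral>z. case_prod \<alpha> z * case_prod Z z + case_prod Y z * case_prod \<alpha>' z + case_prod \<beta> z * case_prod \<beta>' z + case_prod \<gamma> z * case_prod \<gamma>' z \<partial>Q t)"
proof -
  have t': "t \<in> {0..T}" "0 \<in> {0..T}" using t by auto
  let ?N = "mart_part Y \<alpha>" and ?N' = "mart_part Z \<alpha>'" and ?A = "primitive \<alpha>" and ?B = "primitive \<alpha>'"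
  note a = ito_processD(4)[OF Y] and a' = ito_processD(4)[OF Z]
  note L = ito_processD(3)[OF Y t'(2)] ito_processD(3)[OF Z t'(2)] primitive_L2(2)[OF a t'(1)] primitive_L2(2)[OF a' t'(1)]
    ito_processD(7)[OF Y t'(1)] ito_processD(7)[OF Z t'(1)]
  have "(\<integral>\<omega>. Y t \<omega> * Z t \<omega> \<partial>M) = (\<integral>\<omega>. Y 0 \<omega> * Z 0 \<omega> + (?B t \<omega> * Y 0 \<omega> + ?N' t \<omega> * Y 0 \<omega>) + (?A t \<omega> * Z 0 \<omega> + ?A t \<omega> * ?B t \<omega> + ?A t \<omega> * ?N' t \<omega>)
     + (?N t \<omega> * Z 0 \<omega> + ?B t \<omega> * ?N t \<omega> + ?N t \<omega> * ?N' t \<omega>) \<partial>M)"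
    by (intro Bochner_Integration.integral_cong) (auto simp: mart_part_def algebra_simps)
  also have "\<dots> = (\<integral>\<omega>. Y 0 \<omega> * Z 0 \<omega> \<partial>M) + ((\<integral>\<omega>. ?B t \<omega> * Y 0 \<omega> \<partial>M) + (\<integral>\<omega>. ?N' t \<omega> * Y 0 \<omega> \<partial>M)) + ((\<integral>\<omega>. ?A t \<omega> * Z 0 \<omega> \<partial>M) + (\<integral>\<omega>. ?A t \<omega> * ?B t \<omega> \<partial>M) + (\<integral>\<omega>. ?A t \<omega> * ?N' t \<omega> \<partial>M))
     + ((\<integral>\<omega>. ?N t \<omega> * Z 0 \<omega> \<partial>M) + (\<integral>\<omega>. ?B t \<omega> * ?N t \<omega> \<partial>M) + (\<integral>\<omega>. ?N t \<omega> * ?N' t \<omega> \<partial>M))"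
    using L by (simp add: L2_vars_mult_integrable)
  also have "\<dots> = (\<integral>\<omega>. Y 0 \<omega> * Z 0 \<omega> \<partial>M) + (\<integral>z. case_prod \<alpha>' z * Y 0 (snd z) \<partial>Q t) + ((\<integral>z. case_prod \<alpha> z * Z 0 (snd z) \<partial>Q t)
     + (\<integral>z. case_prod \<alpha> z * case_prod ?B z + case_prod \<alpha>' z * case_prod ?A z \<partial>Q t) + (\<integral>z. case_prod \<alpha> z * case_prod ?N' z \<partial>Q t))
     + ((\<integral>z. case_prod \<alpha>' z * case_prod ?N z \<partial>Q t) + (\<integral>z. case_prod \<beta> z * case_prod \<beta>' z + case_prod \<gamma> z * case_prod \<gamma>' z \<partial>Q t))"
    using mart_part_initial[OF Y t ito_processD(2)[OF Z t'(2)]] mart_part_initial[OF Z t ito_processD(2)[OF Y t'(2)]]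
      expectation_primitive[OF a t L(2)] expectation_primitive[OF a' t L(1)] expectation_primitives[OF a a' t]
      drift_martingale[OF Y Z t] drift_martingale[OF Z Y t] mart_part_isometry(1)[OF Y Z t'(1)] by simp
  also have "\<dots> = (\<integral>\<omega>. Y 0 \<omega> * Z 0 \<omega> \<partial>M) + (\<integral>z. case_prod \<alpha>' z * Y 0 (snd z) + (case_prod \<alpha> z * Z 0 (snd z)
     + (case_prod \<alpha> z * case_prod ?B z + case_prod \<alpha>' z * case_prod ?A z) + case_prod \<alpha> z * case_prod ?N' z)
     + (case_prod \<alpha>' z * case_prod ?N z + (case_prod \<beta> z * case_prod \<beta>' z + case_prod \<gamma> z * case_prod \<gamma>' z)) \<partial>Q t)"
    using L2_Q_restrict[OF a t(2)] L2_Q_restrict[OF a' t(2)] L2_Q_constant_in_time[OF L(1)] L2_Q_constant_in_time[OF L(2)]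
      L2_Q_restrict[OF primitive_L2(1)[OF a] t(2)] L2_Q_restrict[OF primitive_L2(1)[OF a'] t(2)]
      L2_Q_restrict[OF ito_processD(6)[OF Y] t(2)] L2_Q_restrict[OF ito_processD(6)[OF Z] t(2)]
      mart_part_isometry(2,3)[OF Y Y t'(1)] mart_part_isometry(2,3)[OF Z Z t'(1)]
    by (simp add: L2_vars_mult_integrable)
  also have "(\<integral>z. case_prod \<alpha>' z * Y 0 (snd z) + (case_prod \<alpha> z * Z 0 (snd z)
     + (case_prod \<alpha> z * case_prod ?B z + case_prod \<alpha>' z * case_prod ?A z) + case_prod \<alpha> z * case_prod ?N' z)
     + (case_prod \<alpha>' z * case_prod ?N z + (case_prod \<beta> z * case_prod \<beta>' z + case_prod \<gamma> z * case_prod \<gamma>' z)) \<partial>Q t) =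
    (\<integral>z. case_prod \<alpha> z * case_prod Z z + case_prod Y z * case_prod \<alpha>' z + case_prod \<beta> z * case_prod \<beta>' z + case_prod \<gamma> z * case_prod \<gamma>' z \<partial>Q t)"
    by (intro Bochner_Integration.integral_cong) (auto simp: mart_part_def algebra_simps)
  finally show ?thesis .
qed

end

section \<open>Regular conditional laws\<close>

lemma (in prob_space) finite_measure_subalgebraI:
  "subalgebra M G \<Longrightarrow> finite_measure_subalgebra M G"
  by (simp add: finite_measure_subalgebra_def finite_measure_subalgebra_axioms_def finite_measure_axioms)

lemma mono_subseq_tendsto_0:
  fixes u :: "nat \<Rightarrow> real"
  assumes "\<And>n m. n \<le> m \<Longrightarrow> u m \<le> u n" "\<And>n. 0 \<le> u n" "(\<lambda>n. u (r n)) \<longlonglongrightarrow> 0"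
  shows "u \<longlonglongrightarrow> 0"
proof (rule LIMSEQ_I)
  fix e :: real assume "0 < e"
  then obtain n where "norm (u (r n) - 0) < e" using LIMSEQ_D[OF assms(3)] by blast
  then have "norm (u m - 0) < e" if "m \<ge> r n" for m using assms(1)[OF that] assms(2)[of m] assms(2)[of "r n"] by simp
  then show "\<exists>no. \<forall>n\<ge>no. norm (u n - 0) < e" by blast
qed

lemma (in prob_space) AE_tendsto_0_of_decreasing:
  fixes u :: "nat \<Rightarrow> 'a \<Rightarrow> real"
  assumes int: "\<And>n. integrable M (u n)" and pos: "\<And>n. AE x in M. 0 \<le> u n x"
    and mono: "\<And>n m. n \<le> m \<Longrightarrow> AE x in M. u m x \<le> u n x" and lim: "(\<lambda>n. \<integral>x. u n x \<partial>M) \<longlonglongrightarrow> 0"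
  shows "AE x in M. (\<lambda>n. u n x) \<longlonglongrightarrow> 0"
proof -
  have "(\<integral>x. norm (u n x) \<partial>M) = (\<integral>x. u n x \<partial>M)" for n
    using pos[of n] int[of n] by (intro integral_cong_AE) (auto elim: eventually_mono)
  with lim have "(\<lambda>n. \<integral>x. norm (u n x) \<partial>M) \<longlonglongrightarrow> 0" by simp
  then obtain r where r: "AE x in M. (\<lambda>n. u (r n) x) \<longlonglongrightarrow> 0"
    using tendsto_L1_AE_subseq[of M u, OF int] by blast
  have p: "AE x in M. \<forall>n. 0 \<le> u n x" using pos by (simp add: AE_all_countable)
  have m: "AE x in M. \<forall>n m. n \<le> m \<longrightarrow> u m x \<le> u n x" using mono by (simp add: AE_all_countable)
  show ?thesis using r p m by eventually_elim (rule mono_subseq_tendsto_0[where r=r], auto)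
qed

lemma rational_sequence_above:
  fixes x :: real
  obtains q where "\<And>n. q n \<in> \<rat>" "\<And>n. x < q n" "q \<longlonglongrightarrow> x"
proof -
  have "\<exists>q\<in>\<rat>. x < q \<and> q < x + 1 / Suc n" for n :: nat by (rule Rats_dense_in_real) simp
  then obtain q where q: "\<And>n. q n \<in> \<rat>" "\<And>n. x < q n" "\<And>n. q n < x + 1 / Suc n" by metis
  have "q \<longlonglongrightarrow> x"
  proof (rule real_tendsto_sandwich[of "\<lambda>_. x" q _ "\<lambda>n. x + 1 / Suc n"])
    show "(\<lambda>n. x + 1 / Suc n) \<longlonglongrightarrow> x" using tendsto_add[OF tendsto_const LIMSEQ_inverse_real_of_nat, of x] by (simp add: inverse_eq_divide)
    show "(\<lambda>n. x) \<longlonglongrightarrow> x" by simp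
  qed (use q in \<open>auto intro!: always_eventually less_imp_le\<close>)
  with q that show ?thesis by blast
qed

lemma (in prob_space) is_cond_lawI:
  assumes G: "subalgebra M G" and Y [measurable]: "Y \<in> borel_measurable M"
    and kG: "\<kappa> \<in> G \<rightarrow>\<^sub>M prob_algebra borel"
    and kA: "\<And>A B. A \<in> sets G \<Longrightarrow> B \<in> sets borel \<Longrightarrow>
      (\<integral>\<^sup>+\<omega>\<in>A. emeasure (\<kappa> \<omega>) B \<partial>M) = emeasure M (A \<inter> (Y -` B \<inter> space M))"
  shows "is_cond_law M G Y \<kappa>"
proof -
  interpret finite_measure_subalgebra M G by (rule finite_measure_subalgebraI[OF G])
  have spG: "space G = space M" using G by (simp add: subalgebra_def)
  have pk: "prob_space (\<kappa> \<omega>)" if "\<omega> \<in> space M" for \<omega>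
    using measurable_space[OF kG, of \<omega>] that spG by (auto simp: space_prob_algebra)
  have ind: "integrable M (\<lambda>\<omega>. indicator B (Y \<omega>) :: real)" if "B \<in> sets borel" for B
  proof -
    have [measurable]: "B \<in> sets borel" by fact
    show ?thesis by (rule integrable_const_bound[of _ 1]) (auto split: split_indicator)
  qed
  show ?thesis
    unfolding is_cond_law_def
  proof (intro conjI kG ballI)
    fix B :: "real set" assume B: "B \<in> sets borel"
    have mG: "(\<lambda>\<omega>. measure (\<kappa> \<omega>) B) \<in> borel_measurable G"
      using measurable_emeasure_kernel[OF measurable_prob_algebraD[OF kG] B] unfolding measure_def by measurable
    have mM: "(\<lambda>\<omega>. measure (\<kappa> \<omega>) B) \<in> borel_measurable M" using measurable_from_subalg[OF G mG] .
    have im: "integrable M (\<lambda>\<omega>. measure (\<kappa> \<omega>) B)"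
      using mM pk by (intro integrable_const_bound[of _ 1]) (auto intro!: prob_space.prob_le_1)
    have "AE \<omega> in M. real_cond_exp M G (\<lambda>\<omega>. indicator B (Y \<omega>)) \<omega> = measure (\<kappa> \<omega>) B"
    proof (rule real_cond_exp_charact[OF _ ind[OF B] im mG])
      fix A assume A: "A \<in> sets G"
      then have AM [measurable]: "A \<in> sets M" using G by (auto simp: subalgebra_def)
      have [measurable]: "B \<in> sets borel" by fact
      have "ennreal (\<integral>\<omega>. indicator A \<omega> * measure (\<kappa> \<omega>) B \<partial>M) = (\<integral>\<^sup>+\<omega>. ennreal (indicator A \<omega> * measure (\<kappa> \<omega>) B) \<partial>M)"
        using integrable_mult_indicator[OF AM im] by (intro nn_integral_eq_integral[symmetric]) auto
      also have "\<dots> = (\<integral>\<^sup>+\<omega>\<in>A. emeasure (\<kappa> \<omega>) B \<partial>M)"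
        by (intro nn_integral_cong) (auto simp: finite_measure.emeasure_eq_measure[OF prob_space.axioms(1)[OF pk]] split: split_indicator)
      also have "\<dots> = emeasure M (A \<inter> (Y -` B \<inter> space M))" by (rule kA[OF A B])
      also have "\<dots> = ennreal (\<integral>\<omega>. indicator (A \<inter> (Y -` B \<inter> space M)) \<omega> \<partial>M)"
        by (simp add: emeasure_eq_measure Int_absorb1 sets.sets_into_space)
      finally have "(\<integral>\<omega>. indicator A \<omega> * measure (\<kappa> \<omega>) B \<partial>M) = (\<integral>\<omega>. indicator (A \<inter> (Y -` B \<inter> space M)) \<omega> \<partial>M)"
        by (subst (asm) ennreal_inj) auto
      also have "\<dots> = (\<integral>\<omega>. indicator A \<omega> * indicator B (Y \<omega>) \<partial>M)"
        by (intro Bochner_Integration.integral_cong) (auto split: split_indicator)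
      finally show "(LINT \<omega>:A|M. indicator B (Y \<omega>)) = (LINT \<omega>:A|M. measure (\<kappa> \<omega>) B)"
        by (simp add: set_lebesgue_integral_def)
    qed
    then show "AE \<omega> in M. measure (\<kappa> \<omega>) B = real_cond_exp M G (\<lambda>\<omega>. indicator B (Y \<omega>)) \<omega>"
      by eventually_elim simp
  qed
qed

text \<open>The conditional distribution function is first known at rational points only, each up to a
  null set; its right-continuous extension is a distribution function outside one null set.\<close>

theorem (in prob_space) cond_law_exists:
  assumes G: "subalgebra M G" and Y [measurable]: "Y \<in> borel_measurable M"
  obtains \<kappa> where "is_cond_law M G Y \<kappa>"
proof -
  interpret finite_measure_subalgebra M G by (rule finite_measure_subalgebraI[OF G])
  have spG: "space G = space M" using G by (simp add: subalgebra_def)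
  define D where "D q \<omega> = real_cond_exp M G (\<lambda>\<omega>. indicator {..q} (Y \<omega>)) \<omega>" for q \<omega>
  have DG [measurable]: "D q \<in> borel_measurable G" for q unfolding D_def by simp
  have DM [measurable]: "D q \<in> borel_measurable M" for q using measurable_from_subalg[OF G DG] .
  have ind: "integrable M (\<lambda>\<omega>. indicator B (Y \<omega>) :: real)" if "B \<in> sets borel" for B
  proof -
    have [measurable]: "B \<in> sets borel" by fact
    show ?thesis by (rule integrable_const_bound[of _ 1]) (auto split: split_indicator)
  qed
  have Dint: "integrable M (D q)" "(\<integral>\<omega>. D q \<omega> \<partial>M) = cdf (distr M borel Y) q" for q
  proof -
    show "integrable M (D q)" unfolding D_def by (rule real_cond_exp_int(1)[OF ind]) simp
    have "(\<integral>\<omega>. D q \<omega> \<partial>M) = (\<integral>\<omega>. indicator {..q} (Y \<omega>) \<partial>M)"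
      unfolding D_def by (rule real_cond_exp_int(2)[OF ind]) simp
    also have "\<dots> = (\<integral>\<omega>. indicator (Y -` {..q} \<inter> space M) \<omega> \<partial>M)"
      by (intro Bochner_Integration.integral_cong) (auto split: split_indicator)
    finally show "(\<integral>\<omega>. D q \<omega> \<partial>M) = cdf (distr M borel Y) q" by (simp add: cdf_def measure_distr)
  qed
  have DA: "(\<integral>\<omega>\<in>A. D q \<omega> \<partial>M) = (\<integral>\<omega>\<in>A. indicator {..q} (Y \<omega>) \<partial>M)" if "A \<in> sets G" for A q
    unfolding D_def by (rule real_cond_exp_intA[OF ind that, symmetric]) simp
  have Dmono: "AE \<omega> in M. D q \<omega> \<le> D q' \<omega>" if "q \<le> q'" for q q'
    unfolding D_def using that by (intro real_cond_exp_mono ind) (auto split: split_indicator)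
  have D01: "AE \<omega> in M. 0 \<le> D q \<omega>" "AE \<omega> in M. D q \<omega> \<le> 1" for q
  proof -
    show "AE \<omega> in M. 0 \<le> D q \<omega>" unfolding D_def by (intro real_cond_exp_pos) auto
    have "AE \<omega> in M. D q \<omega> \<le> real_cond_exp M G (\<lambda>_. 1) \<omega>"
      unfolding D_def by (intro real_cond_exp_mono ind) (auto split: split_indicator)
    moreover have "AE \<omega> in M. real_cond_exp M G (\<lambda>_. 1) \<omega> = 1" by (rule real_cond_exp_F_meas) auto
    ultimately show "AE \<omega> in M. D q \<omega> \<le> 1" by eventually_elim auto
  qed
  interpret YD: real_distribution "distr M borel Y" by (rule real_distribution_distr) simp
  have lim1: "AE \<omega> in M. (\<lambda>n. 1 - D (real n) \<omega>) \<longlonglongrightarrow> 0"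
  proof (rule AE_tendsto_0_of_decreasing)
    show "integrable M (\<lambda>\<omega>. 1 - D (real n) \<omega>)" for n using Dint by simp
    show "AE \<omega> in M. 0 \<le> 1 - D (real n) \<omega>" for n using D01(2)[of "real n"] by eventually_elim simp
    show "AE \<omega> in M. 1 - D (real m) \<omega> \<le> 1 - D (real n) \<omega>" if "n \<le> m" for n m
      using Dmono[of "real n" "real m"] that by (auto elim: eventually_mono)
    show "(\<lambda>n. \<integral>\<omega>. 1 - D (real n) \<omega> \<partial>M) \<longlonglongrightarrow> 0"
      using tendsto_diff[OF tendsto_const YD.cdf_lim_infty_prob, of 1] Dint by (simp add: prob_space)
  qed
  have lim0: "AE \<omega> in M. (\<lambda>n. D (- real n) \<omega>) \<longlonglongrightarrow> 0"
  proof (rule AE_tendsto_0_of_decreasing)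
    show "AE \<omega> in M. D (- real m) \<omega> \<le> D (- real n) \<omega>" if "n \<le> m" for n m
      using Dmono[of "- real m" "- real n"] that by auto
    show "(\<lambda>n. \<integral>\<omega>. D (- real n) \<omega> \<partial>M) \<longlonglongrightarrow> 0" using YD.cdf_lim_neg_infty Dint by simp
  qed (use Dint D01 in auto)
  define good where "good \<omega> \<longleftrightarrow> (\<forall>q\<in>\<rat>. \<forall>q'\<in>\<rat>. q \<le> q' \<longrightarrow> D q \<omega> \<le> D q' \<omega>) \<and>
    (\<lambda>n. 1 - D (real n) \<omega>) \<longlonglongrightarrow> 0 \<and> (\<lambda>n. D (- real n) \<omega>) \<longlonglongrightarrow> 0" for \<omega>
  have goodAE: "AE \<omega> in M. good \<omega>"
  proof -
    have "AE \<omega> in M. \<forall>q\<in>\<rat>. \<forall>q'\<in>\<rat>. q \<le> q' \<longrightarrow> D q \<omega> \<le> D q' \<omega>"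
      using Dmono by (auto simp: AE_ball_countable[OF countable_rat])
    with lim1 lim0 show ?thesis unfolding good_def by eventually_elim auto
  qed
  have goodG [measurable]: "Measurable.pred G good"
  proof -
    have "{\<omega> \<in> space G. \<forall>q\<in>\<rat>. \<forall>q'\<in>\<rat>. q \<le> q' \<longrightarrow> D q \<omega> \<le> D q' \<omega>} \<in> sets G"
    proof -
      have "{\<omega> \<in> space G. \<forall>(q::rat) q'. q \<le> q' \<longrightarrow> D (of_rat q) \<omega> \<le> D (of_rat q') \<omega>} \<in> sets G" by measurable
      then show ?thesis by (simp add: Rats_def of_rat_less_eq)
    qed
    moreover have "{\<omega> \<in> space G. (\<lambda>n. 1 - D (real n) \<omega>) \<longlonglongrightarrow> 0} \<in> sets G" by measurable
    moreover have "{\<omega> \<in> space G. (\<lambda>n. D (- real n) \<omega>) \<longlonglongrightarrow> 0} \<in> sets G" by measurable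
    ultimately have "{\<omega> \<in> space G. good \<omega>} \<in> sets G" unfolding good_def by (intro sets.sets_Collect_conj)
    then show ?thesis by (simp add: pred_def)
  qed
  have gb: "0 \<le> D q \<omega>" "D q \<omega> \<le> 1" if "good \<omega>" "q \<in> \<rat>" for q \<omega>
  proof -
    have m: "D q \<omega> \<le> D q' \<omega>" if "q \<in> \<rat>" "q' \<in> \<rat>" "q \<le> q'" for q q' using \<open>good \<omega>\<close> that by (auto simp: good_def)
    have l1: "(\<lambda>n. D (real n) \<omega>) \<longlonglongrightarrow> 1" using \<open>good \<omega>\<close> tendsto_diff[OF tendsto_const[of 1], of "\<lambda>n. 1 - D (real n) \<omega>" 0] by (auto simp: good_def)
    obtain N where N: "q \<le> real N" using real_arch_simple by blast
    show "D q \<omega> \<le> 1"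
      by (rule LIMSEQ_le_const[OF l1]) (use N m[OF that(2)] in \<open>auto intro!: exI[of _ N]\<close>)
    obtain K where K: "- q \<le> real K" using real_arch_simple by blast
    have l0: "(\<lambda>n. D (- real n) \<omega>) \<longlonglongrightarrow> 0" using \<open>good \<omega>\<close> by (simp add: good_def)
    show "0 \<le> D q \<omega>"
      by (rule LIMSEQ_le_const2[OF l0]) (use K m[OF _ that(2)] in \<open>auto intro!: exI[of _ K]\<close>)
  qed
  \<comment> \<open>On the exceptional null set the distribution function of the point mass at \<open>0\<close> is used.\<close>
  define F where "F \<omega> x = (if good \<omega> then (INF q\<in>{q\<in>\<rat>. x < q}. D q \<omega>) else indicator {0..} x)" for \<omega> and x :: real
  have ne: "{q\<in>\<rat>. x < q} \<noteq> {}" for x :: real using Rats_dense_in_real[of x "x + 1"] by auto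
  have bd: "bdd_below ((\<lambda>q. D q \<omega>) ` {q\<in>\<rat>. x < q})" if "good \<omega>" for x \<omega>
    using gb[OF that] by (auto intro!: bdd_belowI[of _ 0])
  have Fless: "F \<omega> x < c \<longleftrightarrow> (\<exists>q\<in>{q\<in>\<rat>. x < q}. D q \<omega> < c)" if "good \<omega>" for \<omega> x c
    unfolding F_def using cINF_less_iff[OF ne bd[OF that]] that by simp
  have Fle: "F \<omega> x \<le> D q \<omega>" if "good \<omega>" "q \<in> \<rat>" "x < q" for \<omega> x q
    unfolding F_def using that by (auto intro!: cINF_lower bd)
  have Fge: "c \<le> F \<omega> x" if "good \<omega>" "\<And>q. q \<in> \<rat> \<Longrightarrow> x < q \<Longrightarrow> c \<le> D q \<omega>" for \<omega> x c
    unfolding F_def using that ne[of x] by (auto intro!: cINF_greatest)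
  have Dle: "D q \<omega> \<le> F \<omega> x" if "good \<omega>" "q \<in> \<rat>" "q \<le> x" for \<omega> x q
    using that by (intro Fge) (auto simp: good_def)
  have Fseq: "(\<lambda>n. D (q n) \<omega>) \<longlonglongrightarrow> F \<omega> x" if "good \<omega>" "\<And>n. q n \<in> \<rat>" "\<And>n. x < q n" "q \<longlonglongrightarrow> x" for \<omega> x q
  proof (rule LIMSEQ_I)
    fix e :: real assume "0 < e"
    then have *: "F \<omega> x < F \<omega> x + e" by simp
    note gd = Fless[OF that(1)]
    then obtain r where r: "r \<in> \<rat>" "x < r" "D r \<omega> < F \<omega> x + e"
      using *[unfolded gd] by auto
    have "eventually (\<lambda>n. q n < r) sequentially" using order_tendstoD(2)[OF that(4) r(2)] .
    then obtain N where N: "\<And>n. n \<ge> N \<Longrightarrow> q n < r" by (auto simp: eventually_sequentially)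
    have "norm (D (q n) \<omega> - F \<omega> x) < e" if "n \<ge> N" for n
    proof -
      have "D (q n) \<omega> \<le> D r \<omega>" using \<open>good \<omega>\<close> \<open>\<And>n. q n \<in> \<rat>\<close> r N[OF that] by (auto simp: good_def)
      then show ?thesis using Fle[OF \<open>good \<omega>\<close> \<open>\<And>n. q n \<in> \<rat>\<close> \<open>\<And>n. x < q n\<close>, of n] r(3) by simp
    qed
    then show "\<exists>no. \<forall>n\<ge>no. norm (D (q n) \<omega> - F \<omega> x) < e" by blast
  qed
  have Fmono: "F \<omega> x \<le> F \<omega> y" if "x \<le> y" for \<omega> x y
  proof (cases "good \<omega>")
    case True
    then show ?thesis using that by (intro Fge Fle) auto
  qed (use that in \<open>auto simp: F_def split: split_indicator\<close>)
  have Frc: "continuous (at_right a) (F \<omega>)" for \<omega> a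
  proof (cases "good \<omega>")
    case True
    show ?thesis unfolding continuous_within
    proof (rule tendstoI)
      fix e :: real assume "0 < e"
      then have *: "F \<omega> a < F \<omega> a + e" by simp
      then obtain r where r: "r \<in> \<rat>" "a < r" "D r \<omega> < F \<omega> a + e"
        using *[unfolded Fless[OF True]] by auto
      have "eventually (\<lambda>y. y \<in> {a<..<r}) (at_right a)" using r(2) by (rule eventually_at_right_real)
      then show "eventually (\<lambda>y. dist (F \<omega> y) (F \<omega> a) < e) (at_right a)"
      proof eventually_elim
        case (elim y)
        then have "F \<omega> y \<le> D r \<omega>" using True r by (intro Fle) auto
        moreover have "F \<omega> a \<le> F \<omega> y" using elim by (intro Fmono) auto
        ultimately show ?case using r(3) by (simp add: dist_real_def)
      qed
    qed
  next
    case False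
    have "eventually (\<lambda>y. F \<omega> y = F \<omega> a) (at_right a)"
    proof (cases "0 \<le> a")
      case True
      show ?thesis using eventually_at_right_real[of a "a+1", simplified]
        by eventually_elim (use False True in \<open>auto simp: F_def\<close>)
    next
      case A: False
      then have "a < 0" by simp
      from eventually_at_right_real[OF this] show ?thesis
        by eventually_elim (use False A in \<open>auto simp: F_def\<close>)
    qed
    then show ?thesis unfolding continuous_within by (rule tendsto_eventually)
  qed
  have F01: "0 \<le> F \<omega> x" "F \<omega> x \<le> 1" for \<omega> x
  proof -
    show "0 \<le> F \<omega> x"
    proof (cases "good \<omega>")
      case True then show ?thesis using gb by (intro Fge) auto
    qed (auto simp: F_def)
    show "F \<omega> x \<le> 1"
    proof (cases "good \<omega>")
      case True
      obtain q where "q \<in> \<rat>" "x < q" using ne[of x] by auto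
      then show ?thesis using Fle[OF True] gb[OF True] order_trans by blast
    qed (auto simp: F_def split: split_indicator)
  qed
  have Ftop: "(F \<omega> \<longlongrightarrow> 1) at_top" for \<omega>
  proof (cases "good \<omega>")
    case True
    show ?thesis
    proof (rule order_tendstoI)
      fix c :: real assume "c < 1"
      have "(\<lambda>n. D (real n) \<omega>) \<longlonglongrightarrow> 1" using True tendsto_diff[OF tendsto_const[of 1], of "\<lambda>n. 1 - D (real n) \<omega>" 0] by (auto simp: good_def)
      from order_tendstoD(1)[OF this \<open>c < 1\<close>] obtain n where n: "c < D (real n) \<omega>" by (auto simp: eventually_sequentially)
      have "c < F \<omega> x" if "real n \<le> x" for x using n Dle[OF True, of "real n" x] that by simp
      then show "eventually (\<lambda>x. c < F \<omega> x) at_top" by (auto simp: eventually_at_top_linorder)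
    next
      fix c :: real assume "1 < c" then show "eventually (\<lambda>x. F \<omega> x < c) at_top"
        using F01(2)[of \<omega>] by (intro always_eventually) (auto intro: le_less_trans)
    qed
  next
    case False
    then have "eventually (\<lambda>x. F \<omega> x = 1) at_top" by (auto simp: F_def eventually_at_top_linorder intro!: exI[of _ 0])
    then show ?thesis by (rule tendsto_eventually)
  qed
  have Fbot: "(F \<omega> \<longlongrightarrow> 0) at_bot" for \<omega>
  proof (cases "good \<omega>")
    case True
    show ?thesis
    proof (rule order_tendstoI)
      fix c :: real assume "0 < c"
      have "(\<lambda>n. D (- real n) \<omega>) \<longlonglongrightarrow> 0" using True by (simp add: good_def)
      from order_tendstoD(2)[OF this \<open>0 < c\<close>] obtain n where n: "D (- real n) \<omega> < c" by (auto simp: eventually_sequentially)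
      have "F \<omega> x < c" if "x \<le> - real n - 1" for x using n Fle[OF True, of "- real n" x] that by simp
      then show "eventually (\<lambda>x. F \<omega> x < c) at_bot" by (auto simp: eventually_at_bot_linorder)
    next
      fix c :: real assume "c < 0" then show "eventually (\<lambda>x. c < F \<omega> x) at_bot"
        using F01(1)[of \<omega>] by (intro always_eventually) (auto intro: less_le_trans)
    qed
  next
    case False
    then have "eventually (\<lambda>x. F \<omega> x = 0) at_bot" by (auto simp: F_def eventually_at_bot_linorder intro!: exI[of _ "-1"])
    then show ?thesis by (rule tendsto_eventually)
  qed
  define \<kappa> where "\<kappa> \<omega> = interval_measure (F \<omega>)" for \<omega>
  have kd: "real_distribution (\<kappa> \<omega>)" for \<omega>
    unfolding \<kappa>_def by (rule real_distribution_interval_measure[OF Fmono Frc Fbot Ftop])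
  have kc: "emeasure (\<kappa> \<omega>) {..x} = ennreal (F \<omega> x)" "measure (\<kappa> \<omega>) {..x} = F \<omega> x" for \<omega> x
  proof -
    show "emeasure (\<kappa> \<omega>) {..x} = ennreal (F \<omega> x)"
      unfolding \<kappa>_def by (rule emeasure_interval_measure_Iic[OF Fmono Frc Fbot])
    show "measure (\<kappa> \<omega>) {..x} = F \<omega> x"
      unfolding \<kappa>_def by (rule measure_interval_measure_Iic[OF Fmono Frc Fbot])
  qed
  have FG [measurable]: "(\<lambda>\<omega>. F \<omega> x) \<in> borel_measurable G" for x
  proof (rule borel_measurable_iff_less[THEN iffD2], rule)
    fix c :: real
    have "{\<omega> \<in> space G. F \<omega> x < c} =
      {\<omega> \<in> space G. (good \<omega> \<and> (\<exists>q::rat. x < of_rat q \<and> D (of_rat q) \<omega> < c)) \<or> (\<not> good \<omega> \<and> indicator {0..} x < c)}"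
    proof (intro Collect_cong conj_cong refl)
      fix \<omega>
      show "F \<omega> x < c \<longleftrightarrow> (good \<omega> \<and> (\<exists>q::rat. x < of_rat q \<and> D (of_rat q) \<omega> < c)) \<or> (\<not> good \<omega> \<and> indicator {0..} x < c)"
        using Fless[of \<omega> x c] by (cases "good \<omega>") (auto simp: F_def Rats_def)
    qed
    also have "\<dots> \<in> sets G" by measurable
    finally show "{\<omega> \<in> space G. F \<omega> x < c} \<in> sets G" .
  qed
  have kG: "\<kappa> \<in> G \<rightarrow>\<^sub>M prob_algebra borel"
  proof (rule measurable_prob_algebra_generated[where \<Omega>=UNIV and G="range atMost"])
    show "sets borel = sigma_sets UNIV (range (atMost :: real \<Rightarrow> _))"
      by (simp add: borel_eq_atMost)
    show "Int_stable (range (atMost :: real \<Rightarrow> _))" by (auto simp: Int_stable_def)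
    show "prob_space (\<kappa> \<omega>)" "sets (\<kappa> \<omega>) = sets borel" for \<omega>
      using kd[of \<omega>] by (auto simp: real_distribution_def real_distribution_axioms_def)
  qed (auto simp: kc)
  have kA: "(\<integral>\<^sup>+\<omega>\<in>A. emeasure (\<kappa> \<omega>) B \<partial>M) = emeasure M (A \<inter> (Y -` B \<inter> space M))" if A: "A \<in> sets G" and B: "B \<in> sets borel" for A B
  proof -
    have AM [measurable]: "A \<in> sets M" using A G by (auto simp: subalgebra_def)
    have mk [measurable]: "(\<lambda>\<omega>. emeasure (\<kappa> \<omega>) B) \<in> borel_measurable M" if "B \<in> sets borel" for B
      using measurable_from_subalg[OF G measurable_emeasure_kernel[OF measurable_prob_algebraD[OF kG] that]] .
    have setsk: "sets (\<kappa> \<omega>) = sets borel" "space (\<kappa> \<omega>) = UNIV" "emeasure (\<kappa> \<omega>) UNIV = 1" for \<omega>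
    proof -
      show 1: "sets (\<kappa> \<omega>) = sets borel" using kd[of \<omega>] by (simp add: real_distribution_def real_distribution_axioms_def)
      show 2: "space (\<kappa> \<omega>) = UNIV" using sets_eq_imp_space_eq[OF 1] by simp
      show "emeasure (\<kappa> \<omega>) UNIV = 1"
        using prob_space.emeasure_space_1[OF real_distribution.axioms(1)[OF kd[of \<omega>]]] by (simp add: 2)
    qed
    have st: "Int_stable (range (atMost :: real \<Rightarrow> _))" "range (atMost :: real \<Rightarrow> _) \<subseteq> Pow UNIV"
      by (auto simp: Int_stable_def)
    have "B \<in> sigma_sets UNIV (range (atMost :: real \<Rightarrow> _))" using B by (simp add: borel_eq_atMost)
    from st this show ?thesis
    proof (induction B rule: sigma_sets_induct_disjoint)
      case (basic B)
      then obtain x where B: "B = {..x}" by auto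
      obtain q where q: "\<And>n. q n \<in> \<rat>" "\<And>n. x < q n" "q \<longlonglongrightarrow> x" by (rule rational_sequence_above[of x]) blast
      have [measurable]: "(\<lambda>\<omega>. F \<omega> x) \<in> borel_measurable M" using measurable_from_subalg[OF G FG] .
      have "(\<lambda>n. \<integral>\<omega>. indicator A \<omega> * D (q n) \<omega> \<partial>M) \<longlonglongrightarrow> (\<integral>\<omega>. indicator A \<omega> * F \<omega> x \<partial>M)"
      proof (rule integral_dominated_convergence[where w="\<lambda>_. 1"])
        show "AE \<omega> in M. (\<lambda>n. indicator A \<omega> * D (q n) \<omega>) \<longlonglongrightarrow> indicator A \<omega> * F \<omega> x"
          using goodAE by eventually_elim (intro tendsto_mult tendsto_const Fseq q)
        show "AE \<omega> in M. norm (indicator A \<omega> * D (q n) \<omega>) \<le> 1" for n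
          using D01[of "q n"] by eventually_elim (auto split: split_indicator)
      qed auto
      moreover have "(\<lambda>n. \<integral>\<omega>. indicator A \<omega> * indicator {..q n} (Y \<omega>) \<partial>M) \<longlonglongrightarrow> (\<integral>\<omega>. indicator A \<omega> * (indicator {..x} (Y \<omega>) :: real) \<partial>M)"
      proof (rule integral_dominated_convergence[where w="\<lambda>_. 1"])
        have "(\<lambda>n. indicator A \<omega> * indicator {..q n} (Y \<omega>)) \<longlonglongrightarrow> (indicator A \<omega> * indicator {..x} (Y \<omega>) :: real)" for \<omega>
        proof (rule tendsto_eventually, cases "Y \<omega> \<le> x")
          case True then show "\<forall>\<^sub>F n in sequentially. indicator A \<omega> * indicator {..q n} (Y \<omega>) = (indicator A \<omega> * indicator {..x} (Y \<omega>) :: real)"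
            using q(2) by (intro always_eventually) (auto intro: order_trans less_imp_le simp: indicator_def)
        next
          case False
          then have "\<forall>\<^sub>F n in sequentially. q n < Y \<omega>" using order_tendstoD(2)[OF q(3)] by auto
          then show "\<forall>\<^sub>F n in sequentially. indicator A \<omega> * indicator {..q n} (Y \<omega>) = (indicator A \<omega> * indicator {..x} (Y \<omega>) :: real)"
            by eventually_elim (use False in \<open>auto simp: indicator_def\<close>)
        qed
        then show "AE \<omega> in M. (\<lambda>n. indicator A \<omega> * indicator {..q n} (Y \<omega>)) \<longlonglongrightarrow> (indicator A \<omega> * indicator {..x} (Y \<omega>) :: real)" by simp
      qed (auto split: split_indicator)
      moreover have "(\<integral>\<omega>. indicator A \<omega> * D (q n) \<omega> \<partial>M) = (\<integral>\<omega>. indicator A \<omega> * indicator {..q n} (Y \<omega>) \<partial>M)" for n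
        using DA[OF A, of "q n"] by (simp add: set_lebesgue_integral_def)
      ultimately have e: "(\<integral>\<omega>. indicator A \<omega> * F \<omega> x \<partial>M) = (\<integral>\<omega>. indicator A \<omega> * indicator {..x} (Y \<omega>) \<partial>M)"
        using LIMSEQ_unique by simp
      have "(\<integral>\<^sup>+\<omega>\<in>A. emeasure (\<kappa> \<omega>) B \<partial>M) = (\<integral>\<^sup>+\<omega>. ennreal (indicator A \<omega> * F \<omega> x) \<partial>M)"
        unfolding B kc by (intro nn_integral_cong) (auto split: split_indicator)
      also have "\<dots> = ennreal (\<integral>\<omega>. indicator A \<omega> * F \<omega> x \<partial>M)"
        using F01 by (intro nn_integral_eq_integral integrable_const_bound[of _ 1]) (auto split: split_indicator)
      also have "\<dots> = (\<integral>\<^sup>+\<omega>. ennreal (indicator A \<omega> * indicator {..x} (Y \<omega>)) \<partial>M)"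
        unfolding e by (intro nn_integral_eq_integral[symmetric] integrable_const_bound[of _ 1]) (auto split: split_indicator)
      also have "\<dots> = (\<integral>\<^sup>+\<omega>. indicator (A \<inter> (Y -` B \<inter> space M)) \<omega> \<partial>M)"
        unfolding B by (intro nn_integral_cong) (auto split: split_indicator)
      also have "\<dots> = emeasure M (A \<inter> (Y -` B \<inter> space M))" unfolding B by (intro nn_integral_indicator) measurable
      finally show ?case .
    next
      case empty then show ?case by simp
    next
      case (compl B)
      then have B [measurable]: "B \<in> sets borel" by (simp add: borel_eq_atMost)
      have "(\<integral>\<^sup>+\<omega>\<in>A. emeasure (\<kappa> \<omega>) (UNIV - B) \<partial>M) = (\<integral>\<^sup>+\<omega>. indicator A \<omega> - emeasure (\<kappa> \<omega>) B * indicator A \<omega> \<partial>M)"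
      proof (intro nn_integral_cong)
        fix \<omega> assume "\<omega> \<in> space M"
        have "emeasure (\<kappa> \<omega>) (UNIV - B) = 1 - emeasure (\<kappa> \<omega>) B"
          using emeasure_compl[of B "\<kappa> \<omega>"] B setsk[of \<omega>]
            finite_measure.emeasure_finite[OF prob_space.axioms(1)[OF real_distribution.axioms(1)[OF kd[of \<omega>]]]]
          by auto
        then show "emeasure (\<kappa> \<omega>) (UNIV - B) * indicator A \<omega> = indicator A \<omega> - emeasure (\<kappa> \<omega>) B * indicator A \<omega>"
          by (auto split: split_indicator)
      qed
      also have "\<dots> = (\<integral>\<^sup>+\<omega>. indicator A \<omega> \<partial>M) - (\<integral>\<^sup>+\<omega>. emeasure (\<kappa> \<omega>) B * indicator A \<omega> \<partial>M)"
      proof (rule nn_integral_diff)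
        show "(\<integral>\<^sup>+\<omega>. emeasure (\<kappa> \<omega>) B * indicator A \<omega> \<partial>M) \<noteq> \<infinity>" unfolding compl by simp
        have "emeasure (\<kappa> \<omega>) B \<le> 1" for \<omega> using emeasure_mono[of B UNIV "\<kappa> \<omega>"] setsk[of \<omega>] by simp
        then show "AE \<omega> in M. emeasure (\<kappa> \<omega>) B * indicator A \<omega> \<le> indicator A \<omega>" by (auto split: split_indicator)
      qed measurable
      also have "\<dots> = emeasure M A - emeasure M (A \<inter> (Y -` B \<inter> space M))" unfolding compl by simp
      also have "\<dots> = emeasure M (A - (A \<inter> (Y -` B \<inter> space M)))" by (intro emeasure_Diff[symmetric]) auto
      also have "A - (A \<inter> (Y -` B \<inter> space M)) = A \<inter> (Y -` (UNIV - B) \<inter> space M)"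
        using sets.sets_into_space[OF AM] by auto
      finally show ?case .
    next
      case (union B)
      then have B [measurable]: "B i \<in> sets borel" for i by (auto simp: borel_eq_atMost)
      have "(\<integral>\<^sup>+\<omega>\<in>A. emeasure (\<kappa> \<omega>) (\<Union>i. B i) \<partial>M) = (\<integral>\<^sup>+\<omega>. (\<Sum>i. emeasure (\<kappa> \<omega>) (B i) * indicator A \<omega>) \<partial>M)"
        using union(1) setsk(1) by (intro nn_integral_cong) (simp add: suminf_emeasure[symmetric] image_subset_iff)
      also have "\<dots> = (\<Sum>i. \<integral>\<^sup>+\<omega>. emeasure (\<kappa> \<omega>) (B i) * indicator A \<omega> \<partial>M)" by (rule nn_integral_suminf) measurable
      also have "\<dots> = (\<Sum>i. emeasure M (A \<inter> (Y -` B i \<inter> space M)))" unfolding union(3) by simp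
      also have "\<dots> = emeasure M (\<Union>i. A \<inter> (Y -` B i \<inter> space M))"
        using union(1) by (intro suminf_emeasure) (auto simp: disjoint_family_on_def)
      also have "(\<Union>i. A \<inter> (Y -` B i \<inter> space M)) = A \<inter> (Y -` (\<Union>i. B i) \<inter> space M)" by auto
      finally show ?case .
    qed
  qed
  have "is_cond_law M G Y \<kappa>" by (rule is_cond_lawI[OF G Y kG kA])
  with that show ?thesis by blast
qed

lemma nn_integral_distr':
  "T \<in> M \<rightarrow>\<^sub>M N \<Longrightarrow> f \<in> borel_measurable N \<Longrightarrow> (\<integral>\<^sup>+z. f z \<partial>distr M N T) = (\<integral>\<^sup>+x. f (T x) \<partial>M)"
  by (simp add: nn_integral_distr)

lemma (in prob_space) is_cond_lawD:
  assumes G: "subalgebra M G" and X [measurable]: "X \<in> borel_measurable M" and \<kappa>: "is_cond_law M G X \<kappa>"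
  shows "\<kappa> \<in> G \<rightarrow>\<^sub>M prob_algebra borel"
    "A \<in> sets G \<Longrightarrow> B \<in> sets borel \<Longrightarrow>
      (\<integral>\<^sup>+\<omega>\<in>A. emeasure (\<kappa> \<omega>) B \<partial>M) = emeasure M (A \<inter> (X -` B \<inter> space M))"
proof -
  interpret finite_measure_subalgebra M G by (rule finite_measure_subalgebraI[OF G])
  have spG: "space G = space M" using G by (simp add: subalgebra_def)
  show kG: "\<kappa> \<in> G \<rightarrow>\<^sub>M prob_algebra borel" using \<kappa> by (simp add: is_cond_law_def)
  have pk: "prob_space (\<kappa> \<omega>)" if "\<omega> \<in> space M" for \<omega>
    using measurable_space[OF kG, of \<omega>] that spG by (auto simp: space_prob_algebra)
  assume A: "A \<in> sets G" and B [measurable]: "B \<in> sets borel"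
  have AM [measurable]: "A \<in> sets M" using A G by (auto simp: subalgebra_def)
  have ind: "integrable M (\<lambda>\<omega>. indicator B (X \<omega>) :: real)"
    by (rule integrable_const_bound[of _ 1]) (auto split: split_indicator)
  have mG: "(\<lambda>\<omega>. measure (\<kappa> \<omega>) B) \<in> borel_measurable G"
    using measurable_emeasure_kernel[OF measurable_prob_algebraD[OF kG] B] unfolding measure_def by measurable
  have mM [measurable]: "(\<lambda>\<omega>. measure (\<kappa> \<omega>) B) \<in> borel_measurable M" using measurable_from_subalg[OF G mG] .
  have "(\<integral>\<^sup>+\<omega>\<in>A. emeasure (\<kappa> \<omega>) B \<partial>M) = (\<integral>\<^sup>+\<omega>. ennreal (indicator A \<omega> * measure (\<kappa> \<omega>) B) \<partial>M)"
    by (intro nn_integral_cong) (auto simp: finite_measure.emeasure_eq_measure[OF prob_space.axioms(1)[OF pk]] split: split_indicator)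
  also have "\<dots> = ennreal (\<integral>\<omega>. indicator A \<omega> * measure (\<kappa> \<omega>) B \<partial>M)"
    using pk by (intro nn_integral_eq_integral integrable_const_bound[of _ 1] AE_I2)
      (auto split: split_indicator intro: prob_space.prob_le_1)
  also have "(\<integral>\<omega>. indicator A \<omega> * measure (\<kappa> \<omega>) B \<partial>M) = (\<integral>\<omega>. indicator A \<omega> * real_cond_exp M G (\<lambda>\<omega>. indicator B (X \<omega>)) \<omega> \<partial>M)"
  proof (intro integral_cong_AE)
    have "AE \<omega> in M. measure (\<kappa> \<omega>) B = real_cond_exp M G (\<lambda>\<omega>. indicator B (X \<omega>)) \<omega>"
      using \<kappa> B by (simp add: is_cond_law_def)
    then show "AE \<omega> in M. indicator A \<omega> * measure (\<kappa> \<omega>) B = indicator A \<omega> * real_cond_exp M G (\<lambda>\<omega>. indicator B (X \<omega>)) \<omega>"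
      by eventually_elim simp
  qed measurable
  also have "\<dots> = (\<integral>\<omega>. indicator A \<omega> * indicator B (X \<omega>) \<partial>M)"
    using real_cond_exp_intA[OF ind A] by (simp add: set_lebesgue_integral_def)
  also have "\<dots> = (\<integral>\<omega>. indicator (A \<inter> (X -` B \<inter> space M)) \<omega> \<partial>M)"
    by (intro Bochner_Integration.integral_cong) (auto split: split_indicator)
  also have "ennreal \<dots> = emeasure M (A \<inter> (X -` B \<inter> space M))"
    by (simp add: emeasure_eq_measure Int_absorb1 sets.sets_into_space)
  finally show "(\<integral>\<^sup>+\<omega>\<in>A. emeasure (\<kappa> \<omega>) B \<partial>M) = emeasure M (A \<inter> (X -` B \<inter> space M))" .
qed

text \<open>Two versions agree on the half-lines with rational end point outside one null set, and these
  determine a distribution by right-continuity.\<close>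

lemma (in prob_space) cond_law_unique:
  assumes G: "subalgebra M G" and \<kappa>: "is_cond_law M G X \<kappa>" "is_cond_law M G X \<kappa>'"
  shows "AE \<omega> in M. \<kappa> \<omega> = \<kappa>' \<omega>"
proof -
  have spG: "space G = space M" using G by (simp add: subalgebra_def)
  have rd: "real_distribution (\<kappa> \<omega>)" if "is_cond_law M G X \<kappa>" "\<omega> \<in> space M" for \<omega> \<kappa>
    using that measurable_space[of \<kappa> G "prob_algebra borel" \<omega>] spG
    by (auto simp: is_cond_law_def space_prob_algebra real_distribution_def real_distribution_axioms_def)
  have "AE \<omega> in M. \<forall>q\<in>\<rat>. measure (\<kappa> \<omega>) {..q} = measure (\<kappa>' \<omega>) {..q::real}"
  proof (subst AE_ball_countable[OF countable_rat], rule ballI)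
    fix q :: real
    have "AE \<omega> in M. measure (\<kappa> \<omega>) {..q} = real_cond_exp M G (\<lambda>\<omega>. indicator {..q} (X \<omega>)) \<omega>"
      "AE \<omega> in M. measure (\<kappa>' \<omega>) {..q} = real_cond_exp M G (\<lambda>\<omega>. indicator {..q} (X \<omega>)) \<omega>"
      using \<kappa> by (auto simp: is_cond_law_def)
    then show "AE \<omega> in M. measure (\<kappa> \<omega>) {..q} = measure (\<kappa>' \<omega>) {..q}" by eventually_elim simp
  qed
  with AE_space show ?thesis
  proof eventually_elim
    case (elim \<omega>)
    note r = rd[OF \<kappa>(1) elim(1)] rd[OF \<kappa>(2) elim(1)]
    show ?case
    proof (rule cdf_unique[OF r], rule ext)
      fix x :: real
      obtain q where q: "\<And>n. q n \<in> \<rat>" "\<And>n. x < q n" "q \<longlonglongrightarrow> x" by (rule rational_sequence_above[of x]) blast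
      have f: "filterlim q (at_right x) sequentially" using q by (auto simp: filterlim_at intro: always_eventually)
      have l: "(\<lambda>n. cdf N (q n)) \<longlonglongrightarrow> cdf N x" if "real_distribution N" for N
      proof -
        interpret N: real_distribution N by fact
        have "(cdf N \<longlongrightarrow> cdf N x) (at_right x)" using N.cdf_is_right_cont[of x] by (simp add: continuous_within)
        then show ?thesis using f by (rule filterlim_compose)
      qed
      have "(\<lambda>n. cdf (\<kappa> \<omega>) (q n)) = (\<lambda>n. cdf (\<kappa>' \<omega>) (q n))" using elim(2) q(1) by (auto simp: cdf_def)
      then show "cdf (\<kappa> \<omega>) x = cdf (\<kappa>' \<omega>) x" using l[OF r(1)] l[OF r(2)] LIMSEQ_unique by metis
    qed
  qed
qed

text \<open>Both sides integrate \<open>h\<close> against probability measures on the product; on rectangles these agree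
  by the definition of the conditional law.\<close>

theorem (in prob_space) cond_law_disintegration:
  assumes G: "subalgebra M G" and X: "X \<in> borel_measurable M" and \<kappa>: "is_cond_law M G X \<kappa>"
    and h: "h \<in> borel_measurable (G \<Otimes>\<^sub>M borel)"
  shows "(\<integral>\<^sup>+\<omega>. h (\<omega>, X \<omega>) \<partial>M) = (\<integral>\<^sup>+\<omega>. \<integral>\<^sup>+x. h (\<omega>, x) \<partial>\<kappa> \<omega> \<partial>M)"
proof -
  note D = is_cond_lawD[OF G X \<kappa>]
  note kS = measurable_prob_algebraD[OF D(1)]
  have spG: "space G = space M" using G by (simp add: subalgebra_def)
  have setsk: "sets (\<kappa> \<omega>) = sets borel" "space (\<kappa> \<omega>) = UNIV" if "\<omega> \<in> space M" for \<omega>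
  proof -
    show "sets (\<kappa> \<omega>) = sets borel" using measurable_space[OF D(1), of \<omega>] that spG by (auto simp: space_prob_algebra)
    from sets_eq_imp_space_eq[OF this] show "space (\<kappa> \<omega>) = UNIV" by simp
  qed
  let ?G = "restr_to_subalg M G" and ?GB = "G \<Otimes>\<^sub>M (borel :: real measure)"
  have idG: "(\<lambda>\<omega>. \<omega>) \<in> M \<rightarrow>\<^sub>M G" by (rule measurable_from_subalg[OF G]) simp
  have mX: "(\<lambda>\<omega>. (\<omega>, X \<omega>)) \<in> M \<rightarrow>\<^sub>M ?GB" using idG X by (rule measurable_Pair)
  define K where "K \<omega> = distr (\<kappa> \<omega>) ?GB (Pair \<omega>)" for \<omega>
  have KG: "K \<in> G \<rightarrow>\<^sub>M subprob_algebra ?GB"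
    unfolding K_def[abs_def] by (rule measurable_distr2[OF _ kS]) simp
  have KG': "K \<in> ?G \<rightarrow>\<^sub>M subprob_algebra ?GB"
    using KG by (simp add: measurable_cong_sets[OF sets_restr_to_subalg[OF G] refl])
  have Pm: "Pair \<omega> \<in> \<kappa> \<omega> \<rightarrow>\<^sub>M ?GB" if "\<omega> \<in> space M" for \<omega>
    using that by (simp add: measurable_cong_sets[OF setsk(1) refl] spG)
  have Kint: "(\<integral>\<^sup>+z. f z \<partial>K \<omega>) = (\<integral>\<^sup>+x. f (\<omega>, x) \<partial>\<kappa> \<omega>)" if "\<omega> \<in> space M" "f \<in> borel_measurable ?GB" for \<omega> f
    unfolding K_def by (rule nn_integral_distr'[OF Pm[OF that(1)] that(2)])
  have bind: "(\<integral>\<^sup>+z. f z \<partial>(?G \<bind> K)) = (\<integral>\<^sup>+\<omega>. \<integral>\<^sup>+x. f (\<omega>, x) \<partial>\<kappa> \<omega> \<partial>M)" if f: "f \<in> borel_measurable ?GB" for f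
  proof -
    have "(\<integral>\<^sup>+z. f z \<partial>(?G \<bind> K)) = (\<integral>\<^sup>+\<omega>. \<integral>\<^sup>+z. f z \<partial>K \<omega> \<partial>?G)" by (rule nn_integral_bind[OF f KG'])
    also have "\<dots> = (\<integral>\<^sup>+\<omega>. \<integral>\<^sup>+z. f z \<partial>K \<omega> \<partial>M)"
      by (rule nn_integral_subalgebra2[OF G]) (rule measurable_compose[OF KG nn_integral_measurable_subprob_algebra[OF f]])
    also have "\<dots> = (\<integral>\<^sup>+\<omega>. \<integral>\<^sup>+x. f (\<omega>, x) \<partial>\<kappa> \<omega> \<partial>M)" by (intro nn_integral_cong Kint f)
    finally show ?thesis .
  qed
  have ne: "space ?G \<noteq> {}" using not_empty by (simp add: space_restr_to_subalg)
  have "distr M ?GB (\<lambda>\<omega>. (\<omega>, X \<omega>)) = ?G \<bind> K"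
  proof (rule measure_eqI_generator_eq[where E="{a \<times> b | a b. a \<in> sets G \<and> b \<in> sets (borel :: real measure)}" and A="\<lambda>_::nat. space ?GB"])
    show "Int_stable {a \<times> b | a b. a \<in> sets G \<and> b \<in> sets (borel :: real measure)}" by (rule Int_stable_pair_measure_generator)
    show "{a \<times> b | a b. a \<in> sets G \<and> b \<in> sets (borel :: real measure)} \<subseteq> Pow (space ?GB)"
      using sets.sets_into_space by (fastforce simp: space_pair_measure)
    show "sets (distr M ?GB (\<lambda>\<omega>. (\<omega>, X \<omega>))) = sigma_sets (space ?GB) {a \<times> b | a b. a \<in> sets G \<and> b \<in> sets (borel :: real measure)}"
      by (simp add: sets_pair_measure space_pair_measure)
    show "sets (?G \<bind> K) = sigma_sets (space ?GB) {a \<times> b | a b. a \<in> sets G \<and> b \<in> sets (borel :: real measure)}"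
      using sets_bind[OF sets_kernel[OF KG'] ne] by (simp add: sets_pair_measure space_pair_measure)
    show "range (\<lambda>_::nat. space ?GB) \<subseteq> {a \<times> b | a b. a \<in> sets G \<and> b \<in> sets (borel :: real measure)}"
    proof -
      have "space ?GB \<in> {a \<times> b | a b. a \<in> sets G \<and> b \<in> sets (borel :: real measure)}"
        unfolding mem_Collect_eq by (rule exI[of _ "space G"], rule exI[of _ UNIV]) (simp add: space_pair_measure)
      then show ?thesis by auto
    qed
    show "(\<Union>i::nat. space ?GB) = space ?GB" by simp
    show "emeasure (distr M ?GB (\<lambda>\<omega>. (\<omega>, X \<omega>))) (space ?GB) \<noteq> \<infinity>"
      by (simp add: emeasure_distr mX)
    fix S assume "S \<in> {a \<times> b | a b. a \<in> sets G \<and> b \<in> sets (borel :: real measure)}"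
    then obtain A B where S: "S = A \<times> B" "A \<in> sets G" "B \<in> sets borel" by auto
    have Sm: "S \<in> sets ?GB" using S by simp
    have "emeasure (?G \<bind> K) S = (\<integral>\<^sup>+z. indicator S z \<partial>(?G \<bind> K))"
      using Sm sets_bind[OF sets_kernel[OF KG'] ne] by simp
    also have "\<dots> = (\<integral>\<^sup>+\<omega>. \<integral>\<^sup>+x. indicator S (\<omega>, x) \<partial>\<kappa> \<omega> \<partial>M)" using Sm by (intro bind) simp
    also have "\<dots> = (\<integral>\<^sup>+\<omega>\<in>A. emeasure (\<kappa> \<omega>) B \<partial>M)"
    proof (intro nn_integral_cong)
      fix \<omega> assume w: "\<omega> \<in> space M"
      have "(\<integral>\<^sup>+x. indicator S (\<omega>, x) \<partial>\<kappa> \<omega>) = (\<integral>\<^sup>+x. indicator A \<omega> * indicator B x \<partial>\<kappa> \<omega>)"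
        by (intro nn_integral_cong) (auto simp: S split: split_indicator)
      also have "\<dots> = indicator A \<omega> * emeasure (\<kappa> \<omega>) B"
        using S(3) setsk(1)[OF w] by (simp add: nn_integral_cmult)
      finally show "(\<integral>\<^sup>+x. indicator S (\<omega>, x) \<partial>\<kappa> \<omega>) = emeasure (\<kappa> \<omega>) B * indicator A \<omega>" by (simp add: mult.commute)
    qed
    also have "\<dots> = emeasure M (A \<inter> (X -` B \<inter> space M))" by (rule D(2)[OF S(2,3)])
    also have "A \<inter> (X -` B \<inter> space M) = (\<lambda>\<omega>. (\<omega>, X \<omega>)) -` S \<inter> space M" using S by auto
    also have "emeasure M \<dots> = emeasure (distr M ?GB (\<lambda>\<omega>. (\<omega>, X \<omega>))) S" by (simp add: emeasure_distr mX Sm)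
    finally show "emeasure (distr M ?GB (\<lambda>\<omega>. (\<omega>, X \<omega>))) S = emeasure (?G \<bind> K) S" by simp
  qed
  then have "(\<integral>\<^sup>+z. h z \<partial>distr M ?GB (\<lambda>\<omega>. (\<omega>, X \<omega>))) = (\<integral>\<^sup>+z. h z \<partial>(?G \<bind> K))" by simp
  then show ?thesis unfolding bind[OF h] nn_integral_distr'[OF mX h] .
qed

text \<open>A function that is measurable for the \<open>\<sigma>\<close>-algebra generated by \<open>p\<close> is constant on the fibres
  of \<open>p\<close>, so it may be evaluated at a chosen point of each fibre.\<close>

lemma vimage_algebra_fibre_const:
  fixes f :: "'a \<Rightarrow> ennreal"
  assumes f: "f \<in> borel_measurable (vimage_algebra S p N)" and p: "p \<in> S \<rightarrow> space N"
    and ab: "a \<in> S" "b \<in> S" "p a = p b"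
  shows "f a = f b"
proof -
  have "f -` {f a} \<inter> space (vimage_algebra S p N) \<in> sets (vimage_algebra S p N)"
    using f by (rule measurable_sets) simp
  then obtain A where "f -` {f a} \<inter> S = p -` A \<inter> S" using p by (auto simp: sets_vimage_algebra2)
  then show ?thesis using ab by (metis IntD1 IntI insertI1 singletonD vimage_eq)
qed

text \<open>The conditional law of \<open>X'\<close> given \<open>G\<close> and \<open>X\<close> is a kernel in the pair \<open>(\<omega>, X \<omega>)\<close>; to see it
  as such, take conditional laws on the product space, where \<open>(\<omega>, x)\<close> is a coordinate.\<close>

lemma (in prob_space) cond_law_kernel:
  fixes X X' :: "'a \<Rightarrow> real"
  assumes G: "subalgebra M G" and X: "X \<in> borel_measurable M" and X': "X' \<in> borel_measurable M"
  obtains k where "k \<in> G \<Otimes>\<^sub>M borel \<rightarrow>\<^sub>M prob_algebra (borel :: real measure)"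
    "\<And>h. h \<in> borel_measurable ((G \<Otimes>\<^sub>M borel) \<Otimes>\<^sub>M borel) \<Longrightarrow>
      (\<integral>\<^sup>+\<omega>. h ((\<omega>, X \<omega>), X' \<omega>) \<partial>M) = (\<integral>\<^sup>+\<omega>. \<integral>\<^sup>+y. h ((\<omega>, X \<omega>), y) \<partial>k (\<omega>, X \<omega>) \<partial>M)"
proof -
  have spG: "space G = space M" using G by (simp add: subalgebra_def)
  have idG: "(\<lambda>\<omega>. \<omega>) \<in> M \<rightarrow>\<^sub>M G" by (rule measurable_from_subalg[OF G]) simp
  let ?B = "G \<Otimes>\<^sub>M (borel :: real measure)"
  let ?C = "?B \<Otimes>\<^sub>M (borel :: real measure)"
  let ?Z = "\<lambda>\<omega>. ((\<omega>, X \<omega>), X' \<omega>)"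
  have Z: "?Z \<in> M \<rightarrow>\<^sub>M ?C" using idG X X' by (intro measurable_Pair)
  define P where "P = distr M ?C ?Z"
  interpret P: prob_space P unfolding P_def by (rule prob_space_distr[OF Z])
  have spP: "space P = space ?C" and setsP: "sets P = sets ?C" by (auto simp: P_def)
  define H where "H = vimage_algebra (space P) fst ?B"
  have fstP: "fst \<in> space P \<rightarrow> space ?B" by (auto simp: spP space_pair_measure)
  have H: "subalgebra P H"
    unfolding subalgebra_def
  proof
    show "sets H \<subseteq> sets P"
      unfolding H_def sets_vimage_algebra2[OF fstP]
      using measurable_sets[of fst ?C ?B] by (auto simp: setsP spP)
  qed (simp add: H_def)
  have "snd \<in> borel_measurable P" using measurable_snd[of ?B "borel :: real measure"] by (simp add: measurable_cong_sets[OF setsP refl])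
  from P.cond_law_exists[OF H this] obtain k' where k': "is_cond_law P H snd k'" by blast
  note D = P.is_cond_lawD(1)[OF H \<open>snd \<in> borel_measurable P\<close> k']
  have sec: "(\<lambda>z. (z, 0)) \<in> ?B \<rightarrow>\<^sub>M H"
    unfolding H_def by (rule measurable_vimage_algebra2) (auto simp: spP space_pair_measure)
  define k where "k z = k' (z, 0)" for z
  have km: "k \<in> ?B \<rightarrow>\<^sub>M prob_algebra borel" unfolding k_def[abs_def] by (rule measurable_compose[OF sec D])
  have fstH: "fst \<in> H \<rightarrow>\<^sub>M ?B" unfolding H_def using fstP by (rule measurable_vimage_algebra1)
  have "(\<integral>\<^sup>+\<omega>. h (?Z \<omega>) \<partial>M) = (\<integral>\<^sup>+\<omega>. \<integral>\<^sup>+y. h ((\<omega>, X \<omega>), y) \<partial>k (\<omega>, X \<omega>) \<partial>M)" if h: "h \<in> borel_measurable ?C" for h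
  proof -
    have hm: "(\<lambda>(w, y). h (fst w, y)) \<in> borel_measurable (H \<Otimes>\<^sub>M borel)"
    proof -
      have "(\<lambda>wy. (fst (fst wy), snd wy)) \<in> H \<Otimes>\<^sub>M borel \<rightarrow>\<^sub>M ?C"
        by (intro measurable_Pair measurable_compose[OF measurable_fst fstH] measurable_snd)
      from measurable_compose[OF this h] show ?thesis by (simp add: split_beta')
    qed
    define g where "g w = (\<integral>\<^sup>+y. h (fst w, y) \<partial>k' w)" for w
    have g: "g \<in> borel_measurable H"
      unfolding g_def[abs_def] using hm measurable_prob_algebraD[OF D]
      by (rule nn_integral_measurable_subprob_algebra2)
    have gconst: "g w = g (fst w, 0)" if "w \<in> space P" for w
      using g that fstP unfolding H_def
      by (intro vimage_algebra_fibre_const[of g "space P" fst ?B]) (auto simp: spP space_pair_measure)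
    have gk: "g (z, 0) = (\<integral>\<^sup>+y. h (z, y) \<partial>k z)" for z by (simp add: g_def k_def)
    have "(\<integral>\<^sup>+\<omega>. h (?Z \<omega>) \<partial>M) = (\<integral>\<^sup>+w. h w \<partial>P)" unfolding P_def by (rule nn_integral_distr'[OF Z h, symmetric])
    also have "\<dots> = (\<integral>\<^sup>+w. g w \<partial>P)"
      using P.cond_law_disintegration[OF H \<open>snd \<in> borel_measurable P\<close> k' hm] by (simp add: g_def)
    also have "\<dots> = (\<integral>\<^sup>+w. g (fst w, 0) \<partial>P)" using gconst by (intro nn_integral_cong)
    also have "\<dots> = (\<integral>\<^sup>+\<omega>. g (fst (?Z \<omega>), 0) \<partial>M)"
      unfolding P_def by (rule nn_integral_distr'[OF Z]) (rule measurable_compose[OF measurable_compose[OF measurable_fst sec] g])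
    finally show ?thesis by (simp add: gk)
  qed
  with km show ?thesis using that by blast
qed

text \<open>The joint conditional law of two variables is composed of the given law of the first and the
  kernel of the second given the first.\<close>

theorem (in prob_space) joint_cond_law:
  fixes X X' :: "'a \<Rightarrow> real"
  assumes G: "subalgebra M G" and X: "X \<in> borel_measurable M" and X': "X' \<in> borel_measurable M"
    and \<mu>: "is_cond_law M G X \<mu>" and \<mu>': "is_cond_law M G X' \<mu>'"
  obtains \<kappa> where "\<kappa> \<in> G \<rightarrow>\<^sub>M prob_algebra (borel :: (real \<times> real) measure)"
    "\<And>h. h \<in> borel_measurable (G \<Otimes>\<^sub>M borel) \<Longrightarrow>
      (\<integral>\<^sup>+\<omega>. h (\<omega>, (X \<omega>, X' \<omega>)) \<partial>M) = (\<integral>\<^sup>+\<omega>. \<integral>\<^sup>+z. h (\<omega>, z) \<partial>\<kappa> \<omega> \<partial>M)"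
    "AE \<omega> in M. distr (\<kappa> \<omega>) borel fst = \<mu> \<omega>" "AE \<omega> in M. distr (\<kappa> \<omega>) borel snd = \<mu>' \<omega>"
proof -
  have spG: "space G = space M" using G by (simp add: subalgebra_def)
  let ?B = "G \<Otimes>\<^sub>M (borel :: real measure)"
  note D = is_cond_lawD(1)[OF G X \<mu>]
  obtain k where k: "k \<in> ?B \<rightarrow>\<^sub>M prob_algebra (borel :: real measure)"
    and kint: "\<And>h. h \<in> borel_measurable (?B \<Otimes>\<^sub>M borel) \<Longrightarrow>
      (\<integral>\<^sup>+\<omega>. h ((\<omega>, X \<omega>), X' \<omega>) \<partial>M) = (\<integral>\<^sup>+\<omega>. \<integral>\<^sup>+y. h ((\<omega>, X \<omega>), y) \<partial>k (\<omega>, X \<omega>) \<partial>M)"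
    using cond_law_kernel[OF G X X'] by blast
  let ?K = "\<lambda>\<omega> x. distr (k (\<omega>, x)) (borel :: (real \<times> real) measure) (Pair x)"
  define \<kappa> where "\<kappa> \<omega> = \<mu> \<omega> \<bind> ?K \<omega>" for \<omega>
  have Pm: "case_prod Pair \<in> borel \<Otimes>\<^sub>M borel \<rightarrow>\<^sub>M (borel :: (real \<times> real) measure)" by (simp add: borel_prod)
  have KB: "(\<lambda>z. ?K (fst z) (snd z)) \<in> ?B \<rightarrow>\<^sub>M subprob_algebra borel"
  proof -
    have "(\<lambda>z. distr (k z) (borel :: (real \<times> real) measure) (\<lambda>y. (snd z, y))) \<in> ?B \<rightarrow>\<^sub>M subprob_algebra borel"
    proof (rule measurable_distr2[OF _ measurable_prob_algebraD[OF k]])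
      show "(\<lambda>(z, y). (snd z, y)) \<in> ?B \<Otimes>\<^sub>M borel \<rightarrow>\<^sub>M (borel :: (real \<times> real) measure)"
        unfolding borel_prod[symmetric] by measurable
    qed
    then show ?thesis by simp
  qed
  have K\<omega>: "?K \<omega> \<in> borel \<rightarrow>\<^sub>M subprob_algebra borel" if "\<omega> \<in> space M" for \<omega>
    using measurable_compose[OF measurable_Pair1'[of \<omega> G "borel :: real measure"] KB] that spG by simp
  have \<mu>s: "sets (\<mu> \<omega>) = sets borel" "prob_space (\<mu> \<omega>)" "space (\<mu> \<omega>) = UNIV" if "\<omega> \<in> space M" for \<omega>
  proof -
    show "sets (\<mu> \<omega>) = sets borel" "prob_space (\<mu> \<omega>)"
      using measurable_space[OF D, of \<omega>] that spG by (auto simp: space_prob_algebra)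
    from sets_eq_imp_space_eq[OF this(1)] show "space (\<mu> \<omega>) = UNIV" by simp
  qed
  have ks: "sets (k (\<omega>, x)) = sets borel" "prob_space (k (\<omega>, x))" if "\<omega> \<in> space M" for \<omega> x
    using measurable_space[OF k, of "(\<omega>, x)"] that spG by (auto simp: space_prob_algebra space_pair_measure)
  have K\<mu>: "?K \<omega> \<in> \<mu> \<omega> \<rightarrow>\<^sub>M subprob_algebra borel" if "\<omega> \<in> space M" for \<omega>
    using K\<omega>[OF that] by (simp add: measurable_cong_sets[OF \<mu>s(1)[OF that] refl])
  have \<kappa>int: "(\<integral>\<^sup>+z. f z \<partial>\<kappa> \<omega>) = (\<integral>\<^sup>+x. \<integral>\<^sup>+y. f (x, y) \<partial>k (\<omega>, x) \<partial>\<mu> \<omega>)" if "\<omega> \<in> space M" "f \<in> borel_measurable borel" for \<omega> f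
  proof -
    have "(\<integral>\<^sup>+z. f z \<partial>\<kappa> \<omega>) = (\<integral>\<^sup>+x. \<integral>\<^sup>+z. f z \<partial>?K \<omega> x \<partial>\<mu> \<omega>)"
      unfolding \<kappa>_def by (rule nn_integral_bind[OF that(2) K\<mu>[OF that(1)]])
    also have "\<dots> = (\<integral>\<^sup>+x. \<integral>\<^sup>+y. f (x, y) \<partial>k (\<omega>, x) \<partial>\<mu> \<omega>)"
    proof (intro nn_integral_cong)
      fix x
      have "Pair x \<in> borel \<rightarrow>\<^sub>M (borel :: (real \<times> real) measure)" unfolding borel_prod[symmetric] by simp
      then have "Pair x \<in> k (\<omega>, x) \<rightarrow>\<^sub>M (borel :: (real \<times> real) measure)"
        by (simp add: measurable_cong_sets[OF ks(1)[OF that(1)] refl])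
      then show "(\<integral>\<^sup>+z. f z \<partial>?K \<omega> x) = (\<integral>\<^sup>+y. f (x, y) \<partial>k (\<omega>, x))" using that(2) by (rule nn_integral_distr')
    qed
    finally show ?thesis .
  qed
  have \<kappa>S: "\<kappa> \<in> G \<rightarrow>\<^sub>M subprob_algebra borel"
    unfolding \<kappa>_def[abs_def] by (rule measurable_bind[OF measurable_prob_algebraD[OF D] KB])
  have \<kappa>s: "sets (\<kappa> \<omega>) = sets borel" "prob_space (\<kappa> \<omega>)" "space (\<kappa> \<omega>) = UNIV" if w: "\<omega> \<in> space M" for \<omega>
  proof -
    show 1: "sets (\<kappa> \<omega>) = sets borel" using sets_kernel[OF \<kappa>S] w spG by simp
    from sets_eq_imp_space_eq[OF this] show 2: "space (\<kappa> \<omega>) = UNIV" by simp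
    have "emeasure (\<kappa> \<omega>) UNIV = (\<integral>\<^sup>+z. 1 \<partial>\<kappa> \<omega>)" using 2 by simp
    also have "\<dots> = (\<integral>\<^sup>+x. \<integral>\<^sup>+y. 1 \<partial>k (\<omega>, x) \<partial>\<mu> \<omega>)" by (rule \<kappa>int[OF w]) simp
    also have "\<dots> = 1" using prob_space.emeasure_space_1[OF ks(2)[OF w]] prob_space.emeasure_space_1[OF \<mu>s(2)[OF w]] by simp
    finally show "prob_space (\<kappa> \<omega>)" using 2 by (intro prob_spaceI) simp
  qed
  have \<kappa>P: "\<kappa> \<in> G \<rightarrow>\<^sub>M prob_algebra borel"
    using \<kappa>S \<kappa>s(2) by (simp add: prob_algebra_def measurable_restrict_space2_iff spG)
  have main: "(\<integral>\<^sup>+\<omega>. h (\<omega>, (X \<omega>, X' \<omega>)) \<partial>M) = (\<integral>\<^sup>+\<omega>. \<integral>\<^sup>+z. h (\<omega>, z) \<partial>\<kappa> \<omega> \<partial>M)" if h: "h \<in> borel_measurable (G \<Otimes>\<^sub>M borel)" for h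
  proof -
    have h': "(\<lambda>((\<omega>, x), y). h (\<omega>, (x, y))) \<in> borel_measurable (?B \<Otimes>\<^sub>M borel)"
    proof -
      have "(\<lambda>z. (fst (fst z), (snd (fst z), snd z))) \<in> ?B \<Otimes>\<^sub>M borel \<rightarrow>\<^sub>M G \<Otimes>\<^sub>M (borel :: (real \<times> real) measure)"
        unfolding borel_prod[symmetric] by measurable
      from measurable_compose[OF this h] show ?thesis by (simp add: split_beta')
    qed
    have g: "(\<lambda>z. \<integral>\<^sup>+y. h (fst z, (snd z, y)) \<partial>k z) \<in> borel_measurable ?B"
      using h' measurable_prob_algebraD[OF k] by (intro nn_integral_measurable_subprob_algebra2) (auto simp: split_beta')
    have "(\<integral>\<^sup>+\<omega>. h (\<omega>, (X \<omega>, X' \<omega>)) \<partial>M) = (\<integral>\<^sup>+\<omega>. \<integral>\<^sup>+y. h (\<omega>, (X \<omega>, y)) \<partial>k (\<omega>, X \<omega>) \<partial>M)"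
      using kint[OF h'] by simp
    also have "\<dots> = (\<integral>\<^sup>+\<omega>. \<integral>\<^sup>+x. \<integral>\<^sup>+y. h (\<omega>, (x, y)) \<partial>k (\<omega>, x) \<partial>\<mu> \<omega> \<partial>M)"
      using cond_law_disintegration[OF G X \<mu> g] by simp
    also have "\<dots> = (\<integral>\<^sup>+\<omega>. \<integral>\<^sup>+z. h (\<omega>, z) \<partial>\<kappa> \<omega> \<partial>M)"
    proof (intro nn_integral_cong)
      fix \<omega> assume w: "\<omega> \<in> space M"
      have "(\<lambda>z. h (\<omega>, z)) \<in> borel_measurable borel"
        using measurable_compose[OF measurable_Pair1'[of \<omega> G borel] h] w spG by simp
      from \<kappa>int[OF w this] show "(\<integral>\<^sup>+x. \<integral>\<^sup>+y. h (\<omega>, (x, y)) \<partial>k (\<omega>, x) \<partial>\<mu> \<omega>) = (\<integral>\<^sup>+z. h (\<omega>, z) \<partial>\<kappa> \<omega>)" by simp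
    qed
    finally show ?thesis .
  qed
  have marg: "AE \<omega> in M. distr (\<kappa> \<omega>) borel p = \<nu> \<omega>"
    if p: "p \<in> borel_measurable borel" and \<nu>: "is_cond_law M G (\<lambda>\<omega>. p (X \<omega>, X' \<omega>)) \<nu>" for p :: "real \<times> real \<Rightarrow> real" and \<nu>
  proof (rule cond_law_unique[OF G _ \<nu>])
    have XX: "(\<lambda>\<omega>. (X \<omega>, X' \<omega>)) \<in> M \<rightarrow>\<^sub>M borel" unfolding borel_prod[symmetric] using X X' by (rule measurable_Pair)
    have pX: "(\<lambda>\<omega>. p (X \<omega>, X' \<omega>)) \<in> borel_measurable M" by (rule measurable_compose[OF XX p])
    have dk: "(\<lambda>\<omega>. distr (\<kappa> \<omega>) borel p) \<in> G \<rightarrow>\<^sub>M prob_algebra borel"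
      by (rule measurable_compose[OF \<kappa>P measurable_distr_prob_space[OF p]])
    show "is_cond_law M G (\<lambda>\<omega>. p (X \<omega>, X' \<omega>)) (\<lambda>\<omega>. distr (\<kappa> \<omega>) borel p)"
    proof (rule is_cond_lawI[OF G pX dk])
      fix A and B :: "real set" assume A: "A \<in> sets G" and B: "B \<in> sets borel"
      have AM: "A \<in> sets M" using A G by (auto simp: subalgebra_def)
      let ?h = "\<lambda>(\<omega>, z). indicator A \<omega> * indicator B (p z) :: ennreal"
      have h: "?h \<in> borel_measurable (G \<Otimes>\<^sub>M borel)"
      proof -
        note [measurable] = A B p
        show ?thesis by measurable
      qed
      have "(\<integral>\<^sup>+\<omega>\<in>A. emeasure (distr (\<kappa> \<omega>) borel p) B \<partial>M) = (\<integral>\<^sup>+\<omega>. \<integral>\<^sup>+z. ?h (\<omega>, z) \<partial>\<kappa> \<omega> \<partial>M)"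
      proof (intro nn_integral_cong)
        fix \<omega> assume w: "\<omega> \<in> space M"
        have pk: "p \<in> borel_measurable (\<kappa> \<omega>)" using p by (simp add: measurable_cong_sets[OF \<kappa>s(1)[OF w] refl])
        have "(\<integral>\<^sup>+z. ?h (\<omega>, z) \<partial>\<kappa> \<omega>) = indicator A \<omega> * (\<integral>\<^sup>+z. indicator B (p z) \<partial>\<kappa> \<omega>)"
          using pk B by (simp add: nn_integral_cmult)
        also have "(\<integral>\<^sup>+z. indicator B (p z) \<partial>\<kappa> \<omega>) = (\<integral>\<^sup>+y. indicator B y \<partial>distr (\<kappa> \<omega>) borel p)"
          by (rule nn_integral_distr'[OF pk, symmetric]) (use B in simp)
        also have "\<dots> = emeasure (distr (\<kappa> \<omega>) borel p) B" using B by simp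
        finally show "emeasure (distr (\<kappa> \<omega>) borel p) B * indicator A \<omega> = (\<integral>\<^sup>+z. ?h (\<omega>, z) \<partial>\<kappa> \<omega>)" by (simp add: mult.commute)
      qed
      also have "\<dots> = (\<integral>\<^sup>+\<omega>. ?h (\<omega>, (X \<omega>, X' \<omega>)) \<partial>M)" by (rule main[OF h, symmetric])
      also have "\<dots> = (\<integral>\<^sup>+\<omega>. indicator (A \<inter> ((\<lambda>\<omega>. p (X \<omega>, X' \<omega>)) -` B \<inter> space M)) \<omega> \<partial>M)"
        by (intro nn_integral_cong) (auto split: split_indicator)
      also have "\<dots> = emeasure M (A \<inter> ((\<lambda>\<omega>. p (X \<omega>, X' \<omega>)) -` B \<inter> space M))"
        by (rule nn_integral_indicator[OF sets.Int[OF AM measurable_sets[OF pX B]]])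
      finally show "(\<integral>\<^sup>+\<omega>\<in>A. emeasure (distr (\<kappa> \<omega>) borel p) B \<partial>M) = emeasure M (A \<inter> ((\<lambda>\<omega>. p (X \<omega>, X' \<omega>)) -` B \<inter> space M))" .
    qed
  qed
  have "AE \<omega> in M. distr (\<kappa> \<omega>) borel fst = \<mu> \<omega>" using \<mu> by (intro marg) (auto simp: borel_prod[symmetric])
  moreover have "AE \<omega> in M. distr (\<kappa> \<omega>) borel snd = \<mu>' \<omega>" using \<mu>' by (intro marg) (auto simp: borel_prod[symmetric])
  ultimately show ?thesis using \<kappa>P main that by blast
qed

section \<open>The Wasserstein distance along conditional laws\<close>

lemma coupling_cost_bounds:
  assumes "\<pi> \<in> couplings m m'"
  shows "0 \<le> W2 m m'" "(W2 m m')\<^sup>2 \<le> (\<integral>z. (fst z - snd z)\<^sup>2 \<partial>\<pi>)" "W2 m m' \<le> sqrt (\<integral>z. (fst z - snd z)\<^sup>2 \<partial>\<pi>)"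
proof -
  let ?c = "\<lambda>\<pi> :: (real \<times> real) measure. \<integral>z. (fst z - snd z)\<^sup>2 \<partial>\<pi>"
  have lower: "(INF \<pi>\<in>couplings m m'. ?c \<pi>) \<le> ?c \<pi>"
    by (rule cINF_lower[OF _ assms]) (auto intro!: bdd_belowI[of _ 0])
  have nonneg: "0 \<le> (INF \<pi>\<in>couplings m m'. ?c \<pi>)"
    using assms by (intro cINF_greatest) auto
  show "0 \<le> W2 m m'" "(W2 m m')\<^sup>2 \<le> ?c \<pi>" "W2 m m' \<le> sqrt (?c \<pi>)"
    using lower nonneg by (auto simp: W2_def)
qed

lemma (in prob_space) joint_law_coupling:
  assumes "\<xi> \<in> borel_measurable M" "\<xi>' \<in> borel_measurable M"
  shows "distr M borel (\<lambda>\<omega>. (\<xi> \<omega>, \<xi>' \<omega>)) \<in> couplings (distr M borel \<xi>) (distr M borel \<xi>')"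
    "(\<integral>z. (fst z - snd z)\<^sup>2 \<partial>distr M borel (\<lambda>\<omega>. (\<xi> \<omega>, \<xi>' \<omega>))) = (\<integral>\<omega>. (\<xi> \<omega> - \<xi>' \<omega>)\<^sup>2 \<partial>M)"
proof -
  have m: "(\<lambda>\<omega>. (\<xi> \<omega>, \<xi>' \<omega>)) \<in> M \<rightarrow>\<^sub>M (borel :: (real \<times> real) measure)"
    unfolding borel_prod[symmetric] using assms by (rule measurable_Pair)
  have ps: "(fst :: real \<times> real \<Rightarrow> real) \<in> borel_measurable borel" "(snd :: real \<times> real \<Rightarrow> real) \<in> borel_measurable borel"
    by (auto simp: borel_prod[symmetric])
  show "distr M borel (\<lambda>\<omega>. (\<xi> \<omega>, \<xi>' \<omega>)) \<in> couplings (distr M borel \<xi>) (distr M borel \<xi>')"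
    using m ps prob_space_distr[OF m] by (auto simp: couplings_def space_prob_algebra distr_distr comp_def)
  have "(\<lambda>z :: real \<times> real. (fst z - snd z)\<^sup>2) \<in> borel_measurable borel"
    using ps by (intro borel_measurable_power borel_measurable_diff)
  then show "(\<integral>z. (fst z - snd z)\<^sup>2 \<partial>distr M borel (\<lambda>\<omega>. (\<xi> \<omega>, \<xi>' \<omega>))) = (\<integral>\<omega>. (\<xi> \<omega> - \<xi>' \<omega>)\<^sup>2 \<partial>M)"
    by (simp add: integral_distr[OF m])
qed

lemma (in prob_space) W2_distr_le:
  assumes "\<xi> \<in> borel_measurable M" "\<xi>' \<in> borel_measurable M"
  shows "W2 (distr M borel \<xi>) (distr M borel \<xi>') \<le> sqrt (\<integral>\<omega>. (\<xi> \<omega> - \<xi>' \<omega>)\<^sup>2 \<partial>M)"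
  using coupling_cost_bounds(3)[OF joint_law_coupling(1)[OF assms]] joint_law_coupling(2)[OF assms] by simp

lemma (in prob_space) distr_in_P2:
  assumes "\<xi> \<in> L2_vars M M" shows "distr M borel \<xi> \<in> P2"
  using assms prob_space_distr[of \<xi> borel]
  by (auto simp: P2_def L2_vars_def space_prob_algebra integrable_distr_eq)

lemma P2D:
  assumes "m \<in> P2"
  shows "real_distribution m" "prob_space m" "sets m = sets borel" "space m = UNIV" "(\<lambda>x. x) \<in> L2_vars m m"
proof -
  show "prob_space m" "sets m = sets borel" using assms by (auto simp: P2_def space_prob_algebra)
  then show "real_distribution m" by (simp add: real_distribution_def real_distribution_axioms_def)
  show "space m = UNIV" using sets_eq_imp_space_eq[OF \<open>sets m = sets borel\<close>] by simp
  have "(\<lambda>x. x) \<in> borel_measurable m" by (simp add: measurable_cong_sets[OF \<open>sets m = sets borel\<close> refl])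
  then show "(\<lambda>x. x) \<in> L2_vars m m" using assms by (simp add: P2_def L2_vars_def)
qed

text \<open>Rounding up to the grid of mesh \<open>1/N\<close> in \<open>[-N,N]\<close>, written as a sum of steps.\<close>

definition grid_steps :: "nat \<Rightarrow> (nat \<Rightarrow> bool) \<Rightarrow> real" where
  "grid_steps N s = - real N + (\<Sum>j<2*N^2. of_bool (s j)) / real N"

abbreviation grid_round :: "nat \<Rightarrow> real \<Rightarrow> real" where
  "grid_round N x \<equiv> grid_steps N (\<lambda>j. - real N + real j / real N < x)"

lemma sum_steps: "(\<Sum>j<n. of_bool (real j < y)) = real (min n (nat \<lceil>y\<rceil>))"
proof (induction n)
  case (Suc n)
  have "real n < y \<longleftrightarrow> n < nat \<lceil>y\<rceil>" by linarith
  then show ?case using Suc by (auto simp: min_def)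
qed simp

lemma grid_round_bounds:
  assumes N: "N \<ge> 1"
  shows "\<bar>grid_round N x\<bar> \<le> \<bar>x\<bar> + 1" "\<bar>x\<bar> < real N \<Longrightarrow> \<bar>grid_round N x - x\<bar> \<le> 1 / real N"
proof -
  let ?y = "(x + real N) * real N"
  define c where "c = real (min (2*N^2) (nat \<lceil>?y\<rceil>))"
  have Np: "0 < real N" using N by simp
  have "(- real N + real j / real N < x) = (real j < ?y)" for j
    using Np by (simp add: field_simps)
  then have r: "grid_round N x = - real N + c / real N"
    by (simp only: grid_steps_def sum_steps c_def)
  have cN: "c \<le> 2 * real N * real N"
  proof -
    have "min (2*N^2) (nat \<lceil>?y\<rceil>) \<le> 2*N^2" by (rule min.cobounded1)
    then have "c \<le> real (2*N^2)" unfolding c_def by (rule of_nat_mono)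
    then show ?thesis by (simp add: power2_eq_square)
  qed
  have c0: "0 \<le> c" unfolding c_def by (rule of_nat_0_le_iff)
  have range: "\<bar>grid_round N x\<bar> \<le> real N"
  proof -
    have "c / real N \<le> 2 * real N" using Np cN by (simp add: pos_divide_le_eq)
    moreover have "0 \<le> c / real N" using c0 by simp
    ultimately show ?thesis unfolding r abs_le_iff by linarith
  qed
  show near: "\<bar>grid_round N x - x\<bar> \<le> 1 / real N" if "\<bar>x\<bar> < real N"
  proof -
    have y0: "0 < ?y" using that Np by (intro mult_pos_pos) auto
    have "?y \<le> (2 * real N) * real N" using that Np by (intro mult_right_mono) auto
    then have "?y \<le> real_of_int (int (2 * N^2))" by (simp add: power2_eq_square)
    then have "nat \<lceil>?y\<rceil> \<le> 2 * N^2" by (simp only: ceiling_le_iff nat_le_iff)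
    then have c: "c = real_of_int \<lceil>?y\<rceil>" using y0 unfolding c_def by (simp only: min_absorb2) simp
    have "?y \<le> c" "c \<le> ?y + 1" unfolding c by linarith+
    then have "?y / real N \<le> c / real N" "c / real N \<le> (?y + 1) / real N"
      using Np by (intro divide_right_mono; simp)+
    moreover have "?y / real N = x + real N" "(?y + 1) / real N = x + real N + 1 / real N"
      using Np by (auto simp: field_simps)
    ultimately show ?thesis unfolding r abs_le_iff by linarith
  qed
  show "\<bar>grid_round N x\<bar> \<le> \<bar>x\<bar> + 1"
  proof (cases "\<bar>x\<bar> < real N")
    case True
    have "1 / real N \<le> 1" using N by simp
    then show ?thesis using near[OF True] by linarith
  qed (use range in linarith)
qed

lemma grid_round_tendsto: "(\<lambda>N. grid_round N x) \<longlonglongrightarrow> x"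
proof -
  obtain N0 where N0: "\<bar>x\<bar> < real N0" using reals_Archimedean2 by blast
  have "(\<lambda>N. grid_round N x - x) \<longlonglongrightarrow> 0"
  proof (rule Lim_null_comparison[OF _ lim_1_over_n])
    show "eventually (\<lambda>N. norm (grid_round N x - x) \<le> 1 / real N) sequentially"
      using eventually_ge_at_top[of "max 1 N0"]
    proof eventually_elim
      case (elim N)
      then have "1 \<le> N" "\<bar>x\<bar> < real N" using N0 by auto
      from grid_round_bounds(2)[OF this] show ?case by simp
    qed
  qed
  from tendsto_add[OF this tendsto_const[of x]] show ?thesis by simp
qed

lemma grid_round_L2:
  assumes m: "m \<in> P2"
  shows "(\<lambda>N. \<integral>x. (x - grid_round N x)\<^sup>2 \<partial>m) \<longlonglongrightarrow> 0"
proof -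
  interpret prob_space m by (rule P2D(2)[OF m])
  have rm: "grid_round N \<in> borel_measurable m" for N
    unfolding grid_steps_def measurable_cong_sets[OF P2D(3)[OF m] refl] by measurable
  have idm: "(\<lambda>x. x) \<in> borel_measurable m" using P2D(5)[OF m] by (simp add: L2_vars_def)
  have "(\<lambda>N. \<integral>x. (x - grid_round (Suc N) x)\<^sup>2 \<partial>m) \<longlonglongrightarrow> (\<integral>x. 0 \<partial>m)"
  proof (rule integral_dominated_convergence[where w="\<lambda>x. 8 * x\<^sup>2 + 2"])
    show "integrable m (\<lambda>x. 8 * x\<^sup>2 + 2)" using P2D(5)[OF m] by (simp add: L2_vars_def)
    show "(\<lambda>x. (x - grid_round (Suc N) x)\<^sup>2) \<in> borel_measurable m" for N using rm idm by measurable
    show "AE x in m. (\<lambda>N. (x - grid_round (Suc N) x)\<^sup>2) \<longlonglongrightarrow> 0"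
    proof (rule AE_I2)
      fix x
      have "(\<lambda>N. (x - grid_round (Suc N) x)\<^sup>2) \<longlonglongrightarrow> (x - x)\<^sup>2"
        by (intro tendsto_intros LIMSEQ_Suc[OF grid_round_tendsto])
      then show "(\<lambda>N. (x - grid_round (Suc N) x)\<^sup>2) \<longlonglongrightarrow> 0" by simp
    qed
    show "AE x in m. norm ((x - grid_round (Suc N) x)\<^sup>2) \<le> 8 * x\<^sup>2 + 2" for N
    proof (rule AE_I2)
      fix x
      have "\<bar>x - grid_round (Suc N) x\<bar> \<le> 2 * \<bar>x\<bar> + 1" using grid_round_bounds(1)[of "Suc N" x] by linarith
      then have "(x - grid_round (Suc N) x)\<^sup>2 \<le> (2 * \<bar>x\<bar> + 1)\<^sup>2" by (metis abs_ge_zero power2_abs power_mono)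
      also have "\<dots> \<le> 8 * x\<^sup>2 + 2"
        using zero_le_power2[of "2 * \<bar>x\<bar> - 1"] by (simp add: power2_sum power2_diff power_mult_distrib)
      finally show "norm ((x - grid_round (Suc N) x)\<^sup>2) \<le> 8 * x\<^sup>2 + 2" by simp
    qed
  qed simp
  then have "(\<lambda>N. \<integral>x. (x - grid_round (Suc N) x)\<^sup>2 \<partial>m) \<longlonglongrightarrow> 0" by (simp only: Bochner_Integration.integral_zero)
  then show ?thesis by (rule LIMSEQ_imp_Suc[of "\<lambda>N. \<integral>x. (x - grid_round N x)\<^sup>2 \<partial>m"])
qed

abbreviation unit_lborel :: "real measure" where "unit_lborel \<equiv> restrict_space lborel {0<..<1}"

lemma prob_space_unit: "prob_space unit_lborel"
  by (auto simp: emeasure_restrict_space space_restrict_space intro!: prob_spaceI)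

text \<open>If \<open>c j\<close> is the value of a distribution function at the \<open>j\<close>-th grid point, this is the quantile
  function rounded to the grid.\<close>

definition step_map :: "nat \<Rightarrow> (nat \<Rightarrow> real) \<Rightarrow> real \<Rightarrow> real" where
  "step_map N c u = grid_steps N (\<lambda>j. c j < u)"

lemma step_map_L2: "step_map N c \<in> L2_vars unit_lborel unit_lborel"
proof -
  interpret U: prob_space unit_lborel by (rule prob_space_unit)
  have m: "(\<lambda>x. x) \<in> borel_measurable unit_lborel" by (intro measurable_restrict_space1) simp
  have "step_map N c \<in> borel_measurable unit_lborel"
    unfolding step_map_def[abs_def] grid_steps_def using m by measurable
  moreover have "\<bar>step_map N c u\<bar> \<le> real N + real (2*N^2) / real N" for u
  proof -
    have "0 \<le> (\<Sum>j<2*N^2. of_bool (c j < u) :: real)" by (intro sum_nonneg) auto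
    moreover have "(\<Sum>j<2*N^2. of_bool (c j < u)) \<le> (\<Sum>j<2*N^2. 1 :: real)" by (intro sum_mono) auto
    ultimately have "0 \<le> (\<Sum>j<2*N^2. of_bool (c j < u) :: real) / real N" "(\<Sum>j<2*N^2. of_bool (c j < u)) / real N \<le> real (2*N^2) / real N"
      by (auto intro!: divide_right_mono divide_nonneg_nonneg)
    then show ?thesis unfolding step_map_def grid_steps_def by linarith
  qed
  ultimately show ?thesis using L2_vars_bounded[OF U.finite_measure_axioms subalgebra_refl] by blast
qed

text \<open>Moving each jump of a step function by at most \<open>e\<close> changes it on a set of small measure only.\<close>

lemma step_map_perturb:
  assumes N: "N \<ge> 1" and c: "\<And>j. \<bar>c j - c' j\<bar> \<le> e"
  shows "(\<integral>u. (step_map N c u - step_map N c' u)\<^sup>2 \<partial>unit_lborel) \<le> 4 * real N ^ 2 * e"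
proof -
  interpret U: prob_space unit_lborel by (rule prob_space_unit)
  let ?n = "2 * N^2"
  have Np: "0 < real N" using N by simp
  let ?S = "\<lambda>j. {min (c j) (c' j)<..max (c j) (c' j)}"
  have bound: "(step_map N c u - step_map N c' u)\<^sup>2 \<le> (\<Sum>j<?n. indicator (?S j) u) * 2" for u
  proof -
    let ?d = "\<lambda>j. of_bool (c j < u) - of_bool (c' j < u) :: real"
    let ?s = "(\<Sum>j<?n. indicator (?S j) u) :: real"
    have e: "step_map N c u - step_map N c' u = (\<Sum>j<?n. ?d j) / real N"
      by (simp add: step_map_def grid_steps_def sum_subtractf diff_divide_distrib)
    have "\<bar>\<Sum>j<?n. ?d j\<bar> \<le> (\<Sum>j<?n. \<bar>?d j\<bar>)" by (rule sum_abs)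
    also have "\<dots> \<le> ?s" by (intro sum_mono) (auto simp: indicator_def)
    finally have d: "\<bar>\<Sum>j<?n. ?d j\<bar> \<le> ?s" .
    have "?s \<le> (\<Sum>j<?n. 1)" by (intro sum_mono) (auto simp: indicator_def)
    then have s: "?s \<le> real ?n" by simp
    have s0: "0 \<le> ?s" by (intro sum_nonneg) auto
    have sq: "D\<^sup>2 \<le> S * K" if "\<bar>D\<bar> \<le> S" "S \<le> K" "0 \<le> S" for D S K :: real
    proof -
      have "D\<^sup>2 \<le> S\<^sup>2" using that abs_le_square_iff[of D S] by simp
      also have "\<dots> \<le> S * K" unfolding power2_eq_square using that by (intro mult_left_mono)
      finally show ?thesis .
    qed
    have "(\<Sum>j<?n. ?d j)\<^sup>2 \<le> ?s * real ?n" by (rule sq[OF d s s0])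
    then have "(\<Sum>j<?n. ?d j)\<^sup>2 / (real N)\<^sup>2 \<le> ?s * real ?n / (real N)\<^sup>2" by (rule divide_right_mono) simp
    also have "?s * real ?n / (real N)\<^sup>2 = ?s * 2" using Np by simp
    finally show ?thesis unfolding e by (simp add: power_divide)
  qed
  have Ii: "integrable unit_lborel (\<lambda>u. indicator (?S j) u :: real)" for j
    by (rule U.integrable_const_bound[of _ 1]) (auto intro!: measurable_restrict_space1 split: split_indicator)
  have Iv: "(\<integral>u. indicator (?S j) u \<partial>unit_lborel) \<le> e" for j
  proof -
    have "(\<integral>u. indicator (?S j) u \<partial>unit_lborel) = (\<integral>u. indicator {0<..<1} u *\<^sub>R (indicator (?S j) u :: real) \<partial>lborel)"
      by (intro integral_restrict_space) simp
    also have "\<dots> = measure lborel ({0<..<1} \<inter> ?S j)"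
      by (simp add: indicator_inter_arith[symmetric])
    also have "\<dots> \<le> measure lborel (?S j)"
      by (intro measure_mono_fmeasurable fmeasurableI) auto
    also have "\<dots> = max (c j) (c' j) - min (c j) (c' j)" by (rule measure_lborel_Ioc) simp
    also have "\<dots> \<le> e" using c[of j] by linarith
    finally show ?thesis .
  qed
  have "(\<integral>u. (step_map N c u - step_map N c' u)\<^sup>2 \<partial>unit_lborel) \<le> (\<integral>u. (\<Sum>j<?n. indicator (?S j) u) * 2 \<partial>unit_lborel)"
    using bound Ii L2_diff[OF step_map_L2 step_map_L2, of N c N c'] by (intro integral_mono) (auto simp: L2_vars_def)
  also have "\<dots> = (\<Sum>j<?n. \<integral>u. indicator (?S j) u \<partial>unit_lborel) * 2"
    using Ii by (simp add: Bochner_Integration.integral_sum)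
  also have "\<dots> \<le> (\<Sum>j<?n. e) * 2" using Iv by (intro mult_right_mono sum_mono) auto
  also have "\<dots> = 4 * real N ^ 2 * e" by simp
  finally show ?thesis .
qed

lemma measurable_list_count_space:
  fixes f :: "nat \<Rightarrow> 'a \<Rightarrow> int"
  assumes "\<And>j. j \<in> set js \<Longrightarrow> f j \<in> G \<rightarrow>\<^sub>M count_space UNIV"
  shows "(\<lambda>\<omega>. map (\<lambda>j. f j \<omega>) js) \<in> G \<rightarrow>\<^sub>M count_space UNIV"
  using assms
proof (induction js)
  case (Cons j js)
  then have 1: "f j \<in> G \<rightarrow>\<^sub>M count_space UNIV" and 2: "(\<lambda>\<omega>. map (\<lambda>j. f j \<omega>) js) \<in> G \<rightarrow>\<^sub>M count_space UNIV" by auto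
  show ?case
    unfolding measurable_count_space_eq2_countable
  proof (intro conjI ballI)
    fix xs :: "int list"
    show "(\<lambda>\<omega>. map (\<lambda>j. f j \<omega>) (j # js)) -` {xs} \<inter> space G \<in> sets G"
    proof (cases xs)
      case (Cons y ys)
      have "(\<lambda>\<omega>. map (\<lambda>j. f j \<omega>) (j # js)) -` {xs} \<inter> space G =
         (f j -` {y} \<inter> space G) \<inter> ((\<lambda>\<omega>. map (\<lambda>j. f j \<omega>) js) -` {ys} \<inter> space G)" using Cons by auto
      also have "\<dots> \<in> sets G" using 1 2 by (intro sets.Int measurable_sets) auto
      finally show ?thesis .
    next
      case Nil
      have "(\<lambda>\<omega>. map (\<lambda>j. f j \<omega>) (j # js)) -` {[]} = {}" by auto
      then show ?thesis unfolding Nil by (simp only: Int_empty_left sets.empty_sets)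
    qed
  qed simp
qed simp

text \<open>A \<open>W2\<close>-continuous function of a random law is measurable already for the \<open>\<sigma>\<close>-algebra of the
  evaluations: the quantile function is approximated by step functions whose finitely many jumps
  are rounded values of the distribution function, so that the approximating laws depend on \<open>\<omega>\<close>
  through countably many values only.\<close>

theorem W2_lipschitz_measurable:
  assumes \<phi>: "\<And>m m'. m \<in> P2 \<Longrightarrow> m' \<in> P2 \<Longrightarrow> \<bar>\<phi> m - \<phi> m'\<bar> \<le> K * W2 m m'"
    and K: "0 \<le> K" and \<kappa>: "\<kappa> \<in> G \<rightarrow>\<^sub>M prob_algebra borel" and P2: "\<And>\<omega>. \<omega> \<in> space G \<Longrightarrow> \<kappa> \<omega> \<in> P2"
  shows "(\<lambda>\<omega>. \<phi> (\<kappa> \<omega>) :: real) \<in> borel_measurable G"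
proof -
  interpret U: prob_space unit_lborel by (rule prob_space_unit)
  let ?x = "\<lambda>N j. - real N + real j / real N"
  \<comment> \<open>There are \<open>2 N\<^sup>2\<close> jumps, so an accuracy of \<open>N\<^sup>-\<^sup>3\<close> in the distribution function suffices.\<close>
  let ?i = "\<lambda>N \<omega> j. \<lfloor>real N ^ 3 * measure (\<kappa> \<omega>) {..?x N j}\<rfloor>"
  let ?l = "\<lambda>N \<omega>. map (?i N \<omega>) [0..<2*N^2]"
  define \<nu> where "\<nu> N is = distr unit_lborel borel (step_map N (\<lambda>j. real_of_int (is ! j) / real N ^ 3))" for N and "is" :: "int list"
  have im: "(\<lambda>\<omega>. ?i N \<omega> j) \<in> G \<rightarrow>\<^sub>M count_space UNIV" for N j
  proof -
    have "(\<lambda>\<omega>. measure (\<kappa> \<omega>) {..?x N j}) \<in> borel_measurable G"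
      using measurable_emeasure_kernel[OF measurable_prob_algebraD[OF \<kappa>], of "{..?x N j}"] unfolding measure_def by measurable
    then show ?thesis by measurable
  qed
  have lm: "?l N \<in> G \<rightarrow>\<^sub>M count_space UNIV" for N
    using im by (intro measurable_list_count_space) auto
  have approx_m: "(\<lambda>\<omega>. \<phi> (\<nu> N (?l N \<omega>))) \<in> borel_measurable G" for N
    by (rule measurable_compose[OF lm]) simp
  have conv: "(\<lambda>N. \<phi> (\<nu> N (?l N \<omega>))) \<longlonglongrightarrow> \<phi> (\<kappa> \<omega>)" if w: "\<omega> \<in> space G" for \<omega>
  proof -
    let ?m = "\<kappa> \<omega>"
    have m: "?m \<in> P2" using P2[OF w] .
    interpret C: cdf_distribution ?m unfolding cdf_distribution_def by (rule P2D(1)[OF m])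
    define q where "q = C.I"
    have qd: "distr unit_lborel borel q = ?m" unfolding q_def by (rule C.distr_I_eq_M)
    have qm: "q \<in> borel_measurable unit_lborel"
    proof -
      have "sets (restrict_space borel {0<..<1::real}) = sets unit_lborel" by (intro sets_restrict_space_cong) simp
      from measurable_cong_sets[OF this refl] C.measurable_CI show ?thesis unfolding q_def by blast
    qed
    have q: "u \<le> measure ?m {..x} \<longleftrightarrow> q u \<le> x" if "u \<in> {0<..<1}" for u x
      using C.pseudoinverse' that unfolding q_def cdf_def by blast
    have q2: "integrable unit_lborel (\<lambda>u. (q u)\<^sup>2)"
    proof -
      have "integrable (distr unit_lborel borel q) (\<lambda>x. x\<^sup>2)" unfolding qd using P2D(5)[OF m] by (simp add: L2_vars_def)
      then show ?thesis using qm by (simp add: integrable_distr_eq)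
    qed
    have qL: "q \<in> L2_vars unit_lborel unit_lborel" using qm q2 by (simp add: L2_vars_def)
    define e where "e N = (\<integral>x. (x - grid_round N x)\<^sup>2 \<partial>?m)" for N
    have dist: "W2 ?m (\<nu> N (?l N \<omega>)) \<le> sqrt (2 * e N + 8 / real N)" if N: "N \<ge> 1" for N
    proof -
      have Np: "0 < real N" using N by simp
      let ?c = "\<lambda>j. measure ?m {..?x N j}"
      let ?c' = "\<lambda>j. if j < 2*N^2 then real_of_int (?i N \<omega> j) / real N ^ 3 else ?c j"
      have same: "step_map N (\<lambda>j. real_of_int (?l N \<omega> ! j) / real N ^ 3) = step_map N ?c'"
        by (auto simp: step_map_def grid_steps_def fun_eq_iff intro!: sum.cong)
      have sr: "step_map N ?c u = grid_round N (q u)" if "u \<in> {0<..<1}" for u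
      proof -
        have "(?c j < u) = (?x N j < q u)" for j using q[OF that, of "?x N j"] by auto
        then show ?thesis by (simp only: step_map_def)
      qed
      have cc: "\<bar>?c j - ?c' j\<bar> \<le> 1 / real N ^ 3" for j
      proof (cases "j < 2*N^2")
        case True
        have "\<bar>real N ^ 3 * ?c j - real_of_int (?i N \<omega> j)\<bar> \<le> 1" by linarith
        then have "\<bar>real N ^ 3 * ?c j - real_of_int (?i N \<omega> j)\<bar> / real N ^ 3 \<le> 1 / real N ^ 3"
          by (intro divide_right_mono) auto
        moreover have "?c j - ?c' j = (real N ^ 3 * ?c j - real_of_int (?i N \<omega> j)) / real N ^ 3"
          using True Np by (simp add: diff_divide_distrib)
        then have "\<bar>?c j - ?c' j\<bar> = \<bar>real N ^ 3 * ?c j - real_of_int (?i N \<omega> j)\<bar> / real N ^ 3"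
          by (simp only: abs_divide) simp
        ultimately show ?thesis by simp
      qed simp
      have d1: "(\<integral>u. (q u - step_map N ?c u)\<^sup>2 \<partial>unit_lborel) = e N"
      proof -
        have rm: "(\<lambda>x. (x - grid_round N x)\<^sup>2) \<in> borel_measurable borel" unfolding grid_steps_def by measurable
        have "e N = (\<integral>x. (x - grid_round N x)\<^sup>2 \<partial>distr unit_lborel borel q)" by (simp add: e_def qd)
        also have "\<dots> = (\<integral>u. (q u - grid_round N (q u))\<^sup>2 \<partial>unit_lborel)" by (rule integral_distr[OF qm rm])
        also have "\<dots> = (\<integral>u. (q u - step_map N ?c u)\<^sup>2 \<partial>unit_lborel)"
        proof (intro Bochner_Integration.integral_cong refl)
          fix u assume "u \<in> space unit_lborel"
          then have "u \<in> {0<..<1}" by (simp add: space_restrict_space)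
          then show "(q u - grid_round N (q u))\<^sup>2 = (q u - step_map N ?c u)\<^sup>2" by (simp only: sr)
        qed
        finally show ?thesis by (rule sym)
      qed
      have d2: "(\<integral>u. (step_map N ?c u - step_map N ?c' u)\<^sup>2 \<partial>unit_lborel) \<le> 4 / real N"
      proof -
        have "4 * real N ^ 2 * (1 / real N ^ 3) = 4 / real N" using Np by (simp add: power2_eq_square power3_eq_cube)
        then show ?thesis using step_map_perturb[OF N cc] by simp
      qed
      note L = L2_diff[OF qL step_map_L2[of N ?c]] L2_diff[OF step_map_L2[of N ?c] step_map_L2[of N ?c']]
        L2_diff[OF qL step_map_L2[of N ?c']]
      have "(\<integral>u. (q u - step_map N ?c' u)\<^sup>2 \<partial>unit_lborel) \<le>
        (\<integral>u. 2 * (q u - step_map N ?c u)\<^sup>2 + 2 * (step_map N ?c u - step_map N ?c' u)\<^sup>2 \<partial>unit_lborel)"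
      proof (rule integral_mono)
        fix u
        have "(a - b)\<^sup>2 \<le> 2 * (a - d)\<^sup>2 + 2 * (d - b)\<^sup>2" for a b d :: real
          using zero_le_power2[of "(a - d) - (d - b)"] by (simp add: power2_eq_square algebra_simps)
        then show "(q u - step_map N ?c' u)\<^sup>2 \<le> 2 * (q u - step_map N ?c u)\<^sup>2 + 2 * (step_map N ?c u - step_map N ?c' u)\<^sup>2" .
      qed (use L in \<open>simp_all add: L2_vars_def\<close>)
      also have "\<dots> = 2 * e N + 2 * (\<integral>u. (step_map N ?c u - step_map N ?c' u)\<^sup>2 \<partial>unit_lborel)"
        using L d1 by (simp add: L2_vars_def)
      also have "\<dots> \<le> 2 * e N + 8 / real N" using d2 by simp
      finally have "sqrt (\<integral>u. (q u - step_map N ?c' u)\<^sup>2 \<partial>unit_lborel) \<le> sqrt (2 * e N + 8 / real N)" by simp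
      moreover have "W2 ?m (\<nu> N (?l N \<omega>)) \<le> sqrt (\<integral>u. (q u - step_map N ?c' u)\<^sup>2 \<partial>unit_lborel)"
        using U.W2_distr_le[OF qm L2_varsD(1)[OF step_map_L2[of N ?c']]] unfolding \<nu>_def same qd .
      ultimately show ?thesis by (rule order_trans[rotated])
    qed
    have nP2: "\<nu> N is \<in> P2" for N "is" unfolding \<nu>_def by (rule U.distr_in_P2[OF step_map_L2])
    have lim: "(\<lambda>N. K * sqrt (2 * e N + 8 / real N)) \<longlonglongrightarrow> 0"
    proof -
      have "(\<lambda>N. K * sqrt (2 * e N + 8 / real N)) \<longlonglongrightarrow> K * sqrt (2 * 0 + 0)"
        unfolding e_def by (intro tendsto_intros grid_round_L2[OF m])
      then show ?thesis by simp
    qed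
    have "(\<lambda>N. \<phi> (\<nu> N (?l N \<omega>)) - \<phi> ?m) \<longlonglongrightarrow> 0"
    proof (rule Lim_null_comparison[OF _ lim])
      show "eventually (\<lambda>N. norm (\<phi> (\<nu> N (?l N \<omega>)) - \<phi> ?m) \<le> K * sqrt (2 * e N + 8 / real N)) sequentially"
        using eventually_ge_at_top[of 1]
      proof eventually_elim
        case (elim N)
        have "norm (\<phi> (\<nu> N (?l N \<omega>)) - \<phi> ?m) \<le> K * W2 ?m (\<nu> N (?l N \<omega>))"
          using \<phi>[OF m nP2] by (simp add: abs_minus_commute)
        also have "\<dots> \<le> K * sqrt (2 * e N + 8 / real N)" using dist[OF elim] K by (rule mult_left_mono)
        finally show ?case .
      qed
    qed
    from tendsto_add[OF this tendsto_const[of "\<phi> ?m"]] show ?thesis by simp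
  qed
  show ?thesis by (rule borel_measurable_LIMSEQ_real[OF conv approx_m])
qed

text \<open>Round the continuous variable to a grid, which leaves countably many measurable sections.\<close>

lemma caratheodory_measurable:
  fixes f :: "real \<Rightarrow> 'a \<Rightarrow> real"
  assumes m: "\<And>x. f x \<in> borel_measurable G" and c: "\<And>\<omega>. \<omega> \<in> space G \<Longrightarrow> continuous_on UNIV (\<lambda>x. f x \<omega>)"
  shows "(\<lambda>(\<omega>, x). f x \<omega>) \<in> borel_measurable (G \<Otimes>\<^sub>M borel)"
proof (rule borel_measurable_LIMSEQ_real)
  let ?g = "\<lambda>n (\<omega>, x). f (real_of_int \<lfloor>real (Suc n) * x\<rfloor> / real (Suc n)) \<omega>"
  fix z assume z: "z \<in> space (G \<Otimes>\<^sub>M (borel :: real measure))"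
  obtain \<omega> x where zz: "z = (\<omega>, x)" by (cases z)
  have "(\<lambda>n. real_of_int \<lfloor>real (Suc n) * x\<rfloor> / real (Suc n)) \<longlonglongrightarrow> x"
  proof (rule real_tendsto_sandwich)
    show "\<forall>\<^sub>F n in sequentially. x - 1 / real (Suc n) \<le> real_of_int \<lfloor>real (Suc n) * x\<rfloor> / real (Suc n)"
    proof (intro always_eventually allI)
      fix n
      have "real (Suc n) * x - 1 \<le> real_of_int \<lfloor>real (Suc n) * x\<rfloor>" by linarith
      then have "(real (Suc n) * x - 1) / real (Suc n) \<le> real_of_int \<lfloor>real (Suc n) * x\<rfloor> / real (Suc n)"
        by (intro divide_right_mono) auto
      moreover have "(real (Suc n) * x - 1) / real (Suc n) = x - 1 / real (Suc n)" by (simp add: diff_divide_distrib del: of_nat_Suc)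
      ultimately show "x - 1 / real (Suc n) \<le> real_of_int \<lfloor>real (Suc n) * x\<rfloor> / real (Suc n)" by simp
    qed
    show "\<forall>\<^sub>F n in sequentially. real_of_int \<lfloor>real (Suc n) * x\<rfloor> / real (Suc n) \<le> x"
    proof (intro always_eventually allI)
      fix n
      have "real_of_int \<lfloor>real (Suc n) * x\<rfloor> \<le> real (Suc n) * x" by linarith
      then have "real_of_int \<lfloor>real (Suc n) * x\<rfloor> / real (Suc n) \<le> (real (Suc n) * x) / real (Suc n)"
        by (intro divide_right_mono) auto
      then show "real_of_int \<lfloor>real (Suc n) * x\<rfloor> / real (Suc n) \<le> x" by (simp del: of_nat_Suc)
    qed
    show "(\<lambda>n. x - 1 / real (Suc n)) \<longlonglongrightarrow> x"
      using tendsto_diff[OF tendsto_const LIMSEQ_inverse_real_of_nat, of x] by (simp add: inverse_eq_divide)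
  qed simp
  moreover have "isCont (\<lambda>x. f x \<omega>) x" using c z zz by (auto simp: space_pair_measure continuous_on_eq_continuous_at)
  ultimately have "(\<lambda>n. f (real_of_int \<lfloor>real (Suc n) * x\<rfloor> / real (Suc n)) \<omega>) \<longlonglongrightarrow> f x \<omega>"
    by (rule isCont_tendsto_compose[rotated])
  then show "(\<lambda>n. ?g n z) \<longlonglongrightarrow> (\<lambda>(\<omega>, x). f x \<omega>) z" by (simp add: zz)
next
  fix n
  have "(\<lambda>z. f (real_of_int \<lfloor>real (Suc n) * snd z\<rfloor> / real (Suc n)) (fst z)) \<in> borel_measurable (G \<Otimes>\<^sub>M borel)"
  proof (rule measurable_compose_countable[of "\<lambda>i z. f (real_of_int i / real (Suc n)) (fst z)" _ _ "\<lambda>z. \<lfloor>real (Suc n) * snd z\<rfloor>"])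
    show "(\<lambda>z. f (real_of_int i / real (Suc n)) (fst z)) \<in> borel_measurable (G \<Otimes>\<^sub>M borel)" for i
      by (rule measurable_compose[OF measurable_fst m])
  qed measurable
  then show "(\<lambda>(\<omega>, x). f (real_of_int \<lfloor>real (Suc n) * x\<rfloor> / real (Suc n)) \<omega>) \<in> borel_measurable (G \<Otimes>\<^sub>M borel)"
    by (simp add: split_beta')
qed

locale cond_law_pair = prob_space M for M :: "'a measure" +
  fixes G :: "'a measure" and X X' :: "'a \<Rightarrow> real" and \<mu> \<mu>' :: "'a \<Rightarrow> real measure"
  assumes G: "subalgebra M G" and X: "X \<in> L2_vars M M" and X': "X' \<in> L2_vars M M"
    and \<mu>: "is_cond_law M G X \<mu>" and \<mu>': "is_cond_law M G X' \<mu>'"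
    and P2: "\<And>\<omega>. \<omega> \<in> space M \<Longrightarrow> \<mu> \<omega> \<in> P2" "\<And>\<omega>. \<omega> \<in> space M \<Longrightarrow> \<mu>' \<omega> \<in> P2"
begin

lemma spG: "space G = space M" using G by (simp add: subalgebra_def)

text \<open>The joint conditional law couples the two conditional laws, and its cost averages to the
  squared distance of the variables. The cost \<open>h\<close> serves as a measurable majorant of the squared
  distance of the conditional laws.\<close>

theorem W2_cond_laws:
  obtains h where "integrable M h" "\<And>\<omega>. 0 \<le> h \<omega>" "(\<integral>\<omega>. h \<omega> \<partial>M) = (\<integral>\<omega>. (X' \<omega> - X \<omega>)\<^sup>2 \<partial>M)"
    "AE \<omega> in M. 0 \<le> W2 (\<mu> \<omega>) (\<mu>' \<omega>) \<and> (W2 (\<mu> \<omega>) (\<mu>' \<omega>))\<^sup>2 \<le> h \<omega>"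
proof -
  obtain \<kappa> where \<kappa>: "\<kappa> \<in> G \<rightarrow>\<^sub>M prob_algebra (borel :: (real \<times> real) measure)"
    and main: "\<And>h. h \<in> borel_measurable (G \<Otimes>\<^sub>M borel) \<Longrightarrow>
      (\<integral>\<^sup>+\<omega>. h (\<omega>, (X \<omega>, X' \<omega>)) \<partial>M) = (\<integral>\<^sup>+\<omega>. \<integral>\<^sup>+z. h (\<omega>, z) \<partial>\<kappa> \<omega> \<partial>M)"
    and marg: "AE \<omega> in M. distr (\<kappa> \<omega>) borel fst = \<mu> \<omega>" "AE \<omega> in M. distr (\<kappa> \<omega>) borel snd = \<mu>' \<omega>"
    by (rule joint_cond_law[OF G L2_varsD(1)[OF X] L2_varsD(1)[OF X'] \<mu> \<mu>']) blast
  have cm: "(\<lambda>z :: real \<times> real. (fst z - snd z)\<^sup>2) \<in> borel_measurable borel"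
    unfolding borel_prod[symmetric] by measurable
  define hn where "hn \<omega> = (\<integral>\<^sup>+z. ennreal ((fst z - snd z)\<^sup>2) \<partial>\<kappa> \<omega>)" for \<omega>
  define h where "h \<omega> = enn2real (hn \<omega>)" for \<omega>
  have hG: "hn \<in> borel_measurable G"
    unfolding hn_def[abs_def]
    using measurable_compose[OF measurable_prob_algebraD[OF \<kappa>] nn_integral_measurable_subprob_algebra[of "\<lambda>z. ennreal ((fst z - snd z)\<^sup>2)"]] cm
    by simp
  have hM [measurable]: "hn \<in> borel_measurable M" using measurable_from_subalg[OF G hG] .
  have d: "integrable M (\<lambda>\<omega>. (X' \<omega> - X \<omega>)\<^sup>2)" using L2_diff[OF X' X] by (simp add: L2_vars_def)
  have "(\<integral>\<^sup>+\<omega>. hn \<omega> \<partial>M) = (\<integral>\<^sup>+\<omega>. ennreal ((X \<omega> - X' \<omega>)\<^sup>2) \<partial>M)"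
    unfolding hn_def using main[of "\<lambda>(\<omega>, z). ennreal ((fst z - snd z)\<^sup>2)"] measurable_compose[OF measurable_snd cm, of G]
    by (simp add: split_beta')
  also have "\<dots> = (\<integral>\<^sup>+\<omega>. ennreal ((X' \<omega> - X \<omega>)\<^sup>2) \<partial>M)" by (simp only: power2_commute)
  also have "\<dots> = ennreal (\<integral>\<omega>. (X' \<omega> - X \<omega>)\<^sup>2 \<partial>M)" using d by (intro nn_integral_eq_integral) auto
  finally have e: "(\<integral>\<^sup>+\<omega>. hn \<omega> \<partial>M) = ennreal (\<integral>\<omega>. (X' \<omega> - X \<omega>)\<^sup>2 \<partial>M)" .
  have fin: "AE \<omega> in M. hn \<omega> \<noteq> \<infinity>" by (rule nn_integral_PInf_AE[OF hM]) (simp add: e)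
  have eh: "(\<integral>\<^sup>+\<omega>. ennreal (h \<omega>) \<partial>M) = ennreal (\<integral>\<omega>. (X' \<omega> - X \<omega>)\<^sup>2 \<partial>M)"
  proof -
    have "(\<integral>\<^sup>+\<omega>. ennreal (h \<omega>) \<partial>M) = (\<integral>\<^sup>+\<omega>. hn \<omega> \<partial>M)"
      using fin by (intro nn_integral_cong_AE) (auto simp: h_def less_top elim!: eventually_mono)
    then show ?thesis by (simp add: e)
  qed
  have h0: "0 \<le> h \<omega>" for \<omega> by (simp add: h_def)
  have hm: "h \<in> borel_measurable M" unfolding h_def[abs_def] by measurable
  have hi: "integrable M h" using eh h0 hm by (intro integrableI_nonneg) auto
  have "ennreal (\<integral>\<omega>. h \<omega> \<partial>M) = ennreal (\<integral>\<omega>. (X' \<omega> - X \<omega>)\<^sup>2 \<partial>M)"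
    using nn_integral_eq_integral[OF hi] h0 eh by simp
  then have heq: "(\<integral>\<omega>. h \<omega> \<partial>M) = (\<integral>\<omega>. (X' \<omega> - X \<omega>)\<^sup>2 \<partial>M)" using h0 by (subst (asm) ennreal_inj) auto
  have "AE \<omega> in M. 0 \<le> W2 (\<mu> \<omega>) (\<mu>' \<omega>) \<and> (W2 (\<mu> \<omega>) (\<mu>' \<omega>))\<^sup>2 \<le> h \<omega>"
    using marg AE_space
  proof eventually_elim
    case (elim \<omega>)
    have "\<kappa> \<omega> \<in> space (prob_algebra borel)" using measurable_space[OF \<kappa>, of \<omega>] elim(3) by (simp add: spG)
    then have c: "\<kappa> \<omega> \<in> couplings (\<mu> \<omega>) (\<mu>' \<omega>)" using elim by (simp add: couplings_def)
    have sk: "sets (\<kappa> \<omega>) = sets borel" using \<open>\<kappa> \<omega> \<in> space (prob_algebra borel)\<close> by (simp add: space_prob_algebra)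
    have "(\<integral>z. (fst z - snd z)\<^sup>2 \<partial>\<kappa> \<omega>) = h \<omega>"
      unfolding h_def hn_def using cm by (intro integral_eq_nn_integral) (auto simp: measurable_cong_sets[OF sk refl])
    then show ?case using coupling_cost_bounds(1,2)[OF c] by simp
  qed
  then show ?thesis using that[OF hi h0 heq] by blast
qed

text \<open>Weak monotonicity is a statement about laws; applied to the joint conditional law at each
  \<open>\<omega>\<close> and averaged, it holds conditionally on the common noise.\<close>

theorem weakly_monotone_cond_laws:
  assumes mono: "weakly_monotone \<phi>" and K: "0 \<le> K"
    and lip: "\<And>x x' m m'. m \<in> P2 \<Longrightarrow> m' \<in> P2 \<Longrightarrow> \<bar>\<phi> x' m' - \<phi> x m\<bar> \<le> K * (\<bar>x' - x\<bar> + W2 m m')"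
    and lipx: "\<And>x x' m. m \<in> P2 \<Longrightarrow> \<bar>\<phi> x' m - \<phi> x m\<bar> \<le> K * \<bar>x' - x\<bar>"
    and lipm: "\<And>x m m'. m \<in> P2 \<Longrightarrow> m' \<in> P2 \<Longrightarrow> \<bar>\<phi> x m - \<phi> x m'\<bar> \<le> K * W2 m m'"
  shows "(\<lambda>\<omega>. \<phi> (X' \<omega>) (\<mu>' \<omega>) - \<phi> (X \<omega>) (\<mu> \<omega>)) \<in> L2_vars M M"
    "0 \<le> (\<integral>\<omega>. (\<phi> (X' \<omega>) (\<mu>' \<omega>) - \<phi> (X \<omega>) (\<mu> \<omega>)) * (X' \<omega> - X \<omega>) \<partial>M)"
    "(\<integral>\<omega>. (\<phi> (X' \<omega>) (\<mu>' \<omega>) - \<phi> (X \<omega>) (\<mu> \<omega>))\<^sup>2 \<partial>M) \<le> 4 * K\<^sup>2 * (\<integral>\<omega>. (X' \<omega> - X \<omega>)\<^sup>2 \<partial>M)"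
proof -
  obtain \<kappa> where \<kappa>: "\<kappa> \<in> G \<rightarrow>\<^sub>M prob_algebra (borel :: (real \<times> real) measure)"
    and main: "\<And>h. h \<in> borel_measurable (G \<Otimes>\<^sub>M borel) \<Longrightarrow>
      (\<integral>\<^sup>+\<omega>. h (\<omega>, (X \<omega>, X' \<omega>)) \<partial>M) = (\<integral>\<^sup>+\<omega>. \<integral>\<^sup>+z. h (\<omega>, z) \<partial>\<kappa> \<omega> \<partial>M)"
    and marg: "AE \<omega> in M. distr (\<kappa> \<omega>) borel fst = \<mu> \<omega>" "AE \<omega> in M. distr (\<kappa> \<omega>) borel snd = \<mu>' \<omega>"
    by (rule joint_cond_law[OF G L2_varsD(1)[OF X] L2_varsD(1)[OF X'] \<mu> \<mu>']) blast
  obtain h where h: "integrable M h" "\<And>\<omega>. 0 \<le> h \<omega>" "(\<integral>\<omega>. h \<omega> \<partial>M) = (\<integral>\<omega>. (X' \<omega> - X \<omega>)\<^sup>2 \<partial>M)"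
    "AE \<omega> in M. 0 \<le> W2 (\<mu> \<omega>) (\<mu>' \<omega>) \<and> (W2 (\<mu> \<omega>) (\<mu>' \<omega>))\<^sup>2 \<le> h \<omega>" by (rule W2_cond_laws) blast
  have joint: "(\<lambda>(\<omega>, x). \<phi> x (\<nu> \<omega>)) \<in> borel_measurable (G \<Otimes>\<^sub>M borel)"
    if "\<nu> \<in> G \<rightarrow>\<^sub>M prob_algebra borel" "\<And>\<omega>. \<omega> \<in> space G \<Longrightarrow> \<nu> \<omega> \<in> P2" for \<nu>
  proof (rule caratheodory_measurable)
    show "(\<lambda>\<omega>. \<phi> x (\<nu> \<omega>)) \<in> borel_measurable G" for x
      by (rule W2_lipschitz_measurable[OF lipm K that])
    show "continuous_on UNIV (\<lambda>x. \<phi> x (\<nu> \<omega>))" if "\<omega> \<in> space G" for \<omega>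
    proof (rule lipschitz_on_continuous_on, rule lipschitz_onI)
      show "dist (\<phi> x (\<nu> \<omega>)) (\<phi> y (\<nu> \<omega>)) \<le> K * dist x y" for x y
        using lipx[OF \<open>\<And>\<omega>. \<omega> \<in> space G \<Longrightarrow> \<nu> \<omega> \<in> P2\<close>[OF that], of x y] by (simp add: dist_real_def)
    qed (rule K)
  qed
  have \<mu>G: "\<mu> \<in> G \<rightarrow>\<^sub>M prob_algebra borel" "\<mu>' \<in> G \<rightarrow>\<^sub>M prob_algebra borel"
    using \<mu> \<mu>' by (auto simp: is_cond_law_def)
  have j1: "(\<lambda>(\<omega>, x). \<phi> x (\<mu> \<omega>)) \<in> borel_measurable (G \<Otimes>\<^sub>M borel)" using P2 by (intro joint \<mu>G) (simp add: spG)
  have j2: "(\<lambda>(\<omega>, x). \<phi> x (\<mu>' \<omega>)) \<in> borel_measurable (G \<Otimes>\<^sub>M borel)" using P2 by (intro joint \<mu>G) (simp add: spG)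
  define \<Phi> where "\<Phi> w = (\<phi> (snd (snd w)) (\<mu>' (fst w)) - \<phi> (fst (snd w)) (\<mu> (fst w))) * (snd (snd w) - fst (snd w))" for w
  have idG: "(\<lambda>\<omega>. \<omega>) \<in> M \<rightarrow>\<^sub>M G" by (rule measurable_from_subalg[OF G]) simp
  have \<Phi>m: "\<Phi> \<in> borel_measurable (G \<Otimes>\<^sub>M (borel :: (real \<times> real) measure))"
  proof -
    have p: "(\<lambda>w. (fst w, fst (snd w))) \<in> G \<Otimes>\<^sub>M (borel \<Otimes>\<^sub>M borel) \<rightarrow>\<^sub>M G \<Otimes>\<^sub>M borel"
      "(\<lambda>w. (fst w, snd (snd w))) \<in> G \<Otimes>\<^sub>M (borel \<Otimes>\<^sub>M borel) \<rightarrow>\<^sub>M G \<Otimes>\<^sub>M borel" by measurable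
    have "(\<lambda>w. \<phi> (fst (snd w)) (\<mu> (fst w))) \<in> borel_measurable (G \<Otimes>\<^sub>M (borel \<Otimes>\<^sub>M borel))"
      "(\<lambda>w. \<phi> (snd (snd w)) (\<mu>' (fst w))) \<in> borel_measurable (G \<Otimes>\<^sub>M (borel \<Otimes>\<^sub>M borel))"
      using measurable_compose[OF p(1) j1] measurable_compose[OF p(2) j2] by (simp_all add: split_beta')
    then show ?thesis unfolding \<Phi>_def[abs_def] borel_prod[symmetric] by measurable
  qed
  let ?d = "\<lambda>\<omega>. \<phi> (X' \<omega>) (\<mu>' \<omega>) - \<phi> (X \<omega>) (\<mu> \<omega>)"
  have dm: "?d \<in> borel_measurable M"
    using measurable_compose[OF measurable_Pair[OF idG L2_varsD(1)[OF X]] j1]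
      measurable_compose[OF measurable_Pair[OF idG L2_varsD(1)[OF X']] j2] by simp
  have DX: "(\<lambda>\<omega>. X' \<omega> - X \<omega>) \<in> L2_vars M M" by (rule L2_diff[OF X' X])
  have bd: "AE \<omega> in M. (?d \<omega>)\<^sup>2 \<le> 2 * K\<^sup>2 * ((X' \<omega> - X \<omega>)\<^sup>2 + h \<omega>)"
    using h(4) AE_space
  proof eventually_elim
    case (elim \<omega>)
    have "\<bar>?d \<omega>\<bar> \<le> K * (\<bar>X' \<omega> - X \<omega>\<bar> + W2 (\<mu> \<omega>) (\<mu>' \<omega>))" using lip P2 elim by blast
    then have "(?d \<omega>)\<^sup>2 \<le> (K * (\<bar>X' \<omega> - X \<omega>\<bar> + W2 (\<mu> \<omega>) (\<mu>' \<omega>)))\<^sup>2"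
      using K elim by (subst abs_le_square_iff[symmetric]) simp
    also have "\<dots> = K\<^sup>2 * (\<bar>X' \<omega> - X \<omega>\<bar> + W2 (\<mu> \<omega>) (\<mu>' \<omega>))\<^sup>2" by (simp add: power_mult_distrib)
    also have "\<dots> \<le> K\<^sup>2 * (2 * ((X' \<omega> - X \<omega>)\<^sup>2 + h \<omega>))"
    proof (rule mult_left_mono)
      have "(\<bar>X' \<omega> - X \<omega>\<bar> + W2 (\<mu> \<omega>) (\<mu>' \<omega>))\<^sup>2 \<le> 2 * ((X' \<omega> - X \<omega>)\<^sup>2 + (W2 (\<mu> \<omega>) (\<mu>' \<omega>))\<^sup>2)"
        using sum_squares_bound[of "\<bar>X' \<omega> - X \<omega>\<bar>" "W2 (\<mu> \<omega>) (\<mu>' \<omega>)"] by (simp add: power2_sum)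
      also have "\<dots> \<le> 2 * ((X' \<omega> - X \<omega>)\<^sup>2 + h \<omega>)" using elim by simp
      finally show "(\<bar>X' \<omega> - X \<omega>\<bar> + W2 (\<mu> \<omega>) (\<mu>' \<omega>))\<^sup>2 \<le> 2 * ((X' \<omega> - X \<omega>)\<^sup>2 + h \<omega>)" .
    qed simp
    finally show ?case by (simp only: mult_ac)
  qed
  have bi: "integrable M (\<lambda>\<omega>. 2 * K\<^sup>2 * ((X' \<omega> - X \<omega>)\<^sup>2 + h \<omega>))" using DX h(1) by (simp add: L2_vars_def)
  have d2: "integrable M (\<lambda>\<omega>. (?d \<omega>)\<^sup>2)"
    by (rule Bochner_Integration.integrable_bound[OF bi]) (use dm bd in \<open>auto elim!: eventually_mono\<close>)
  show dL: "?d \<in> L2_vars M M" using dm d2 by (simp add: L2_vars_def)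
  have "(\<integral>\<omega>. (?d \<omega>)\<^sup>2 \<partial>M) \<le> (\<integral>\<omega>. 2 * K\<^sup>2 * ((X' \<omega> - X \<omega>)\<^sup>2 + h \<omega>) \<partial>M)"
    by (rule integral_mono_AE[OF d2 bi bd])
  also have "\<dots> = 4 * K\<^sup>2 * (\<integral>\<omega>. (X' \<omega> - X \<omega>)\<^sup>2 \<partial>M)" using DX h(1,3) by (simp add: L2_vars_def)
  finally show "(\<integral>\<omega>. (?d \<omega>)\<^sup>2 \<partial>M) \<le> 4 * K\<^sup>2 * (\<integral>\<omega>. (X' \<omega> - X \<omega>)\<^sup>2 \<partial>M)" .
  have di: "integrable M (\<lambda>\<omega>. ?d \<omega> * (X' \<omega> - X \<omega>))" by (rule L2_vars_mult_integrable[OF dL DX])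
  \<comment> \<open>The positive and the negative part of the integral are \<open>p 1\<close> and \<open>p (-1)\<close>.\<close>
  define p where "p s \<omega> = (\<integral>\<^sup>+z. ennreal (s * \<Phi> (\<omega>, z)) \<partial>\<kappa> \<omega>)" for s :: real and \<omega>
  have pe: "(\<integral>\<^sup>+\<omega>. ennreal (s * (?d \<omega> * (X' \<omega> - X \<omega>))) \<partial>M) = (\<integral>\<^sup>+\<omega>. p s \<omega> \<partial>M)" for s
  proof -
    have "(\<lambda>w. ennreal (s * \<Phi> w)) \<in> borel_measurable (G \<Otimes>\<^sub>M borel)" using \<Phi>m by measurable
    from main[OF this] show ?thesis by (simp add: p_def \<Phi>_def)
  qed
  have pm: "p s \<in> borel_measurable M" for s
  proof -
    have "(\<lambda>(\<omega>, z). ennreal (s * \<Phi> (\<omega>, z))) \<in> borel_measurable (G \<Otimes>\<^sub>M borel)" using \<Phi>m by (simp add: split_beta')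
    from nn_integral_measurable_subprob_algebra2[OF this measurable_prob_algebraD[OF \<kappa>]]
    have "p s \<in> borel_measurable G" by (simp add: p_def[abs_def])
    then show ?thesis by (rule measurable_from_subalg[OF G])
  qed
  have pfin: "AE \<omega> in M. p s \<omega> \<noteq> \<infinity>" for s
  proof (rule nn_integral_PInf_AE[OF pm])
    have "(\<integral>\<^sup>+\<omega>. ennreal (s * (?d \<omega> * (X' \<omega> - X \<omega>))) \<partial>M) \<le> (\<integral>\<^sup>+\<omega>. ennreal (norm (s * (?d \<omega> * (X' \<omega> - X \<omega>)))) \<partial>M)"
      by (intro nn_integral_mono ennreal_leI) simp
    also have "\<dots> < \<infinity>" using integrable_mult_right[OF di, of s] unfolding integrable_iff_bounded by blast
    finally show "(\<integral>\<^sup>+\<omega>. p s \<omega> \<partial>M) \<noteq> \<infinity>" unfolding pe by simp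
  qed
  have "AE \<omega> in M. p (-1) \<omega> \<le> p 1 \<omega>"
    using pfin[of 1] pfin[of "-1"] marg AE_space
  proof eventually_elim
    case (elim \<omega>)
    have k: "\<kappa> \<omega> \<in> space (prob_algebra borel)" using measurable_space[OF \<kappa>, of \<omega>] elim by (simp add: spG)
    have sk: "sets (\<kappa> \<omega>) = sets borel" and pk: "prob_space (\<kappa> \<omega>)" using k by (auto simp: space_prob_algebra)
    have mk: "f \<in> borel_measurable (\<kappa> \<omega>)" if "f \<in> borel_measurable borel" for f :: "real \<times> real \<Rightarrow> real"
      using that by (simp add: measurable_cong_sets[OF sk refl])
    have fs: "(fst :: real \<times> real \<Rightarrow> real) \<in> borel_measurable (\<kappa> \<omega>)" "(snd :: real \<times> real \<Rightarrow> real) \<in> borel_measurable (\<kappa> \<omega>)"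
      by (auto intro!: mk simp: borel_prod[symmetric])
    have "integrable (distr (\<kappa> \<omega>) borel fst) (\<lambda>x. x\<^sup>2)" "integrable (distr (\<kappa> \<omega>) borel snd) (\<lambda>x. x\<^sup>2)"
      using P2D(5)[OF P2(1)] P2D(5)[OF P2(2)] elim by (auto simp: L2_vars_def)
    then have L: "fst \<in> L2_vars (\<kappa> \<omega>) (\<kappa> \<omega>)" "snd \<in> L2_vars (\<kappa> \<omega>) (\<kappa> \<omega>)"
      using fs by (auto simp: L2_vars_def integrable_distr_eq)
    have "0 \<le> (\<integral>z. (\<phi> (snd z) (distr (\<kappa> \<omega>) borel snd) - \<phi> (fst z) (distr (\<kappa> \<omega>) borel fst)) * (snd z - fst z) \<partial>\<kappa> \<omega>)"
      using mono pk L unfolding weakly_monotone_def by blast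
    then have "0 \<le> (\<integral>z. \<Phi> (\<omega>, z) \<partial>\<kappa> \<omega>)" using elim by (simp add: \<Phi>_def)
    moreover have \<Phi>\<omega>: "(\<lambda>z. \<Phi> (\<omega>, z)) \<in> borel_measurable (\<kappa> \<omega>)"
      using measurable_compose[OF measurable_Pair1'[of \<omega> G borel] \<Phi>m] elim by (intro mk) (auto simp: spG)
    have ii: "integrable (\<kappa> \<omega>) (\<lambda>z. \<Phi> (\<omega>, z))"
      using \<Phi>\<omega> elim(1,2) unfolding real_integrable_def p_def by simp
    have "(\<integral>z. \<Phi> (\<omega>, z) \<partial>\<kappa> \<omega>) = enn2real (p 1 \<omega>) - enn2real (p (-1) \<omega>)"
      using real_lebesgue_integral_def[OF ii] by (simp add: p_def)
    ultimately have "enn2real (p (-1) \<omega>) \<le> enn2real (p 1 \<omega>)" by simp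
    then have "ennreal (enn2real (p (-1) \<omega>)) \<le> ennreal (enn2real (p 1 \<omega>))" by (rule ennreal_leI)
    moreover have "ennreal (enn2real (p 1 \<omega>)) = p 1 \<omega>" "ennreal (enn2real (p (-1) \<omega>)) = p (-1) \<omega>"
      using elim(1,2) by (simp_all add: less_top)
    ultimately show ?case by metis
  qed
  then have le: "(\<integral>\<^sup>+\<omega>. p (-1) \<omega> \<partial>M) \<le> (\<integral>\<^sup>+\<omega>. p 1 \<omega> \<partial>M)" by (rule nn_integral_mono_AE)
  have "(\<integral>\<^sup>+\<omega>. p 1 \<omega> \<partial>M) < \<infinity>"
  proof -
    have "(\<integral>\<^sup>+\<omega>. ennreal (1 * (?d \<omega> * (X' \<omega> - X \<omega>))) \<partial>M) \<le> (\<integral>\<^sup>+\<omega>. ennreal (norm (?d \<omega> * (X' \<omega> - X \<omega>))) \<partial>M)"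
      by (intro nn_integral_mono ennreal_leI) simp
    also have "\<dots> < \<infinity>" using di unfolding integrable_iff_bounded by blast
    finally show ?thesis unfolding pe .
  qed
  then have "enn2real (\<integral>\<^sup>+\<omega>. p (-1) \<omega> \<partial>M) \<le> enn2real (\<integral>\<^sup>+\<omega>. p 1 \<omega> \<partial>M)" using le by (intro enn2real_mono) auto
  moreover have "(\<integral>\<omega>. ?d \<omega> * (X' \<omega> - X \<omega>) \<partial>M) = enn2real (\<integral>\<^sup>+\<omega>. p 1 \<omega> \<partial>M) - enn2real (\<integral>\<^sup>+\<omega>. p (-1) \<omega> \<partial>M)"
    using real_lebesgue_integral_def[OF di] pe[of 1] pe[of "-1"] by simp
  ultimately show "0 \<le> (\<integral>\<omega>. ?d \<omega> * (X' \<omega> - X \<omega>) \<partial>M)" by simp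
qed

end

section \<open>The minimiser of the Hamiltonian\<close>

lemma W2_nonneg:
  assumes "m \<in> P2" "m' \<in> P2" shows "0 \<le> W2 m m'"
proof -
  interpret m: prob_space m by (rule P2D(2)[OF assms(1)])
  interpret m': prob_space m' by (rule P2D(2)[OF assms(2)])
  interpret P: pair_prob_space m m' ..
  have f: "fst \<in> m \<Otimes>\<^sub>M m' \<rightarrow>\<^sub>M borel" "snd \<in> m \<Otimes>\<^sub>M m' \<rightarrow>\<^sub>M borel"
    using measurable_fst[of m m'] measurable_snd[of m m']
    by (simp_all add: measurable_cong_sets[OF refl P2D(3)[OF assms(1)]] measurable_cong_sets[OF refl P2D(3)[OF assms(2)]])
  have "distr (m \<Otimes>\<^sub>M m') borel fst = distr (m \<Otimes>\<^sub>M m') m fst" "distr (m \<Otimes>\<^sub>M m') borel snd = distr (m \<Otimes>\<^sub>M m') m' snd"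
    by (intro distr_cong; simp add: P2D(3)[OF assms(1)] P2D(3)[OF assms(2)])+
  moreover have "distr (m \<Otimes>\<^sub>M m') m fst = m" by (rule m'.distr_pair_fst)
  moreover have "distr (m \<Otimes>\<^sub>M m') m' snd = m'"
  proof (intro measure_eqI)
    fix A assume "A \<in> sets (distr (m \<Otimes>\<^sub>M m') m' snd)"
    then have A: "A \<in> sets m'" by simp
    have "snd -` A \<inter> space (m \<Otimes>\<^sub>M m') = space m \<times> A" using sets.sets_into_space[OF A] by (auto simp: space_pair_measure)
    then show "emeasure (distr (m \<Otimes>\<^sub>M m') m' snd) A = emeasure m' A"
      using A by (simp add: emeasure_distr m'.emeasure_pair_measure_Times m.emeasure_space_1)
  qed simp
  ultimately show ?thesis
    using coupling_cost_bounds(1)[OF P.joint_law_coupling(1)[OF f]] by simp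
qed

text \<open>A point of \<open>P2\<close> at which expressions independent of the measure argument can be evaluated.\<close>

lemma dirac_P2: "return borel (0::real) \<in> P2" "second_moment (return borel 0) = 0"
proof -
  have "(\<lambda>x. x\<^sup>2) \<in> borel_measurable (borel :: real measure)" by measurable
  then show "return borel (0::real) \<in> P2" "second_moment (return borel 0) = 0"
    using prob_space_return[of "0::real" borel]
    by (auto simp: P2_def second_moment_def space_prob_algebra integral_return integrable_iff_bounded nn_integral_return)
qed

locale fbsde_data =
  fixes T L :: real
    and b :: coeff and b0 :: "real \<Rightarrow> real measure \<Rightarrow> real" and b1 b2 :: "real \<Rightarrow> real"
    and \<sigma> :: coeff and \<sigma>0 :: "real \<Rightarrow> real measure \<Rightarrow> real" and \<sigma>1 \<sigma>2 :: "real \<Rightarrow> real"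
    and \<sigma>\<^sub>c :: coeff and \<sigma>\<^sub>c0 :: "real \<Rightarrow> real measure \<Rightarrow> real" and \<sigma>\<^sub>c1 \<sigma>\<^sub>c2 :: "real \<Rightarrow> real"
    and f :: coeff and f0 :: "real \<Rightarrow> real \<Rightarrow> real \<Rightarrow> real" and f1 :: "real \<Rightarrow> real \<Rightarrow> real measure \<Rightarrow> real"
    and g :: "real \<Rightarrow> real measure \<Rightarrow> real" and L\<^sub>m C\<^sub>f :: real
  assumes L_pos: "0 < L" and data: "measurable_data T b \<sigma> \<sigma>\<^sub>c f g"
    and H1: "H1 T L b b0 b1 b2 \<sigma> \<sigma>0 \<sigma>1 \<sigma>2 \<sigma>\<^sub>c \<sigma>\<^sub>c0 \<sigma>\<^sub>c1 \<sigma>\<^sub>c2"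
    and H2: "H2 T L f g" and H3: "H3 T L f f0 f1 g" and H4: "H4 T C\<^sub>f f0 f1 g"
    and H5: "H5 T L L\<^sub>m b0 \<sigma>0 \<sigma>\<^sub>c0 f1 g" and H6: "H6 T f1 g"
begin

abbreviation "f0x t x u \<equiv> deriv (\<lambda>y. f0 t y u) x"
abbreviation "f0u t x u \<equiv> deriv (\<lambda>v. f0 t x v) u"
abbreviation "f1x t x m \<equiv> deriv (\<lambda>y. f1 t y m) x"
abbreviation "gx x m \<equiv> deriv (\<lambda>y. g y m) x"
abbreviation "slope t p q q\<^sub>c \<equiv> b2 t * p + \<sigma>2 t * q + \<sigma>\<^sub>c2 t * q\<^sub>c"
abbreviation "uh \<equiv> u_hat b \<sigma> \<sigma>\<^sub>c f"

lemma Cf_pos: "0 < C\<^sub>f" using H4 by (simp add: H4_def)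

lemma affine:
  assumes "t \<in> {0..T}" "m \<in> P2"
  shows "b t x u m = b0 t m + b1 t * x + b2 t * u" "\<sigma> t x u m = \<sigma>0 t m + \<sigma>1 t * x + \<sigma>2 t * u"
    "\<sigma>\<^sub>c t x u m = \<sigma>\<^sub>c0 t m + \<sigma>\<^sub>c1 t * x + \<sigma>\<^sub>c2 t * u"
  using H1 assms by (simp_all add: H1_def affine_coeff_def)

lemma coeff_bounds:
  assumes "t \<in> {0..T}"
  shows "\<bar>b1 t\<bar> \<le> L" "\<bar>b2 t\<bar> \<le> L" "\<bar>\<sigma>1 t\<bar> \<le> L" "\<bar>\<sigma>2 t\<bar> \<le> L" "\<bar>\<sigma>\<^sub>c1 t\<bar> \<le> L" "\<bar>\<sigma>\<^sub>c2 t\<bar> \<le> L"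
    "m \<in> P2 \<Longrightarrow> \<bar>b0 t m\<bar> \<le> L * (1 + sqrt (second_moment m))"
  using H1 assms by (simp_all add: H1_def affine_coeff_def)

lemma coeff_measurable:
  shows "b1 \<in> borel_measurable (borel_time T)" "b2 \<in> borel_measurable (borel_time T)"
    "\<sigma>1 \<in> borel_measurable (borel_time T)" "\<sigma>2 \<in> borel_measurable (borel_time T)"
    "\<sigma>\<^sub>c1 \<in> borel_measurable (borel_time T)" "\<sigma>\<^sub>c2 \<in> borel_measurable (borel_time T)"
  using H1 by (simp_all add: H1_def affine_coeff_def)

lemma coeff_W2_lipschitz:
  assumes "t \<in> {0..T}" "m \<in> P2" "m' \<in> P2" and c: "L\<^sub>m \<le> c"
  shows "\<bar>b0 t m' - b0 t m\<bar> \<le> c * W2 m m'" "\<bar>\<sigma>0 t m' - \<sigma>0 t m\<bar> \<le> c * W2 m m'" "\<bar>\<sigma>\<^sub>c0 t m' - \<sigma>\<^sub>c0 t m\<bar> \<le> c * W2 m m'"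
proof -
  have "\<bar>b0 t m' - b0 t m\<bar> + \<bar>\<sigma>0 t m' - \<sigma>0 t m\<bar> + \<bar>\<sigma>\<^sub>c0 t m' - \<sigma>\<^sub>c0 t m\<bar> \<le> L\<^sub>m * W2 m m'"
    using H5 assms by (simp add: H5_def)
  also have "\<dots> \<le> c * W2 m m'" using c W2_nonneg[OF assms(2,3)] by (rule mult_right_mono)
  finally show "\<bar>b0 t m' - b0 t m\<bar> \<le> c * W2 m m'" "\<bar>\<sigma>0 t m' - \<sigma>0 t m\<bar> \<le> c * W2 m m'" "\<bar>\<sigma>\<^sub>c0 t m' - \<sigma>\<^sub>c0 t m\<bar> \<le> c * W2 m m'"
    by linarith+
qed

lemma Lm_le_L: "L\<^sub>m \<le> L" using H5 by (simp add: H5_def)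

lemma cost_lipschitz:
  assumes "t \<in> {0..T}"
  shows "m \<in> P2 \<Longrightarrow> \<bar>f1x t x' m - f1x t x m\<bar> \<le> L * \<bar>x' - x\<bar>"
    "m \<in> P2 \<Longrightarrow> m' \<in> P2 \<Longrightarrow> \<bar>f1x t x m - f1x t x m'\<bar> \<le> L * W2 m m'"
    "m \<in> P2 \<Longrightarrow> m' \<in> P2 \<Longrightarrow> \<bar>f1x t x' m' - f1x t x m\<bar> \<le> L * (\<bar>x' - x\<bar> + W2 m m')"
    "m \<in> P2 \<Longrightarrow> \<bar>gx x' m - gx x m\<bar> \<le> L * \<bar>x' - x\<bar>"
    "m \<in> P2 \<Longrightarrow> m' \<in> P2 \<Longrightarrow> \<bar>gx x m - gx x m'\<bar> \<le> L * W2 m m'"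
    "m \<in> P2 \<Longrightarrow> m' \<in> P2 \<Longrightarrow> \<bar>gx x' m' - gx x m\<bar> \<le> L * (\<bar>x' - x\<bar> + W2 m m')"
proof -
  show 1: "\<bar>f1x t x' m - f1x t x m\<bar> \<le> L * \<bar>x' - x\<bar>" if "m \<in> P2" for m
  proof -
    have "L-lipschitz_on UNIV (\<lambda>x. f1x t x m)" using H3 assms that by (simp add: H3_def)
    from lipschitz_onD[OF this, of x' x] show ?thesis by (simp add: dist_real_def)
  qed
  show 2: "\<bar>gx x' m - gx x m\<bar> \<le> L * \<bar>x' - x\<bar>" if "m \<in> P2" for m
  proof -
    have "L-lipschitz_on UNIV (\<lambda>x. gx x m)" using H3 that by (simp add: H3_def)
    from lipschitz_onD[OF this, of x' x] show ?thesis by (simp add: dist_real_def)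
  qed
  have 3: "\<bar>f1x t x m' - f1x t x m\<bar> + \<bar>gx x m' - gx x m\<bar> \<le> L * W2 m m'" if "m \<in> P2" "m' \<in> P2" for m m' x
    using H5 assms that by (simp add: H5_def)
  show "\<bar>f1x t x m - f1x t x m'\<bar> \<le> L * W2 m m'" "\<bar>gx x m - gx x m'\<bar> \<le> L * W2 m m'" if "m \<in> P2" "m' \<in> P2"
    using 3[OF that, of x] by linarith+
  show "\<bar>f1x t x' m' - f1x t x m\<bar> \<le> L * (\<bar>x' - x\<bar> + W2 m m')" "\<bar>gx x' m' - gx x m\<bar> \<le> L * (\<bar>x' - x\<bar> + W2 m m')"
    if "m \<in> P2" "m' \<in> P2"
    using 3[OF that, of x'] 1[OF that(1)] 2[OF that(1)] unfolding distrib_left by linarith+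
qed

lemma f0_derivatives:
  assumes t: "t \<in> {0..T}"
  shows "((\<lambda>y. f0 t y u) has_real_derivative f0x t x u) (at x)" "((\<lambda>v. f0 t x v) has_real_derivative f0u t x u) (at u)"
proof -
  have "(\<lambda>(x, u). f0 t x u) differentiable (at (x, u))"
    using H3 t by (auto simp: H3_def differentiable_on_def)
  then have d: "(\<lambda>z. f0 t (fst z) (snd z)) differentiable (at (x, u))" by (simp add: split_beta')
  have "(\<lambda>y. (y, u)) differentiable (at x)" "(\<lambda>v. (x, v)) differentiable (at u)"
    unfolding differentiable_def by (auto intro!: derivative_eq_intros exI)
  then have "(\<lambda>y. f0 t y u) differentiable (at x)" "(\<lambda>v. f0 t x v) differentiable (at u)"
    using differentiable_chain_at[of "\<lambda>y. (y, u)" x "\<lambda>z. f0 t (fst z) (snd z)"] d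
      differentiable_chain_at[of "\<lambda>v. (x, v)" u "\<lambda>z. f0 t (fst z) (snd z)"] by (auto simp: comp_def)
  then show "((\<lambda>y. f0 t y u) has_real_derivative f0x t x u) (at x)" "((\<lambda>v. f0 t x v) has_real_derivative f0u t x u) (at u)"
    unfolding real_differentiable_def using DERIV_imp_deriv by blast+
qed

lemma f1_derivative:
  assumes t: "t \<in> {0..T}" "m \<in> P2"
  shows "((\<lambda>y. f1 t y m) has_real_derivative f1x t x m) (at x)"
proof -
  have "(\<lambda>x. f1 t x m) differentiable (at x)" using H3 t by (auto simp: H3_def differentiable_on_def)
  then obtain d where "((\<lambda>y. f1 t y m) has_real_derivative d) (at x)" by (auto simp: real_differentiable_def)
  then show ?thesis using DERIV_imp_deriv by blast
qed

lemma f_derivatives: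
  assumes t: "t \<in> {0..T}" "m \<in> P2"
  shows "((\<lambda>y. f t y u m) has_real_derivative f0x t x u + f1x t x m) (at x)" "deriv (\<lambda>y. f t y u m) x = f0x t x u + f1x t x m"
    "((\<lambda>v. f t x v m) has_real_derivative f0u t x u) (at u)" "deriv (\<lambda>v. f t x v m) u = f0u t x u"
proof -
  have e: "f t y v m = f0 t y v + f1 t y m" for y v using H3 t by (simp add: H3_def)
  show 1: "((\<lambda>y. f t y u m) has_real_derivative f0x t x u + f1x t x m) (at x)"
    unfolding e by (intro derivative_intros f0_derivatives f1_derivative t)
  show 2: "((\<lambda>v. f t x v m) has_real_derivative f0u t x u) (at u)"
    unfolding e using DERIV_add[OF f0_derivatives(2)[OF t(1)] DERIV_const[of "f1 t x m"]] by simp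
  show "deriv (\<lambda>y. f t y u m) x = f0x t x u + f1x t x m" by (rule DERIV_imp_deriv[OF 1])
  show "deriv (\<lambda>v. f t x v m) u = f0u t x u" by (rule DERIV_imp_deriv[OF 2])
qed

lemma f0_lipschitz:
  assumes t: "t \<in> {0..T}"
  shows "\<bar>f0x t x' u' - f0x t x u\<bar> \<le> L * (\<bar>x' - x\<bar> + \<bar>u' - u\<bar>)" "\<bar>f0u t x' u' - f0u t x u\<bar> \<le> L * (\<bar>x' - x\<bar> + \<bar>u' - u\<bar>)"
proof -
  have "L-lipschitz_on UNIV (\<lambda>(x, u). (f0x t x u, f0u t x u))" using H3 t by (simp add: H3_def)
  from lipschitz_onD[OF this, of "(x', u')" "(x, u)"]
  have d: "dist (f0x t x' u', f0u t x' u') (f0x t x u, f0u t x u) \<le> L * dist (x', u') (x, u)" by simp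
  have "dist (x', u') (x, u) \<le> \<bar>x' - x\<bar> + \<bar>u' - u\<bar>"
    unfolding dist_Pair_Pair dist_real_def by (metis abs_ge_zero power2_abs sqrt_sum_squares_le_sum)
  with d L_pos have d2: "dist (f0x t x' u', f0u t x' u') (f0x t x u, f0u t x u) \<le> L * (\<bar>x' - x\<bar> + \<bar>u' - u\<bar>)"
    by (meson less_imp_le mult_left_mono order_trans)
  have "\<bar>f0x t x' u' - f0x t x u\<bar> \<le> dist (f0x t x' u', f0u t x' u') (f0x t x u, f0u t x u)"
    using dist_fst_le[of "(f0x t x' u', f0u t x' u')" "(f0x t x u, f0u t x u)"] by (simp add: dist_real_def)
  with d2 show "\<bar>f0x t x' u' - f0x t x u\<bar> \<le> L * (\<bar>x' - x\<bar> + \<bar>u' - u\<bar>)" by simp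
  have "\<bar>f0u t x' u' - f0u t x u\<bar> \<le> dist (f0x t x' u', f0u t x' u') (f0x t x u, f0u t x u)"
    using dist_snd_le[of "(f0x t x' u', f0u t x' u')" "(f0x t x u, f0u t x u)"] by (simp add: dist_real_def)
  with d2 show "\<bar>f0u t x' u' - f0u t x u\<bar> \<le> L * (\<bar>x' - x\<bar> + \<bar>u' - u\<bar>)" by simp
qed

lemma f0_strongly_monotone:
  assumes t: "t \<in> {0..T}"
  shows "(f0x t x' u' - f0x t x u) * (x' - x) + (f0u t x' u' - f0u t x u) * (u' - u) \<ge> 2 * C\<^sub>f * (u' - u)\<^sup>2"
proof -
  have "f0 t x' u' - f0 t x u - (f0x t x u * (x' - x) + f0u t x u * (u' - u)) \<ge> C\<^sub>f * \<bar>u' - u\<bar>\<^sup>2"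
    "f0 t x u - f0 t x' u' - (f0x t x' u' * (x - x') + f0u t x' u' * (u - u')) \<ge> C\<^sub>f * \<bar>u - u'\<bar>\<^sup>2"
    using H4 t unfolding H4_def by blast+
  then show ?thesis by (simp add: power2_commute[of u u'] algebra_simps)
qed

lemma f0u_monotone:
  assumes t: "t \<in> {0..T}"
  shows "(f0u t x u' - f0u t x u) * (u' - u) \<ge> 2 * C\<^sub>f * (u' - u)\<^sup>2"
  using f0_strongly_monotone[OF t, where x=x and x'=x and u=u and u'=u'] by simp

lemma growth:
  assumes t: "t \<in> {0..T}" and m: "m \<in> P2"
  shows "\<bar>f0x t x u + f1x t x m\<bar> \<le> L * (1 + \<bar>x\<bar> + \<bar>u\<bar> + sqrt (second_moment m))" "\<bar>f0u t x 0\<bar> \<le> L * (1 + \<bar>x\<bar>)"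
proof -
  have "Max {\<bar>deriv (\<lambda>y. f t y u m) x\<bar>, \<bar>deriv (\<lambda>v. f t x v m) u\<bar>, \<bar>deriv (\<lambda>y. g y m) x\<bar>}
          \<le> L * (1 + \<bar>x\<bar> + \<bar>u\<bar> + sqrt (second_moment m))" using H2 t m unfolding H2_def by blast
  then show "\<bar>f0x t x u + f1x t x m\<bar> \<le> L * (1 + \<bar>x\<bar> + \<bar>u\<bar> + sqrt (second_moment m))"
    using f_derivatives(2)[OF t m] by simp
  have "Max {\<bar>deriv (\<lambda>y. f t y 0 (return borel 0)) x\<bar>, \<bar>deriv (\<lambda>v. f t x v (return borel 0)) 0\<bar>, \<bar>deriv (\<lambda>y. g y (return borel 0)) x\<bar>}
          \<le> L * (1 + \<bar>x\<bar> + \<bar>0\<bar> + sqrt (second_moment (return borel 0)))" using H2 t dirac_P2(1) unfolding H2_def by blast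
  then show "\<bar>f0u t x 0\<bar> \<le> L * (1 + \<bar>x\<bar>)"
    using f_derivatives(4)[OF t dirac_P2(1)] by (simp add: dirac_P2(2))
qed

text \<open>Strong monotonicity of \<open>f0u\<close> yields a zero of the \<open>u\<close>-derivative by the intermediate value
  theorem, and strong convexity makes it the only minimiser, whatever \<open>m\<close>.\<close>

lemma uh_characterisation:
  assumes t: "t \<in> {0..T}"
  shows "slope t p q q\<^sub>c + f0u t x (uh t x p q q\<^sub>c) = 0" "\<bar>uh t x p q q\<^sub>c\<bar> \<le> (L * (\<bar>p\<bar> + \<bar>q\<bar> + \<bar>q\<^sub>c\<bar>) + L * (1 + \<bar>x\<bar>)) / (2 * C\<^sub>f)"
    "uh t x p q q\<^sub>c < c \<longleftrightarrow> slope t p q q\<^sub>c + f0u t x c > 0"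
proof -
  let ?a = "slope t p q q\<^sub>c"
  define \<psi> where "\<psi> u = ?a + f0u t x u" for u
  have mono: "(\<psi> u' - \<psi> u) * (u' - u) \<ge> 2 * C\<^sub>f * (u' - u)\<^sup>2" for u u'
    using f0u_monotone[OF t, where x=x and u=u and u'=u'] by (simp add: \<psi>_def)
  have cont: "continuous_on S \<psi>" for S
  proof (rule lipschitz_on_continuous_on, rule lipschitz_onI)
    show "dist (\<psi> u) (\<psi> v) \<le> L * dist u v" for u v using f0_lipschitz(2)[OF t, of x u x v] by (simp add: \<psi>_def dist_real_def)
  qed (use L_pos in simp)
  have incr: "\<psi> u + 2 * C\<^sub>f * (u' - u) \<le> \<psi> u'" if "u < u'" for u u'
  proof -
    have "2 * C\<^sub>f * (u' - u) * (u' - u) \<le> (\<psi> u' - \<psi> u) * (u' - u)" using mono[where u=u and u'=u'] by (simp add: power2_eq_square mult.assoc)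
    then show ?thesis using that by simp
  qed
  define r where "r = \<bar>\<psi> 0\<bar> / (2 * C\<^sub>f)"
  have r0: "0 \<le> r" and rC: "2 * C\<^sub>f * r = \<bar>\<psi> 0\<bar>" using Cf_pos by (auto simp: r_def)
  have "\<psi> (- r) \<le> 0" "0 \<le> \<psi> r"
    using incr[of "-r" 0] incr[of 0 r] r0 rC by (cases "r = 0"; auto simp: algebra_simps)+
  then obtain u0 where u0: "\<psi> u0 = 0" using IVT'[of \<psi> "-r" 0 r] r0 cont by auto
  have hmin: "?a * v + f0 t x v \<ge> ?a * u0 + f0 t x u0 + C\<^sub>f * (v - u0)\<^sup>2" for v
  proof -
    have "f0 t x v - f0 t x u0 - (f0x t x u0 * (x - x) + f0u t x u0 * (v - u0)) \<ge> C\<^sub>f * \<bar>v - u0\<bar>\<^sup>2"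
      using H4 t unfolding H4_def by blast
    moreover have "f0u t x u0 = - ?a" using u0 by (simp add: \<psi>_def)
    ultimately show ?thesis by (simp add: algebra_simps)
  qed
  have ham: "hamiltonian b \<sigma> \<sigma>\<^sub>c f t x p q q\<^sub>c v m - hamiltonian b \<sigma> \<sigma>\<^sub>c f t x p q q\<^sub>c u m = (?a * v + f0 t x v) - (?a * u + f0 t x u)"
    if "m \<in> P2" for u v m
    using H3 t that by (simp add: hamiltonian_def affine[OF t that] H3_def algebra_simps)
  have "uh t x p q q\<^sub>c = u0"
    unfolding u_hat_def
  proof (rule the_equality)
    show "\<forall>m\<in>P2. \<forall>v. hamiltonian b \<sigma> \<sigma>\<^sub>c f t x p q q\<^sub>c u0 m \<le> hamiltonian b \<sigma> \<sigma>\<^sub>c f t x p q q\<^sub>c v m"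
    proof (intro ballI allI)
      fix m v assume m: "m \<in> P2"
      have "0 \<le> C\<^sub>f * (v - u0)\<^sup>2" using Cf_pos by simp
      then show "hamiltonian b \<sigma> \<sigma>\<^sub>c f t x p q q\<^sub>c u0 m \<le> hamiltonian b \<sigma> \<sigma>\<^sub>c f t x p q q\<^sub>c v m"
        using hmin[of v] ham[OF m, of v u0] by linarith
    qed
    fix u assume "\<forall>m\<in>P2. \<forall>v. hamiltonian b \<sigma> \<sigma>\<^sub>c f t x p q q\<^sub>c u m \<le> hamiltonian b \<sigma> \<sigma>\<^sub>c f t x p q q\<^sub>c v m"
    then have "hamiltonian b \<sigma> \<sigma>\<^sub>c f t x p q q\<^sub>c u (return borel 0) \<le> hamiltonian b \<sigma> \<sigma>\<^sub>c f t x p q q\<^sub>c u0 (return borel 0)"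
      using dirac_P2(1) by blast
    then have "C\<^sub>f * (u - u0)\<^sup>2 \<le> 0" using hmin[of u] ham[OF dirac_P2(1), of u u0] by linarith
    then show "u = u0" using Cf_pos by (simp add: mult_le_0_iff)
  qed
  then have z: "\<psi> (uh t x p q q\<^sub>c) = 0" using u0 by simp
  then show "slope t p q q\<^sub>c + f0u t x (uh t x p q q\<^sub>c) = 0" by (simp add: \<psi>_def)
  show "uh t x p q q\<^sub>c < c \<longleftrightarrow> slope t p q q\<^sub>c + f0u t x c > 0"
  proof
    assume "uh t x p q q\<^sub>c < c"
    from incr[OF this] this Cf_pos z have "\<psi> c > 0"
      by (smt (verit) mult_pos_pos)
    then show "slope t p q q\<^sub>c + f0u t x c > 0" by (simp add: \<psi>_def)
  next
    assume "slope t p q q\<^sub>c + f0u t x c > 0"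
    then have c: "\<psi> c > 0" by (simp add: \<psi>_def)
    show "uh t x p q q\<^sub>c < c"
    proof (rule ccontr)
      assume "\<not> uh t x p q q\<^sub>c < c"
      then consider "c = uh t x p q q\<^sub>c" | "c < uh t x p q q\<^sub>c" by linarith
      then show False
      proof cases
        case 2
        have "0 < 2 * C\<^sub>f * (uh t x p q q\<^sub>c - c)" using Cf_pos 2 by simp
        then show False using incr[OF 2] z c by linarith
      qed (use z c in simp)
    qed
  qed
  show "\<bar>uh t x p q q\<^sub>c\<bar> \<le> (L * (\<bar>p\<bar> + \<bar>q\<bar> + \<bar>q\<^sub>c\<bar>) + L * (1 + \<bar>x\<bar>)) / (2 * C\<^sub>f)"
  proof -
    let ?u = "uh t x p q q\<^sub>c"
    have "2 * C\<^sub>f * ?u\<^sup>2 \<le> - \<psi> 0 * ?u" using mono[where u=0 and u'="?u"] z by simp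
    also have "\<dots> \<le> \<bar>\<psi> 0\<bar> * \<bar>?u\<bar>" by (metis abs_ge_self abs_minus_cancel abs_mult)
    finally have "2 * C\<^sub>f * \<bar>?u\<bar> * \<bar>?u\<bar> \<le> \<bar>\<psi> 0\<bar> * \<bar>?u\<bar>" by (simp add: power2_eq_square mult.assoc)
    then have "2 * C\<^sub>f * \<bar>?u\<bar> \<le> \<bar>\<psi> 0\<bar>" by (cases "?u = 0") auto
    also have "\<bar>\<psi> 0\<bar> \<le> \<bar>b2 t * p\<bar> + \<bar>\<sigma>2 t * q\<bar> + \<bar>\<sigma>\<^sub>c2 t * q\<^sub>c\<bar> + \<bar>f0u t x 0\<bar>" unfolding \<psi>_def by linarith
    also have "\<dots> \<le> L * \<bar>p\<bar> + L * \<bar>q\<bar> + L * \<bar>q\<^sub>c\<bar> + L * (1 + \<bar>x\<bar>)"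
      unfolding abs_mult by (intro add_mono mult_right_mono coeff_bounds[OF t] growth(2)[OF t dirac_P2(1)]) auto
    finally have "2 * C\<^sub>f * \<bar>?u\<bar> \<le> L * (\<bar>p\<bar> + \<bar>q\<bar> + \<bar>q\<^sub>c\<bar>) + L * (1 + \<bar>x\<bar>)" by (simp add: distrib_left)
    then show ?thesis using Cf_pos by (simp add: pos_le_divide_eq mult_ac)
  qed
qed

lemma deriv_hamiltonian:
  assumes t: "t \<in> {0..T}" and m: "m \<in> P2"
  shows "deriv (\<lambda>x. hamiltonian b \<sigma> \<sigma>\<^sub>c f t x p q q\<^sub>c u m) x = b1 t * p + \<sigma>1 t * q + \<sigma>\<^sub>c1 t * q\<^sub>c + (f0x t x u + f1x t x m)"
proof (rule DERIV_imp_deriv)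
  have "hamiltonian b \<sigma> \<sigma>\<^sub>c f t y p q q\<^sub>c u m = (b0 t m + b1 t * y + b2 t * u) * p + (\<sigma>0 t m + \<sigma>1 t * y + \<sigma>2 t * u) * q
     + (\<sigma>\<^sub>c0 t m + \<sigma>\<^sub>c1 t * y + \<sigma>\<^sub>c2 t * u) * q\<^sub>c + f t y u m" for y
    by (simp add: hamiltonian_def affine[OF t m])
  then show "((\<lambda>x. hamiltonian b \<sigma> \<sigma>\<^sub>c f t x p q q\<^sub>c u m) has_real_derivative b1 t * p + \<sigma>1 t * q + \<sigma>\<^sub>c1 t * q\<^sub>c + (f0x t x u + f1x t x m)) (at x)"
    by (auto intro!: derivative_eq_intros f_derivatives(1)[OF t m])
qed

lemma measurable_coeff_comp:
  assumes "measurable_coeff T \<phi>" "\<tau> \<in> N \<rightarrow>\<^sub>M borel_time T" "x \<in> borel_measurable N" "u \<in> borel_measurable N" "\<mu> \<in> N \<rightarrow>\<^sub>M borel_P2"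
  shows "(\<lambda>z. \<phi> (\<tau> z) (x z) (u z) (\<mu> z)) \<in> borel_measurable N"
proof -
  have "(\<lambda>z. (\<tau> z, x z, u z, \<mu> z)) \<in> N \<rightarrow>\<^sub>M borel_time T \<Otimes>\<^sub>M borel \<Otimes>\<^sub>M borel \<Otimes>\<^sub>M borel_P2"
    using assms by (intro measurable_Pair)
  from measurable_compose[OF this assms(1)[unfolded measurable_coeff_def]] show ?thesis by simp
qed

lemma measurable_dirac: "(\<lambda>_. return borel (0::real)) \<in> N \<rightarrow>\<^sub>M borel_P2"
  using dirac_P2(1) by (intro measurable_const) (simp add: borel_P2_def space_measure_of_conv)

text \<open>The partial derivatives of \<open>f\<close> are limits of difference quotients, hence jointly measurable.
  Since measurability is a property of \<open>f\<close>, it is the sum of the \<open>x\<close>-derivatives of \<open>f0\<close> and \<open>f1\<close>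
  that is measurable.\<close>

lemma f_derivatives_measurable:
  assumes \<tau>: "\<tau> \<in> N \<rightarrow>\<^sub>M borel_time T" and x: "x \<in> borel_measurable N" and u: "u \<in> borel_measurable N" and \<mu>: "\<mu> \<in> N \<rightarrow>\<^sub>M borel_P2"
  shows "(\<lambda>z. f0x (\<tau> z) (x z) (u z) + f1x (\<tau> z) (x z) (\<mu> z)) \<in> borel_measurable N"
    "(\<lambda>z. f0u (\<tau> z) (x z) (u z)) \<in> borel_measurable N"
proof -
  have f: "measurable_coeff T f" using data by (simp add: measurable_data_def)
  have tz: "\<tau> z \<in> {0..T}" "\<mu> z \<in> P2" if "z \<in> space N" for z
    using measurable_space[OF \<tau> that] measurable_space[OF \<mu> that]
    by (auto simp: space_restrict_space borel_P2_def space_measure_of_conv)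
  have dq: "(\<lambda>n. (h (y + 1 / real (Suc n)) - h y) * real (Suc n)) \<longlonglongrightarrow> d" if "(h has_real_derivative d) (at y)" for h :: "real \<Rightarrow> real" and d y
  proof -
    have l: "(\<lambda>e. (h (y + e) - h y) / e) \<midarrow>0\<rightarrow> d" using that by (simp add: DERIV_def)
    have "filterlim (\<lambda>n. 1 / real (Suc n)) (at 0) sequentially"
      unfolding filterlim_at using LIMSEQ_inverse_real_of_nat by (auto simp: inverse_eq_divide)
    from filterlim_compose[OF l this] show ?thesis by simp
  qed
  show "(\<lambda>z. f0x (\<tau> z) (x z) (u z) + f1x (\<tau> z) (x z) (\<mu> z)) \<in> borel_measurable N"
  proof (rule borel_measurable_LIMSEQ_real)
    show "(\<lambda>n. (f (\<tau> z) (x z + 1 / real (Suc n)) (u z) (\<mu> z) - f (\<tau> z) (x z) (u z) (\<mu> z)) * real (Suc n))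
       \<longlonglongrightarrow> f0x (\<tau> z) (x z) (u z) + f1x (\<tau> z) (x z) (\<mu> z)" if "z \<in> space N" for z
      by (rule dq[OF f_derivatives(1)[OF tz[OF that]]])
    show "(\<lambda>z. (f (\<tau> z) (x z + 1 / real (Suc n)) (u z) (\<mu> z) - f (\<tau> z) (x z) (u z) (\<mu> z)) * real (Suc n)) \<in> borel_measurable N" for n
      using x u by (intro borel_measurable_times borel_measurable_diff borel_measurable_const measurable_coeff_comp[OF f \<tau> _ _ \<mu>] borel_measurable_add)
  qed
  show "(\<lambda>z. f0u (\<tau> z) (x z) (u z)) \<in> borel_measurable N"
  proof (rule borel_measurable_LIMSEQ_real)
    show "(\<lambda>n. (f (\<tau> z) (x z) (u z + 1 / real (Suc n)) (\<mu> z) - f (\<tau> z) (x z) (u z) (\<mu> z)) * real (Suc n))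
       \<longlonglongrightarrow> f0u (\<tau> z) (x z) (u z)" if "z \<in> space N" for z
      by (rule dq[OF f_derivatives(3)[OF tz[OF that]]])
    show "(\<lambda>z. (f (\<tau> z) (x z) (u z + 1 / real (Suc n)) (\<mu> z) - f (\<tau> z) (x z) (u z) (\<mu> z)) * real (Suc n)) \<in> borel_measurable N" for n
      using x u by (intro borel_measurable_times borel_measurable_diff borel_measurable_const measurable_coeff_comp[OF f \<tau> _ _ \<mu>] borel_measurable_add)
  qed
qed

text \<open>The strict sublevel sets of the minimiser are described by the sign of the \<open>u\<close>-derivative of the
  Hamiltonian at a constant control, which is measurable.\<close>

lemma uh_measurable:
  assumes \<tau>: "\<tau> \<in> N \<rightarrow>\<^sub>M borel_time T" and x: "x \<in> borel_measurable N"
    and p: "p \<in> borel_measurable N" "q \<in> borel_measurable N" "q\<^sub>c \<in> borel_measurable N"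
  shows "(\<lambda>z. uh (\<tau> z) (x z) (p z) (q z) (q\<^sub>c z)) \<in> borel_measurable N"
proof (rule borel_measurable_iff_less[THEN iffD2], rule allI)
  fix c
  note [measurable] = f_derivatives_measurable(2)[OF \<tau> x borel_measurable_const measurable_dirac, of c] p
    measurable_compose[OF \<tau> coeff_measurable(2)] measurable_compose[OF \<tau> coeff_measurable(4)] measurable_compose[OF \<tau> coeff_measurable(6)]
  have "{z \<in> space N. uh (\<tau> z) (x z) (p z) (q z) (q\<^sub>c z) < c} = {z \<in> space N. slope (\<tau> z) (p z) (q z) (q\<^sub>c z) + f0u (\<tau> z) (x z) c > 0}"
  proof (intro Collect_cong conj_cong refl)
    fix z assume "z \<in> space N"
    then have "\<tau> z \<in> {0..T}" using measurable_space[OF \<tau>] by (auto simp: space_restrict_space)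
    from uh_characterisation(3)[OF this]
    show "uh (\<tau> z) (x z) (p z) (q z) (q\<^sub>c z) < c \<longleftrightarrow> slope (\<tau> z) (p z) (q z) (q\<^sub>c z) + f0u (\<tau> z) (x z) c > 0" .
  qed
  also have "\<dots> \<in> sets N" by measurable
  finally show "{z \<in> space N. uh (\<tau> z) (x z) (p z) (q z) (q\<^sub>c z) < c} \<in> sets N" .
qed

end

section \<open>Solutions as square-integrable Ito processes\<close>

locale fbsde = common_noise M T W W\<^sub>c \<xi>0 +
  fbsde_data T L b b0 b1 b2 \<sigma> \<sigma>0 \<sigma>1 \<sigma>2 \<sigma>\<^sub>c \<sigma>\<^sub>c0 \<sigma>\<^sub>c1 \<sigma>\<^sub>c2 f f0 f1 g L\<^sub>m C\<^sub>f
  for M :: "'a measure" and T W W\<^sub>c \<xi>0 L b b0 b1 b2 \<sigma> \<sigma>0 \<sigma>1 \<sigma>2 \<sigma>\<^sub>c \<sigma>\<^sub>c0 \<sigma>\<^sub>c1 \<sigma>\<^sub>c2 f f0 f1 g L\<^sub>m C\<^sub>f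
begin

definition control where
  "control X p q q\<^sub>c t \<omega> = uh t (X t \<omega>) (p t \<omega>) (q t \<omega>) (q\<^sub>c t \<omega>)"

abbreviation along where
  "along \<phi> X u \<mu> \<equiv> (\<lambda>t \<omega>. \<phi> t (X t \<omega>) (u t \<omega>) (\<mu> t \<omega>) :: real)"

abbreviation adjoint_drift where
  "adjoint_drift X p q q\<^sub>c u \<mu> \<equiv> (\<lambda>t \<omega>. - deriv (\<lambda>x. hamiltonian b \<sigma> \<sigma>\<^sub>c f t x (p t \<omega>) (q t \<omega>) (q\<^sub>c t \<omega>) (u t \<omega>) (\<mu> t \<omega>)) (X t \<omega>))"

text \<open>The given notion of solution, with the version \<open>\<mu>\<close> of the conditional laws made explicit.\<close>

definition solution :: "(real \<Rightarrow> 'a \<Rightarrow> real) \<Rightarrow> (real \<Rightarrow> 'a \<Rightarrow> real) \<Rightarrow> (real \<Rightarrow> 'a \<Rightarrow> real) \<Rightarrow> (real \<Rightarrow> 'a \<Rightarrow> real) \<Rightarrow> (real \<Rightarrow> 'a \<Rightarrow> real measure) \<Rightarrow> bool" where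
  "solution X p q q\<^sub>c \<mu> \<longleftrightarrow>
     adapted_process M F T X \<and> adapted_process M F T p \<and> adapted_process M F T q \<and> adapted_process M F T q\<^sub>c \<and>
     square_integrable_quadruple M T X p q q\<^sub>c \<and>
     cond_law_process M G T X \<mu> \<and>
     has_stoch_differential M F T W W\<^sub>c X (along b X (control X p q q\<^sub>c) \<mu>) (along \<sigma> X (control X p q q\<^sub>c) \<mu>) (along \<sigma>\<^sub>c X (control X p q q\<^sub>c) \<mu>) \<and>
     has_stoch_differential M F T W W\<^sub>c p (adjoint_drift X p q q\<^sub>c (control X p q q\<^sub>c) \<mu>) q q\<^sub>c \<and>
     (AE \<omega> in M. X 0 \<omega> = \<xi>0 \<omega>) \<and> (AE \<omega> in M. p T \<omega> = gx (X T \<omega>) (\<mu> T \<omega>))"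

lemma solution_exists:
  assumes "fbsde_solution M T W W\<^sub>c \<xi>0 b \<sigma> \<sigma>\<^sub>c f g X p q q\<^sub>c" "square_integrable_quadruple M T X p q q\<^sub>c"
  obtains \<mu> where "solution X p q q\<^sub>c \<mu>"
  using assms unfolding fbsde_solution_def Let_def solution_def control_def[abs_def] by blast

lemma norm_pair_square: "(norm (x::real, y::real))\<^sup>2 = x\<^sup>2 + y\<^sup>2"
  by (simp add: norm_Pair)

lemma measurable_time_const: "t \<in> {0..T} \<Longrightarrow> (\<lambda>_. t) \<in> N \<rightarrow>\<^sub>M borel_time T"
  by (intro measurable_const) (simp add: space_restrict_space)

lemma measurable_time_Q: "fst \<in> Q T \<rightarrow>\<^sub>M borel_time T"
  using measurable_fst[of "R T" M] by (simp add: measurable_cong_sets[OF refl sets_restrict_lborel])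

context
  fixes X p q q\<^sub>c :: "real \<Rightarrow> 'a \<Rightarrow> real" and \<mu> :: "real \<Rightarrow> 'a \<Rightarrow> real measure"
  assumes sol: "solution X p q q\<^sub>c \<mu>"
begin

abbreviation (input) u where "u \<equiv> control X p q q\<^sub>c"

lemma sol_measurable:
  shows "case_prod X \<in> borel_measurable (Q T)" "case_prod p \<in> borel_measurable (Q T)"
    "case_prod q \<in> borel_measurable (Q T)" "case_prod q\<^sub>c \<in> borel_measurable (Q T)"
  using sol by (auto simp: solution_def adapted_process_def measurable_process_Q)

lemma sol_adapted:
  assumes "t \<in> {0..T}"
  shows "X t \<in> borel_measurable (F t)" "p t \<in> borel_measurable (F t)" "q t \<in> borel_measurable (F t)" "q\<^sub>c t \<in> borel_measurable (F t)"
  using sol assms by (auto simp: solution_def adapted_process_def)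

lemma sol_law:
  shows "t \<in> {0..T} \<Longrightarrow> \<omega> \<in> space M \<Longrightarrow> \<mu> t \<omega> \<in> P2" "t \<in> {0..T} \<Longrightarrow> is_cond_law M (G t) (X t) (\<mu> t)"
    "case_prod \<mu> \<in> Q T \<rightarrow>\<^sub>M borel_P2"
proof -
  have m: "case_prod \<mu> \<in> borel_time T \<Otimes>\<^sub>M M \<rightarrow>\<^sub>M borel_P2" and
    "t \<in> {0..T} \<Longrightarrow> is_cond_law M (G t) (X t) (\<mu> t)" for t
    using sol by (auto simp: solution_def cond_law_process_def)
  then show "t \<in> {0..T} \<Longrightarrow> is_cond_law M (G t) (X t) (\<mu> t)" by simp
  show "case_prod \<mu> \<in> Q T \<rightarrow>\<^sub>M borel_P2" using m by (simp add: measurable_cong_sets[OF sets_Q refl])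
  assume "t \<in> {0..T}" "\<omega> \<in> space M"
  then show "\<mu> t \<omega> \<in> P2"
    using measurable_space[OF m, of "(t, \<omega>)"] by (simp add: space_pair_measure space_restrict_space borel_P2_def space_measure_of_conv)
qed

lemma sol_second_moments:
  obtains C where "0 \<le> C" "\<And>t. t \<in> {0..T} \<Longrightarrow> (\<integral>\<^sup>+\<omega>. ennreal ((X t \<omega>)\<^sup>2) \<partial>M) \<le> ennreal C"
    "\<And>t. t \<in> {0..T} \<Longrightarrow> (\<integral>\<^sup>+\<omega>. ennreal ((p t \<omega>)\<^sup>2) \<partial>M) \<le> ennreal C"
    "(\<integral>\<^sup>+\<omega>. (\<integral>\<^sup>+t\<in>{0..T}. ennreal ((q t \<omega>)\<^sup>2) \<partial>lborel) \<partial>M) \<le> ennreal C"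
    "(\<integral>\<^sup>+\<omega>. (\<integral>\<^sup>+t\<in>{0..T}. ennreal ((q\<^sub>c t \<omega>)\<^sup>2) \<partial>lborel) \<partial>M) \<le> ennreal C"
proof -
  let ?S = "\<lambda>\<omega>. (SUP t\<in>{0..T}. ennreal ((norm (X t \<omega>, p t \<omega>))\<^sup>2)) + (\<integral>\<^sup>+t\<in>{0..T}. ennreal ((norm (q t \<omega>, q\<^sub>c t \<omega>))\<^sup>2) \<partial>lborel)"
  have fin: "(\<integral>\<^sup>+\<omega>. ?S \<omega> \<partial>M) < \<infinity>" using sol by (simp add: solution_def square_integrable_quadruple_def)
  define C where "C = enn2real (\<integral>\<^sup>+\<omega>. ?S \<omega> \<partial>M)"
  have C: "ennreal C = (\<integral>\<^sup>+\<omega>. ?S \<omega> \<partial>M)" using fin by (simp add: C_def less_top)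
  have sup: "ennreal ((norm (X t \<omega>, p t \<omega>))\<^sup>2) \<le> ?S \<omega>" if "t \<in> {0..T}" for t \<omega>
  proof -
    have "ennreal ((norm (X t \<omega>, p t \<omega>))\<^sup>2) \<le> (SUP t\<in>{0..T}. ennreal ((norm (X t \<omega>, p t \<omega>))\<^sup>2))"
      by (rule SUP_upper[OF that])
    then show ?thesis by (rule add_increasing2[rotated]) simp
  qed
  have q: "(\<integral>\<^sup>+t\<in>{0..T}. ennreal ((norm (q t \<omega>, q\<^sub>c t \<omega>))\<^sup>2) \<partial>lborel) \<le> ?S \<omega>" for \<omega>
    by (rule add_increasing) auto
  have "(\<integral>\<^sup>+\<omega>. ennreal ((X t \<omega>)\<^sup>2) \<partial>M) \<le> ennreal C" "(\<integral>\<^sup>+\<omega>. ennreal ((p t \<omega>)\<^sup>2) \<partial>M) \<le> ennreal C" if "t \<in> {0..T}" for t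
    unfolding C by (intro nn_integral_mono order_trans[OF _ sup[OF that]] ennreal_leI; simp add: norm_pair_square)+
  moreover have "(\<integral>\<^sup>+\<omega>. (\<integral>\<^sup>+t\<in>{0..T}. ennreal ((q t \<omega>)\<^sup>2) \<partial>lborel) \<partial>M) \<le> ennreal C"
    "(\<integral>\<^sup>+\<omega>. (\<integral>\<^sup>+t\<in>{0..T}. ennreal ((q\<^sub>c t \<omega>)\<^sup>2) \<partial>lborel) \<partial>M) \<le> ennreal C"
    unfolding C by (intro nn_integral_mono order_trans[OF _ q] mult_right_mono ennreal_leI; simp add: norm_pair_square)+
  moreover have "0 \<le> C" by (simp add: C_def)
  ultimately show ?thesis using that by blast
qed

text \<open>A bound on the second moments at almost every time is enough for square integrability in
  time and chance.\<close>

lemma L2_Q_of_times: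
  assumes Y: "case_prod Y \<in> borel_measurable (Q T)"
    and bd: "AE s in R T. (\<integral>\<^sup>+\<omega>. ennreal ((Y s \<omega>)\<^sup>2) \<partial>M) \<le> ennreal (B s)" and B: "integrable (R T) B"
  shows "case_prod Y \<in> L2_vars (Q T) (Q T)"
proof -
  have "(\<integral>\<^sup>+z. ennreal ((case_prod Y z)\<^sup>2) \<partial>Q T) = (\<integral>\<^sup>+s. \<integral>\<^sup>+\<omega>. ennreal ((Y s \<omega>)\<^sup>2) \<partial>M \<partial>R T)"
    using nn_integral_fst[of "\<lambda>z. ennreal ((case_prod Y z)\<^sup>2)" "R T"] Y by simp
  also have "\<dots> \<le> (\<integral>\<^sup>+s. ennreal (norm (B s)) \<partial>R T)"
    using bd by (intro nn_integral_mono_AE) (auto elim!: eventually_mono intro: order_trans ennreal_leI)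
  also have "\<dots> < \<infinity>" using B by (simp add: integrable_iff_bounded)
  finally show ?thesis using Y by (auto simp: L2_vars_def intro!: integrableI_nonneg)
qed

lemma sol_L2_Q:
  shows "case_prod X \<in> L2_vars (Q T) (Q T)" "case_prod p \<in> L2_vars (Q T) (Q T)"
    "case_prod q \<in> L2_vars (Q T) (Q T)" "case_prod q\<^sub>c \<in> L2_vars (Q T) (Q T)"
proof -
  obtain C where C: "0 \<le> C" "\<And>t. t \<in> {0..T} \<Longrightarrow> (\<integral>\<^sup>+\<omega>. ennreal ((X t \<omega>)\<^sup>2) \<partial>M) \<le> ennreal C"
    "\<And>t. t \<in> {0..T} \<Longrightarrow> (\<integral>\<^sup>+\<omega>. ennreal ((p t \<omega>)\<^sup>2) \<partial>M) \<le> ennreal C"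
    "(\<integral>\<^sup>+\<omega>. (\<integral>\<^sup>+t\<in>{0..T}. ennreal ((q t \<omega>)\<^sup>2) \<partial>lborel) \<partial>M) \<le> ennreal C"
    "(\<integral>\<^sup>+\<omega>. (\<integral>\<^sup>+t\<in>{0..T}. ennreal ((q\<^sub>c t \<omega>)\<^sup>2) \<partial>lborel) \<partial>M) \<le> ennreal C" using sol_second_moments by blast
  interpret R: finite_measure "R T" by (rule finite_measure_time)
  interpret P: pair_sigma_finite "R T" M by (rule pair_Q)
  show "case_prod X \<in> L2_vars (Q T) (Q T)" "case_prod p \<in> L2_vars (Q T) (Q T)"
    using C by (intro L2_Q_of_times[where B="\<lambda>_. C"] sol_measurable; auto simp: space_restrict_space intro!: AE_I2)+
  have "case_prod Y \<in> L2_vars (Q T) (Q T)"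
    if Y: "case_prod Y \<in> borel_measurable (Q T)" and "(\<integral>\<^sup>+\<omega>. (\<integral>\<^sup>+t\<in>{0..T}. ennreal ((Y t \<omega>)\<^sup>2) \<partial>lborel) \<partial>M) \<le> ennreal C" for Y
  proof -
    have "(\<integral>\<^sup>+z. ennreal ((case_prod Y z)\<^sup>2) \<partial>Q T) = (\<integral>\<^sup>+\<omega>. \<integral>\<^sup>+s. ennreal ((Y s \<omega>)\<^sup>2) \<partial>R T \<partial>M)"
      using P.nn_integral_snd[of "\<lambda>z. ennreal ((case_prod Y z)\<^sup>2)"] Y by simp
    also have "\<dots> \<le> ennreal C" using that(2) by (simp add: nn_integral_restrict_space)
    finally have "(\<integral>\<^sup>+z. ennreal ((case_prod Y z)\<^sup>2) \<partial>Q T) < \<infinity>" by (rule le_less_trans) simp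
    then show ?thesis using Y by (auto simp: L2_vars_def intro!: integrableI_nonneg)
  qed
  then show "case_prod q \<in> L2_vars (Q T) (Q T)" "case_prod q\<^sub>c \<in> L2_vars (Q T) (Q T)" using C sol_measurable by auto
qed

lemma sol_L2_time:
  assumes t: "t \<in> {0..T}"
  shows "X t \<in> L2_vars M (F t)" "p t \<in> L2_vars M (F t)" "X t \<in> L2_vars M M" "p t \<in> L2_vars M M"
proof -
  obtain C where C: "\<And>t. t \<in> {0..T} \<Longrightarrow> (\<integral>\<^sup>+\<omega>. ennreal ((X t \<omega>)\<^sup>2) \<partial>M) \<le> ennreal C"
    "\<And>t. t \<in> {0..T} \<Longrightarrow> (\<integral>\<^sup>+\<omega>. ennreal ((p t \<omega>)\<^sup>2) \<partial>M) \<le> ennreal C"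
    by (rule sol_second_moments) iprover
  have sub: "subalgebra M (F t)" using t by (intro subalgebra_F) simp
  have m: "X t \<in> borel_measurable M" "p t \<in> borel_measurable M"
    using measurable_from_subalg[OF sub] sol_adapted[OF t] by auto
  have "integrable M (\<lambda>\<omega>. (X t \<omega>)\<^sup>2)"
  proof (rule integrableI_nonneg)
    show "(\<integral>\<^sup>+\<omega>. ennreal ((X t \<omega>)\<^sup>2) \<partial>M) < \<infinity>" by (rule le_less_trans[OF C(1)[OF t]]) simp
  qed (use m(1) in simp_all)
  moreover have "integrable M (\<lambda>\<omega>. (p t \<omega>)\<^sup>2)"
  proof (rule integrableI_nonneg)
    show "(\<integral>\<^sup>+\<omega>. ennreal ((p t \<omega>)\<^sup>2) \<partial>M) < \<infinity>" by (rule le_less_trans[OF C(2)[OF t]]) simp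
  qed (use m(2) in simp_all)
  ultimately show "X t \<in> L2_vars M (F t)" "p t \<in> L2_vars M (F t)" "X t \<in> L2_vars M M" "p t \<in> L2_vars M M"
    using m sol_adapted[OF t] by (simp_all add: L2_vars_def)
qed

lemma control_measurable:
  shows "case_prod u \<in> borel_measurable (Q T)" "t \<in> {0..T} \<Longrightarrow> u t \<in> borel_measurable (F t)"
proof -
  show "case_prod u \<in> borel_measurable (Q T)"
    using uh_measurable[OF measurable_time_Q sol_measurable] by (simp add: control_def split_beta')
  show "u t \<in> borel_measurable (F t)" if "t \<in> {0..T}"
    using uh_measurable[OF measurable_time_const[OF that] sol_adapted[OF that]] by (simp add: control_def[abs_def])
qed

lemma L2_abs: "Y \<in> L2_vars N N' \<Longrightarrow> (\<lambda>z. \<bar>Y z\<bar>) \<in> L2_vars N N'"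
  by (auto simp: L2_vars_def intro: borel_measurable_abs)

lemma control_L2: "case_prod u \<in> L2_vars (Q T) (Q T)"
proof -
  let ?b = "\<lambda>z. inverse (2 * C\<^sub>f) * (L * (\<bar>case_prod p z\<bar> + \<bar>case_prod q z\<bar> + \<bar>case_prod q\<^sub>c z\<bar>) + L * (1 + \<bar>case_prod X z\<bar>))"
  have b: "?b \<in> L2_vars (Q T) (Q T)"
    by (intro L2_vars_cmult L2_add L2_abs sol_L2_Q L2_const finite_measure_Q)
  show ?thesis
  proof (rule L2_vars_bound[OF control_measurable(1) subalgebra_refl b], rule AE_I2)
    fix z assume z: "z \<in> space (Q T)"
    obtain t \<omega> where tw: "z = (t, \<omega>)" by (cases z)
    have "\<bar>u t \<omega>\<bar> \<le> ?b (t, \<omega>)"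
      using uh_characterisation(2)[of t "X t \<omega>" "p t \<omega>" "q t \<omega>" "q\<^sub>c t \<omega>"] z tw
      unfolding control_def divide_inverse by (simp only: space_Q mem_Times_iff fst_conv snd_conv prod.case mult.commute)
    then have "\<bar>case_prod u z\<bar> \<le> ?b z" unfolding tw by (simp only: prod.case)
    then show "\<bar>case_prod u z\<bar> \<le> \<bar>?b z\<bar>" by (rule order_trans[OF _ abs_ge_self])
  qed
qed

text \<open>The conditional second moments average to the second moment of the state, which bounds the
  terms of linear growth in the law.\<close>

lemma second_moment_cond_law:
  assumes t: "t \<in> {0..T}"
  shows "(\<lambda>\<omega>. ennreal (second_moment (\<mu> t \<omega>))) \<in> borel_measurable M"
    "(\<integral>\<^sup>+\<omega>. ennreal (second_moment (\<mu> t \<omega>)) \<partial>M) = (\<integral>\<^sup>+\<omega>. ennreal ((X t \<omega>)\<^sup>2) \<partial>M)"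
proof -
  have G: "subalgebra M (G t)" using t by (intro subalgebra_G) simp
  have e: "ennreal (second_moment (\<mu> t \<omega>)) = (\<integral>\<^sup>+x. ennreal (x\<^sup>2) \<partial>\<mu> t \<omega>)" if "\<omega> \<in> space M" for \<omega>
    unfolding second_moment_def using P2D(5)[OF sol_law(1)[OF t that]]
    by (intro nn_integral_eq_integral[symmetric]) (auto simp: L2_vars_def)
  note D = is_cond_lawD(1)[OF G L2_varsD(1)[OF sol_L2_time(3)[OF t]] sol_law(2)[OF t]]
  have sq: "(\<lambda>x. ennreal (x\<^sup>2)) \<in> borel_measurable (borel :: real measure)" by measurable
  have "(\<lambda>\<omega>. \<integral>\<^sup>+x. ennreal (x\<^sup>2) \<partial>\<mu> t \<omega>) \<in> borel_measurable (G t)"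
    by (rule measurable_compose[OF measurable_prob_algebraD[OF D] nn_integral_measurable_subprob_algebra[OF sq]])
  then have "(\<lambda>\<omega>. \<integral>\<^sup>+x. ennreal (x\<^sup>2) \<partial>\<mu> t \<omega>) \<in> borel_measurable M" by (rule measurable_from_subalg[OF G])
  then show "(\<lambda>\<omega>. ennreal (second_moment (\<mu> t \<omega>))) \<in> borel_measurable M"
    by (rule measurable_cong[THEN iffD2, rotated]) (rule e)
  have "(\<lambda>z. ennreal ((snd z)\<^sup>2)) \<in> borel_measurable (G t \<Otimes>\<^sub>M (borel :: real measure))" by measurable
  from cond_law_disintegration[OF G L2_varsD(1)[OF sol_L2_time(3)[OF t]] sol_law(2)[OF t] this]
  have "(\<integral>\<^sup>+\<omega>. ennreal ((X t \<omega>)\<^sup>2) \<partial>M) = (\<integral>\<^sup>+\<omega>. \<integral>\<^sup>+x. ennreal (x\<^sup>2) \<partial>\<mu> t \<omega> \<partial>M)" by simp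
  also have "\<dots> = (\<integral>\<^sup>+\<omega>. ennreal (second_moment (\<mu> t \<omega>)) \<partial>M)" by (intro nn_integral_cong e[symmetric])
  finally show "(\<integral>\<^sup>+\<omega>. ennreal (second_moment (\<mu> t \<omega>)) \<partial>M) = (\<integral>\<^sup>+\<omega>. ennreal ((X t \<omega>)\<^sup>2) \<partial>M)" by simp
qed

lemma L2_Q_growth:
  assumes \<alpha>: "case_prod \<alpha> \<in> borel_measurable (Q T)" and Y: "case_prod Y \<in> L2_vars (Q T) (Q T)" and K: "0 \<le> K"
    and bd: "\<And>t \<omega>. t \<in> {0..T} \<Longrightarrow> \<omega> \<in> space M \<Longrightarrow> \<bar>\<alpha> t \<omega>\<bar> \<le> K * (\<bar>Y t \<omega>\<bar> + sqrt (second_moment (\<mu> t \<omega>)))"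
  shows "case_prod \<alpha> \<in> L2_vars (Q T) (Q T)"
proof -
  interpret P: pair_sigma_finite "R T" M by (rule pair_Q)
  interpret R: finite_measure "R T" by (rule finite_measure_time)
  obtain C where C: "0 \<le> C" "\<And>t. t \<in> {0..T} \<Longrightarrow> (\<integral>\<^sup>+\<omega>. ennreal ((X t \<omega>)\<^sup>2) \<partial>M) \<le> ennreal C"
    by (rule sol_second_moments) iprover
  have Yi: "integrable (Q T) (\<lambda>(s, \<omega>). (Y s \<omega>)\<^sup>2)" using Y by (simp add: L2_vars_def split_beta')
  show ?thesis
  proof (rule L2_Q_of_times[OF \<alpha>])
    show "integrable (R T) (\<lambda>s. 2 * K\<^sup>2 * ((\<integral>\<omega>. (Y s \<omega>)\<^sup>2 \<partial>M) + C))" using P.integrable_fst'[OF Yi] by simp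
    show "AE s in R T. (\<integral>\<^sup>+\<omega>. ennreal ((\<alpha> s \<omega>)\<^sup>2) \<partial>M) \<le> ennreal (2 * K\<^sup>2 * ((\<integral>\<omega>. (Y s \<omega>)\<^sup>2 \<partial>M) + C))"
      using L2_Q_sections(2)[OF Y] AE_space
    proof eventually_elim
      case (elim s)
      then have s: "s \<in> {0..T}" and Ys: "(\<lambda>\<omega>. Y s \<omega>) \<in> L2_vars M M" by (auto simp: space_restrict_space)
      have Ym: "(\<lambda>\<omega>. ennreal ((Y s \<omega>)\<^sup>2)) \<in> borel_measurable M" using L2_varsD(1)[OF Ys] by measurable
      note sm = second_moment_cond_law[OF s]
      have "(\<integral>\<^sup>+\<omega>. ennreal ((\<alpha> s \<omega>)\<^sup>2) \<partial>M) \<le> (\<integral>\<^sup>+\<omega>. ennreal (2 * K\<^sup>2) * (ennreal ((Y s \<omega>)\<^sup>2) + ennreal (second_moment (\<mu> s \<omega>))) \<partial>M)"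
      proof (intro nn_integral_mono)
        fix \<omega> assume w: "\<omega> \<in> space M"
        let ?r = "sqrt (second_moment (\<mu> s \<omega>))"
        have sm0: "0 \<le> second_moment (\<mu> s \<omega>)" by (simp add: second_moment_def)
        have "(\<alpha> s \<omega>)\<^sup>2 \<le> (K * (\<bar>Y s \<omega>\<bar> + ?r))\<^sup>2"
          using bd[OF s w] K sm0 by (subst abs_le_square_iff[symmetric]) simp
        also have "\<dots> = K\<^sup>2 * (\<bar>Y s \<omega>\<bar> + ?r)\<^sup>2" by (simp add: power_mult_distrib)
        also have "\<dots> \<le> K\<^sup>2 * (2 * ((Y s \<omega>)\<^sup>2 + second_moment (\<mu> s \<omega>)))"
        proof (rule mult_left_mono)
          show "(\<bar>Y s \<omega>\<bar> + ?r)\<^sup>2 \<le> 2 * ((Y s \<omega>)\<^sup>2 + second_moment (\<mu> s \<omega>))"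
            using sum_squares_bound[of "\<bar>Y s \<omega>\<bar>" ?r] sm0 by (simp add: power2_sum)
        qed simp
        finally have "(\<alpha> s \<omega>)\<^sup>2 \<le> 2 * K\<^sup>2 * ((Y s \<omega>)\<^sup>2 + second_moment (\<mu> s \<omega>))" by (simp only: mult_ac)
        then have "ennreal ((\<alpha> s \<omega>)\<^sup>2) \<le> ennreal (2 * K\<^sup>2 * ((Y s \<omega>)\<^sup>2 + second_moment (\<mu> s \<omega>)))" by (rule ennreal_leI)
        also have "\<dots> = ennreal (2 * K\<^sup>2) * (ennreal ((Y s \<omega>)\<^sup>2) + ennreal (second_moment (\<mu> s \<omega>)))"
          using sm0 by (subst ennreal_mult) (auto simp: ennreal_plus)
        finally show "ennreal ((\<alpha> s \<omega>)\<^sup>2) \<le> ennreal (2 * K\<^sup>2) * (ennreal ((Y s \<omega>)\<^sup>2) + ennreal (second_moment (\<mu> s \<omega>)))" .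
      qed
      also have "\<dots> = ennreal (2 * K\<^sup>2) * ((\<integral>\<^sup>+\<omega>. ennreal ((Y s \<omega>)\<^sup>2) \<partial>M) + (\<integral>\<^sup>+\<omega>. ennreal (second_moment (\<mu> s \<omega>)) \<partial>M))"
        using Ym sm(1) by (subst nn_integral_cmult) (auto simp: nn_integral_add)
      also have "\<dots> \<le> ennreal (2 * K\<^sup>2) * (ennreal (\<integral>\<omega>. (Y s \<omega>)\<^sup>2 \<partial>M) + ennreal C)"
        unfolding sm(2) using C(2)[OF s] L2_varsD(2)[OF Ys]
        by (intro mult_left_mono add_mono) (auto simp: nn_integral_eq_integral)
      also have "\<dots> = ennreal (2 * K\<^sup>2 * ((\<integral>\<omega>. (Y s \<omega>)\<^sup>2 \<partial>M) + C))"
        using C(1) by (subst ennreal_mult) (auto simp: ennreal_plus)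
      finally show ?case .
    qed
  qed
qed

lemma measurable_along:
  assumes "measurable_coeff T \<phi>" shows "case_prod (along \<phi> X u \<mu>) \<in> borel_measurable (Q T)"
  using measurable_coeff_comp[OF assms measurable_time_Q sol_measurable(1) control_measurable(1) sol_law(3)] by (simp add: split_beta')

lemma drift_L2: "case_prod (along b X u \<mu>) \<in> L2_vars (Q T) (Q T)"
proof -
  let ?Y = "\<lambda>t \<omega>. 1 + \<bar>X t \<omega>\<bar> + \<bar>u t \<omega>\<bar>"
  have Y: "case_prod ?Y \<in> L2_vars (Q T) (Q T)"
  proof -
    have "(\<lambda>z. 1 + \<bar>case_prod X z\<bar> + \<bar>case_prod u z\<bar>) \<in> L2_vars (Q T) (Q T)"
      by (intro L2_add L2_abs sol_L2_Q control_L2 L2_const finite_measure_Q)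
    then show ?thesis by (simp add: split_beta')
  qed
  show ?thesis
  proof (rule L2_Q_growth[OF _ Y])
    show "case_prod (along b X u \<mu>) \<in> borel_measurable (Q T)" using data by (intro measurable_along) (simp add: measurable_data_def)
    show "0 \<le> L" using L_pos by simp
    fix t \<omega> assume t: "t \<in> {0..T}" and w: "\<omega> \<in> space M"
    note m = sol_law(1)[OF t w]
    have "\<bar>b t (X t \<omega>) (u t \<omega>) (\<mu> t \<omega>)\<bar> \<le> \<bar>b0 t (\<mu> t \<omega>)\<bar> + \<bar>b1 t * X t \<omega>\<bar> + \<bar>b2 t * u t \<omega>\<bar>"
      unfolding affine(1)[OF t m] by linarith
    also have "\<dots> \<le> L * (1 + sqrt (second_moment (\<mu> t \<omega>))) + L * \<bar>X t \<omega>\<bar> + L * \<bar>u t \<omega>\<bar>"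
      unfolding abs_mult by (intro add_mono mult_right_mono coeff_bounds[OF t] m) auto
    also have "\<dots> = L * (\<bar>?Y t \<omega>\<bar> + sqrt (second_moment (\<mu> t \<omega>)))" by (simp add: algebra_simps)
    finally show "\<bar>b t (X t \<omega>) (u t \<omega>) (\<mu> t \<omega>)\<bar> \<le> L * (\<bar>?Y t \<omega>\<bar> + sqrt (second_moment (\<mu> t \<omega>)))" .
  qed
qed

lemma adjoint_drift_eq:
  assumes "t \<in> {0..T}" "\<omega> \<in> space M"
  shows "adjoint_drift X p q q\<^sub>c u \<mu> t \<omega> =
    - (b1 t * p t \<omega> + \<sigma>1 t * q t \<omega> + \<sigma>\<^sub>c1 t * q\<^sub>c t \<omega> + (f0x t (X t \<omega>) (u t \<omega>) + f1x t (X t \<omega>) (\<mu> t \<omega>)))"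
  using deriv_hamiltonian[OF assms(1) sol_law(1)[OF assms]] by simp

lemma adjoint_drift_L2: "case_prod (adjoint_drift X p q q\<^sub>c u \<mu>) \<in> L2_vars (Q T) (Q T)"
proof -
  let ?Y = "\<lambda>t \<omega>. 1 + \<bar>X t \<omega>\<bar> + \<bar>u t \<omega>\<bar> + \<bar>p t \<omega>\<bar> + \<bar>q t \<omega>\<bar> + \<bar>q\<^sub>c t \<omega>\<bar>"
  have Y: "case_prod ?Y \<in> L2_vars (Q T) (Q T)"
  proof -
    have "(\<lambda>z. 1 + \<bar>case_prod X z\<bar> + \<bar>case_prod u z\<bar> + \<bar>case_prod p z\<bar> + \<bar>case_prod q z\<bar> + \<bar>case_prod q\<^sub>c z\<bar>) \<in> L2_vars (Q T) (Q T)"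
      by (intro L2_add L2_abs sol_L2_Q control_L2 L2_const finite_measure_Q)
    then show ?thesis by (simp add: split_beta')
  qed
  have eq: "case_prod (adjoint_drift X p q q\<^sub>c u \<mu>) z = - (b1 (fst z) * case_prod p z + \<sigma>1 (fst z) * case_prod q z + \<sigma>\<^sub>c1 (fst z) * case_prod q\<^sub>c z
    + (f0x (fst z) (case_prod X z) (case_prod u z) + f1x (fst z) (case_prod X z) (case_prod \<mu> z)))" if "z \<in> space (Q T)" for z
    using that adjoint_drift_eq[of "fst z" "snd z"] by (cases z) (simp add: space_Q)
  note [measurable] = sol_measurable measurable_compose[OF measurable_time_Q coeff_measurable(1)]
    measurable_compose[OF measurable_time_Q coeff_measurable(3)] measurable_compose[OF measurable_time_Q coeff_measurable(5)]
    f_derivatives_measurable(1)[OF measurable_time_Q sol_measurable(1) control_measurable(1) sol_law(3)]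
  have m: "case_prod (adjoint_drift X p q q\<^sub>c u \<mu>) \<in> borel_measurable (Q T)"
    by (subst measurable_cong[OF eq]) measurable
  show ?thesis
  proof (rule L2_Q_growth[OF m Y])
    show "0 \<le> L" using L_pos by simp
    fix t \<omega> assume t: "t \<in> {0..T}" and w: "\<omega> \<in> space M"
    have "\<bar>adjoint_drift X p q q\<^sub>c u \<mu> t \<omega>\<bar> \<le> \<bar>b1 t * p t \<omega>\<bar> + \<bar>\<sigma>1 t * q t \<omega>\<bar> + \<bar>\<sigma>\<^sub>c1 t * q\<^sub>c t \<omega>\<bar> + \<bar>f0x t (X t \<omega>) (u t \<omega>) + f1x t (X t \<omega>) (\<mu> t \<omega>)\<bar>"
      unfolding adjoint_drift_eq[OF t w] by linarith
    also have "\<dots> \<le> L * \<bar>p t \<omega>\<bar> + L * \<bar>q t \<omega>\<bar> + L * \<bar>q\<^sub>c t \<omega>\<bar> + L * (1 + \<bar>X t \<omega>\<bar> + \<bar>u t \<omega>\<bar> + sqrt (second_moment (\<mu> t \<omega>)))"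
      unfolding abs_mult by (intro add_mono mult_right_mono coeff_bounds[OF t] growth(1)[OF t sol_law(1)[OF t w]]) auto
    also have "\<dots> = L * (\<bar>?Y t \<omega>\<bar> + sqrt (second_moment (\<mu> t \<omega>)))" by (simp add: algebra_simps)
    finally show "\<bar>adjoint_drift X p q q\<^sub>c u \<mu> t \<omega>\<bar> \<le> L * (\<bar>?Y t \<omega>\<bar> + sqrt (second_moment (\<mu> t \<omega>)))" .
  qed
qed

text \<open>At a fixed time and a fixed measure, \<open>f1x\<close> is a Lipschitz function of the state, and it can be
  subtracted from the measurable sum \<open>f0x + f1x\<close>.\<close>

lemma f0x_adapted:
  assumes t: "t \<in> {0..T}"
  shows "(\<lambda>\<omega>. f0x t (X t \<omega>) (u t \<omega>)) \<in> borel_measurable (F t)"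
proof -
  have "continuous_on UNIV (\<lambda>x. f1x t x (return borel 0))"
  proof (rule lipschitz_on_continuous_on, rule lipschitz_onI)
    show "dist (f1x t x (return borel 0)) (f1x t y (return borel 0)) \<le> L * dist x y" for x y
      using cost_lipschitz(1)[OF t dirac_P2(1), of x y] by (simp add: dist_real_def)
  qed (use L_pos in simp)
  then have "(\<lambda>x. f1x t x (return borel 0)) \<in> borel_measurable borel" by (rule borel_measurable_continuous_onI)
  from measurable_compose[OF sol_adapted(1)[OF t] this]
    f_derivatives_measurable(1)[OF measurable_time_const[OF t] sol_adapted(1)[OF t] control_measurable(2)[OF t] measurable_dirac]
  have "(\<lambda>\<omega>. (f0x t (X t \<omega>) (u t \<omega>) + f1x t (X t \<omega>) (return borel 0)) - f1x t (X t \<omega>) (return borel 0)) \<in> borel_measurable (F t)"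
    by (intro borel_measurable_diff)
  then show ?thesis by simp
qed

text \<open>The process \<open>\<mu>\<close> is jointly measurable with respect to all events. That a functional of
  \<open>\<mu> t\<close> is known at time \<open>t\<close> comes from its Lipschitz continuity.\<close>

lemma law_functional_adapted:
  assumes t: "t \<in> {0..T}" and \<phi>: "\<And>m m'. m \<in> P2 \<Longrightarrow> m' \<in> P2 \<Longrightarrow> \<bar>\<phi> m - \<phi> m'\<bar> \<le> L * W2 m m'"
  shows "(\<lambda>\<omega>. \<phi> (\<mu> t \<omega>) :: real) \<in> borel_measurable (G t)"
proof (rule W2_lipschitz_measurable[OF \<phi>])
  have G: "subalgebra M (G t)" using t by (intro subalgebra_G) simp
  show "0 \<le> L" using L_pos by simp
  show "\<mu> t \<in> G t \<rightarrow>\<^sub>M prob_algebra borel" using sol_law(2)[OF t] by (simp add: is_cond_law_def)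
  show "\<mu> t \<omega> \<in> P2" if "\<omega> \<in> space (G t)" for \<omega> using that sol_law(1)[OF t] G by (simp add: subalgebra_def)
qed

lemma drift_adapted:
  assumes t: "t \<in> {0..T}"
  shows "along b X u \<mu> t \<in> borel_measurable (F t)"
proof -
  have "(\<lambda>\<omega>. b0 t (\<mu> t \<omega>)) \<in> borel_measurable (G t)"
  proof (rule law_functional_adapted[OF t])
    show "\<bar>b0 t m - b0 t m'\<bar> \<le> L * W2 m m'" if "m \<in> P2" "m' \<in> P2" for m m'
      using coeff_W2_lipschitz(1)[OF t that Lm_le_L] by (simp add: abs_minus_commute)
  qed
  then have [measurable]: "(\<lambda>\<omega>. b0 t (\<mu> t \<omega>)) \<in> borel_measurable (F t)"
    using t by (intro measurable_from_subalg[OF subalgebra_F_G]) auto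
  note [measurable] = sol_adapted[OF t] control_measurable(2)[OF t]
  have "(\<lambda>\<omega>. b0 t (\<mu> t \<omega>) + b1 t * X t \<omega> + b2 t * u t \<omega>) \<in> borel_measurable (F t)" by measurable
  then show ?thesis by (rule measurable_cong[THEN iffD2, rotated]) (simp add: affine[OF t sol_law(1)[OF t]])
qed

lemma adjoint_drift_adapted:
  assumes t: "t \<in> {0..T}"
  shows "adjoint_drift X p q q\<^sub>c u \<mu> t \<in> borel_measurable (F t)"
proof -
  have "(\<lambda>(\<omega>, x). f1x t x (\<mu> t \<omega>)) \<in> borel_measurable (G t \<Otimes>\<^sub>M borel)"
  proof (rule caratheodory_measurable)
    show "(\<lambda>\<omega>. f1x t x (\<mu> t \<omega>)) \<in> borel_measurable (G t)" for x
      by (rule law_functional_adapted[OF t]) (rule cost_lipschitz(2)[OF t])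
    show "continuous_on UNIV (\<lambda>x. f1x t x (\<mu> t \<omega>))" if "\<omega> \<in> space (G t)" for \<omega>
    proof (rule lipschitz_on_continuous_on, rule lipschitz_onI)
      have "\<omega> \<in> space M" using that subalgebra_G[of t] t by (simp add: subalgebra_def)
      from cost_lipschitz(1)[OF t sol_law(1)[OF t this]]
      show "dist (f1x t x (\<mu> t \<omega>)) (f1x t y (\<mu> t \<omega>)) \<le> L * dist x y" for x y by (simp add: dist_real_def)
    qed (use L_pos in simp)
  qed
  moreover have "(\<lambda>\<omega>. (\<omega>, X t \<omega>)) \<in> F t \<rightarrow>\<^sub>M G t \<Otimes>\<^sub>M borel"
  proof (rule measurable_Pair)
    show "(\<lambda>\<omega>. \<omega>) \<in> F t \<rightarrow>\<^sub>M G t" using t by (intro measurable_from_subalg[OF subalgebra_F_G]) auto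
  qed (rule sol_adapted(1)[OF t])
  ultimately have "(\<lambda>\<omega>. f1x t (X t \<omega>) (\<mu> t \<omega>)) \<in> borel_measurable (F t)" using measurable_compose by fastforce
  note [measurable] = this f0x_adapted[OF t] sol_adapted[OF t]
  have "(\<lambda>\<omega>. - (b1 t * p t \<omega> + \<sigma>1 t * q t \<omega> + \<sigma>\<^sub>c1 t * q\<^sub>c t \<omega> + (f0x t (X t \<omega>) (u t \<omega>) + f1x t (X t \<omega>) (\<mu> t \<omega>)))) \<in> borel_measurable (F t)"
    by measurable
  then show ?thesis by (rule measurable_cong[THEN iffD2, rotated]) (simp add: adjoint_drift_eq[OF t])
qed

theorem solution_ito_processes:
  shows "ito_process X (along b X u \<mu>) (along \<sigma> X u \<mu>) (along \<sigma>\<^sub>c X u \<mu>)"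
    "ito_process p (adjoint_drift X p q q\<^sub>c u \<mu>) q q\<^sub>c"
proof -
  have "has_stoch_differential M F T W W\<^sub>c X (along b X u \<mu>) (along \<sigma> X u \<mu>) (along \<sigma>\<^sub>c X u \<mu>)"
    "has_stoch_differential M F T W W\<^sub>c p (adjoint_drift X p q q\<^sub>c u \<mu>) q q\<^sub>c"
    using sol by (auto simp: solution_def)
  then show "ito_process X (along b X u \<mu>) (along \<sigma> X u \<mu>) (along \<sigma>\<^sub>c X u \<mu>)"
    "ito_process p (adjoint_drift X p q q\<^sub>c u \<mu>) q q\<^sub>c"
    unfolding ito_process_def
    using sol_L2_Q sol_L2_time drift_L2 adjoint_drift_L2 drift_adapted adjoint_drift_adapted by blast+
qed

end

end

section \<open>Energy identities for differences\<close>

lemma integral_R_exp: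
  fixes C :: real
  assumes "0 \<le> t"
  shows "integrable (restrict_space lborel {0..t}) (\<lambda>s. exp (C * s))"
    "C \<noteq> 0 \<Longrightarrow> (\<integral>s. exp (C * s) \<partial>restrict_space lborel {0..t}) = (exp (C * t) - 1) / C"
proof -
  have c: "continuous_on {0..t} (\<lambda>s. exp (C * s))" by (intro continuous_intros)
  have "set_integrable lborel {0..t} (\<lambda>s. exp (C * s))"
    by (rule borel_integrable_atLeastAtMost') (rule c)
  then show "integrable (restrict_space lborel {0..t}) (\<lambda>s. exp (C * s))"
    by (simp add: integrable_restrict_space set_integrable_def)
  assume "C \<noteq> 0"
  then have "((\<lambda>s. exp (C * s) / C) has_real_derivative exp (C * s)) (at s within {0..t})" for s
    by (auto intro!: derivative_eq_intros)
  then have "has_bochner_integral lborel (\<lambda>s. indicator {0..t} s *\<^sub>R exp (C * s)) (exp (C * t) / C - exp (C * 0) / C)"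
    using assms by (intro has_bochner_integral_FTC_Icc[where F="\<lambda>s. exp (C * s) / C", unfolded has_real_derivative_iff_has_vector_derivative[symmetric]] c)
      (auto simp: has_real_derivative_iff_has_vector_derivative)
  then have "(\<integral>s. indicator {0..t} s *\<^sub>R exp (C * s) \<partial>lborel) = exp (C * t) / C - exp (C * 0) / C"
    by (rule has_bochner_integral_integral_eq)
  then show "(\<integral>s. exp (C * s) \<partial>restrict_space lborel {0..t}) = (exp (C * t) - 1) / C"
    by (simp add: integral_restrict_space diff_divide_distrib)
qed

lemma integral_R_mono:
  fixes y :: "real \<Rightarrow> real"
  assumes "integrable (restrict_space lborel {0..T}) y" "\<And>s. s \<in> {0..T} \<Longrightarrow> 0 \<le> y s" "t \<le> T"
  shows "integrable (restrict_space lborel {0..t}) y"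
    "(\<integral>s. y s \<partial>restrict_space lborel {0..t}) \<le> (\<integral>s. y s \<partial>restrict_space lborel {0..T})"
proof -
  have T: "set_integrable lborel {0..T} y" using assms(1) by (simp add: integrable_restrict_space set_integrable_def)
  have t: "set_integrable lborel {0..t} y" by (rule set_integrable_subset[OF T]) (use assms(3) in auto)
  show "integrable (restrict_space lborel {0..t}) y" using t by (simp add: integrable_restrict_space set_integrable_def)
  show "(\<integral>s. y s \<partial>restrict_space lborel {0..t}) \<le> (\<integral>s. y s \<partial>restrict_space lborel {0..T})"
    using T t assms(2,3) unfolding set_integral_time_full[symmetric] set_lebesgue_integral_def set_integrable_def
    by (intro integral_mono) (auto split: split_indicator)
qed

text \<open>Compare \<open>y\<close> with its supremum in the norm with weight \<open>exp (2 C t)\<close>, in which integration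
  has norm at most \<open>1 / (2 C)\<close>. This gives Gronwall's inequality with a factor two, which is
  harmless here.\<close>

lemma gronwall_forward:
  fixes y :: "real \<Rightarrow> real"
  assumes i: "integrable (restrict_space lborel {0..T}) y" and y0: "\<And>t. t \<in> {0..T} \<Longrightarrow> 0 \<le> y t"
    and C: "0 < C" and A: "0 \<le> A"
    and le: "\<And>t. t \<in> {0..T} \<Longrightarrow> y t \<le> A + C * (\<integral>s. y s \<partial>restrict_space lborel {0..t})" and t: "t \<in> {0..T}"
  shows "y t \<le> 2 * A * exp (2 * C * T)"
proof -
  let ?R = "\<lambda>t. restrict_space lborel {0..t}"
  define m where "m = (SUP t\<in>{0..T}. exp (- (2 * C * t)) * y t)"
  have bdd: "bdd_above ((\<lambda>t. exp (- (2 * C * t)) * y t) ` {0..T})"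
  proof (rule bdd_aboveI2)
    fix t assume t: "t \<in> {0..T}"
    have "exp (- (2 * C * t)) * y t \<le> 1 * y t" using t C y0[OF t] by (intro mult_right_mono) auto
    also have "\<dots> \<le> A + C * (\<integral>s. y s \<partial>?R T)"
      using le[OF t] integral_R_mono(2)[OF i y0, of t] C t by (smt (verit) atLeastAtMost_iff mult_left_mono)
    finally show "exp (- (2 * C * t)) * y t \<le> A + C * (\<integral>s. y s \<partial>?R T)" .
  qed
  have ym: "y t \<le> m * exp (2 * C * t)" if "t \<in> {0..T}" for t
    using cSUP_upper[OF that bdd] by (simp add: m_def exp_minus field_simps)
  have m0: "0 \<le> m" using ym[OF t] y0[OF t] by (meson exp_gt_zero order_trans zero_le_mult_iff linorder_not_less)
  have "m \<le> A + m / 2"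
    unfolding m_def
  proof (rule cSUP_least)
    fix t assume t: "t \<in> {0..T}"
    have "(\<integral>s. y s \<partial>?R t) \<le> (\<integral>s. m * exp (2 * C * s) \<partial>?R t)"
      using t ym integral_R_mono(1)[OF i y0, of t] integral_R_exp(1)[of t "2 * C"] by (intro integral_mono) (auto simp: space_restrict_space)
    also have "\<dots> = m * ((exp (2 * C * t) - 1) / (2 * C))" using t C integral_R_exp(2)[of t "2 * C"] by simp
    finally have "C * (\<integral>s. y s \<partial>?R t) \<le> C * (m * ((exp (2 * C * t) - 1) / (2 * C)))" using C by (intro mult_left_mono) auto
    also have "\<dots> = m * (exp (2 * C * t) - 1) / 2" using C by simp
    also have "\<dots> \<le> m * exp (2 * C * t) / 2" using m0 by (simp add: algebra_simps)
    finally have "y t \<le> A + m / 2 * exp (2 * C * t)" using le[OF t] by simp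
    then have "exp (- (2 * C * t)) * y t \<le> exp (- (2 * C * t)) * A + m / 2" by (simp add: exp_minus field_simps)
    also have "\<dots> \<le> 1 * A + m / 2" using A C t by (intro add_mono mult_right_mono) auto
    finally show "exp (- (2 * C * t)) * y t \<le> A + (SUP t\<in>{0..T}. exp (- (2 * C * t)) * y t) / 2" by (simp add: m_def)
  qed (use t in auto)
  then have "m * exp (2 * C * t) \<le> (2 * A) * exp (2 * C * T)"
    using t C A by (intro mult_mono) auto
  with ym[OF t] show ?thesis by simp
qed

lemma gronwall_backward:
  fixes y :: "real \<Rightarrow> real"
  assumes i: "integrable (restrict_space lborel {0..T}) y" and y0: "\<And>t. t \<in> {0..T} \<Longrightarrow> 0 \<le> y t"
    and C: "0 < C" and A: "0 \<le> A"
    and le: "\<And>t. t \<in> {0..T} \<Longrightarrow> y t \<le> A + C * ((\<integral>s. y s \<partial>restrict_space lborel {0..T}) - (\<integral>s. y s \<partial>restrict_space lborel {0..t}))"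
    and t: "t \<in> {0..T}"
  shows "y t \<le> 2 * A * exp (2 * C * T)"
proof -
  let ?R = "\<lambda>t. restrict_space lborel {0..t}"
  define m where "m = (SUP t\<in>{0..T}. exp (2 * C * t) * y t)"
  have bdd: "bdd_above ((\<lambda>t. exp (2 * C * t) * y t) ` {0..T})"
  proof (rule bdd_aboveI2)
    fix t assume t: "t \<in> {0..T}"
    have "0 \<le> (\<integral>s. y s \<partial>?R t)" using y0 t by (intro integral_nonneg_AE AE_I2) (auto simp: space_restrict_space)
    then have "y t \<le> A + C * (\<integral>s. y s \<partial>?R T)" using le[OF t] C by (smt (verit) mult_left_mono)
    then show "exp (2 * C * t) * y t \<le> exp (2 * C * T) * (A + C * (\<integral>s. y s \<partial>?R T))"
      using t C y0[OF t] by (intro mult_mono) auto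
  qed
  have ym: "y t \<le> m * exp ((- (2 * C)) * t)" if "t \<in> {0..T}" for t
    using cSUP_upper[OF that bdd] by (simp add: m_def exp_minus field_simps)
  have m0: "0 \<le> m" using ym[OF t] y0[OF t] by (meson exp_gt_zero order_trans zero_le_mult_iff linorder_not_less)
  have "m \<le> A * exp (2 * C * T) + m / 2"
    unfolding m_def
  proof (rule cSUP_least)
    fix t assume t: "t \<in> {0..T}"
    let ?w = "\<lambda>s. m * exp ((- (2 * C)) * s)"
    have w: "integrable (?R s) ?w" "(\<integral>r. ?w r \<partial>?R s) = m * ((exp (- (2 * C) * s) - 1) / (- (2 * C)))" if "0 \<le> s" for s
      using that C integral_R_exp[of s "- (2 * C)"] by simp_all
    have "(\<integral>s. ?w s - y s \<partial>?R t) \<le> (\<integral>s. ?w s - y s \<partial>?R T)"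
      using i w t ym by (intro integral_R_mono(2)) auto
    then have "(\<integral>s. y s \<partial>?R T) - (\<integral>s. y s \<partial>?R t) \<le> (\<integral>s. ?w s \<partial>?R T) - (\<integral>s. ?w s \<partial>?R t)"
      using w[of t] w[of T] i integral_R_mono(1)[OF i y0, of t] t by simp
    also have "\<dots> = m * (exp (- (2 * C) * t) - exp (- (2 * C) * T)) / (2 * C)"
      using w(2)[of t] w(2)[of T] t C by (simp add: field_simps)
    also have "\<dots> \<le> m * exp (- (2 * C) * t) / (2 * C)"
      using m0 C by (intro divide_right_mono mult_left_mono) auto
    finally have "C * ((\<integral>s. y s \<partial>?R T) - (\<integral>s. y s \<partial>?R t)) \<le> C * (m * exp (- (2 * C) * t) / (2 * C))"
      using C by (intro mult_left_mono) auto
    also have "\<dots> = m * exp (- (2 * C) * t) / 2" using C by simp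
    finally have "y t \<le> A + m / 2 * exp (- (2 * C) * t)" using le[OF t] by simp
    then have "exp (2 * C * t) * y t \<le> exp (2 * C * t) * (A + m / 2 * exp (- (2 * C) * t))" by (intro mult_left_mono) auto
    also have "\<dots> = exp (2 * C * t) * A + m / 2" by (simp add: algebra_simps exp_minus_inverse flip: exp_add)
    also have "\<dots> \<le> exp (2 * C * T) * A + m / 2" using A C t by (intro add_mono mult_right_mono) auto
    finally show "exp (2 * C * t) * y t \<le> A * exp (2 * C * T) + (SUP t\<in>{0..T}. exp (2 * C * t) * y t) / 2" by (simp add: m_def mult.commute)
  qed (use t in auto)
  then have m2: "m \<le> 2 * A * exp (2 * C * T)" by simp
  have "m * exp ((- (2 * C)) * t) \<le> m * 1" using m0 t C by (intro mult_left_mono) auto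
  with ym[OF t] m2 show ?thesis by simp
qed

definition gap :: "('i \<Rightarrow> 'a \<Rightarrow> real) \<Rightarrow> ('i \<Rightarrow> 'a \<Rightarrow> real) \<Rightarrow> 'i \<Rightarrow> 'a \<Rightarrow> real" where
  "gap A A' s \<omega> = A' s \<omega> - A s \<omega>"

context common_noise begin

definition inner_at :: "(real \<Rightarrow> 'a \<Rightarrow> real) \<Rightarrow> (real \<Rightarrow> 'a \<Rightarrow> real) \<Rightarrow> real \<Rightarrow> real" where
  "inner_at A B s = (\<integral>\<omega>. A s \<omega> * B s \<omega> \<partial>M)"

lemma inner_at_integral:
  assumes A: "case_prod A \<in> L2_vars (Q T) (Q T)" and B: "case_prod B \<in> L2_vars (Q T) (Q T)" and t: "t \<le> T"
  shows "integrable (R t) (inner_at A B)" "integrable (Q t) (\<lambda>z. case_prod A z * case_prod B z)"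
    "(\<integral>z. case_prod A z * case_prod B z \<partial>Q t) = (\<integral>s. inner_at A B s \<partial>R t)"
proof -
  interpret P: pair_sigma_finite "R t" M by (rule pair_Q)
  show i: "integrable (Q t) (\<lambda>z. case_prod A z * case_prod B z)"
    using L2_vars_mult_integrable[OF L2_Q_restrict[OF A t] L2_Q_restrict[OF B t]] .
  show "integrable (R t) (inner_at A B)" "(\<integral>z. case_prod A z * case_prod B z \<partial>Q t) = (\<integral>s. inner_at A B s \<partial>R t)"
    using P.integrable_fst'[OF i] P.integral_fst'[OF i] by (simp_all add: inner_at_def[abs_def])
qed

lemma gap_L2_Q:
  assumes "case_prod A \<in> L2_vars (Q T) (Q T)" "case_prod A' \<in> L2_vars (Q T) (Q T)"
  shows "case_prod (gap A A') \<in> L2_vars (Q T) (Q T)"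
proof -
  have "case_prod (gap A A') = (\<lambda>z. case_prod A' z - case_prod A z)" by (auto simp: gap_def fun_eq_iff)
  then show ?thesis using L2_diff[OF assms(2,1)] by simp
qed

lemma ito_coefficients_L2:
  assumes "ito_process Y \<alpha> \<beta> \<gamma>"
  shows "case_prod Y \<in> L2_vars (Q T) (Q T)" "case_prod \<alpha> \<in> L2_vars (Q T) (Q T)"
    "case_prod \<beta> \<in> L2_vars (Q T) (Q T)" "case_prod \<gamma> \<in> L2_vars (Q T) (Q T)"
  using ito_processD(1,4)[OF assms] mart_part_isometry(2,3)[OF assms assms, of T] T_pos by auto

text \<open>Both sides are bilinear in the two pairs of processes, so four product rules add up.\<close>

lemma product_rule_gap:
  assumes Y: "ito_process Y \<alpha> \<beta> \<gamma>" and Y': "ito_process Y' \<alpha>' \<beta>' \<gamma>'"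
    and Z: "ito_process Z a b c" and Z': "ito_process Z' a' b' c'" and t: "t \<in> {0..T}"
  shows "inner_at (gap Y Y') (gap Z Z') t = inner_at (gap Y Y') (gap Z Z') 0 +
     (\<integral>s. inner_at (gap \<alpha> \<alpha>') (gap Z Z') s + inner_at (gap Y Y') (gap a a') s
        + inner_at (gap \<beta> \<beta>') (gap b b') s + inner_at (gap \<gamma> \<gamma>') (gap c c') s \<partial>R t)"
proof -
  note L2 = ito_coefficients_L2
  define \<Phi> where "\<Phi> Y \<alpha> \<beta> \<gamma> Z a b c z = case_prod \<alpha> z * case_prod Z z + case_prod Y z * case_prod a z + case_prod \<beta> z * case_prod b z + case_prod \<gamma> z * case_prod c z"
    for Y \<alpha> \<beta> \<gamma> Z a b c :: "real \<Rightarrow> 'a \<Rightarrow> real" and z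
  have t': "0 \<le> t" "t \<le> T" using t by auto
  have pr: "inner_at Y Z t = inner_at Y Z 0 + (\<integral>z. \<Phi> Y \<alpha> \<beta> \<gamma> Z a b c z \<partial>Q t)" "integrable (Q t) (\<Phi> Y \<alpha> \<beta> \<gamma> Z a b c)"
    if "ito_process Y \<alpha> \<beta> \<gamma>" "ito_process Z a b c" for Y \<alpha> \<beta> \<gamma> Z a b c
    using product_rule[OF that t'] inner_at_integral(2)[OF _ _ t'(2)] L2[OF that(1)] L2[OF that(2)]
    by (simp_all add: \<Phi>_def[abs_def] inner_at_def)
  have ex: "inner_at (gap Y Y') (gap Z Z') s = inner_at Y' Z' s - inner_at Y' Z s - inner_at Y Z' s + inner_at Y Z s" if "s \<in> {0..T}" for s
  proof -
    have L: "Y s \<in> L2_vars M M" "Y' s \<in> L2_vars M M" "Z s \<in> L2_vars M M" "Z' s \<in> L2_vars M M"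
      using ito_processD(3) Y Y' Z Z' that by blast+
    have e: "gap Y Y' s \<omega> * gap Z Z' s \<omega> = Y' s \<omega> * Z' s \<omega> - Y' s \<omega> * Z s \<omega> - Y s \<omega> * Z' s \<omega> + Y s \<omega> * Z s \<omega>" for \<omega>
      by (simp add: gap_def algebra_simps)
    show ?thesis unfolding inner_at_def e using L by (simp add: L2_vars_mult_integrable)
  qed
  have "(\<integral>s. inner_at (gap \<alpha> \<alpha>') (gap Z Z') s + inner_at (gap Y Y') (gap a a') s
        + inner_at (gap \<beta> \<beta>') (gap b b') s + inner_at (gap \<gamma> \<gamma>') (gap c c') s \<partial>R t)
     = (\<integral>z. \<Phi> (gap Y Y') (gap \<alpha> \<alpha>') (gap \<beta> \<beta>') (gap \<gamma> \<gamma>') (gap Z Z') (gap a a') (gap b b') (gap c c') z \<partial>Q t)"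
    unfolding \<Phi>_def using inner_at_integral[OF _ _ t'(2)] gap_L2_Q[OF L2(1)[OF Y] L2(1)[OF Y']] gap_L2_Q[OF L2(2)[OF Y] L2(2)[OF Y']]
      gap_L2_Q[OF L2(3)[OF Y] L2(3)[OF Y']] gap_L2_Q[OF L2(4)[OF Y] L2(4)[OF Y']]
      gap_L2_Q[OF L2(1)[OF Z] L2(1)[OF Z']] gap_L2_Q[OF L2(2)[OF Z] L2(2)[OF Z']]
      gap_L2_Q[OF L2(3)[OF Z] L2(3)[OF Z']] gap_L2_Q[OF L2(4)[OF Z] L2(4)[OF Z']] by simp
  also have "\<dots> = (\<integral>z. \<Phi> Y' \<alpha>' \<beta>' \<gamma>' Z' a' b' c' z - \<Phi> Y' \<alpha>' \<beta>' \<gamma>' Z a b c z - \<Phi> Y \<alpha> \<beta> \<gamma> Z' a' b' c' z + \<Phi> Y \<alpha> \<beta> \<gamma> Z a b c z \<partial>Q t)"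
    by (intro Bochner_Integration.integral_cong refl) (auto simp: \<Phi>_def gap_def algebra_simps split: prod.splits)
  also have "\<dots> = (\<integral>z. \<Phi> Y' \<alpha>' \<beta>' \<gamma>' Z' a' b' c' z \<partial>Q t) - (\<integral>z. \<Phi> Y' \<alpha>' \<beta>' \<gamma>' Z a b c z \<partial>Q t) - (\<integral>z. \<Phi> Y \<alpha> \<beta> \<gamma> Z' a' b' c' z \<partial>Q t) + (\<integral>z. \<Phi> Y \<alpha> \<beta> \<gamma> Z a b c z \<partial>Q t)"
    using pr(2)[OF Y' Z'] pr(2)[OF Y' Z] pr(2)[OF Y Z'] pr(2)[OF Y Z] by simp
  finally show ?thesis
    using ex[OF t] ex[of 0] T_pos pr(1)[OF Y' Z'] pr(1)[OF Y' Z] pr(1)[OF Y Z'] pr(1)[OF Y Z] by simp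
qed

lemma AE_R_restrict: "(AE s in R T. P s) \<Longrightarrow> t \<le> T \<Longrightarrow> AE s in R t. P s"
  by (subst (asm) AE_restrict_space_iff) (auto simp: AE_restrict_space_iff elim!: eventually_mono)

end

section \<open>Estimates for the difference of two solutions\<close>

lemma square_le_sum3:
  fixes D a b c K :: real
  assumes "\<bar>D\<bar> \<le> a + b + c" shows "D\<^sup>2 \<le> 3 * (a\<^sup>2 + b\<^sup>2 + c\<^sup>2)"
proof -
  have "D\<^sup>2 \<le> (a + b + c)\<^sup>2" using assms by (subst abs_le_square_iff[symmetric]) simp
  moreover have "0 \<le> (a - b)\<^sup>2 + (a - c)\<^sup>2 + (b - c)\<^sup>2" by simp
  ultimately show ?thesis by (simp add: power2_eq_square algebra_simps)
qed

lemma young: "a * b \<le> (a\<^sup>2 + b\<^sup>2) / 2" for a b :: real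
  using sum_squares_bound[of a b] by simp

locale fbsde_pair = fbsde +
  fixes X p q q\<^sub>c \<mu> X' p' q' q\<^sub>c' \<mu>'
  assumes sol: "solution X p q q\<^sub>c \<mu>" and sol': "solution X' p' q' q\<^sub>c' \<mu>'"
begin

abbreviation "ctrl \<equiv> control X p q q\<^sub>c"
abbreviation "ctrl' \<equiv> control X' p' q' q\<^sub>c'"
abbreviation "dX \<equiv> gap X X'"
abbreviation "dp \<equiv> gap p p'"
abbreviation "dq \<equiv> gap q q'"
abbreviation "dq\<^sub>c \<equiv> gap q\<^sub>c q\<^sub>c'"
abbreviation "du \<equiv> gap ctrl ctrl'"
abbreviation "db \<equiv> gap (along b X ctrl \<mu>) (along b X' ctrl' \<mu>')"
abbreviation "d\<sigma> \<equiv> gap (along \<sigma> X ctrl \<mu>) (along \<sigma> X' ctrl' \<mu>')"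
abbreviation "d\<sigma>\<^sub>c \<equiv> gap (along \<sigma>\<^sub>c X ctrl \<mu>) (along \<sigma>\<^sub>c X' ctrl' \<mu>')"
abbreviation "dA \<equiv> gap (adjoint_drift X p q q\<^sub>c ctrl \<mu>) (adjoint_drift X' p' q' q\<^sub>c' ctrl' \<mu>')"
abbreviation "sq Y \<equiv> inner_at Y Y"

lemmas ito_X = solution_ito_processes(1)[OF sol] solution_ito_processes(1)[OF sol']
lemmas ito_p = solution_ito_processes(2)[OF sol] solution_ito_processes(2)[OF sol']

lemma gaps_L2_Q:
  shows "case_prod dX \<in> L2_vars (Q T) (Q T)" "case_prod dp \<in> L2_vars (Q T) (Q T)"
    "case_prod dq \<in> L2_vars (Q T) (Q T)" "case_prod dq\<^sub>c \<in> L2_vars (Q T) (Q T)" "case_prod du \<in> L2_vars (Q T) (Q T)"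
    "case_prod db \<in> L2_vars (Q T) (Q T)" "case_prod d\<sigma> \<in> L2_vars (Q T) (Q T)" "case_prod d\<sigma>\<^sub>c \<in> L2_vars (Q T) (Q T)"
    "case_prod dA \<in> L2_vars (Q T) (Q T)"
proof -
  note 1 = ito_coefficients_L2[OF ito_X(1)] and 2 = ito_coefficients_L2[OF ito_X(2)]
    and 3 = ito_coefficients_L2[OF ito_p(1)] and 4 = ito_coefficients_L2[OF ito_p(2)]
  show "case_prod dX \<in> L2_vars (Q T) (Q T)" "case_prod db \<in> L2_vars (Q T) (Q T)"
    "case_prod d\<sigma> \<in> L2_vars (Q T) (Q T)" "case_prod d\<sigma>\<^sub>c \<in> L2_vars (Q T) (Q T)"
    using gap_L2_Q[OF 1(1) 2(1)] gap_L2_Q[OF 1(2) 2(2)] gap_L2_Q[OF 1(3) 2(3)] gap_L2_Q[OF 1(4) 2(4)] by blast+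
  show "case_prod dp \<in> L2_vars (Q T) (Q T)" "case_prod dA \<in> L2_vars (Q T) (Q T)"
    "case_prod dq \<in> L2_vars (Q T) (Q T)" "case_prod dq\<^sub>c \<in> L2_vars (Q T) (Q T)"
    using gap_L2_Q[OF 3(1) 4(1)] gap_L2_Q[OF 3(2) 4(2)] gap_L2_Q[OF 3(3) 4(3)] gap_L2_Q[OF 3(4) 4(4)] by blast+
  show "case_prod du \<in> L2_vars (Q T) (Q T)"
    by (rule gap_L2_Q[OF control_L2[OF sol] control_L2[OF sol']])
qed

lemma gaps_L2_time:
  assumes "s \<in> {0..T}" shows "dX s \<in> L2_vars M M" "dp s \<in> L2_vars M M"
  using L2_diff[OF sol_L2_time(3)[OF sol' assms] sol_L2_time(3)[OF sol assms]]
    L2_diff[OF sol_L2_time(4)[OF sol' assms] sol_L2_time(4)[OF sol assms]] by (simp_all add: gap_def[abs_def])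

text \<open>The remaining processes are square integrable at almost every time only.\<close>

definition regular_time :: "real \<Rightarrow> bool" where
  "regular_time s \<longleftrightarrow> s \<in> {0..T} \<and> dq s \<in> L2_vars M M \<and> dq\<^sub>c s \<in> L2_vars M M \<and> du s \<in> L2_vars M M \<and>
     db s \<in> L2_vars M M \<and> d\<sigma> s \<in> L2_vars M M \<and> d\<sigma>\<^sub>c s \<in> L2_vars M M \<and> dA s \<in> L2_vars M M"

lemma AE_regular_time: "AE s in R T. regular_time s"
proof -
  have eta: "(\<lambda>\<omega>. case_prod Y (s, \<omega>)) = Y s" for Y :: "real \<Rightarrow> 'a \<Rightarrow> real" and s by simp
  note sec = gaps_L2_Q[THEN L2_Q_sections(2), unfolded eta]
  have "AE s in R T. s \<in> {0..T}" by (intro AE_I2) (simp add: space_restrict_space)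
  with sec(3-9) show ?thesis by eventually_elim (simp add: regular_time_def)
qed

lemma regular_timeD:
  assumes "regular_time s"
  shows "s \<in> {0..T}" "dX s \<in> L2_vars M M" "dp s \<in> L2_vars M M" "dq s \<in> L2_vars M M" "dq\<^sub>c s \<in> L2_vars M M" "du s \<in> L2_vars M M"
    "db s \<in> L2_vars M M" "d\<sigma> s \<in> L2_vars M M" "d\<sigma>\<^sub>c s \<in> L2_vars M M" "dA s \<in> L2_vars M M"
  using assms gaps_L2_time[of s] by (auto simp: regular_time_def)

lemma sq_eq: "sq Y s = (\<integral>\<omega>. (Y s \<omega>)\<^sup>2 \<partial>M)" by (simp add: inner_at_def power2_eq_square)

lemma sq_nonneg: "0 \<le> sq Y s" by (simp add: sq_eq)

lemma cond_law_pair_at: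
  assumes "s \<in> {0..T}" shows "cond_law_pair M (G s) (X s) (X' s) (\<mu> s) (\<mu>' s)"
proof
  show "subalgebra M (G s)" using assms by (intro subalgebra_G) simp
qed (use sol_L2_time[OF sol assms] sol_L2_time[OF sol' assms] sol_law[OF sol] sol_law[OF sol'] assms in auto)

lemma W2_gap:
  assumes "s \<in> {0..T}"
  obtains h where "integrable M h" "\<And>\<omega>. 0 \<le> h \<omega>" "(\<integral>\<omega>. h \<omega> \<partial>M) = sq dX s"
    "AE \<omega> in M. 0 \<le> W2 (\<mu> s \<omega>) (\<mu>' s \<omega>) \<and> (W2 (\<mu> s \<omega>) (\<mu>' s \<omega>))\<^sup>2 \<le> h \<omega>"
proof -
  interpret cp: cond_law_pair M "G s" "X s" "X' s" "\<mu> s" "\<mu>' s" by (rule cond_law_pair_at[OF assms])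
  obtain h where "integrable M h" "\<And>\<omega>. 0 \<le> h \<omega>" "(\<integral>\<omega>. h \<omega> \<partial>M) = (\<integral>\<omega>. (X' s \<omega> - X s \<omega>)\<^sup>2 \<partial>M)"
    "AE \<omega> in M. 0 \<le> W2 (\<mu> s \<omega>) (\<mu>' s \<omega>) \<and> (W2 (\<mu> s \<omega>) (\<mu>' s \<omega>))\<^sup>2 \<le> h \<omega>" by (rule cp.W2_cond_laws) blast
  then show ?thesis by (intro that[of h]) (simp_all only: sq_eq gap_def)
qed

text \<open>The square of the distance of the conditional laws averages to at most \<open>sq dX s\<close>, so the
  dependence on the law costs no more than the dependence on the state.\<close>

lemma coefficient_gap_bound:
  assumes s: "regular_time s" and D: "D \<in> L2_vars M M"
    and eq: "\<And>\<omega>. \<omega> \<in> space M \<Longrightarrow> D \<omega> = d0 \<omega> + a1 * dX s \<omega> + a2 * du s \<omega>"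
    and lip: "\<And>\<omega>. \<omega> \<in> space M \<Longrightarrow> \<bar>d0 \<omega>\<bar> \<le> L * W2 (\<mu> s \<omega>) (\<mu>' s \<omega>)" and a: "\<bar>a1\<bar> \<le> L" "\<bar>a2\<bar> \<le> L"
  shows "(\<integral>\<omega>. (D \<omega>)\<^sup>2 \<partial>M) \<le> 3 * L\<^sup>2 * (2 * sq dX s + sq du s)"
proof -
  note r = regular_timeD[OF s]
  obtain h where h: "integrable M h" "\<And>\<omega>. 0 \<le> h \<omega>" "(\<integral>\<omega>. h \<omega> \<partial>M) = sq dX s"
    "AE \<omega> in M. 0 \<le> W2 (\<mu> s \<omega>) (\<mu>' s \<omega>) \<and> (W2 (\<mu> s \<omega>) (\<mu>' s \<omega>))\<^sup>2 \<le> h \<omega>" using W2_gap[OF r(1)] by blast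
  have "(\<integral>\<omega>. (D \<omega>)\<^sup>2 \<partial>M) \<le> (\<integral>\<omega>. 3 * L\<^sup>2 * (h \<omega> + (dX s \<omega>)\<^sup>2 + (du s \<omega>)\<^sup>2) \<partial>M)"
  proof (rule integral_mono_AE)
    show "integrable M (\<lambda>\<omega>. (D \<omega>)\<^sup>2)" "integrable M (\<lambda>\<omega>. 3 * L\<^sup>2 * (h \<omega> + (dX s \<omega>)\<^sup>2 + (du s \<omega>)\<^sup>2))"
      using L2_varsD(2)[OF D] h(1) L2_varsD(2)[OF r(2)] L2_varsD(2)[OF r(6)] by auto
    show "AE \<omega> in M. (D \<omega>)\<^sup>2 \<le> 3 * L\<^sup>2 * (h \<omega> + (dX s \<omega>)\<^sup>2 + (du s \<omega>)\<^sup>2)"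
      using h(4) AE_space
    proof eventually_elim
      case (elim \<omega>)
      have "\<bar>D \<omega>\<bar> \<le> \<bar>d0 \<omega>\<bar> + \<bar>a1\<bar> * \<bar>dX s \<omega>\<bar> + \<bar>a2\<bar> * \<bar>du s \<omega>\<bar>"
        unfolding eq[OF elim(2)] abs_mult[symmetric] by linarith
      also have "\<dots> \<le> L * W2 (\<mu> s \<omega>) (\<mu>' s \<omega>) + L * \<bar>dX s \<omega>\<bar> + L * \<bar>du s \<omega>\<bar>"
        using lip[OF elim(2)] a by (intro add_mono mult_right_mono) auto
      finally have "(D \<omega>)\<^sup>2 \<le> 3 * ((L * W2 (\<mu> s \<omega>) (\<mu>' s \<omega>))\<^sup>2 + (L * \<bar>dX s \<omega>\<bar>)\<^sup>2 + (L * \<bar>du s \<omega>\<bar>)\<^sup>2)" by (rule square_le_sum3)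
      also have "\<dots> = 3 * L\<^sup>2 * ((W2 (\<mu> s \<omega>) (\<mu>' s \<omega>))\<^sup>2 + (dX s \<omega>)\<^sup>2 + (du s \<omega>)\<^sup>2)" by (simp add: power_mult_distrib algebra_simps)
      also have "\<dots> \<le> 3 * L\<^sup>2 * (h \<omega> + (dX s \<omega>)\<^sup>2 + (du s \<omega>)\<^sup>2)" using elim(1) by (intro mult_left_mono add_right_mono) auto
      finally show ?case .
    qed
  qed
  also have "\<dots> = 3 * L\<^sup>2 * (2 * sq dX s + sq du s)"
    using h(1,3) L2_varsD(2)[OF r(2)] L2_varsD(2)[OF r(6)] by (simp add: sq_eq)
  finally show ?thesis .
qed

lemma coefficient_gaps:
  assumes "s \<in> {0..T}" "\<omega> \<in> space M"
  shows "db s \<omega> = (b0 s (\<mu>' s \<omega>) - b0 s (\<mu> s \<omega>)) + b1 s * dX s \<omega> + b2 s * du s \<omega>"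
    "d\<sigma> s \<omega> = (\<sigma>0 s (\<mu>' s \<omega>) - \<sigma>0 s (\<mu> s \<omega>)) + \<sigma>1 s * dX s \<omega> + \<sigma>2 s * du s \<omega>"
    "d\<sigma>\<^sub>c s \<omega> = (\<sigma>\<^sub>c0 s (\<mu>' s \<omega>) - \<sigma>\<^sub>c0 s (\<mu> s \<omega>)) + \<sigma>\<^sub>c1 s * dX s \<omega> + \<sigma>\<^sub>c2 s * du s \<omega>"
  using affine[OF assms(1) sol_law(1)[OF sol assms]] affine[OF assms(1) sol_law(1)[OF sol' assms]]
  by (simp_all add: gap_def algebra_simps)

lemma coefficient_gap_bounds:
  assumes s: "regular_time s"
  shows "sq db s \<le> 3 * L\<^sup>2 * (2 * sq dX s + sq du s)" "sq d\<sigma> s \<le> 3 * L\<^sup>2 * (2 * sq dX s + sq du s)"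
    "sq d\<sigma>\<^sub>c s \<le> 3 * L\<^sup>2 * (2 * sq dX s + sq du s)"
proof -
  note r = regular_timeD[OF s]
  note lip = coeff_W2_lipschitz[OF r(1) sol_law(1)[OF sol r(1)] sol_law(1)[OF sol' r(1)] Lm_le_L]
  show "sq db s \<le> 3 * L\<^sup>2 * (2 * sq dX s + sq du s)"
    unfolding sq_eq[of db] by (rule coefficient_gap_bound[OF s r(7) coefficient_gaps(1)[OF r(1)] lip(1) coeff_bounds(1,2)[OF r(1)]])
  show "sq d\<sigma> s \<le> 3 * L\<^sup>2 * (2 * sq dX s + sq du s)"
    unfolding sq_eq[of d\<sigma>] by (rule coefficient_gap_bound[OF s r(8) coefficient_gaps(2)[OF r(1)] lip(2) coeff_bounds(3,4)[OF r(1)]])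
  show "sq d\<sigma>\<^sub>c s \<le> 3 * L\<^sup>2 * (2 * sq dX s + sq du s)"
    unfolding sq_eq[of d\<sigma>\<^sub>c] by (rule coefficient_gap_bound[OF s r(9) coefficient_gaps(3)[OF r(1)] lip(3) coeff_bounds(5,6)[OF r(1)]])
qed

lemma forward_rate:
  assumes s: "regular_time s"
  shows "2 * inner_at db dX s + sq d\<sigma> s + sq d\<sigma>\<^sub>c s \<le> (1 + 18 * L\<^sup>2) * sq dX s + 9 * L\<^sup>2 * sq du s"
proof -
  note r = regular_timeD[OF s]
  have "inner_at db dX s \<le> (\<integral>\<omega>. ((db s \<omega>)\<^sup>2 + (dX s \<omega>)\<^sup>2) / 2 \<partial>M)"
    unfolding inner_at_def using L2_vars_mult_integrable[OF r(7) r(2)] L2_varsD(2)[OF r(7)] L2_varsD(2)[OF r(2)]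
    by (intro integral_mono young) auto
  also have "\<dots> = (sq db s + sq dX s) / 2"
    using L2_varsD(2)[OF r(7)] L2_varsD(2)[OF r(2)] by (simp add: sq_eq)
  finally have "2 * inner_at db dX s + sq d\<sigma> s + sq d\<sigma>\<^sub>c s \<le> sq dX s + sq db s + sq d\<sigma> s + sq d\<sigma>\<^sub>c s" by simp
  also have "\<dots> \<le> sq dX s + 9 * L\<^sup>2 * (2 * sq dX s + sq du s)" using coefficient_gap_bounds[OF s] by linarith
  finally show ?thesis by (simp add: algebra_simps)
qed

abbreviation "df1x s \<omega> \<equiv> f1x s (X' s \<omega>) (\<mu>' s \<omega>) - f1x s (X s \<omega>) (\<mu> s \<omega>)"
abbreviation "df0x s \<omega> \<equiv> f0x s (X' s \<omega>) (ctrl' s \<omega>) - f0x s (X s \<omega>) (ctrl s \<omega>)"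
abbreviation "df0u s \<omega> \<equiv> f0u s (X' s \<omega>) (ctrl' s \<omega>) - f0u s (X s \<omega>) (ctrl s \<omega>)"

text \<open>Weak monotonicity holds conditionally on the common noise, which is where the conditional laws
  enter as an advantage and not as an error term.\<close>

lemma f1x_gap:
  assumes s: "s \<in> {0..T}"
  shows "df1x s \<in> L2_vars M M" "0 \<le> (\<integral>\<omega>. df1x s \<omega> * dX s \<omega> \<partial>M)" "(\<integral>\<omega>. (df1x s \<omega>)\<^sup>2 \<partial>M) \<le> 4 * L\<^sup>2 * sq dX s"
proof -
  interpret cp: cond_law_pair M "G s" "X s" "X' s" "\<mu> s" "\<mu>' s" by (rule cond_law_pair_at[OF s])
  have w: "weakly_monotone (\<lambda>x m. f1x s x m)" using H6 s by (simp add: H6_def)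
  show "df1x s \<in> L2_vars M M" "0 \<le> (\<integral>\<omega>. df1x s \<omega> * dX s \<omega> \<partial>M)" "(\<integral>\<omega>. (df1x s \<omega>)\<^sup>2 \<partial>M) \<le> 4 * L\<^sup>2 * sq dX s"
    using cp.weakly_monotone_cond_laws[OF w less_imp_le[OF L_pos] cost_lipschitz(3)[OF s] cost_lipschitz(1)[OF s] cost_lipschitz(2)[OF s]]
    by (simp_all add: sq_eq gap_def)
qed

text \<open>The terminal condition turns weak monotonicity of \<open>gx\<close> into a sign for the final pairing.\<close>

lemma terminal_gap:
  shows "0 \<le> inner_at dX dp T" "sq dp T \<le> 4 * L\<^sup>2 * sq dX T"
proof -
  have T: "T \<in> {0..T}" using T_pos by simp
  interpret cp: cond_law_pair M "G T" "X T" "X' T" "\<mu> T" "\<mu>' T" by (rule cond_law_pair_at[OF T])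
  have w: "weakly_monotone (\<lambda>x m. gx x m)" using H6 by (simp add: H6_def)
  note * = cp.weakly_monotone_cond_laws[OF w less_imp_le[OF L_pos] cost_lipschitz(6)[OF T] cost_lipschitz(4)[OF T] cost_lipschitz(5)[OF T]]
  have "AE \<omega> in M. p T \<omega> = gx (X T \<omega>) (\<mu> T \<omega>)" "AE \<omega> in M. p' T \<omega> = gx (X' T \<omega>) (\<mu>' T \<omega>)"
    using sol sol' by (simp_all add: solution_def)
  then have e: "AE \<omega> in M. dp T \<omega> = gx (X' T \<omega>) (\<mu>' T \<omega>) - gx (X T \<omega>) (\<mu> T \<omega>)"
    by eventually_elim (simp add: gap_def)
  note m [measurable] = L2_varsD(1)[OF *(1)] L2_varsD(1)[OF gaps_L2_time(1)[OF T]] L2_varsD(1)[OF gaps_L2_time(2)[OF T]]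
  have "inner_at dX dp T = (\<integral>\<omega>. (gx (X' T \<omega>) (\<mu>' T \<omega>) - gx (X T \<omega>) (\<mu> T \<omega>)) * dX T \<omega> \<partial>M)"
    unfolding inner_at_def
    by (rule integral_cong_AE) (use e in \<open>measurable; auto elim!: eventually_mono simp: mult.commute\<close>)+
  then show "0 \<le> inner_at dX dp T" using *(2) by (simp add: gap_def)
  have "sq dp T = (\<integral>\<omega>. (gx (X' T \<omega>) (\<mu>' T \<omega>) - gx (X T \<omega>) (\<mu> T \<omega>))\<^sup>2 \<partial>M)"
    unfolding sq_eq by (rule integral_cong_AE) (use e in \<open>measurable; auto elim!: eventually_mono\<close>)+
  then show "sq dp T \<le> 4 * L\<^sup>2 * sq dX T" using *(3) by (simp add: sq_eq gap_def)
qed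

lemma adjoint_gap:
  assumes "s \<in> {0..T}" "\<omega> \<in> space M"
  shows "dA s \<omega> = - (b1 s * dp s \<omega> + \<sigma>1 s * dq s \<omega> + \<sigma>\<^sub>c1 s * dq\<^sub>c s \<omega> + (df0x s \<omega> + df1x s \<omega>))"
  using adjoint_drift_eq[OF sol assms] adjoint_drift_eq[OF sol' assms] by (simp add: gap_def algebra_simps)

text \<open>Young's inequality is weighted so that the martingale integrands come with the factor
  \<open>1 / 2\<close>; the Ito term in the energy identity has factor \<open>1\<close> and absorbs them.\<close>

lemma backward_rate:
  assumes s: "regular_time s"
  shows "- 2 * inner_at dA dp s \<le> (1 + 2 * L + 4 * L\<^sup>2) * sq dp s + (sq dq s + sq dq\<^sub>c s) / 2 + 15 * L\<^sup>2 * (sq dX s + sq du s)"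
proof -
  note r = regular_timeD[OF s]
  note i = r(2-6)[THEN L2_varsD(2)] L2_varsD(2)[OF f1x_gap(1)[OF r(1)]]
  have "- 2 * inner_at dA dp s = (\<integral>\<omega>. - 2 * (dA s \<omega> * dp s \<omega>) \<partial>M)" by (simp add: inner_at_def)
  also have "\<dots> \<le> (\<integral>\<omega>. (1 + 2 * L + 4 * L\<^sup>2) * (dp s \<omega>)\<^sup>2 + ((dq s \<omega>)\<^sup>2 + (dq\<^sub>c s \<omega>)\<^sup>2) / 2
      + 3 * ((df1x s \<omega>)\<^sup>2 + L\<^sup>2 * ((dX s \<omega>)\<^sup>2 + (du s \<omega>)\<^sup>2)) \<partial>M)"
  proof (rule integral_mono)
    show "integrable M (\<lambda>\<omega>. - 2 * (dA s \<omega> * dp s \<omega>))" using L2_vars_mult_integrable[OF r(10) r(3)] by simp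
    show "integrable M (\<lambda>\<omega>. (1 + 2 * L + 4 * L\<^sup>2) * (dp s \<omega>)\<^sup>2 + ((dq s \<omega>)\<^sup>2 + (dq\<^sub>c s \<omega>)\<^sup>2) / 2
      + 3 * ((df1x s \<omega>)\<^sup>2 + L\<^sup>2 * ((dX s \<omega>)\<^sup>2 + (du s \<omega>)\<^sup>2)))" using i by simp
    fix \<omega> assume w: "\<omega> \<in> space M"
    let ?P = "dp s \<omega>" and ?q = "dq s \<omega>" and ?r = "dq\<^sub>c s \<omega>" and ?F = "df0x s \<omega> + df1x s \<omega>"
    have 1: "b1 s * ?P * ?P \<le> L * ?P\<^sup>2"
      using coeff_bounds(1)[OF r(1)] by (simp add: power2_eq_square mult.assoc mult_right_mono)
    have coef: "2 * (a * c * ?P) \<le> c\<^sup>2 / 2 + 2 * L\<^sup>2 * ?P\<^sup>2" if "\<bar>a\<bar> \<le> L" for a c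
    proof -
      have "a\<^sup>2 \<le> L\<^sup>2" using that L_pos by (subst abs_le_square_iff[symmetric]) simp
      then have "2 * (a\<^sup>2 * ?P\<^sup>2) \<le> 2 * (L\<^sup>2 * ?P\<^sup>2)" by (intro mult_left_mono mult_right_mono) auto
      moreover have "c * (2 * a * ?P) \<le> (c\<^sup>2 + (2 * a * ?P)\<^sup>2) / 2" by (rule young)
      ultimately show ?thesis
        using young[of "c / sqrt 2" "sqrt 2 * (2 * a * ?P) / sqrt 2"] sum_squares_bound[of "c / 2" "2 * a * ?P"]
        by (simp add: power_mult_distrib power_divide algebra_simps)
    qed
    have F: "2 * (?F * ?P) \<le> ?P\<^sup>2 + ?F\<^sup>2" using young[of ?F ?P] by simp
    have "\<bar>?F\<bar> \<le> \<bar>df1x s \<omega>\<bar> + L * \<bar>dX s \<omega>\<bar> + L * \<bar>du s \<omega>\<bar>"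
      using f0_lipschitz(1)[OF r(1), where x'="X' s \<omega>" and u'="ctrl' s \<omega>" and x="X s \<omega>" and u="ctrl s \<omega>"] abs_triangle_ineq[of "df0x s \<omega>" "df1x s \<omega>"]
      by (simp add: gap_def distrib_left)
    then have "?F\<^sup>2 \<le> 3 * (\<bar>df1x s \<omega>\<bar>\<^sup>2 + (L * \<bar>dX s \<omega>\<bar>)\<^sup>2 + (L * \<bar>du s \<omega>\<bar>)\<^sup>2)" by (rule square_le_sum3)
    then have F2: "?F\<^sup>2 \<le> 3 * ((df1x s \<omega>)\<^sup>2 + L\<^sup>2 * ((dX s \<omega>)\<^sup>2 + (du s \<omega>)\<^sup>2))" by (simp add: power_mult_distrib distrib_left)
    have "- 2 * (dA s \<omega> * ?P) = 2 * (b1 s * ?P * ?P) + 2 * (\<sigma>1 s * ?q * ?P) + 2 * (\<sigma>\<^sub>c1 s * ?r * ?P) + 2 * (?F * ?P)"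
      unfolding adjoint_gap[OF r(1) w] by (simp add: algebra_simps)
    also have "\<dots> \<le> 2 * (L * ?P\<^sup>2) + (?q\<^sup>2 / 2 + 2 * L\<^sup>2 * ?P\<^sup>2) + (?r\<^sup>2 / 2 + 2 * L\<^sup>2 * ?P\<^sup>2) + (?P\<^sup>2 + 3 * ((df1x s \<omega>)\<^sup>2 + L\<^sup>2 * ((dX s \<omega>)\<^sup>2 + (du s \<omega>)\<^sup>2)))"
      using 1 coef[OF coeff_bounds(3)[OF r(1)], of ?q] coef[OF coeff_bounds(5)[OF r(1)], of ?r] F F2 by linarith
    also have "\<dots> = (1 + 2 * L + 4 * L\<^sup>2) * ?P\<^sup>2 + (?q\<^sup>2 + ?r\<^sup>2) / 2 + 3 * ((df1x s \<omega>)\<^sup>2 + L\<^sup>2 * ((dX s \<omega>)\<^sup>2 + (du s \<omega>)\<^sup>2))"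
      by (simp add: algebra_simps)
    finally show "- 2 * (dA s \<omega> * ?P) \<le> (1 + 2 * L + 4 * L\<^sup>2) * ?P\<^sup>2 + (?q\<^sup>2 + ?r\<^sup>2) / 2 + 3 * ((df1x s \<omega>)\<^sup>2 + L\<^sup>2 * ((dX s \<omega>)\<^sup>2 + (du s \<omega>)\<^sup>2))" .
  qed
  also have "\<dots> = (1 + 2 * L + 4 * L\<^sup>2) * sq dp s + (sq dq s + sq dq\<^sub>c s) / 2 + 3 * ((\<integral>\<omega>. (df1x s \<omega>)\<^sup>2 \<partial>M) + L\<^sup>2 * (sq dX s + sq du s))"
    using i by (simp add: sq_eq)
  also have "\<dots> \<le> (1 + 2 * L + 4 * L\<^sup>2) * sq dp s + (sq dq s + sq dq\<^sub>c s) / 2 + 3 * (4 * L\<^sup>2 * sq dX s + L\<^sup>2 * (sq dX s + sq du s))"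
    using f1x_gap(3)[OF r(1)] by simp
  also have "\<dots> \<le> (1 + 2 * L + 4 * L\<^sup>2) * sq dp s + (sq dq s + sq dq\<^sub>c s) / 2 + 15 * L\<^sup>2 * (sq dX s + sq du s)"
    using sq_nonneg[of du s] by (simp add: algebra_simps mult_nonneg_nonneg)
  finally show ?thesis .
qed

text \<open>The first-order condition for the controls turns the control terms into \<open>- df0u * du\<close>; together
  with \<open>- df0x * dX\<close> they are controlled by strong convexity, and \<open>df1x * dX\<close> by weak monotonicity.
  Only the dependence of the coefficients on the conditional law is left, with the small factor.\<close>

lemma duality_rate:
  assumes s: "regular_time s" and c: "L\<^sub>m \<le> c" "0 \<le> c"
  shows "inner_at db dp s + inner_at dX dA s + inner_at d\<sigma> dq s + inner_at d\<sigma>\<^sub>c dq\<^sub>c s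
    \<le> c / 2 * (3 * sq dX s + sq dp s + (sq dq s + sq dq\<^sub>c s)) - 2 * C\<^sub>f * sq du s"
proof -
  note r = regular_timeD[OF s]
  note i = r(2-6)[THEN L2_varsD(2)]
  note m = L2_vars_mult_integrable[OF r(7) r(3)] L2_vars_mult_integrable[OF r(2) r(10)] L2_vars_mult_integrable[OF r(8) r(4)]
    L2_vars_mult_integrable[OF r(9) r(5)] L2_vars_mult_integrable[OF f1x_gap(1)[OF r(1)] r(2)]
  obtain h where h: "integrable M h" "\<And>\<omega>. 0 \<le> h \<omega>" "(\<integral>\<omega>. h \<omega> \<partial>M) = sq dX s"
    "AE \<omega> in M. 0 \<le> W2 (\<mu> s \<omega>) (\<mu>' s \<omega>) \<and> (W2 (\<mu> s \<omega>) (\<mu>' s \<omega>))\<^sup>2 \<le> h \<omega>" using W2_gap[OF r(1)] by blast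
  have "inner_at db dp s + inner_at dX dA s + inner_at d\<sigma> dq s + inner_at d\<sigma>\<^sub>c dq\<^sub>c s
    = (\<integral>\<omega>. db s \<omega> * dp s \<omega> + dX s \<omega> * dA s \<omega> + d\<sigma> s \<omega> * dq s \<omega> + d\<sigma>\<^sub>c s \<omega> * dq\<^sub>c s \<omega> \<partial>M)"
    using m by (simp add: inner_at_def)
  also have "\<dots> \<le> (\<integral>\<omega>. c / 2 * (3 * h \<omega> + (dp s \<omega>)\<^sup>2 + ((dq s \<omega>)\<^sup>2 + (dq\<^sub>c s \<omega>)\<^sup>2)) - 2 * C\<^sub>f * (du s \<omega>)\<^sup>2 - df1x s \<omega> * dX s \<omega> \<partial>M)"
  proof (rule integral_mono_AE)
    show "integrable M (\<lambda>\<omega>. db s \<omega> * dp s \<omega> + dX s \<omega> * dA s \<omega> + d\<sigma> s \<omega> * dq s \<omega> + d\<sigma>\<^sub>c s \<omega> * dq\<^sub>c s \<omega>)" using m by simp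
    show "integrable M (\<lambda>\<omega>. c / 2 * (3 * h \<omega> + (dp s \<omega>)\<^sup>2 + ((dq s \<omega>)\<^sup>2 + (dq\<^sub>c s \<omega>)\<^sup>2)) - 2 * C\<^sub>f * (du s \<omega>)\<^sup>2 - df1x s \<omega> * dX s \<omega>)"
      using m(5) i h(1) by (intro Bochner_Integration.integrable_diff Bochner_Integration.integrable_add integrable_mult_right)
    show "AE \<omega> in M. db s \<omega> * dp s \<omega> + dX s \<omega> * dA s \<omega> + d\<sigma> s \<omega> * dq s \<omega> + d\<sigma>\<^sub>c s \<omega> * dq\<^sub>c s \<omega>
      \<le> c / 2 * (3 * h \<omega> + (dp s \<omega>)\<^sup>2 + ((dq s \<omega>)\<^sup>2 + (dq\<^sub>c s \<omega>)\<^sup>2)) - 2 * C\<^sub>f * (du s \<omega>)\<^sup>2 - df1x s \<omega> * dX s \<omega>"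
      using h(4) AE_space
    proof eventually_elim
      case (elim \<omega>)
      note law = sol_law(1)[OF sol r(1) elim(2)] sol_law(1)[OF sol' r(1) elim(2)]
      let ?W = "W2 (\<mu> s \<omega>) (\<mu>' s \<omega>)" and ?P = "dp s \<omega>" and ?q = "dq s \<omega>" and ?r = "dq\<^sub>c s \<omega>" and ?x = "dX s \<omega>" and ?v = "du s \<omega>"
      define B where "B = b0 s (\<mu>' s \<omega>) - b0 s (\<mu> s \<omega>)"
      define S where "S = \<sigma>0 s (\<mu>' s \<omega>) - \<sigma>0 s (\<mu> s \<omega>)"
      define S' where "S' = \<sigma>\<^sub>c0 s (\<mu>' s \<omega>) - \<sigma>\<^sub>c0 s (\<mu> s \<omega>)"
      have small: "\<bar>B\<bar> \<le> c * ?W" "\<bar>S\<bar> \<le> c * ?W" "\<bar>S'\<bar> \<le> c * ?W"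
        unfolding B_def S_def S'_def by (rule coeff_W2_lipschitz[OF r(1) law c(1)])+
      have prod: "a * k \<le> c / 2 * (h \<omega> + k\<^sup>2)" if "\<bar>a\<bar> \<le> c * ?W" for a k
      proof -
        have "a * k \<le> \<bar>a\<bar> * \<bar>k\<bar>" by (metis abs_ge_self abs_mult)
        also have "\<dots> \<le> c * ?W * \<bar>k\<bar>" using that by (intro mult_right_mono) auto
        also have "\<dots> = c * (?W * \<bar>k\<bar>)" by simp
        also have "\<dots> \<le> c * ((?W\<^sup>2 + \<bar>k\<bar>\<^sup>2) / 2)" by (intro mult_left_mono young c(2))
        also have "\<dots> \<le> c * ((h \<omega> + k\<^sup>2) / 2)" using elim(1) c(2) by (intro mult_left_mono divide_right_mono) auto
        finally show ?thesis by simp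
      qed
      have foc: "b2 s * ?P + \<sigma>2 s * ?q + \<sigma>\<^sub>c2 s * ?r = - df0u s \<omega>"
        using uh_characterisation(1)[OF r(1), of "p s \<omega>" "q s \<omega>" "q\<^sub>c s \<omega>" "X s \<omega>"]
          uh_characterisation(1)[OF r(1), of "p' s \<omega>" "q' s \<omega>" "q\<^sub>c' s \<omega>" "X' s \<omega>"]
        by (simp add: gap_def control_def algebra_simps)
      have conv: "df0x s \<omega> * ?x + df0u s \<omega> * ?v \<ge> 2 * C\<^sub>f * ?v\<^sup>2"
        using f0_strongly_monotone[OF r(1), where x'="X' s \<omega>" and u'="ctrl' s \<omega>" and x="X s \<omega>" and u="ctrl s \<omega>"] by (simp add: gap_def)
      have "db s \<omega> * ?P + ?x * dA s \<omega> + d\<sigma> s \<omega> * ?q + d\<sigma>\<^sub>c s \<omega> * ?r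
        = B * ?P + S * ?q + S' * ?r + (b2 s * ?P + \<sigma>2 s * ?q + \<sigma>\<^sub>c2 s * ?r) * ?v - df0x s \<omega> * ?x - df1x s \<omega> * ?x"
        unfolding coefficient_gaps[OF r(1) elim(2)] adjoint_gap[OF r(1) elim(2)] B_def S_def S'_def by (simp add: algebra_simps)
      also have "\<dots> = B * ?P + S * ?q + S' * ?r - (df0x s \<omega> * ?x + df0u s \<omega> * ?v) - df1x s \<omega> * ?x"
        unfolding foc by (simp add: algebra_simps)
      also have "\<dots> \<le> c / 2 * (h \<omega> + ?P\<^sup>2) + c / 2 * (h \<omega> + ?q\<^sup>2) + c / 2 * (h \<omega> + ?r\<^sup>2) - 2 * C\<^sub>f * ?v\<^sup>2 - df1x s \<omega> * ?x"
        using prod[OF small(1), of ?P] prod[OF small(2), of ?q] prod[OF small(3), of ?r] conv by linarith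
      also have "\<dots> = c / 2 * (3 * h \<omega> + ?P\<^sup>2 + (?q\<^sup>2 + ?r\<^sup>2)) - 2 * C\<^sub>f * ?v\<^sup>2 - df1x s \<omega> * ?x" by (simp add: algebra_simps)
      finally show ?case .
    qed
  qed
  also have "\<dots> = c / 2 * (3 * sq dX s + sq dp s + (sq dq s + sq dq\<^sub>c s)) - 2 * C\<^sub>f * sq du s - (\<integral>\<omega>. df1x s \<omega> * dX s \<omega> \<partial>M)"
  proof -
    have "integrable M (\<lambda>\<omega>. 3 * h \<omega> + (dp s \<omega>)\<^sup>2 + ((dq s \<omega>)\<^sup>2 + (dq\<^sub>c s \<omega>)\<^sup>2))" using i h(1) by simp
    then show ?thesis using i h(1,3) m(5) by (simp add: sq_eq)
  qed
  also have "\<dots> \<le> c / 2 * (3 * sq dX s + sq dp s + (sq dq s + sq dq\<^sub>c s)) - 2 * C\<^sub>f * sq du s" using f1x_gap(2)[OF r(1)] by simp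
  finally show ?thesis .
qed

end

section \<open>Uniqueness\<close>

text \<open>Bounds relative to the energy \<open>\<integral> E |u' - u|\<^sup>2 dt\<close> of the difference of the controls:
  \<open>forward_const\<close> for \<open>E |X' - X|\<^sup>2\<close>, \<open>source_const\<close> for the data of the backward equation,
  \<open>backward_const\<close> for \<open>E |p' - p|\<^sup>2\<close>, \<open>integrand_const\<close> for the energy of the martingale integrands,
  and \<open>total_const\<close> for the combination that the pairing of the two equations produces. The factor
  two in front of the exponentials comes from the form of Gronwall's inequality used here.\<close>

definition forward_const :: "real \<Rightarrow> real \<Rightarrow> real" where
  "forward_const T L = 18 * L\<^sup>2 * exp (2 * (1 + 18 * L\<^sup>2) * T)"

definition source_const :: "real \<Rightarrow> real \<Rightarrow> real" where
  "source_const T L = 4 * L\<^sup>2 * forward_const T L + 15 * L\<^sup>2 * (T * forward_const T L + 1)"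

definition backward_const :: "real \<Rightarrow> real \<Rightarrow> real" where
  "backward_const T L = 2 * source_const T L * exp (2 * (1 + 2 * L + 4 * L\<^sup>2) * T)"

definition integrand_const :: "real \<Rightarrow> real \<Rightarrow> real" where
  "integrand_const T L = 2 * (source_const T L + (1 + 2 * L + 4 * L\<^sup>2) * (T * backward_const T L))"

definition total_const :: "real \<Rightarrow> real \<Rightarrow> real" where
  "total_const T L = 3 * (T * forward_const T L) + T * backward_const T L + integrand_const T L"

lemma const_pos:
  assumes "0 < T" "0 < L"
  shows "0 < forward_const T L" "0 < source_const T L" "0 < backward_const T L" "0 < integrand_const T L" "0 < total_const T L"
proof -
  have e: "0 < 1 + 2 * L + 4 * L\<^sup>2" using assms by (simp add: add_pos_nonneg)
  show 1: "0 < forward_const T L" using assms by (simp add: forward_const_def)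
  show 2: "0 < source_const T L" using assms 1 unfolding source_const_def by (intro add_pos_pos mult_pos_pos) auto
  show 3: "0 < backward_const T L" using 2 by (simp add: backward_const_def)
  show 4: "0 < integrand_const T L" using 2 3 e assms unfolding integrand_const_def by (intro add_pos_pos mult_pos_pos) auto
  show "0 < total_const T L" using 1 3 4 assms unfolding total_const_def by (intro add_pos_pos mult_pos_pos) auto
qed

context fbsde_pair begin

definition control_energy :: real where
  "control_energy = (\<integral>s. sq du s \<partial>R T)"

abbreviation "k1 \<equiv> forward_const T L"
abbreviation "k2 \<equiv> backward_const T L"
abbreviation "k3 \<equiv> integrand_const T L"

lemma consts_pos: "0 < k1" "0 < source_const T L" "0 < k2" "0 < k3"
  using const_pos[OF T_pos L_pos] by simp_all

lemma sq_integrable: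
  assumes "t \<le> T"
  shows "integrable (R t) (sq dX)" "integrable (R t) (sq dp)" "integrable (R t) (sq dq)" "integrable (R t) (sq dq\<^sub>c)" "integrable (R t) (sq du)"
  using gaps_L2_Q by (auto intro!: inner_at_integral(1) assms)

lemma sq_integral_mono:
  assumes "case_prod Y \<in> L2_vars (Q T) (Q T)" "t \<le> T"
  shows "(\<integral>s. sq Y s \<partial>R t) \<le> (\<integral>s. sq Y s \<partial>R T)"
  by (rule integral_R_mono(2)[OF inner_at_integral(1)[OF assms(1,1) order_refl] sq_nonneg assms(2)])

lemma control_energy_nonneg: "0 \<le> control_energy"
  unfolding control_energy_def by (intro integral_nonneg_AE AE_I2 sq_nonneg)

lemma initial_gap: "AE \<omega> in M. dX 0 \<omega> = 0"
proof -
  have "AE \<omega> in M. X 0 \<omega> = \<xi>0 \<omega>" "AE \<omega> in M. X' 0 \<omega> = \<xi>0 \<omega>" using sol sol' by (simp_all add: solution_def)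
  then show ?thesis by eventually_elim (simp add: gap_def)
qed

lemma inner_at_initial: "inner_at dX Y 0 = 0"
  unfolding inner_at_def by (rule integral_eq_zero_AE) (use initial_gap in \<open>auto elim!: eventually_mono\<close>)

lemma forward_estimate:
  assumes t: "t \<in> {0..T}" shows "sq dX t \<le> k1 * control_energy"
proof -
  let ?C = "1 + 18 * L\<^sup>2"
  have "sq dX t \<le> 2 * (9 * L\<^sup>2 * control_energy) * exp (2 * ?C * T)"
  proof (rule gronwall_forward[OF sq_integrable(1)[OF order_refl] sq_nonneg _ _ _ t])
    show "0 < ?C" by (simp add: add_pos_nonneg)
    show "0 \<le> 9 * L\<^sup>2 * control_energy" using control_energy_nonneg by simp
    fix t assume t: "t \<in> {0..T}"
    then have tT: "t \<le> T" by simp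
    note I = inner_at_integral(1)[OF _ _ tT]
    have "sq dX t = (\<integral>s. inner_at db dX s + inner_at dX db s + sq d\<sigma> s + sq d\<sigma>\<^sub>c s \<partial>R t)"
      using product_rule_gap[OF ito_X ito_X t] inner_at_initial by simp
    also have "\<dots> \<le> (\<integral>s. ?C * sq dX s + 9 * L\<^sup>2 * sq du s \<partial>R t)"
    proof (rule integral_mono_AE)
      show "integrable (R t) (\<lambda>s. inner_at db dX s + inner_at dX db s + sq d\<sigma> s + sq d\<sigma>\<^sub>c s)"
        by (intro Bochner_Integration.integrable_add I gaps_L2_Q)
      show "integrable (R t) (\<lambda>s. ?C * sq dX s + 9 * L\<^sup>2 * sq du s)"
        by (intro Bochner_Integration.integrable_add integrable_mult_right sq_integrable tT)
      show "AE s in R t. inner_at db dX s + inner_at dX db s + sq d\<sigma> s + sq d\<sigma>\<^sub>c s \<le> ?C * sq dX s + 9 * L\<^sup>2 * sq du s"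
        using AE_R_restrict[OF AE_regular_time tT]
      proof eventually_elim
        case (elim s)
        have "inner_at dX db s = inner_at db dX s" by (simp add: inner_at_def mult.commute)
        then show ?case using forward_rate[OF elim] by simp
      qed
    qed
    also have "\<dots> = ?C * (\<integral>s. sq dX s \<partial>R t) + 9 * L\<^sup>2 * (\<integral>s. sq du s \<partial>R t)"
      using sq_integrable[OF tT] by simp
    also have "\<dots> \<le> ?C * (\<integral>s. sq dX s \<partial>R t) + 9 * L\<^sup>2 * control_energy"
      unfolding control_energy_def by (intro add_left_mono mult_left_mono sq_integral_mono gaps_L2_Q tT) auto
    finally show "sq dX t \<le> 9 * L\<^sup>2 * control_energy + ?C * (\<integral>s. sq dX s \<partial>R t)" by simp
  qed
  then show ?thesis by (simp add: forward_const_def mult_ac)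
qed

lemma integral_le_const:
  fixes y :: "real \<Rightarrow> real"
  assumes "integrable (R T) y" "\<And>s. s \<in> {0..T} \<Longrightarrow> y s \<le> c"
  shows "(\<integral>s. y s \<partial>R T) \<le> T * c"
proof -
  interpret R: finite_measure "R T" by (rule finite_measure_time)
  have "(\<integral>s. y s \<partial>R T) \<le> (\<integral>s. c \<partial>R T)" using assms by (intro integral_mono) (auto simp: space_restrict_space)
  also have "\<dots> = T * c" using T_pos by (simp add: measure_restrict_space space_restrict_space)
  finally show ?thesis .
qed

lemma state_energy: "(\<integral>s. sq dX s \<partial>R T) \<le> T * k1 * control_energy"
  using integral_le_const[OF sq_integrable(1)[OF order_refl] forward_estimate] by (simp add: mult_ac)

text \<open>The energy identity for \<open>p\<close> on \<open>[t, T]\<close> bounds \<open>p\<close> and the martingale integrands together: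
  half of the latter is absorbed by Young's inequality.\<close>

lemma backward_energy:
  assumes t: "t \<in> {0..T}"
  shows "sq dp t + ((\<integral>s. sq dq s + sq dq\<^sub>c s \<partial>R T) - (\<integral>s. sq dq s + sq dq\<^sub>c s \<partial>R t)) / 2
    \<le> source_const T L * control_energy + (1 + 2 * L + 4 * L\<^sup>2) * ((\<integral>s. sq dp s \<partial>R T) - (\<integral>s. sq dp s \<partial>R t))"
proof -
  let ?C = "1 + 2 * L + 4 * L\<^sup>2" and ?T = T
  let ?z = "\<lambda>s. sq dq s + sq dq\<^sub>c s" and ?a = "\<lambda>s. inner_at dA dp s + inner_at dp dA s"
  let ?e = "\<lambda>s. ?C * sq dp s + ?z s / 2 + 15 * L\<^sup>2 * (sq dX s + sq du s) + ?a s"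
  have tT: "t \<le> T" and T: "T \<in> {0..T}" using t T_pos by auto
  have i: "integrable (R t) (sq dp)" "integrable (R t) ?z" "integrable (R t) ?a" "integrable (R t) (\<lambda>s. sq dX s + sq du s)" if "t \<le> T" for t
    using sq_integrable[OF that] inner_at_integral(1)[OF gaps_L2_Q(9) gaps_L2_Q(2) that] inner_at_integral(1)[OF gaps_L2_Q(2) gaps_L2_Q(9) that]
    by auto
  have id: "sq dp t = sq dp 0 + (\<integral>s. ?a s \<partial>R t) + (\<integral>s. ?z s \<partial>R t)" if t: "t \<in> {0..T}" for t
  proof -
    have "sq dp t = sq dp 0 + (\<integral>s. ?a s + ?z s \<partial>R t)"
      using product_rule_gap[OF ito_p ito_p t] by (simp add: add.assoc)
    then show ?thesis using i[of t] t by simp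
  qed
  have e: "(\<integral>s. ?e s \<partial>R t) = ?C * (\<integral>s. sq dp s \<partial>R t) + (\<integral>s. ?z s \<partial>R t) / 2 + 15 * L\<^sup>2 * (\<integral>s. sq dX s + sq du s \<partial>R t) + (\<integral>s. ?a s \<partial>R t)"
    "integrable (R t) ?e" if "t \<le> T" for t
    using i[OF that] by simp_all
  have gen: "x + (z' - z) / 2 \<le> x' + C * (y' - y) + S * (w' - w)"
    if "C * y + z / 2 + S * w + a \<le> C * y' + z' / 2 + S * w' + a'" "x = x0 + a + z" "x' = x0 + a' + z'"
    for x x' x0 y y' z z' w w' a a' C S :: real
    using that by (simp add: field_simps)
  have "(\<integral>s. ?e s \<partial>R t) \<le> (\<integral>s. ?e s \<partial>R T)"
  proof -
    have pos: "AE s in R T. 0 \<le> ?e s"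
      using AE_regular_time
    proof eventually_elim
      case (elim s)
      have "inner_at dp dA s = inner_at dA dp s" by (simp add: inner_at_def mult.commute)
      then show ?case using backward_rate[OF elim] by simp
    qed
    have "(\<integral>s. ?e s \<partial>R t) = (\<integral>s. indicator {0..t} s * ?e s \<partial>R T)"
      using set_integral_time[OF tT] by (simp add: set_integral_time_full)
    also have "\<dots> \<le> (\<integral>s. ?e s \<partial>R T)"
    proof (rule integral_mono_AE)
      have "{0..t} \<in> sets (R T)" using tT by (auto simp: sets_restrict_space image_iff intro!: bexI[of _ "{0..t}"])
      then show "integrable (R T) (\<lambda>s. indicator {0..t} s * ?e s)"
        using integrable_real_mult_indicator[OF _ e(2)[OF order_refl]] by (simp add: mult.commute)
      show "integrable (R T) ?e" by (rule e(2)) simp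
      show "AE s in R T. indicator {0..t} s * ?e s \<le> ?e s" using pos by eventually_elim (auto split: split_indicator)
    qed
    finally show ?thesis .
  qed
  then have "sq dp t + ((\<integral>s. ?z s \<partial>R T) - (\<integral>s. ?z s \<partial>R t)) / 2
    \<le> sq dp T + ?C * ((\<integral>s. sq dp s \<partial>R T) - (\<integral>s. sq dp s \<partial>R t)) + 15 * L\<^sup>2 * ((\<integral>s. sq dX s + sq du s \<partial>R T) - (\<integral>s. sq dX s + sq du s \<partial>R t))"
    unfolding e(1)[OF tT] e(1)[OF order_refl] by (rule gen[OF _ id[OF t] id[OF T]])
  also have "15 * L\<^sup>2 * ((\<integral>s. sq dX s + sq du s \<partial>R T) - (\<integral>s. sq dX s + sq du s \<partial>R t)) \<le> 15 * L\<^sup>2 * ((T * k1 + 1) * control_energy)"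
  proof (rule mult_left_mono)
    have "0 \<le> (\<integral>s. sq dX s + sq du s \<partial>R t)" by (intro integral_nonneg_AE AE_I2 add_nonneg_nonneg sq_nonneg)
    moreover have "(\<integral>s. sq dX s + sq du s \<partial>R T) = (\<integral>s. sq dX s \<partial>R T) + control_energy"
      using sq_integrable[OF order_refl] by (simp add: control_energy_def)
    ultimately show "(\<integral>s. sq dX s + sq du s \<partial>R T) - (\<integral>s. sq dX s + sq du s \<partial>R t) \<le> (T * k1 + 1) * control_energy"
      using state_energy by (simp add: distrib_right)
  qed simp
  also have "sq dp T \<le> 4 * L\<^sup>2 * (k1 * control_energy)"
    using terminal_gap(2) mult_left_mono[OF forward_estimate[OF T], of "4 * L\<^sup>2"] by simp
  finally show ?thesis by (simp add: source_const_def algebra_simps)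
qed

lemma backward_estimate:
  assumes t: "t \<in> {0..T}" shows "sq dp t \<le> k2 * control_energy"
proof -
  let ?C = "1 + 2 * L + 4 * L\<^sup>2"
  have "sq dp t \<le> 2 * (source_const T L * control_energy) * exp (2 * ?C * T)"
  proof (rule gronwall_backward[OF sq_integrable(2)[OF order_refl] sq_nonneg _ _ _ t])
    show "0 < ?C" using L_pos by (simp add: add_pos_nonneg)
    show "0 \<le> source_const T L * control_energy" using control_energy_nonneg consts_pos by simp
    fix t assume t: "t \<in> {0..T}"
    have "(\<integral>s. sq dq s + sq dq\<^sub>c s \<partial>R t) \<le> (\<integral>s. sq dq s + sq dq\<^sub>c s \<partial>R T)"
      using t by (intro integral_R_mono(2) Bochner_Integration.integrable_add sq_integrable add_nonneg_nonneg sq_nonneg) auto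
    then show "sq dp t \<le> source_const T L * control_energy + ?C * ((\<integral>s. sq dp s \<partial>R T) - (\<integral>s. sq dp s \<partial>R t))"
      by (intro order_trans[OF _ backward_energy[OF t]]) simp
  qed
  then show ?thesis by (simp add: backward_const_def mult_ac)
qed

lemma adjoint_energy: "(\<integral>s. sq dp s \<partial>R T) \<le> T * k2 * control_energy"
  using integral_le_const[OF sq_integrable(2)[OF order_refl] backward_estimate] by (simp add: mult_ac)

lemma integral_R_0: "(\<integral>s. y s \<partial>R 0) = (0 :: real)"
proof -
  have "AE s in lborel. s \<in> {0..0} \<longrightarrow> y s = 0"
    using AE_lborel_singleton[of 0] by eventually_elim auto
  then have "AE s in R 0. y s = 0" by (subst AE_restrict_space_iff) simp_all
  then show ?thesis by (rule integral_eq_zero_AE)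
qed

lemma integrand_energy: "(\<integral>s. sq dq s + sq dq\<^sub>c s \<partial>R T) \<le> k3 * control_energy"
proof -
  have 0: "0 \<in> {0..T}" using T_pos by simp
  have "(\<integral>s. sq dq s + sq dq\<^sub>c s \<partial>R T) / 2 \<le> source_const T L * control_energy + (1 + 2 * L + 4 * L\<^sup>2) * (\<integral>s. sq dp s \<partial>R T)"
    using backward_energy[OF 0, unfolded integral_R_0] sq_nonneg[of dp 0] by simp
  also have "\<dots> \<le> source_const T L * control_energy + (1 + 2 * L + 4 * L\<^sup>2) * (T * k2 * control_energy)"
    using L_pos by (intro add_left_mono mult_left_mono adjoint_energy) (simp add: add_nonneg_nonneg)
  finally show ?thesis by (simp add: integrand_const_def algebra_simps)
qed

text \<open>Pairing the two equations, all energies are dominated by the control energy; a small factor in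
  front of them leaves no room for a positive one.\<close>

theorem control_energy_zero:
  assumes small: "L\<^sub>m * inverse C\<^sub>f \<le> 2 / total_const T L"
  shows "control_energy = 0"
proof -
  have K: "0 < total_const T L" by (rule const_pos(5)[OF T_pos L_pos])
  define c where "c = 2 / total_const T L * C\<^sub>f"
  have c: "0 \<le> c" using K Cf_pos by (simp add: c_def)
  have Lm: "L\<^sub>m \<le> c" using mult_right_mono[OF small, of C\<^sub>f] Cf_pos by (simp add: c_def mult.assoc)
  have T: "T \<in> {0..T}" using T_pos by simp
  note i = sq_integrable[OF order_refl]
  have "0 \<le> inner_at dX dp T" by (rule terminal_gap(1))
  also have "\<dots> = (\<integral>s. inner_at db dp s + inner_at dX dA s + inner_at d\<sigma> dq s + inner_at d\<sigma>\<^sub>c dq\<^sub>c s \<partial>R T)"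
    using product_rule_gap[OF ito_X ito_p T] inner_at_initial by simp
  also have "\<dots> \<le> (\<integral>s. c / 2 * (3 * sq dX s + sq dp s + (sq dq s + sq dq\<^sub>c s)) - 2 * C\<^sub>f * sq du s \<partial>R T)"
  proof (rule integral_mono_AE)
    show "integrable (R T) (\<lambda>s. inner_at db dp s + inner_at dX dA s + inner_at d\<sigma> dq s + inner_at d\<sigma>\<^sub>c dq\<^sub>c s)"
      by (intro Bochner_Integration.integrable_add inner_at_integral(1) gaps_L2_Q order_refl)
    show "integrable (R T) (\<lambda>s. c / 2 * (3 * sq dX s + sq dp s + (sq dq s + sq dq\<^sub>c s)) - 2 * C\<^sub>f * sq du s)"
      by (intro Bochner_Integration.integrable_diff Bochner_Integration.integrable_add integrable_mult_right i)
    show "AE s in R T. inner_at db dp s + inner_at dX dA s + inner_at d\<sigma> dq s + inner_at d\<sigma>\<^sub>c dq\<^sub>c s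
       \<le> c / 2 * (3 * sq dX s + sq dp s + (sq dq s + sq dq\<^sub>c s)) - 2 * C\<^sub>f * sq du s"
      using AE_regular_time by eventually_elim (rule duality_rate[OF _ Lm c])
  qed
  also have "\<dots> = c / 2 * (3 * (\<integral>s. sq dX s \<partial>R T) + (\<integral>s. sq dp s \<partial>R T) + (\<integral>s. sq dq s + sq dq\<^sub>c s \<partial>R T)) - 2 * C\<^sub>f * control_energy"
  proof -
    have j: "integrable (R T) (\<lambda>s. sq dq s + sq dq\<^sub>c s)" using i by simp
    have "integrable (R T) (\<lambda>s. 3 * sq dX s + sq dp s + (sq dq s + sq dq\<^sub>c s))" using i by simp
    then have "(\<integral>s. c / 2 * (3 * sq dX s + sq dp s + (sq dq s + sq dq\<^sub>c s)) - 2 * C\<^sub>f * sq du s \<partial>R T)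
      = c / 2 * (\<integral>s. 3 * sq dX s + sq dp s + (sq dq s + sq dq\<^sub>c s) \<partial>R T) - 2 * C\<^sub>f * control_energy"
      using i unfolding control_energy_def by (subst Bochner_Integration.integral_diff) auto
    also have "(\<integral>s. 3 * sq dX s + sq dp s + (sq dq s + sq dq\<^sub>c s) \<partial>R T) = 3 * (\<integral>s. sq dX s \<partial>R T) + (\<integral>s. sq dp s \<partial>R T) + (\<integral>s. sq dq s + sq dq\<^sub>c s \<partial>R T)"
    proof -
      have "(\<integral>s. 3 * sq dX s + sq dp s + (sq dq s + sq dq\<^sub>c s) \<partial>R T) = (\<integral>s. 3 * sq dX s + sq dp s \<partial>R T) + (\<integral>s. sq dq s + sq dq\<^sub>c s \<partial>R T)"
        using i by (intro Bochner_Integration.integral_add j) auto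
      then show ?thesis using i by simp
    qed
    finally show ?thesis .
  qed
  also have "\<dots> \<le> c / 2 * (3 * (T * k1 * control_energy) + T * k2 * control_energy + k3 * control_energy) - 2 * C\<^sub>f * control_energy"
    using state_energy adjoint_energy integrand_energy c by (intro diff_right_mono mult_left_mono add_mono) auto
  also have "3 * (T * k1 * control_energy) + T * k2 * control_energy + k3 * control_energy = total_const T L * control_energy"
    by (simp add: total_const_def algebra_simps)
  also have "c / 2 * (total_const T L * control_energy) - 2 * C\<^sub>f * control_energy = - (C\<^sub>f * control_energy)"
    using K by (simp add: c_def)
  finally have "C\<^sub>f * control_energy \<le> 0" by simp
  with Cf_pos control_energy_nonneg show ?thesis by (simp add: mult_le_0_iff)
qed

text \<open>For each time the two states agree almost surely. Both are almost surely continuous, so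
  countably many times decide.\<close>

lemma indistinguishable:
  assumes c: "AE \<omega> in M. continuous_on {0..T} (\<lambda>t. Y t \<omega>)" "AE \<omega> in M. continuous_on {0..T} (\<lambda>t. Y' t \<omega>)"
    and L2: "\<And>t. t \<in> {0..T} \<Longrightarrow> gap Y Y' t \<in> L2_vars M M" and 0: "\<And>t. t \<in> {0..T} \<Longrightarrow> sq (gap Y Y') t = 0"
  shows "AE \<omega> in M. \<forall>t\<in>{0..T}. Y t \<omega> = Y' t \<omega>"
proof -
  let ?D = "{0<..<T} \<inter> \<rat>"
  have "AE \<omega> in M. \<forall>t\<in>?D. Y t \<omega> = Y' t \<omega>"
  proof (rule AE_ball_countable')
    show "countable ?D" using countable_rat by blast
    fix t assume "t \<in> ?D"
    then have t: "t \<in> {0..T}" by auto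
    have "(\<integral>\<omega>. (gap Y Y' t \<omega>)\<^sup>2 \<partial>M) = 0" using 0[OF t] by (simp add: sq_eq)
    then have "AE \<omega> in M. (gap Y Y' t \<omega>)\<^sup>2 = 0"
      using L2_varsD(2)[OF L2[OF t]] by (subst (asm) integral_nonneg_eq_0_iff_AE) auto
    then show "AE \<omega> in M. Y t \<omega> = Y' t \<omega>" by eventually_elim (simp add: gap_def)
  qed
  with c show ?thesis
  proof eventually_elim
    case (elim \<omega>)
    have cl: "closure ?D = {0..T}"
      using closure_open_Int_superset[of "{0<..<T}" "\<rat>"] T_pos Rats_closure_real by simp
    have "continuous_on {0..T} (\<lambda>t. Y t \<omega> - Y' t \<omega>)" using elim by (intro continuous_intros)
    then have "Y t \<omega> - Y' t \<omega> = 0" if "t \<in> {0..T}" for t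
      by (rule continuous_constant_on_closure[of ?D "\<lambda>t. Y t \<omega> - Y' t \<omega>", unfolded cl, OF _ _ that]) (use elim in auto)
    then show ?case by simp
  qed
qed

lemma AE_zero_of_energy:
  assumes Y: "case_prod Y \<in> L2_vars (Q T) (Q T)" and 0: "(\<integral>s. sq Y s \<partial>R T) \<le> 0"
  shows "AE z in Q T. case_prod Y z = 0"
proof -
  have "(\<integral>z. (case_prod Y z)\<^sup>2 \<partial>Q T) = (\<integral>s. sq Y s \<partial>R T)"
    using inner_at_integral(3)[OF Y Y order_refl] by (simp add: power2_eq_square)
  moreover have "0 \<le> (\<integral>z. (case_prod Y z)\<^sup>2 \<partial>Q T)" by simp
  ultimately have "(\<integral>z. (case_prod Y z)\<^sup>2 \<partial>Q T) = 0" using 0 by simp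
  then have "AE z in Q T. (case_prod Y z)\<^sup>2 = 0"
    using L2_varsD(2)[OF Y] by (subst (asm) integral_nonneg_eq_0_iff_AE) auto
  then show ?thesis by eventually_elim simp
qed

theorem solutions_agree:
  assumes "L\<^sub>m * inverse C\<^sub>f \<le> 2 / total_const T L"
  shows "same_solution M T X p q q\<^sub>c X' p' q' q\<^sub>c'"
proof -
  note V = control_energy_zero[OF assms]
  have c: "AE \<omega> in M. continuous_on {0..T} (\<lambda>t. X t \<omega>)" "AE \<omega> in M. continuous_on {0..T} (\<lambda>t. X' t \<omega>)"
    "AE \<omega> in M. continuous_on {0..T} (\<lambda>t. p t \<omega>)" "AE \<omega> in M. continuous_on {0..T} (\<lambda>t. p' t \<omega>)"
    using sol sol' by (simp_all add: solution_def has_stoch_differential_def)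
  have "sq dX t = 0" "sq dp t = 0" if "t \<in> {0..T}" for t
    using forward_estimate[OF that] backward_estimate[OF that] sq_nonneg[of dX t] sq_nonneg[of dp t] V by simp_all
  then have "AE \<omega> in M. \<forall>t\<in>{0..T}. X t \<omega> = X' t \<omega>" "AE \<omega> in M. \<forall>t\<in>{0..T}. p t \<omega> = p' t \<omega>"
    using indistinguishable[OF c(1,2)] indistinguishable[OF c(3,4)] gaps_L2_time by auto
  then have states: "AE \<omega> in M. \<forall>t\<in>{0..T}. X t \<omega> = X' t \<omega> \<and> p t \<omega> = p' t \<omega>" by eventually_elim simp
  have "(\<integral>s. sq dq s \<partial>R T) + (\<integral>s. sq dq\<^sub>c s \<partial>R T) \<le> 0"
    using integrand_energy V sq_integrable[OF order_refl] by simp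
  moreover have "0 \<le> (\<integral>s. sq dq s \<partial>R T)" "0 \<le> (\<integral>s. sq dq\<^sub>c s \<partial>R T)" by (intro integral_nonneg_AE AE_I2 sq_nonneg)+
  ultimately have "(\<integral>s. sq dq s \<partial>R T) \<le> 0" "(\<integral>s. sq dq\<^sub>c s \<partial>R T) \<le> 0" by linarith+
  from AE_zero_of_energy[OF gaps_L2_Q(3) this(1)] AE_zero_of_energy[OF gaps_L2_Q(4) this(2)]
  have "AE z in Q T. q (fst z) (snd z) = q' (fst z) (snd z) \<and> q\<^sub>c (fst z) (snd z) = q\<^sub>c' (fst z) (snd z)"
    by eventually_elim (simp add: split_beta' gap_def)
  with states show ?thesis by (simp add: same_solution_def)
qed

end

theorem theorem5p1:
  fixes T L :: real
  assumes "T > 0" and "L > 0"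
  shows "\<exists>\<delta>>0. \<forall>(M :: 'a measure) W W\<^sub>c \<xi>0
      b b0 b1 b2 \<sigma> \<sigma>0 \<sigma>1 \<sigma>2 \<sigma>\<^sub>c \<sigma>\<^sub>c0 \<sigma>\<^sub>c1 \<sigma>\<^sub>c2 f f0 f1 g L\<^sub>m C\<^sub>f.
    noise_setting M T W W\<^sub>c \<xi>0 \<longrightarrow>
    \<xi>0 \<in> L2_vars M (full_filtration M W W\<^sub>c \<xi>0 0) \<longrightarrow>
    measurable_data T b \<sigma> \<sigma>\<^sub>c f g \<longrightarrow>
    H1 T L b b0 b1 b2 \<sigma> \<sigma>0 \<sigma>1 \<sigma>2 \<sigma>\<^sub>c \<sigma>\<^sub>c0 \<sigma>\<^sub>c1 \<sigma>\<^sub>c2 \<longrightarrow>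
    H2 T L f g \<longrightarrow>
    H3 T L f f0 f1 g \<longrightarrow>
    H4 T C\<^sub>f f0 f1 g \<longrightarrow>
    H5 T L L\<^sub>m b0 \<sigma>0 \<sigma>\<^sub>c0 f1 g \<longrightarrow>
    H6 T f1 g \<longrightarrow>
    L\<^sub>m * inverse C\<^sub>f \<le> \<delta> \<longrightarrow>
    (\<forall>X p q q\<^sub>c X' p' q' q\<^sub>c'.
       fbsde_solution M T W W\<^sub>c \<xi>0 b \<sigma> \<sigma>\<^sub>c f g X p q q\<^sub>c \<longrightarrow>
       square_integrable_quadruple M T X p q q\<^sub>c \<longrightarrow>
       fbsde_solution M T W W\<^sub>c \<xi>0 b \<sigma> \<sigma>\<^sub>c f g X' p' q' q\<^sub>c' \<longrightarrow>
       square_integrable_quadruple M T X' p' q' q\<^sub>c' \<longrightarrow>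
       same_solution M T X p q q\<^sub>c X' p' q' q\<^sub>c')"
proof (rule exI[of _ "2 / total_const T L"], intro conjI allI impI)
  show "0 < 2 / total_const T L" using const_pos(5)[OF assms] by simp
  fix M :: "'a measure" and W W\<^sub>c \<xi>0 b b0 b1 b2 \<sigma> \<sigma>0 \<sigma>1 \<sigma>2 \<sigma>\<^sub>c \<sigma>\<^sub>c0 \<sigma>\<^sub>c1 \<sigma>\<^sub>c2 f f0 f1 g L\<^sub>m C\<^sub>f X p q q\<^sub>c X' p' q' q\<^sub>c'
  assume noise: "noise_setting M T W W\<^sub>c \<xi>0"
    and H: "measurable_data T b \<sigma> \<sigma>\<^sub>c f g" "H1 T L b b0 b1 b2 \<sigma> \<sigma>0 \<sigma>1 \<sigma>2 \<sigma>\<^sub>c \<sigma>\<^sub>c0 \<sigma>\<^sub>c1 \<sigma>\<^sub>c2" "H2 T L f g" "H3 T L f f0 f1 g"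
      "H4 T C\<^sub>f f0 f1 g" "H5 T L L\<^sub>m b0 \<sigma>0 \<sigma>\<^sub>c0 f1 g" "H6 T f1 g"
    and small: "L\<^sub>m * inverse C\<^sub>f \<le> 2 / total_const T L"
    and s: "fbsde_solution M T W W\<^sub>c \<xi>0 b \<sigma> \<sigma>\<^sub>c f g X p q q\<^sub>c" "square_integrable_quadruple M T X p q q\<^sub>c"
    and s': "fbsde_solution M T W W\<^sub>c \<xi>0 b \<sigma> \<sigma>\<^sub>c f g X' p' q' q\<^sub>c'" "square_integrable_quadruple M T X' p' q' q\<^sub>c'"
  interpret prob_space M using noise by (simp add: noise_setting_def)
  interpret fbsde M T W W\<^sub>c \<xi>0 L b b0 b1 b2 \<sigma> \<sigma>0 \<sigma>1 \<sigma>2 \<sigma>\<^sub>c \<sigma>\<^sub>c0 \<sigma>\<^sub>c1 \<sigma>\<^sub>c2 f f0 f1 g L\<^sub>m C\<^sub>f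
    by unfold_locales (use assms noise H in auto)
  obtain \<mu> where \<mu>: "solution X p q q\<^sub>c \<mu>" by (rule solution_exists[OF s])
  obtain \<mu>' where \<mu>': "solution X' p' q' q\<^sub>c' \<mu>'" by (rule solution_exists[OF s'])
  interpret pr: fbsde_pair M T W W\<^sub>c \<xi>0 L b b0 b1 b2 \<sigma> \<sigma>0 \<sigma>1 \<sigma>2 \<sigma>\<^sub>c \<sigma>\<^sub>c0 \<sigma>\<^sub>c1 \<sigma>\<^sub>c2 f f0 f1 g L\<^sub>m C\<^sub>f X p q q\<^sub>c \<mu> X' p' q' q\<^sub>c' \<mu>'
    by unfold_locales (fact \<mu>, fact \<mu>')
  show "same_solution M T X p q q\<^sub>c X' p' q' q\<^sub>c'" by (rule pr.solutions_agree[OF small])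
qed

end
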